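(* Let $(s_{0,0},\ldots,s_{0,m})=\mathcal N(\sigma_0,\ldots,\sigma_m)$ be a Nikishin system and $\mathbf n=(n_0,\ldots,n_m)\in\mathbb Z_+^{m+1}$. Then, for each $k=0,\ldots,m$ and every polynomial $p$, $\deg p\le|\mathbf n|+n_k-1$, $$\int p(x)\,ds_{0,k}(x)=\sum_{i=1}^{|\mathbf n|}\lambda_{\mathbf n,k,i}\,p(x_{\mathbf n,i}).$$ If $\mathbf n=(n,n+1,\ldots,n+1)$, then for each $k=0,\ldots,m$ $$\mathrm{sign}(\lambda_{\mathbf n,k,i})=\mathrm{sign}(s_{0,k}),\qquad i=1,\ldots,|\mathbf n|.$$ Consequently, for the sequence of multi-indices $\mathbf n=(n,n+1,\ldots,n+1)$, $n\in\mathbb Z_+$, for any bounded Riemann–Stieltjes integrable function $f$ on $\mathrm{Co}(\mathrm{supp}\,\sigma_0)$ and each $k=0,\ldots,m$, $$\int f(x)\,ds_{0,k}(x)=\lim_{n\to\infty}\sum_{i=1}^{|\mathbf n|}\lambda_{\mathbf n,k,i}\,f(x_{\mathbf n,i}).$$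
   Context: For a bounded interval $\Delta\subset\mathbb R$, $\mathcal M(\Delta)$ is the class of finite Borel measures $s$ of constant sign on $\mathbb R$ whose support is compact and infinite and such that $\Delta=\mathrm{Co}(\mathrm{supp}\,s)$ (convex hull). $\mathrm{sign}(s)=\pm1$ is the sign of such a measure. $\widehat s(z)=\int\frac{ds(x)}{z-x}$. If $\Delta_\alpha\cap\Delta_\beta=\emptyset$, $\sigma_\alpha\in\mathcal M(\Delta_\alpha)$, $\sigma_\beta\in\mathcal M(\Delta_\beta)$, then $d\langle\sigma_\alpha,\sigma_\beta\rangle(x)=\widehat\sigma_\beta(x)\,d\sigma_\alpha(x)$. Nikishin system: given $\sigma_j\in\mathcal M(\Delta_j)$, $j=0,\ldots,m$, with $\Delta_j\cap\Delta_{j+1}=\emptyset$, put $s_{j,j}=\sigma_j$, $s_{j,k}=\langle\sigma_j,\langle\sigma_{j+1},\ldots,\sigma_k\rangle\rangle$ for $j<k$; $\mathcal N(\sigma_0,\ldots,\sigma_m)=(s_{0,0},\ldots,s_{0,m})$. Type II approximation: for $\mathbf n\in\mathbb Z_+^{m+1}$, $|\mathbf n|=n_0+\cdots+n_m$, $Q_{\mathbf n}$ is a polynomial, not identically zero, $\deg Q_{\mathbf n}\le|\mathbf n|$, such that for some polynomials $P_{\mathbf n,k}$, $Q_{\mathbf n}(z)\widehat s_{0,k}(z)-P_{\mathbf n,k}(z)=\mathcal O(1/z^{n_k+1})$, $z\to\infty$, $k=0,\ldots,m$. $Q_{\mathbf n}$ is unique up to a constant factor and has exactly $|\mathbf n|$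 zeros $x_{\mathbf n,1},\ldots,x_{\mathbf n,|\mathbf n|}$, which are simple and lie in the interior of $\mathrm{Co}(\mathrm{supp}\,\sigma_0)$. The coefficients $\lambda_{\mathbf n,k,i}$ are defined by $$\frac{P_{\mathbf n,k}(z)}{Q_{\mathbf n}(z)}=\sum_{i=1}^{|\mathbf n|}\frac{\lambda_{\mathbf n,k,i}}{z-x_{\mathbf n,i}},\qquad\lambda_{\mathbf n,k,i}=\frac{P_{\mathbf n,k}(x_{\mathbf n,i})}{Q_{\mathbf n}'(x_{\mathbf n,i})}.$$ "Riemann–Stieltjes integrable" is understood with respect to the measure $s_{0,k}$ of the integral in question. *)

theory Defs
  imports
    "HOL-Analysis.Analysis"
    "HOL-Library.Landau_Symbols"
    "HOL-Computational_Algebra.Polynomial"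
begin

text \<open>A measure \<open>s\<close> of constant sign on the real line is stored as its sign (\<open>1\<close> or \<open>- 1\<close>)
  together with the positive measure \<open>|s|\<close>.\<close>

datatype cs_measure = CSM (msign: real) (mabs: "real measure")

definition msupp :: "cs_measure \<Rightarrow> real set" where
  "msupp s = {x. \<forall>U. open U \<longrightarrow> x \<in> U \<longrightarrow> emeasure (mabs s) U \<noteq> 0}"

definition cs_class :: "real set \<Rightarrow> cs_measure set" where
  "cs_class \<Delta> = {s. (msign s = 1 \<or> msign s = - 1) \<and> sets (mabs s) = sets borel \<and>
     finite_measure (mabs s) \<and> compact (msupp s) \<and> infinite (msupp s) \<and>
     \<Delta> = convex hull (msupp s)}"

text \<open>Integration is with respect to the completion because a Riemann-Stieltjes integrable
  function need not be Borel measurable; for Borel functions this makes no difference.\<close>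

definition cs_integral :: "cs_measure \<Rightarrow> (real \<Rightarrow> 'a::{banach, second_countable_topology}) \<Rightarrow> 'a"
  where "cs_integral s f = msign s *\<^sub>R integral\<^sup>L (completion (mabs s)) f"

text \<open>Polymorphic, so that it can be used both at complex points and at real points off the
  support.\<close>

definition cauchy_transform ::
  "cs_measure \<Rightarrow> 'a::{real_normed_field, banach, second_countable_topology} \<Rightarrow> 'a"
  where "cauchy_transform s z = cs_integral s (\<lambda>x. 1 / (z - of_real x))"

text \<open>The measure \<open>\<langle>a, b\<rangle>\<close>, with density the Cauchy transform of \<open>b\<close> with respect to \<open>a\<close>. That
  density has constant sign on the convex hull of the support of \<open>a\<close>, hence the sign of
  \<open>\<langle>a, b\<rangle>\<close> is the sign of its total mass.\<close>

definition cs_prod :: "cs_measure \<Rightarrow> cs_measure \<Rightarrow> cs_measure" where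
  "cs_prod a b = CSM (sgn (cs_integral a (cauchy_transform b :: real \<Rightarrow> real)))
     (density (mabs a) (\<lambda>x. ennreal \<bar>cauchy_transform b x\<bar>))"

text \<open>The measures \<open>s\<^sub>j\<^sub>,\<^sub>k\<close> for \<open>j \<le> k\<close>; the value for \<open>j > k\<close> is irrelevant.\<close>

function nik :: "(nat \<Rightarrow> cs_measure) \<Rightarrow> nat \<Rightarrow> nat \<Rightarrow> cs_measure" where
  "nik \<sigma> j k = (if j < k then cs_prod (\<sigma> j) (nik \<sigma> (Suc j) k) else \<sigma> j)"
  by auto
termination by (relation "Wellfounded.measure (\<lambda>(\<sigma>, j, k). k - j)") auto

declare nik.simps [simp del]

definition nikishin_generators :: "nat \<Rightarrow> (nat \<Rightarrow> real set) \<Rightarrow> (nat \<Rightarrow> cs_measure) \<Rightarrow> bool" where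
  "nikishin_generators m \<Delta> \<sigma> \<longleftrightarrow>
     (\<forall>j\<le>m. \<sigma> j \<in> cs_class (\<Delta> j)) \<and> (\<forall>j<m. \<Delta> j \<inter> \<Delta> (Suc j) = {})"

text \<open>A multi-index \<open>(n\<^sub>0, \<dots>, n\<^sub>m)\<close> is a function of which only the values at \<open>0, \<dots>, m\<close> matter.\<close>

definition mi_norm :: "nat \<Rightarrow> (nat \<Rightarrow> nat) \<Rightarrow> nat" where
  "mi_norm m n = (\<Sum>k\<le>m. n k)"

definition type_II ::
  "nat \<Rightarrow> (nat \<Rightarrow> cs_measure) \<Rightarrow> (nat \<Rightarrow> nat) \<Rightarrow> complex poly \<Rightarrow> (nat \<Rightarrow> complex poly) \<Rightarrow> bool" where
  "type_II m \<sigma> n Q P \<longleftrightarrow> Q \<noteq> 0 \<and> degree Q \<le> mi_norm m n \<and>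
     (\<forall>k\<le>m. (\<lambda>z. poly Q z * cauchy_transform (nik \<sigma> 0 k) z - poly (P k) z)
               \<in> O[at_infinity](\<lambda>z. 1 / z ^ (n k + 1)))"

text \<open>The nodes are indexed by themselves: for a type II denominator \<open>Q\<close> the zeros are real and
  simple and there are \<open>mi_norm m n\<close> of them, so a sum over the enumerated nodes is a sum over
  this set.\<close>

definition nodes :: "complex poly \<Rightarrow> real set" where
  "nodes Q = {x. poly Q (of_real x) = 0}"

definition quad_coeff :: "complex poly \<Rightarrow> complex poly \<Rightarrow> real \<Rightarrow> complex" where
  "quad_coeff Q P x = poly P (of_real x) / poly (pderiv Q) (of_real x)"

definition step_index :: "nat \<Rightarrow> nat \<Rightarrow> nat" where
  "step_index n k = (if k = 0 then n else n + 1)"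

text \<open>The distribution function of \<open>s\<close> on an interval with left end point \<open>a\<close>, normalised to be
  \<open>0\<close> at \<open>a\<close>, so that a point mass at \<open>a\<close> is not lost.\<close>

definition distr_fun :: "cs_measure \<Rightarrow> real \<Rightarrow> real \<Rightarrow> real" where
  "distr_fun s a x = (if x \<le> a then 0 else msign s * measure (mabs s) {..x})"

text \<open>Riemann-Stieltjes integrability in the sense of convergence of all tagged sums as the mesh
  tends to \<open>0\<close>. (With the weaker notion of convergence along refinements, integrability at a
  point mass would depend on the one-sided normalisation of the distribution function.)\<close>

definition rs_integrable :: "cs_measure \<Rightarrow> real set \<Rightarrow> (real \<Rightarrow> 'a::real_normed_vector) \<Rightarrow> bool" where
  "rs_integrable s \<Delta> f \<longleftrightarrow> (\<exists>I. \<forall>\<epsilon>>0. \<exists>\<delta>>0. \<forall>N x t.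
     x 0 = Inf \<Delta> \<and> x N = Sup \<Delta> \<and>
     (\<forall>i<N. x i \<le> x (Suc i) \<and> x (Suc i) - x i < \<delta> \<and> t i \<in> {x i..x (Suc i)}) \<longrightarrow>
     norm ((\<Sum>i<N. (distr_fun s (Inf \<Delta>) (x (Suc i)) - distr_fun s (Inf \<Delta>) (x i)) *\<^sub>R f (t i)) - I)
       < \<epsilon>)"

end

theory Submission
  imports Defs "HOL-Probability.Probability" "HOL-Real_Asymp.Real_Asymp"
begin

text \<open>By the order condition at infinity, \<open>Q\<close> is orthogonal to \<open>x\<^sup>j v\<^sub>k(x)\<close> for
  \<open>j < n\<^sub>k\<close>, where \<open>v\<^sub>k\<close> is the density of \<open>s\<^sub>0\<^sub>,\<^sub>k\<close> with respect to \<open>|\<sigma>\<^sub>0|\<close>. The \<open>v\<^sub>k\<close>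
  form an AT system on \<open>\<Delta>\<^sub>0\<close>: a nontrivial combination \<open>\<Sum>\<^sub>k p\<^sub>k v\<^sub>k\<close> with \<open>deg p\<^sub>k < n\<^sub>k\<close> has at
  most \<open>|n| - 1\<close> zeros there. Hence \<open>Q\<close> has \<open>|n|\<close> zeros on \<open>\<Delta>\<^sub>0\<close>, and the quadrature formula is
  division by \<open>Q\<close> followed by Lagrange interpolation. For arbitrary multi-indices the AT property
  rests on a family of functions, formally minors of a matrix of Cauchy transforms, in which the ratio
  of two members is an affine function plus a Cauchy transform over the next interval. Dividing by the
  member with the largest degree and passing to that interval removes one function from the combination.
  The family is built from the fact that the reciprocal of a Cauchy transform is an affine function
  minus a Cauchy transform.

  For \<open>n = (n, n + 1, \<dots>, n + 1)\<close> the function \<open>\<integral> Q v\<^sub>k / (x - t) d|\<sigma>\<^sub>0|\<close> has \<open>|n| - n\<^sub>k\<close> zeros on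
  \<open>\<Delta>\<^sub>1\<close>. If \<open>W\<close> is the monic polynomial with these zeros, then \<open>Q\<close> is orthogonal to all polynomials of degree
  less than \<open>|n|\<close> with respect to \<open>v\<^sub>k / W\<close>, so the weight at a node \<open>x\<close> is
  \<open>W(x) / Q'(x)\<^sup>2\<close> times the integral of \<open>(Q(t) / (t - x))\<^sup>2 v\<^sub>k(t) / W(t)\<close>, which has the sign of \<open>v\<^sub>k\<close>.
  Quadrature with weights of one sign and growing exactness converges for continuous functions by the
  Weierstrass theorem, and a Riemann-Stieltjes integrable function lies between
  two continuous functions with nearly equal integrals.\<close>

section \<open>Cauchy transforms of measures on compact sets\<close>

text \<open>The obstacle is that \<open>F K\<close> lives off \<open>D (card K)\<close>, the very
  interval on which the ratio of two members has its jump. Formally the jump of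
  \<open>F (insert l S) / F (insert i S)\<close> is \<open>F S\<close> times
  \<open>F (insert i (insert l S))\<close> times a generator over the square of
  \<open>F (insert i S)\<close>, and that square has no meaning on the interval. So no boundary
  values are taken: apart from the generators themselves, the measures \<open>\<nu> K\<close> come
  from the reciprocal theorem, and all further relations follow from Fubini, product formulas for
  Cauchy transforms and comparison beyond all the intervals.

  The affine part of a ratio can raise a degree by one. Growth at infinity shows that its slope
  vanishes unless \<open>l \<le> card S\<close> and \<open>card S < i\<close>. A denominator label
  of largest degree, with ties broken in favour of labels at most \<open>card S\<close>, therefore
  keeps the degrees under control for every multi-index.

  The polynomials \<open>Q\<close> and \<open>P k\<close> are complex; restricted to the real axis,
  their real and imaginary parts turn out to be multiples of the same real polynomials.\<close>

text \<open>For measures of infinite support this is what positivity arguments need: a nonnegative continuous function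
  with finitely many zeros has positive integral.\<close>

definition fat :: "real measure \<Rightarrow> real set \<Rightarrow> bool" where
  "fat M D \<longleftrightarrow> sets M = sets borel \<and> finite_measure M \<and>
     (\<forall>Z. finite Z \<longrightarrow> emeasure M (D - Z) \<noteq> 0)"

text \<open>The integral is cut to \<open>D\<close>, so \<open>\<rho>\<close> has to be continuous
  only there and the behaviour of \<open>M\<close> outside \<open>D\<close> is irrelevant. Values at
  points of \<open>D\<close> carry no meaning.\<close>

definition ct :: "real measure \<Rightarrow> real set \<Rightarrow> (real \<Rightarrow> real) \<Rightarrow> real \<Rightarrow> real" where
  "ct M D \<rho> z = (LINT x:D|M. \<rho> x / (z - x))"

lemma set_integrable_compact:
  fixes f :: "real \<Rightarrow> real"
  assumes M: "sets M = sets borel" "finite_measure M" and D: "compact D" and f: "continuous_on D f"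
  shows "set_integrable M D f"
proof -
  interpret finite_measure M by fact
  have "bounded (f ` D)"
    by (intro compact_imp_bounded compact_continuous_image f D)
  then obtain C where C: "\<And>x. x \<in> D \<Longrightarrow> norm (f x) \<le> C" by (auto simp: bounded_iff)
  have "D \<in> sets borel" using D by (auto intro: borel_closed compact_imp_closed)
  then have "(\<lambda>x. indicator D x *\<^sub>R f x) \<in> borel_measurable borel"
    by (rule borel_measurable_continuous_on_indicator[OF _ f])
  then have m: "(\<lambda>x. indicator D x *\<^sub>R f x) \<in> borel_measurable M"
    using M(1) by (simp cong: measurable_cong_sets)
  show ?thesis unfolding set_integrable_def
    by (rule integrable_const_bound[where B="max C 0", OF _ m])
       (auto simp: indicator_def intro!: AE_I2 dest: C)
qed

text \<open>If the integral were zero, \<open>f\<close> would vanish almost everywhere, so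
  \<open>D\<close> without the finitely many zeros of \<open>f\<close> would be a null set, against
  fatness.\<close>

lemma set_integral_pos_fat:
  fixes f :: "real \<Rightarrow> real"
  assumes M: "fat M D" and D: "compact D" and f: "continuous_on D f"
    and nn: "\<And>x. x \<in> D \<Longrightarrow> 0 \<le> f x" and fin: "finite {x \<in> D. f x = 0}"
  shows "0 < (LINT x:D|M. f x)"
proof -
  have M1: "sets M = sets borel" "finite_measure M" using M by (auto simp: fat_def)
  have int: "set_integrable M D f" by (rule set_integrable_compact[OF M1 D f])
  have ge: "0 \<le> (LINT x:D|M. f x)"
    unfolding set_lebesgue_integral_def by (rule integral_nonneg_AE) (auto simp: indicator_def nn)
  have "(LINT x:D|M. f x) \<noteq> 0"
  proof
    assume "(LINT x:D|M. f x) = 0"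
    then have "AE x in M. indicator D x *\<^sub>R f x = 0"
      using int unfolding set_lebesgue_integral_def set_integrable_def
      by (subst (asm) integral_nonneg_eq_0_iff_AE) (auto simp: indicator_def nn)
    then obtain N where N: "{x \<in> space M. indicator D x *\<^sub>R f x \<noteq> 0} \<subseteq> N" "emeasure M N = 0" "N \<in> sets M"
      by (auto elim: AE_E)
    have "D - {x \<in> D. f x = 0} \<subseteq> N"
      using N(1) sets_eq_imp_space_eq[OF M1(1)] by (auto simp: indicator_def)
    then have "emeasure M (D - {x \<in> D. f x = 0}) \<le> emeasure M N"
      by (rule emeasure_mono[OF _ N(3)])
    then show False using M fin N(2) unfolding fat_def by (metis le_zero_eq)
  qed
  with ge show ?thesis by simp
qed

lemma fat_infinite: "fat M D \<Longrightarrow> infinite D"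
  unfolding fat_def by (metis Diff_cancel emeasure_empty)

lemma continuous_on_parametric_integral:
  fixes g :: "real \<Rightarrow> real \<Rightarrow> real"
  assumes M: "sets M = sets borel" "finite_measure M" and D: "compact D" and E: "compact E"
    and g: "continuous_on (E \<times> D) (\<lambda>(z, x). g z x)"
  shows "continuous_on E (\<lambda>z. LINT x:D|M. g z x)"
proof -
  interpret finite_measure M by fact
  have "bounded ((\<lambda>(z, x). g z x) ` (E \<times> D))"
    by (intro compact_imp_bounded compact_continuous_image g compact_Times D E)
  then obtain C where C: "\<And>z x. z \<in> E \<Longrightarrow> x \<in> D \<Longrightarrow> norm (g z x) \<le> C"
    by (fastforce simp: bounded_iff)
  have gz: "continuous_on D (g z)" if "z \<in> E" for z
    by (rule continuous_on_compose2[OF g, of D "\<lambda>x. (z, x)", simplified]) (auto intro!: continuous_intros simp: that)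
  have gx: "continuous_on E (\<lambda>z. g z x)" if "x \<in> D" for x
    by (rule continuous_on_compose2[OF g, of E "\<lambda>z. (z, x)", simplified]) (auto intro!: continuous_intros simp: that)
  show ?thesis
    unfolding continuous_on_def set_lebesgue_integral_def
  proof (intro ballI)
    fix z assume z: "z \<in> E"
    show "((\<lambda>z. LINT x|M. indicat_real D x *\<^sub>R g z x) \<longlongrightarrow> (LINT x|M. indicat_real D x *\<^sub>R g z x)) (at z within E)"
      unfolding tendsto_at_iff_sequentially comp_def
    proof (intro allI impI)
      fix X assume X: "\<forall>i. X i \<in> E - {z}" "X \<longlonglongrightarrow> z"
      show "(\<lambda>i. LINT x|M. indicat_real D x *\<^sub>R g (X i) x) \<longlonglongrightarrow> (LINT x|M. indicat_real D x *\<^sub>R g z x)"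
      proof (rule integral_dominated_convergence[where w="\<lambda>_. max C 0"])
        show "(\<lambda>x. indicat_real D x *\<^sub>R g z x) \<in> borel_measurable M"
          using set_integrable_compact[OF M D gz[OF z]] by (auto simp: set_integrable_def)
        show "(\<lambda>x. indicat_real D x *\<^sub>R g (X i) x) \<in> borel_measurable M" for i
          using set_integrable_compact[OF M D gz[of "X i"]] X by (auto simp: set_integrable_def)
        show "AE x in M. (\<lambda>i. indicat_real D x *\<^sub>R g (X i) x) \<longlonglongrightarrow> indicat_real D x *\<^sub>R g z x"
        proof (rule AE_I2)
          fix x
          show "(\<lambda>i. indicat_real D x *\<^sub>R g (X i) x) \<longlonglongrightarrow> indicat_real D x *\<^sub>R g z x"
          proof (cases "x \<in> D")
            case True
            have "(\<lambda>i. g (X i) x) \<longlonglongrightarrow> g z x"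
              using continuous_on_tendsto_compose[OF gx[OF True] X(2) z] X(1) by auto
            then show ?thesis by (intro tendsto_intros)
          qed auto
        qed
        show "AE x in M. norm (indicat_real D x *\<^sub>R g (X i) x) \<le> max C 0" for i
          using X(1) C[of "X i"] by (intro AE_I2) (auto simp: indicator_def max.coboundedI1)
      qed auto
    qed
  qed
qed

lemma ct_continuous:
  assumes M: "sets M = sets borel" "finite_measure M" and D: "compact D" and f: "continuous_on D \<rho>"
  shows "continuous_on (- D) (ct M D \<rho>)"
proof -
  have "isCont (ct M D \<rho>) z" if z: "z \<in> - D" for z
  proof -
    have "open (- D)" using D by (simp add: compact_imp_closed open_Compl)
    then obtain e where e: "e > 0" "cball z e \<subseteq> - D" using z open_contains_cball by blast
    have "continuous_on (cball z e) (\<lambda>z. LINT x:D|M. \<rho> x / (z - x))"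
      by (rule continuous_on_parametric_integral[OF M D compact_cball])
         (use e in \<open>auto simp: case_prod_beta intro!: continuous_intros continuous_on_compose2[OF f continuous_on_snd]\<close>)
    then have "continuous_on (ball z e) (ct M D \<rho>)"
      unfolding ct_def by (rule continuous_on_subset) auto
    then show ?thesis using e(1) by (simp add: continuous_on_eq_continuous_at)
  qed
  then show ?thesis by (simp add: continuous_at_imp_continuous_on)
qed

lemma set_integral_Fubini:
  fixes g :: "real \<Rightarrow> real \<Rightarrow> real"
  assumes M: "sets M = sets borel" "finite_measure M" and D: "compact D"
    and N: "sets N = sets borel" "finite_measure N" and E: "compact E"
    and g: "continuous_on (D \<times> E) (\<lambda>(x, y). g x y)"
  shows "(LINT x:D|M. (LINT y:E|N. g x y)) = (LINT y:E|N. (LINT x:D|M. g x y))"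
proof -
  interpret M: finite_measure M by fact
  interpret N: finite_measure N by fact
  interpret P: pair_sigma_finite N M ..
  interpret F: finite_measure "N \<Otimes>\<^sub>M M"
    by (simp add: M.finite_measure_axioms N.finite_measure_axioms finite_measure_pair_measure)
  define h where "h = (\<lambda>y x. indicator (D \<times> E) (x, y) *\<^sub>R g x y)"
  have sD: "D \<times> E \<in> sets borel" using D E by (auto intro!: borel_closed compact_imp_closed compact_Times)
  have sMN: "sets (M \<Otimes>\<^sub>M N) = sets borel"
    using sets_pair_measure_cong[OF M(1) N(1)] unfolding borel_prod .
  have "(\<lambda>p. indicator (D \<times> E) p *\<^sub>R (\<lambda>(x, y). g x y) p) \<in> borel_measurable borel"
    by (rule borel_measurable_continuous_on_indicator[OF sD g])
  then have m0: "(\<lambda>p. indicator (D \<times> E) p *\<^sub>R (\<lambda>(x, y). g x y) p) \<in> borel_measurable (M \<Otimes>\<^sub>M N)"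
    unfolding measurable_cong_sets[OF sMN refl] .
  have m: "case_prod h \<in> borel_measurable (N \<Otimes>\<^sub>M M)"
    using measurable_compose[OF measurable_pair_swap' m0] by (simp add: h_def case_prod_beta split_beta)
  have "bounded ((\<lambda>(x, y). g x y) ` (D \<times> E))"
    by (intro compact_imp_bounded compact_continuous_image g compact_Times D E)
  then obtain C where C: "\<And>x y. x \<in> D \<Longrightarrow> y \<in> E \<Longrightarrow> norm (g x y) \<le> C"
    by (fastforce simp: bounded_iff)
  have int: "integrable (N \<Otimes>\<^sub>M M) (case_prod h)"
    by (rule F.integrable_const_bound[where B="max C 0", OF _ m])
       (auto intro!: AE_I2 max.coboundedI1[OF C[simplified real_norm_def]] simp: h_def indicator_def)
  have "(LINT x|M. LINT y|N. h y x) = (LINT y|N. LINT x|M. h y x)"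
    using P.Fubini_integral[OF int] by simp
  moreover have "(LINT y|N. h y x) = indicator D x *\<^sub>R (LINT y:E|N. g x y)" for x
    unfolding h_def set_lebesgue_integral_def
    by (auto simp: indicator_def intro!: Bochner_Integration.integral_cong)
  moreover have "(LINT x|M. h y x) = indicator E y *\<^sub>R (LINT x:D|M. g x y)" for y
    unfolding h_def set_lebesgue_integral_def
    by (auto simp: indicator_def intro!: Bochner_Integration.integral_cong)
  ultimately show ?thesis by (simp add: set_lebesgue_integral_def)
qed

lemma ct_tendsto_0:
  assumes M: "sets M = sets borel" "finite_measure M" and D: "compact D" and f: "continuous_on D \<rho>"
  shows "(ct M D \<rho> \<longlongrightarrow> 0) at_top"
proof -
  interpret finite_measure M by fact
  have "bounded (\<rho> ` D)" "bounded D"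
    by (auto intro!: compact_imp_bounded compact_continuous_image f D)
  then obtain C R where C: "\<And>x. x \<in> D \<Longrightarrow> \<bar>\<rho> x\<bar> \<le> C" and R: "\<And>x. x \<in> D \<Longrightarrow> \<bar>x\<bar> \<le> R"
    by (auto simp: bounded_iff)
  define K where "K = (LINT x:D|M. 1 :: real)"
  have b: "norm (ct M D \<rho> z) \<le> \<bar>C\<bar> * K / (z - R)" if z: "z > \<bar>R\<bar>" for z
  proof -
    have zx: "z - x \<ge> z - R" "z - x > 0" if "x \<in> D" for x
      using R[OF that] z by auto
    have i1: "set_integrable M D (\<lambda>x. \<rho> x / (z - x))"
      by (rule set_integrable_compact[OF M D]) (use zx in \<open>force intro!: continuous_intros f\<close>)
    have "\<bar>ct M D \<rho> z\<bar> \<le> (LINT x:D|M. \<bar>\<rho> x / (z - x)\<bar>)"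
      unfolding ct_def set_lebesgue_integral_def
      by (rule order_trans[OF integral_abs_bound]) (auto simp: abs_mult indicator_def)
    also have "\<dots> \<le> (LINT x:D|M. \<bar>C\<bar> / (z - R))"
    proof (rule set_integral_mono)
      show "set_integrable M D (\<lambda>x. \<bar>C\<bar> / (z - R))"
        by (rule set_integrable_compact[OF M D]) auto
      show "\<bar>\<rho> x / (z - x)\<bar> \<le> \<bar>C\<bar> / (z - R)" if "x \<in> D" for x
        unfolding abs_divide using zx[OF that] C[OF that] z by (intro frac_le) auto
    qed (use i1 in \<open>rule set_integrable_abs\<close>)
    also have "\<dots> = \<bar>C\<bar> * K / (z - R)"
      unfolding K_def set_lebesgue_integral_def by (simp add: field_simps)
    finally show ?thesis by simp
  qed
  show ?thesis
  proof (rule Lim_null_comparison)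
    show "\<forall>\<^sub>F z in at_top. norm (ct M D \<rho> z) \<le> \<bar>C\<bar> * K / (z - R)"
      using eventually_gt_at_top[of "\<bar>R\<bar>"] by eventually_elim (rule b)
    show "((\<lambda>z. \<bar>C\<bar> * K / (z - R)) \<longlongrightarrow> 0) at_top" by real_asymp
  qed
qed

text \<open>Since \<open>x / (z - x) = z / (z - x) - 1\<close>. This one recursion yields the
  asymptotics at infinity, the vanishing of moments and the multiplication of transforms by
  polynomials.\<close>

lemma ct_mult_var:
  assumes M: "sets M = sets borel" "finite_measure M" and D: "compact D" and f: "continuous_on D \<rho>"
    and z: "z \<notin> D"
  shows "ct M D (\<lambda>x. x * \<rho> x) z = z * ct M D \<rho> z - (LINT x:D|M. \<rho> x)"
proof -
  have ne: "z - x \<noteq> 0" if "x \<in> D" for x using z that by auto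
  have i: "set_integrable M D (\<lambda>x. \<rho> x / (z - x))"
    by (rule set_integrable_compact[OF M D]) (use ne in \<open>force intro!: continuous_intros f\<close>)
  have "ct M D (\<lambda>x. x * \<rho> x) z = (LINT x:D|M. z * (\<rho> x / (z - x)) - \<rho> x)"
    unfolding ct_def
  proof (rule set_lebesgue_integral_cong)
    show "D \<in> sets M" using M D by (auto intro: borel_closed compact_imp_closed)
    show "\<forall>x. x \<in> D \<longrightarrow> x * \<rho> x / (z - x) = z * (\<rho> x / (z - x)) - \<rho> x"
      using ne by (auto simp: field_simps)
  qed
  also have "\<dots> = z * ct M D \<rho> z - (LINT x:D|M. \<rho> x)"
    using set_integral_diff(2)[OF set_integrable_mult_right[of z, OF i] set_integrable_compact[OF M D f]]
    by (simp add: ct_def del: times_divide_eq_right)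
  finally show ?thesis .
qed

lemma ct_asymp:
  assumes M: "sets M = sets borel" "finite_measure M" and D: "compact D" and f: "continuous_on D \<rho>"
  shows "((\<lambda>z. z * ct M D \<rho> z) \<longlongrightarrow> (LINT x:D|M. \<rho> x)) at_top"
proof -
  have "\<forall>\<^sub>F z in at_top. z \<notin> D"
  proof -
    obtain R where R: "\<And>x. x \<in> D \<Longrightarrow> \<bar>x\<bar> \<le> R" using compact_imp_bounded[OF D] by (auto simp: bounded_iff)
    show ?thesis using eventually_gt_at_top[of R] by eventually_elim (use R in force)
  qed
  then have "\<forall>\<^sub>F z in at_top. ct M D (\<lambda>x. x * \<rho> x) z + (LINT x:D|M. \<rho> x) = z * ct M D \<rho> z"
    by eventually_elim (simp add: ct_mult_var[OF M D f])
  moreover have "((\<lambda>z. ct M D (\<lambda>x. x * \<rho> x) z + (LINT x:D|M. \<rho> x)) \<longlongrightarrow> 0 + (LINT x:D|M. \<rho> x)) at_top"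
    by (intro tendsto_intros ct_tendsto_0 M D) (auto intro!: continuous_intros f)
  ultimately show ?thesis by (simp add: tendsto_cong)
qed

section \<open>Interpolation and sign changes\<close>

lemma lagrange_interpolation:
  fixes p :: "'a::field poly"
  assumes Z: "finite Z" and d: "degree p < card Z"
  shows "poly p x = (\<Sum>z\<in>Z. poly p z * (\<Prod>y\<in>Z - {z}. (x - y) / (z - y)))"
proof -
  define q where "q = (\<Sum>z\<in>Z. smult (poly p z / (\<Prod>y\<in>Z - {z}. z - y)) (\<Prod>y\<in>Z - {z}. [:- y, 1:]))"
  have deg: "degree (\<Prod>y\<in>Z - {z}. [:- y, 1:]) < card Z" if "z \<in> Z" for z
  proof -
    have "degree (\<Prod>y\<in>Z - {z}. [:- y, 1:]) \<le> (\<Sum>y\<in>Z - {z}. degree [:- y, 1:])"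
      using degree_prod_sum_le[of "Z - {z}" "\<lambda>y. [:- y, 1:]"] Z by (simp add: comp_def)
    also have "\<dots> < card Z" using that Z d by (simp add: card_Diff_singleton)
    finally show ?thesis .
  qed
  have ev: "poly q t = (\<Sum>z\<in>Z. poly p z * (\<Prod>y\<in>Z - {z}. (t - y) / (z - y)))" for t
    unfolding q_def poly_sum by (simp add: poly_prod prod_dividef)
  have "degree q < card Z"
    unfolding q_def using d
    by (intro degree_sum_less) (auto intro: le_less_trans[OF degree_smult_le] deg)
  moreover have "poly p t = poly q t" if t: "t \<in> Z" for t
  proof -
    have "poly q t = (\<Sum>z\<in>Z. if z = t then poly p t else 0)"
      unfolding ev
    proof (intro sum.cong refl)
      fix z assume z: "z \<in> Z"
      show "poly p z * (\<Prod>y\<in>Z - {z}. (t - y) / (z - y)) = (if z = t then poly p t else 0)"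
      proof (cases "z = t")
        case True
        then have "(\<Prod>y\<in>Z - {z}. (t - y) / (z - y)) = 1" by (intro prod.neutral) auto
        with True show ?thesis by simp
      next
        case False
        then have "(\<Prod>y\<in>Z - {z}. (t - y) / (z - y)) = 0"
          using t Z by (intro prod_zero) auto
        with False show ?thesis by simp
      qed
    qed
    then show ?thesis using Z t by simp
  qed
  ultimately have "p = q" using d poly_eqI_degree[of Z p q] by blast
  then have "poly p x = poly q x" by simp
  also note ev
  finally show ?thesis .
qed

text \<open>Lagrange interpolation at \<open>Z\<close>, divided by the polynomial whose zeros are
  the nodes.\<close>

lemma partial_fractions:
  fixes p :: "'a::field poly"
  assumes Z: "finite Z" and d: "degree p < card Z" and x: "x \<notin> Z"
  shows "(\<Sum>z\<in>Z. poly p z / ((\<Prod>y\<in>Z - {z}. z - y) * (x - z))) = poly p x / (\<Prod>z\<in>Z. x - z)"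
proof -
  have aux: "c * (A / B) / (d * A) = c / (B * d)" if "A \<noteq> 0" "d \<noteq> 0" for A B c d :: 'a
    using that by (cases "B = 0") (simp_all add: field_simps)
  have "poly p x / (\<Prod>z\<in>Z. x - z) = (\<Sum>z\<in>Z. poly p z * (\<Prod>y\<in>Z - {z}. (x - y) / (z - y)) / (\<Prod>z\<in>Z. x - z))"
    unfolding lagrange_interpolation[OF Z d, of x] sum_divide_distrib ..
  also have "\<dots> = (\<Sum>z\<in>Z. poly p z / ((\<Prod>y\<in>Z - {z}. z - y) * (x - z)))"
  proof (intro sum.cong refl)
    fix z assume z: "z \<in> Z"
    have e: "(\<Prod>z\<in>Z. x - z) = (x - z) * (\<Prod>y\<in>Z - {z}. x - y)"
      using Z z by (simp add: prod.remove)
    have "(\<Prod>y\<in>Z - {z}. x - y) \<noteq> 0" "x - z \<noteq> 0" using Z x z by auto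
    then show "poly p z * (\<Prod>y\<in>Z - {z}. (x - y) / (z - y)) / (\<Prod>z\<in>Z. x - z) =
          poly p z / ((\<Prod>y\<in>Z - {z}. z - y) * (x - z))"
      unfolding e prod_dividef by (rule aux)
  qed
  finally show ?thesis ..
qed

text \<open>The residues of a rational function that is O(1 / z^2) at infinity sum to zero. To see
  it, the partial fractions of \<open>(x - t) p(x)\<close> are evaluated at \<open>t\<close> itself:
  the value is zero, and each quotient \<open>(z - t) / (t - z)\<close> is -1.\<close>

lemma partial_fractions_residue_sum:
  fixes p :: "'a::field_char_0 poly"
  assumes Z: "finite Z" and d: "degree p + 1 < card Z"
  shows "(\<Sum>z\<in>Z. poly p z / (\<Prod>y\<in>Z - {z}. z - y)) = 0"
proof -
  obtain t where t: "t \<notin> Z" using Z ex_new_if_finite infinite_UNIV_char_0 by blast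
  have "degree ([:- t, 1:] * p) < card Z"
    using d degree_mult_le[of "[:- t, 1:]" p] by simp
  from partial_fractions[OF Z this t]
  have "(\<Sum>z\<in>Z. ((z - t) * poly p z) / ((\<Prod>y\<in>Z - {z}. z - y) * (t - z))) = 0"
    by (simp add: left_diff_distrib)
  moreover have "((z - t) * poly p z) / ((\<Prod>y\<in>Z - {z}. z - y) * (t - z)) = - (poly p z / (\<Prod>y\<in>Z - {z}. z - y))"
    if "z \<in> Z" for z
  proof -
    have "t - z \<noteq> 0" using that t by auto
    then have "(z - t) / (t - z) = -1" by (simp add: field_simps)
    then show ?thesis by (metis (no_types, opaque_lifting) mult.commute mult_minus1 times_divide_times_eq)
  qed
  ultimately show ?thesis by (simp add: sum_negf)
qed

lemma connected_const_sign:
  fixes f :: "real \<Rightarrow> real"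
  assumes "connected I" "continuous_on I f" "\<And>t. t \<in> I \<Longrightarrow> f t \<noteq> 0"
  shows "(\<forall>t\<in>I. 0 < f t) \<or> (\<forall>t\<in>I. f t < 0)"
proof (rule ccontr)
  assume "\<not> ?thesis"
  then obtain a b where ab: "a \<in> I" "b \<in> I" "f a \<le> 0" "0 \<le> f b" by (auto simp: not_less)
  have "connected (f ` I)" using assms by (intro connected_continuous_image)
  then have "0 \<in> f ` I" using ab unfolding connected_iff_interval by (metis imageI)
  then show False using assms(3) by auto
qed

text \<open>\<open>C\<close> consists of the zeros at which \<open>f\<close> changes sign. The
  induction splits off the largest zero \<open>z\<close>. To the right of \<open>z\<close> all
  factors \<open>t - c\<close> are positive, so the sign of the product there is the constant sign
  of \<open>f\<close>; comparing it with the sign \<open>s\<close> obtained on the left decides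
  whether \<open>z\<close> has to join \<open>C\<close>.\<close>

lemma sign_change_set:
  fixes f :: "real \<Rightarrow> real"
  assumes "is_interval I" "continuous_on I f" "finite {x \<in> I. f x = 0}"
  shows "\<exists>C \<subseteq> {x \<in> I. f x = 0}. \<exists>s \<in> {1, - 1}. \<forall>t\<in>I. 0 \<le> s * f t * (\<Prod>c\<in>C. t - c)"
  using assms
proof (induction "card {x \<in> I. f x = 0}" arbitrary: I)
  case 0
  then have "{x \<in> I. f x = 0} = {}" by simp
  then have "(\<forall>t\<in>I. 0 < f t) \<or> (\<forall>t\<in>I. f t < 0)"
    using 0 by (intro connected_const_sign) (auto simp: is_interval_connected)
  then show ?case by (intro exI[of _ "{}"]) (fastforce intro: less_imp_le)
next
  case (Suc n)
  let ?Z = "{x \<in> I. f x = 0}"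
  define z where "z = Max ?Z"
  have ne: "?Z \<noteq> {}" using Suc.hyps(2) by (metis card.empty nat.distinct(1))
  have z: "z \<in> ?Z" unfolding z_def by (rule Max_in[OF Suc.prems(3) ne])
  have zm: "x \<le> z" if "x \<in> ?Z" for x unfolding z_def using Suc.prems(3) that by simp
  define J where "J = I \<inter> {..<z}"
  have JZ: "{x \<in> J. f x = 0} = ?Z - {z}" unfolding J_def using zm by (auto simp: less_le)
  have "\<exists>C \<subseteq> {x \<in> J. f x = 0}. \<exists>s \<in> {1, - 1}. \<forall>t\<in>J. 0 \<le> s * f t * (\<Prod>c\<in>C. t - c)"
  proof (rule Suc.hyps(1))
    show "n = card {x \<in> J. f x = 0}" unfolding JZ using Suc.hyps(2) z by (simp add: card_Diff_singleton)
    show "is_interval J" unfolding J_def using Suc.prems(1)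
      by (intro is_interval_Int) (auto simp: is_interval_io)
    show "continuous_on J f" using Suc.prems(2) unfolding J_def by (auto elim: continuous_on_subset)
    show "finite {x \<in> J. f x = 0}" unfolding JZ using Suc.prems(3) by simp
  qed
  then obtain C s where C: "C \<subseteq> ?Z - {z}" and s: "s \<in> {1, - 1}"
    and nn: "\<And>t. t \<in> J \<Longrightarrow> 0 \<le> s * f t * (\<Prod>c\<in>C. t - c)" unfolding JZ by blast
  have finC: "finite C" using C Suc.prems(3) by (meson finite_Diff finite_subset)
  have Cz: "c < z" if "c \<in> C" for c using C zm that by (force simp: less_le)
  define K where "K = I \<inter> {z<..}"
  have "(\<forall>t\<in>K. 0 < f t) \<or> (\<forall>t\<in>K. f t < 0)"
  proof (rule connected_const_sign)
    have "is_interval K" unfolding K_def using Suc.prems(1)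
      by (intro is_interval_Int) (auto simp: is_interval_oi)
    then show "connected K" by (simp add: is_interval_connected)
    show "continuous_on K f" using Suc.prems(2) unfolding K_def by (auto elim: continuous_on_subset)
    show "f t \<noteq> 0" if "t \<in> K" for t using that zm[of t] unfolding K_def by auto
  qed
  then obtain e where e: "e \<in> {1, - 1::real}" "\<And>t. t \<in> K \<Longrightarrow> 0 < e * f t" by force
  have pos: "0 < (\<Prod>c\<in>C. t - c)" if "t \<in> K" for t
    using that Cz unfolding K_def by (intro prod_pos) force
  have cases: "t \<in> J \<or> t = z \<or> t \<in> K" if "t \<in> I" for t using that unfolding J_def K_def by force
  show ?case
  proof (cases "e = s")
    case True
    have "0 \<le> s * f t * (\<Prod>c\<in>C. t - c)" if "t \<in> I" for t
      using cases[OF that]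
    proof (elim disjE)
      assume t: "t \<in> K"
      show ?thesis using mult_pos_pos[OF e(2)[OF t] pos[OF t]] True by simp
    qed (use nn z in auto)
    then show ?thesis using C s by (intro exI[of _ C]) auto
  next
    case False
    then have es: "e = - s" using e(1) s by auto
    have p: "(\<Prod>c\<in>insert z C. t - c) = (t - z) * (\<Prod>c\<in>C. t - c)" for t
      using finC Cz by (subst prod.insert) auto
    have "0 \<le> e * f t * (\<Prod>c\<in>insert z C. t - c)" if "t \<in> I" for t
      using cases[OF that]
    proof (elim disjE)
      assume t: "t \<in> J"
      have "0 \<le> (z - t) * (s * f t * (\<Prod>c\<in>C. t - c))"
        using mult_nonneg_nonneg[OF _ nn[OF t], of "z - t"] t unfolding J_def by simp
      also have "\<dots> = e * f t * (\<Prod>c\<in>insert z C. t - c)" unfolding p es by (simp add: algebra_simps)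
      finally show ?thesis .
    next
      assume t: "t \<in> K"
      have "0 \<le> (e * f t) * ((t - z) * (\<Prod>c\<in>C. t - c))"
        using mult_pos_pos[OF e(2)[OF t] mult_pos_pos[OF _ pos[OF t], of "t - z"]] t unfolding K_def by simp
      then show ?thesis unfolding p .
    qed (use z in auto)
    then show ?thesis using C e(1) z by (intro exI[of _ "insert z C"]) auto
  qed
qed

text \<open>A homogeneous linear system with more unknowns than equations. One step of Gaussian
  elimination, with pivot \<open>p\<close>, removes the equation at \<open>z\<close> and the unknown
  \<open>p\<close>.\<close>

lemma exists_nontrivial_vanishing_combination:
  fixes \<phi> :: "'i \<Rightarrow> 'a \<Rightarrow> real"
  assumes "finite Z" "finite I" "card Z < card I"
  shows "\<exists>c. (\<exists>i\<in>I. c i \<noteq> 0) \<and> (\<forall>z\<in>Z. (\<Sum>i\<in>I. c i * \<phi> i z) = 0)"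
  using assms
proof (induction Z arbitrary: I \<phi> rule: finite_induct)
  case empty
  then obtain i where "i \<in> I" by fastforce
  then show ?case by (intro exI[of _ "\<lambda>_. 1"]) auto
next
  case (insert z Z)
  show ?case
  proof (cases "\<forall>i\<in>I. \<phi> i z = 0")
    case True
    obtain c where "\<exists>i\<in>I. c i \<noteq> 0" "\<forall>z\<in>Z. (\<Sum>i\<in>I. c i * \<phi> i z) = 0"
      using insert.IH[of I \<phi>] insert.prems insert.hyps by auto
    with True show ?thesis by (intro exI[of _ c]) auto
  next
    case False
    then obtain p where p: "p \<in> I" "\<phi> p z \<noteq> 0" by auto
    define \<psi> where "\<psi> = (\<lambda>i w. \<phi> i w - \<phi> i z / \<phi> p z * \<phi> p w)"
    obtain c where c: "\<exists>i\<in>I - {p}. c i \<noteq> 0" "\<forall>w\<in>Z. (\<Sum>i\<in>I - {p}. c i * \<psi> i w) = 0"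
    proof -
      have "card Z < card (I - {p})" using insert.prems insert.hyps p by (simp add: card_Diff_singleton)
      then show ?thesis using insert.IH[of "I - {p}" \<psi>] insert.prems that by blast
    qed
    define c' where "c' = (\<lambda>i. if i = p then - (\<Sum>i\<in>I - {p}. c i * \<phi> i z) / \<phi> p z else c i)"
    have e: "(\<Sum>i\<in>I. c' i * \<phi> i w) = (\<Sum>i\<in>I - {p}. c i * \<psi> i w)" for w
    proof -
      have "(\<Sum>i\<in>I. c' i * \<phi> i w) = c' p * \<phi> p w + (\<Sum>i\<in>I - {p}. c' i * \<phi> i w)"
        using insert.prems p by (simp add: sum.remove)
      also have "(\<Sum>i\<in>I - {p}. c' i * \<phi> i w) = (\<Sum>i\<in>I - {p}. c i * \<phi> i w)"
        by (intro sum.cong) (auto simp: c'_def)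
      also have "(\<Sum>i\<in>I - {p}. c i * \<psi> i w) =
          (\<Sum>i\<in>I - {p}. c i * \<phi> i w) - (\<Sum>i\<in>I - {p}. c i * \<phi> i z) / \<phi> p z * \<phi> p w"
        unfolding \<psi>_def by (simp add: algebra_simps sum_subtractf sum_distrib_left sum_distrib_right sum_divide_distrib)
      then have "c' p * \<phi> p w + (\<Sum>i\<in>I - {p}. c i * \<phi> i w) = (\<Sum>i\<in>I - {p}. c i * \<psi> i w)"
        by (simp add: c'_def)
      finally show ?thesis .
    qed
    have "(\<Sum>i\<in>I. c' i * \<phi> i z) = 0" unfolding e \<psi>_def using p(2) by simp
    moreover have "\<exists>i\<in>I. c' i \<noteq> 0" using c(1) unfolding c'_def by auto
    ultimately show ?thesis using c(2) e by (intro exI[of _ c']) auto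
  qed
qed

section \<open>Polynomial multiples of Cauchy transforms and vanishing moments\<close>

lemma set_integral_sum:
  fixes f :: "'i \<Rightarrow> real \<Rightarrow> real"
  assumes "\<And>i. i \<in> I \<Longrightarrow> set_integrable M D (f i)"
  shows "(LINT x:D|M. \<Sum>i\<in>I. f i x) = (\<Sum>i\<in>I. LINT x:D|M. f i x)"
  using assms unfolding set_lebesgue_integral_def set_integrable_def
  by (simp add: sum_distrib_left Bochner_Integration.integral_sum)

text \<open>\<open>R\<close> is the integral of \<open>\<rho>\<close> against
  \<open>(p(z) - p(x)) / (z - x)\<close>, a polynomial in \<open>z\<close>. The induction builds it
  in the manner of Horner's scheme: each step adds one moment as the new constant
  coefficient.\<close>

lemma poly_times_ct:
  assumes M: "sets M = sets borel" "finite_measure M" and D: "compact D" and f: "continuous_on D \<rho>"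
  shows "\<exists>R. (R = 0 \<or> degree R < degree p) \<and>
     (\<forall>z. z \<notin> D \<longrightarrow> poly p z * ct M D \<rho> z = ct M D (\<lambda>x. poly p x * \<rho> x) z + poly R z)"
proof (induction p)
  case 0
  then show ?case by (intro exI[of _ 0]) (simp add: ct_def)
next
  case (pCons a q)
  then obtain R where R: "R = 0 \<or> degree R < degree q"
    "\<And>z. z \<notin> D \<Longrightarrow> poly q z * ct M D \<rho> z = ct M D (\<lambda>x. poly q x * \<rho> x) z + poly R z" by auto
  define R' where "R' = pCons (LINT x:D|M. poly q x * \<rho> x) R"
  have "poly (pCons a q) z * ct M D \<rho> z = ct M D (\<lambda>x. poly (pCons a q) x * \<rho> x) z + poly R' z"
    if z: "z \<notin> D" for z
  proof -
    have ne: "z - x \<noteq> 0" if "x \<in> D" for x using z that by auto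
    have i: "set_integrable M D (\<lambda>x. a * (\<rho> x / (z - x)))" "set_integrable M D (\<lambda>x. x * (poly q x * \<rho> x) / (z - x))"
      by (rule set_integrable_compact[OF M D], use ne in \<open>force intro!: continuous_intros f\<close>)+
    have "ct M D (\<lambda>x. poly (pCons a q) x * \<rho> x) z = (LINT x:D|M. a * (\<rho> x / (z - x)) + x * (poly q x * \<rho> x) / (z - x))"
      unfolding ct_def by (rule arg_cong[where f="set_lebesgue_integral M D"]) (auto simp: field_simps add_divide_distrib)
    also have "\<dots> = a * ct M D \<rho> z + ct M D (\<lambda>x. x * (poly q x * \<rho> x)) z"
      unfolding ct_def by (subst set_integral_add(2)[OF i]) (simp del: times_divide_eq_right)
    also have "ct M D (\<lambda>x. x * (poly q x * \<rho> x)) z = z * ct M D (\<lambda>x. poly q x * \<rho> x) z - (LINT x:D|M. poly q x * \<rho> x)"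
      by (rule ct_mult_var[OF M D _ z]) (auto intro!: continuous_intros f)
    finally show ?thesis unfolding R'_def using R(2)[OF z] by (simp add: algebra_simps)
  qed
  moreover have "R' = 0 \<or> degree R' < degree (pCons a q)"
  proof (cases "q = 0")
    case True
    then show ?thesis using R(1) by (auto simp: R'_def)
  next
    case False
    then show ?thesis using R(1) by (auto simp: R'_def)
  qed
  ultimately show ?case by blast
qed

lemma poly_tendsto_0_imp_zero:
  fixes R :: "real poly"
  assumes "((\<lambda>z. poly R z) \<longlongrightarrow> 0) at_top"
  shows "R = 0"
proof (rule ccontr)
  assume R: "R \<noteq> 0"
  show False
  proof (cases "degree R = 0")
    case True
    then obtain c where "R = [:c:]" by (rule degree_eq_zeroE)
    with assms have "((\<lambda>_. c) \<longlongrightarrow> 0) (at_top :: real filter)" by simp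
    then have "c = 0" by (simp add: tendsto_const_iff)
    with \<open>R = [:c:]\<close> R show False by simp
  next
    case False
    then have "filterlim (poly R) at_infinity at_infinity" by (intro filterlim_poly_at_infinity) simp
    then have "filterlim (poly R) at_infinity at_top"
      by (rule filterlim_compose) (rule filterlim_mono[OF filterlim_ident], auto simp: at_top_le_at_infinity)
    with assms show False
      using not_tendsto_and_filterlim_at_infinity[of "at_top :: real filter"] by auto
  qed
qed

text \<open>The decay is consumed one power at a time. As long as a power of \<open>z\<close> is
  left, \<open>ct_asymp\<close> identifies the limit with the current moment, which is then zero;
  with that moment gone, \<open>ct_mult_var\<close> trades one factor \<open>z\<close> for a factor
  \<open>x\<close> in the density.\<close>

lemma vanishing_moments:
  assumes M: "sets M = sets borel" "finite_measure M" and D: "compact D" and f: "continuous_on D \<rho>"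
    and lim: "((\<lambda>z. z ^ n * ct M D \<rho> z) \<longlongrightarrow> 0) at_top" and p: "p = 0 \<or> degree p < n"
  shows "(LINT x:D|M. poly p x * \<rho> x) = 0"
proof -
  have outD: "\<forall>\<^sub>F z in at_top. z \<notin> D"
  proof -
    obtain R where R: "\<And>x. x \<in> D \<Longrightarrow> \<bar>x\<bar> \<le> R" using compact_imp_bounded[OF D] by (auto simp: bounded_iff)
    show ?thesis using eventually_gt_at_top[of R] by eventually_elim (use R in force)
  qed
  have cont: "continuous_on D (\<lambda>x. x ^ j * \<rho> x)" for j by (intro continuous_intros f)
  have step: "(LINT x:D|M. x ^ j * \<rho> x) = 0 \<and> ((\<lambda>z. z ^ (n - Suc j) * ct M D (\<lambda>x. x ^ Suc j * \<rho> x) z) \<longlongrightarrow> 0) at_top"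
    if j: "j < n" and l: "((\<lambda>z. z ^ (n - j) * ct M D (\<lambda>x. x ^ j * \<rho> x) z) \<longlongrightarrow> 0) at_top" for j
  proof -
    have nj: "n - j = Suc (n - Suc j)" using j by simp
    have "((\<lambda>z. z * ct M D (\<lambda>x. x ^ j * \<rho> x) z) \<longlongrightarrow> 0) at_top"
    proof (rule Lim_null_comparison)
      show "\<forall>\<^sub>F z in at_top. norm (z * ct M D (\<lambda>x. x ^ j * \<rho> x) z) \<le> \<bar>z ^ (n - j) * ct M D (\<lambda>x. x ^ j * \<rho> x) z\<bar>"
        using eventually_ge_at_top[of 1]
      proof eventually_elim
        case (elim z)
        have "1 * \<bar>z * ct M D (\<lambda>x. x ^ j * \<rho> x) z\<bar> \<le> z ^ (n - Suc j) * \<bar>z * ct M D (\<lambda>x. x ^ j * \<rho> x) z\<bar>"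
          by (intro mult_right_mono one_le_power elim) auto
        also have "\<dots> = \<bar>z ^ (n - j) * ct M D (\<lambda>x. x ^ j * \<rho> x) z\<bar>"
          using elim unfolding nj by (simp add: abs_mult)
        finally show ?case by simp
      qed
      show "((\<lambda>z. \<bar>z ^ (n - j) * ct M D (\<lambda>x. x ^ j * \<rho> x) z\<bar>) \<longlongrightarrow> 0) at_top"
        using l by (rule tendsto_rabs_zero)
    qed
    then have 0: "(LINT x:D|M. x ^ j * \<rho> x) = 0"
      using ct_asymp[OF M D cont] tendsto_unique trivial_limit_at_top_linorder by blast
    have "\<forall>\<^sub>F z in at_top. z ^ (n - j) * ct M D (\<lambda>x. x ^ j * \<rho> x) z = z ^ (n - Suc j) * ct M D (\<lambda>x. x ^ Suc j * \<rho> x) z"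
      using outD
    proof eventually_elim
      case (elim z)
      show ?case using ct_mult_var[OF M D cont elim, of j] unfolding nj 0 by (simp add: mult.assoc)
    qed
    with l 0 show ?thesis by (simp add: tendsto_cong)
  qed
  have "((\<lambda>z. z ^ (n - j) * ct M D (\<lambda>x. x ^ j * \<rho> x) z) \<longlongrightarrow> 0) at_top" if "j \<le> n" for j
    using that by (induction j) (use lim step in auto)
  then have mom: "(LINT x:D|M. x ^ j * \<rho> x) = 0" if "j < n" for j using step that by auto
  have "(LINT x:D|M. poly p x * \<rho> x) = (LINT x:D|M. \<Sum>i\<le>degree p. coeff p i * (x ^ i * \<rho> x))"
    by (simp add: poly_altdef sum_distrib_right mult.assoc)
  also have "\<dots> = (\<Sum>i\<le>degree p. coeff p i * (LINT x:D|M. x ^ i * \<rho> x))"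
    by (subst set_integral_sum) (auto intro!: set_integrable_compact[OF M D] continuous_intros f)
  also have "\<dots> = 0" using p mom by (intro sum.neutral) auto
  finally show ?thesis .
qed

section \<open>The reciprocal of a Cauchy transform\<close>

lemma set_integral_nonzero_fat:
  fixes f :: "real \<Rightarrow> real"
  assumes M: "fat M D" and D: "compact D" "connected D" and f: "continuous_on D f"
    and nz: "\<And>x. x \<in> D \<Longrightarrow> f x \<noteq> 0"
  shows "(LINT x:D|M. f x) \<noteq> 0"
  using connected_const_sign[OF D(2) f nz]
proof
  assume p: "\<forall>t\<in>D. 0 < f t"
  have "{x \<in> D. f x = 0} = {}" using nz by auto
  then have fin: "finite {x \<in> D. f x = 0}" by (simp only: finite.emptyI)
  have "0 < (LINT x:D|M. f x)"
    using p by (intro set_integral_pos_fat[OF M D(1) f _ fin]) (auto intro: less_imp_le)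
  then show ?thesis by simp
next
  assume p: "\<forall>t\<in>D. f t < 0"
  have "{x \<in> D. - f x = 0} = {}" using nz by auto
  then have fin: "finite {x \<in> D. - f x = 0}" by (simp only: finite.emptyI)
  have "0 < (LINT x:D|M. - f x)"
    using p by (intro set_integral_pos_fat[OF M D(1) _ _ fin] continuous_intros f) (auto intro: less_imp_le)
  also have "(LINT x:D|M. - f x) = - (LINT x:D|M. f x)"
    using set_integrable_compact[OF _ _ D(1) f] M by (intro set_integral_uminus) (auto simp: fat_def)
  finally show ?thesis by simp
qed

lemma ct_nonzero:
  assumes M: "fat M D" and D: "compact D" "connected D" and f: "continuous_on D \<rho>"
    and nz: "\<And>x. x \<in> D \<Longrightarrow> \<rho> x \<noteq> 0" and z: "z \<notin> D"
  shows "ct M D \<rho> z \<noteq> 0"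
proof -
  have ne: "z - x \<noteq> 0" if "x \<in> D" for x using z that by auto
  show ?thesis unfolding ct_def
    by (rule set_integral_nonzero_fat[OF M D]) (use ne nz in \<open>force intro!: continuous_intros f\<close>)+
qed

text \<open>For a discrete measure the zeros of the Cauchy transform interlace with the nodes, and the reciprocal is
  expanded in partial fractions at these zeros.\<close>

lemma discrete_reciprocal:
  fixes V :: "real set" and w :: "real \<Rightarrow> real"
  assumes V: "finite V" "V \<noteq> {}" "V \<subseteq> {p..q}" and w: "\<And>v. v \<in> V \<Longrightarrow> 0 < w v"
  shows "\<exists>Y \<tau> b. finite Y \<and> Y \<subseteq> {p..q} \<and> (\<forall>y\<in>Y. 0 < \<tau> y) \<and>
     (\<forall>z. z \<notin> {p..q} \<longrightarrow> 1 / (\<Sum>v\<in>V. w v / (z - v)) = z / (\<Sum>v\<in>V. w v) + b - (\<Sum>y\<in>Y. \<tau> y / (z - y)))"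
\<comment> \<open>With a single node the numerator is constant and has no zeros, so the later bound
  \<open>degree T < card Y\<close> could not hold; the reciprocal is then affine.\<close>
proof (cases "card V = 1")
  case True
  then obtain v where "V = {v}" by (auto simp: card_1_singleton_iff)
  then show ?thesis using w
    by (intro exI[of _ "{}"] exI[of _ "\<lambda>_. 1"] exI[of _ "- v / w v"]) (auto simp: diff_divide_distrib)
next
  case False
  define n where "n = card V"
  have n: "2 \<le> n" using False V(1,2) unfolding n_def by (metis One_nat_def Suc_1 card_0_eq le_antisym not_less_eq_eq nat_le_linear le_0_eq)
  define m where "m = (\<Sum>v\<in>V. w v)"
  have m: "0 < m" unfolding m_def using V w by (intro sum_pos) auto
  define L where "L = (\<lambda>v. \<Prod>u\<in>V - {v}. [:- u, 1::real:])"
  define P where "P = (\<Sum>v\<in>V. smult (w v) (L v))"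
  define Q where "Q = (\<Prod>v\<in>V. [:- v, 1::real:])"
  have Qz: "poly Q z = (\<Prod>v\<in>V. z - v)" for z unfolding Q_def by (simp add: poly_prod)
  have Lz: "poly (L v) z = (\<Prod>u\<in>V - {v}. z - u)" for v z unfolding L_def by (simp add: poly_prod)
  have Pz: "poly P z = (\<Sum>v\<in>V. w v * (\<Prod>u\<in>V - {v}. z - u))" for z unfolding P_def by (simp add: poly_sum Lz)
  have monic: "degree (\<Prod>u\<in>A. [:- u, 1::real:]) = card A \<and> coeff (\<Prod>u\<in>A. [:- u, 1::real:]) (card A) = 1"
    if "finite A" for A
  proof -
    have d: "degree (\<Prod>u\<in>A. [:- u, 1::real:]) = card A"
      by (subst degree_prod_eq_sum_degree) auto
    have "lead_coeff (\<Prod>u\<in>A. [:- u, 1::real:]) = 1"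
      by (subst lead_coeff_prod) simp
    with d show ?thesis by simp
  qed
  have dQ: "degree Q = n" "coeff Q n = 1" using monic[OF V(1)] unfolding Q_def n_def by auto
  have dL: "degree (L v) = n - 1" "coeff (L v) (n - 1) = 1" if "v \<in> V" for v
    using monic[of "V - {v}"] V(1) that unfolding L_def n_def by (auto simp: card_Diff_singleton)
  have dP: "degree P \<le> n - 1"
    unfolding P_def by (intro degree_sum_le) (use dL V(1) in \<open>auto intro: order_trans[OF degree_smult_le]\<close>)
  have cP: "coeff P (n - 1) = m"
    unfolding P_def m_def coeff_sum by (intro sum.cong) (simp_all only: coeff_smult dL mult_1_right)
  have PQ: "poly P z = poly Q z * (\<Sum>v\<in>V. w v / (z - v))" if "z \<notin> V" for z
  proof -
    have "w v * (\<Prod>u\<in>V - {v}. z - u) = (\<Prod>v\<in>V. z - v) * (w v / (z - v))" if v: "v \<in> V" for v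
    proof -
      have "z - v \<noteq> 0" using v \<open>z \<notin> V\<close> by auto
      then show ?thesis using prod.remove[OF V(1) v, of "\<lambda>u. z - u"] by simp
    qed
    then show ?thesis unfolding Pz Qz sum_distrib_left by (intro sum.cong) auto
  qed
  have Pv: "poly P v = w v * (\<Prod>u\<in>V - {v}. v - u)" if v: "v \<in> V" for v
  proof -
    have "poly P v = (\<Sum>x\<in>V. if x = v then w v * (\<Prod>u\<in>V - {v}. v - u) else 0)"
      unfolding Pz
    proof (intro sum.cong refl)
      fix x assume x: "x \<in> V"
      show "w x * (\<Prod>u\<in>V - {x}. v - u) = (if x = v then w v * (\<Prod>u\<in>V - {v}. v - u) else 0)"
      proof (cases "x = v")
        case False
        then have "(\<Prod>u\<in>V - {x}. v - u) = 0" using v V(1) by (intro prod_zero) auto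
        with False show ?thesis by simp
      qed simp
    qed
    then show ?thesis using v V(1) by simp
  qed
  \<comment> \<open>Every node except the last has a successor \<open>s v\<close>. All other nodes
    lie on the same side of \<open>v\<close> and of \<open>s v\<close>, so in
    \<open>poly P v * poly P (s v)\<close> only the factors joining these two differ in sign, and
    \<open>P\<close> has a zero in between. This accounts for all \<open>n - 1\<close>
    zeros.\<close>
  define V' where "V' = V - {Max V}"
  define s where "s = (\<lambda>v. Min {u \<in> V. v < u})"
  have s: "s v \<in> V" "v < s v" "\<And>u. u \<in> V \<Longrightarrow> v < u \<Longrightarrow> s v \<le> u" if "v \<in> V'" for v
  proof -
    have "Max V \<in> {u \<in> V. v < u}" using that V unfolding V'_def by (auto simp: less_le)
    then have "s v \<in> {u \<in> V. v < u}" unfolding s_def using V(1) by (intro Min_in) auto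
    then show "s v \<in> V" "v < s v" by auto
    show "s v \<le> u" if "u \<in> V" "v < u" for u unfolding s_def using that V(1) by (intro Min_le) auto
  qed
  have "\<exists>y. v < y \<and> y < s v \<and> poly P y = 0" if v: "v \<in> V'" for v
  proof -
    have vV: "v \<in> V" using v V'_def by auto
    note sv = s[OF v]
    have fin: "finite (V - {v, s v})" using V(1) by simp
    have e1: "(\<Prod>u\<in>V - {v}. v - u) = (v - s v) * (\<Prod>u\<in>V - {v, s v}. v - u)"
    proof -
      have "V - {v} - {s v} = V - {v, s v}" by auto
      then show ?thesis using V(1) sv prod.remove[of "V - {v}" "s v" "\<lambda>u. v - u"] by simp
    qed
    have e2: "(\<Prod>u\<in>V - {s v}. s v - u) = (s v - v) * (\<Prod>u\<in>V - {v, s v}. s v - u)"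
    proof -
      have "V - {s v} - {v} = V - {v, s v}" by auto
      then show ?thesis using V(1) sv vV prod.remove[of "V - {s v}" v "\<lambda>u. s v - u"] by simp
    qed
    have pos: "0 < (\<Prod>u\<in>V - {v, s v}. (v - u) * (s v - u))"
    proof (rule prod_pos)
      fix u assume u: "u \<in> V - {v, s v}"
      show "0 < (v - u) * (s v - u)"
      proof (cases "u < v")
        case True then show ?thesis using sv by (intro mult_pos_pos) auto
      next
        case False
        then have "v < u" using u by auto
        then have "s v < u" using sv(3)[of u] u by auto
        then show ?thesis using sv by (intro mult_neg_neg) auto
      qed
    qed
    have "poly P v * poly P (s v) = (w v * w (s v)) * ((v - s v) * (s v - v)) * (\<Prod>u\<in>V - {v, s v}. (v - u) * (s v - u))"
      unfolding Pv[OF vV] Pv[OF sv(1)] e1 e2 prod.distrib by (simp only: mult_ac)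
    also have "\<dots> < 0"
      using w[OF vV] w[OF sv(1)] sv(2) pos
      by (intro mult_neg_pos mult_pos_neg mult_pos_pos) (auto intro: mult_neg_pos)
    finally show ?thesis using poly_IVT[OF sv(2), of P] by auto
  qed
  then obtain y where y: "\<And>v. v \<in> V' \<Longrightarrow> v < y v \<and> y v < s v \<and> poly P (y v) = 0" by metis
  have mono: "y v < y u" if "v \<in> V'" "u \<in> V'" "v < u" for u v
    using y[OF that(1)] y[OF that(2)] s(3)[OF that(1), of u] that unfolding V'_def by auto
  have inj: "inj_on y V'" by (rule inj_onI) (metis mono less_irrefl linorder_neqE_linordered_idom)
  define Y where "Y = y ` V'"
  have finY: "finite Y" unfolding Y_def V'_def using V(1) by simp
  have cardY: "card Y = n - 1"
  proof -
    have "card Y = card V'" unfolding Y_def by (rule card_image[OF inj])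
    also have "\<dots> = n - 1" unfolding V'_def n_def using V by (simp add: card_Diff_singleton)
    finally show ?thesis .
  qed
  have YV: "Y \<inter> V = {}"
    unfolding Y_def using y s(3) by force
  have Ypq: "Y \<subseteq> {p..q}"
  proof
    fix t assume "t \<in> Y"
    then obtain v where v: "v \<in> V'" "t = y v" unfolding Y_def by auto
    then have "v \<in> V" "s v \<in> V" "v < t" "t < s v" using y s V'_def by auto
    then show "t \<in> {p..q}" using V(3) by force
  qed
  have PY: "P = smult m (\<Prod>y\<in>Y. [:- y, 1:])"
  proof (rule poly_eqI_degree_lead_coeff[where n="n - 1" and A=Y])
    show "coeff P (n - 1) = coeff (smult m (\<Prod>y\<in>Y. [:- y, 1:])) (n - 1)"
      using monic[OF finY] cardY cP by simp
    show "degree (smult m (\<Prod>y\<in>Y. [:- y, 1:])) \<le> n - 1" using monic[OF finY] cardY by simp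
    show "poly P x = poly (smult m (\<Prod>y\<in>Y. [:- y, 1:])) x" if "x \<in> Y" for x
      using that y finY by (auto simp: Y_def poly_prod)
  qed (use dP cardY in auto)
  have PYz: "poly P z = m * (\<Prod>y\<in>Y. z - y)" for z unfolding PY by (simp add: poly_prod)
  \<comment> \<open>Division of \<open>Q\<close> by \<open>P\<close>: the factor
    \<open>z / m\<close> cancels the leading coefficient because \<open>P\<close> has leading
    coefficient \<open>m\<close>, the constant \<open>b\<close> cancels the next one, and the
    remainder \<open>T\<close> has degree below \<open>n - 1\<close>.\<close>
  define R where "R = Q - [:0, 1 / m:] * P"
  define b where "b = coeff R (n - 1) / m"
  define T where "T = R - smult b P"
  have "coeff T i = 0" if i: "n - 1 \<le> i" for i
  proof (cases "i = n - 1")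
    case True
    then show ?thesis unfolding T_def b_def using cP m by simp
  next
    case False
    then have P0: "coeff P i = 0" using dP i by (intro coeff_eq_0) simp
    have "coeff R i = coeff Q i - coeff P (i - 1) / m"
      unfolding R_def using i n by (cases i) auto
    also have "\<dots> = 0"
    proof (cases "i = n")
      case True then show ?thesis using dQ cP m by simp
    next
      case False
      then have "n < i" using i \<open>i \<noteq> n - 1\<close> by simp
      then have "coeff Q i = 0" "coeff P (i - 1) = 0" using dQ(1) dP n by (auto intro!: coeff_eq_0)
      then show ?thesis by simp
    qed
    finally show ?thesis unfolding T_def using P0 by simp
  qed
  then have dT: "degree T < card Y"
    unfolding cardY using n by (intro degree_lessI) auto
  have QT: "poly Q z = (z / m + b) * poly P z + poly T z" for z
    unfolding T_def R_def by (simp add: algebra_simps)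
  define G where "G = (\<lambda>y z. m * (\<Prod>u\<in>Y - {y}. z - u))"
  \<comment> \<open>\<open>G y y\<close> is the derivative of \<open>P\<close> at its zero
    \<open>y\<close>. With \<open>P = Q f\<close> and \<open>f(y) = 0\<close> it equals
    \<open>Q(y) f'(y)\<close>, and \<open>- f'(y)\<close> is a sum of positive terms; this is what
    makes the coefficients \<open>\<tau>\<close> positive. The derivative is computed as the limit
    of two expressions for the difference quotient.\<close>
  have G: "G y y = - poly Q y * (\<Sum>v\<in>V. w v / (y - v) ^ 2)" if yY: "y \<in> Y" for y
  proof -
    define H where "H = (\<lambda>z. - poly Q z * (\<Sum>v\<in>V. w v / ((z - v) * (y - v))))"
    have yV: "y \<notin> V" using yY YV by auto
    have "open (- V)" using V(1) by (simp add: finite_imp_closed open_Compl)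
    then have ev: "\<forall>\<^sub>F z in at y. z \<notin> V"
      using eventually_at_in_open'[of "- V" y] yV by simp
    have Py: "(\<Sum>v\<in>V. w v / (y - v)) = 0"
    proof -
      have "poly P y = 0" using yY finY unfolding PYz by auto
      moreover have "poly Q y \<noteq> 0" unfolding Qz using V(1) yV by auto
      ultimately show ?thesis using PQ[OF yV] by simp
    qed
    have eq: "\<forall>\<^sub>F z in at y. G y z = H z"
      using ev eventually_neq_at_within[of y]
    proof eventually_elim
      case (elim z)
      have "(z - y) * G y z = poly P z"
        unfolding G_def PYz using finY yY by (simp add: prod.remove)
      also have "\<dots> = poly Q z * ((\<Sum>v\<in>V. w v / (z - v)) - (\<Sum>v\<in>V. w v / (y - v)))"
        using PQ[OF elim(1)] Py by simp
      also have "\<dots> = (z - y) * H z"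
      proof -
        have "w v / (z - v) - w v / (y - v) = - (z - y) * (w v / ((z - v) * (y - v)))" if "v \<in> V" for v
        proof -
          have "z - v \<noteq> 0" "y - v \<noteq> 0" using that elim(1) yV by auto
          then show ?thesis by (simp add: field_simps)
        qed
        then have "(\<Sum>v\<in>V. w v / (z - v)) - (\<Sum>v\<in>V. w v / (y - v)) = - (z - y) * (\<Sum>v\<in>V. w v / ((z - v) * (y - v)))"
          unfolding sum_subtractf[symmetric] sum_distrib_left by (intro sum.cong) auto
        then show ?thesis unfolding H_def by (simp only: mult_minus_left mult_minus_right mult_ac)
      qed
      finally show ?case using elim by simp
    qed
    have "continuous_on (- V) H"
      unfolding H_def by (intro continuous_intros) (use yV in auto)
    then have "isCont H y"
      using yV \<open>open (- V)\<close> by (simp add: continuous_on_eq_continuous_at)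
    then have "(H \<longlongrightarrow> H y) (at y)" by (simp add: isCont_def)
    moreover have "isCont (G y) y" unfolding G_def by (intro continuous_intros)
    then have "(G y \<longlongrightarrow> G y y) (at y)" by (simp add: isCont_def)
    ultimately have "G y y = H y"
      using eq tendsto_cong[OF eq] tendsto_unique trivial_limit_at by blast
    then show ?thesis unfolding H_def by (simp add: power2_eq_square)
  qed
  define \<tau> where "\<tau> = (\<lambda>y. 1 / (\<Sum>v\<in>V. w v / (y - v) ^ 2))"
  have \<tau>pos: "0 < \<tau> y" if "y \<in> Y" for y
  proof -
    have "0 < w v / (y - v) ^ 2" if "v \<in> V" for v
      using w[OF that] that YV \<open>y \<in> Y\<close> by (intro divide_pos_pos) auto
    then have "0 < (\<Sum>v\<in>V. w v / (y - v) ^ 2)" using V by (intro sum_pos) auto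
    then show ?thesis unfolding \<tau>_def by simp
  qed
  have "1 / (\<Sum>v\<in>V. w v / (z - v)) = z / m + b - (\<Sum>y\<in>Y. \<tau> y / (z - y))" if z: "z \<notin> {p..q}" for z
  proof -
    have zV: "z \<notin> V" "z \<notin> Y" using z V(3) Ypq by auto
    have Q0: "poly Q z \<noteq> 0" unfolding Qz using V(1) zV by auto
    have P0: "poly P z \<noteq> 0" unfolding PYz using finY zV m by auto
    have "1 / (\<Sum>v\<in>V. w v / (z - v)) = poly Q z / poly P z"
      unfolding PQ[OF zV(1)] using Q0 by simp
    also have "\<dots> = z / m + b + poly T z / poly P z"
      unfolding QT[of z] using P0 by (simp add: field_simps)
    also have "poly T z / poly P z = (poly T z / (\<Prod>y\<in>Y. z - y)) / m"
      unfolding PYz by (simp add: mult.commute)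
    also have "poly T z / (\<Prod>y\<in>Y. z - y) = (\<Sum>y\<in>Y. poly T y / ((\<Prod>u\<in>Y - {y}. y - u) * (z - y)))"
      using partial_fractions[OF finY dT zV(2)] by simp
    also have "\<dots> / m = (\<Sum>y\<in>Y. - (\<tau> y / (z - y)))"
      unfolding sum_divide_distrib
    proof (intro sum.cong refl)
      fix y assume y: "y \<in> Y"
      have "poly P y = 0" using y finY unfolding PYz by auto
      then have T: "poly T y = poly Q y" using QT[of y] by simp
      have Qy: "poly Q y \<noteq> 0" unfolding Qz using V(1) y YV by auto
      have s0: "(\<Sum>v\<in>V. w v / (y - v) ^ 2) \<noteq> 0" using \<tau>pos[OF y] unfolding \<tau>_def by auto
      have "poly T y / ((\<Prod>u\<in>Y - {y}. y - u) * (z - y)) / m = (poly Q y / G y y) / (z - y)"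
        unfolding T G_def by (simp add: mult_ac)
      also have "poly Q y / G y y = - \<tau> y" unfolding G[OF y] \<tau>_def using Qy s0 by (simp add: field_simps)
      finally show "poly T y / ((\<Prod>u\<in>Y - {y}. y - u) * (z - y)) / m = - (\<tau> y / (z - y))" by simp
    qed
    finally show ?thesis by (simp add: sum_negf)
  qed
  then show ?thesis using finY Ypq \<tau>pos unfolding m_def by blast
qed

section \<open>From finite sums to measures: discretisation and weak limits\<close>

lemma finite_measure_integral_finite_range:
  fixes g :: "real \<Rightarrow> real"
  assumes M: "sets M = sets borel" "finite_measure M" and D: "D \<in> sets borel"
    and \<phi>: "\<phi> \<in> borel_measurable borel" and fin: "finite (\<phi> ` D)"
  shows "(LINT x:D|M. g (\<phi> x)) = (\<Sum>v\<in>\<phi> ` D. measure M {x \<in> D. \<phi> x = v} * g v)"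
proof -
  interpret finite_measure M by fact
  have meas: "{x \<in> D. \<phi> x = v} \<in> sets M" for v
  proof -
    have "{x \<in> D. \<phi> x = v} = D \<inter> (\<phi> -` {v} \<inter> space borel)" by auto
    also have "\<dots> \<in> sets borel" using D \<phi> by (intro sets.Int measurable_sets) auto
    finally show ?thesis using M(1) by simp
  qed
  have "indicator D x *\<^sub>R g (\<phi> x) = (\<Sum>v\<in>\<phi> ` D. g v * indicator {x \<in> D. \<phi> x = v} x)" for x
  proof (cases "x \<in> D")
    case True
    then have "(\<Sum>v\<in>\<phi> ` D. g v * indicator {x \<in> D. \<phi> x = v} x) = (\<Sum>v\<in>\<phi> ` D. if v = \<phi> x then g (\<phi> x) else 0)"
      by (intro sum.cong) (auto simp: indicator_def)
    also have "\<dots> = g (\<phi> x)" using True fin by simp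
    finally show ?thesis using True by simp
  qed (auto simp: indicator_def)
  then have "(LINT x:D|M. g (\<phi> x)) = (LINT x|M. (\<Sum>v\<in>\<phi> ` D. g v * indicator {x \<in> D. \<phi> x = v} x))"
    unfolding set_lebesgue_integral_def by simp
  also have "\<dots> = (\<Sum>v\<in>\<phi> ` D. g v * measure M {x \<in> D. \<phi> x = v})"
    using meas by (subst Bochner_Integration.integral_sum) (auto simp: emeasure_eq_measure)
  finally show ?thesis by (simp add: mult.commute)
qed

text \<open>The weights are normalised to a probability measure so that Helly's selection theorem
  applies. Keeping the total weight as a factor covers the empty set, for which a unit mass at
  \<open>p\<close> serves. The interval starts at \<open>p - 1\<close> because the intervals of
  tightness are open on the left.\<close>

lemma real_distribution_finite_support:
  fixes Y :: "real set"
  assumes Y: "finite Y" "Y \<subseteq> {p..q}" and \<tau>: "\<And>y. y \<in> Y \<Longrightarrow> 0 < \<tau> y" and pq: "p \<le> q"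
  shows "\<exists>\<mu>. real_distribution \<mu> \<and> measure \<mu> {p - 1<..q + 1} = 1 \<and>
     (\<forall>g \<in> borel_measurable borel. (\<Sum>y\<in>Y. \<tau> y) * (LINT x|\<mu>. g x) = (\<Sum>y\<in>Y. \<tau> y * (g y :: real)))"
proof -
  have *: "\<exists>\<mu>. real_distribution \<mu> \<and> measure \<mu> {p - 1<..q + 1} = 1 \<and>
     (\<forall>g \<in> borel_measurable borel. (\<Sum>y\<in>Y. \<tau> y) * (LINT x|\<mu>. g x) = (\<Sum>y\<in>Y. \<tau> y * (g y :: real)))"
    if Y: "finite Y" "Y \<subseteq> {p..q}" "Y \<noteq> {}" and \<tau>: "\<And>y. y \<in> Y \<Longrightarrow> 0 < \<tau> y" for Y \<tau>
  proof -
    define T where "T = (\<Sum>y\<in>Y. \<tau> y)"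
    have T: "0 < T" unfolding T_def using Y \<tau> by (intro sum_pos) auto
    define P where "P = point_measure Y (\<lambda>y. ennreal (\<tau> y / T))"
    define \<mu> where "\<mu> = distr P borel (\<lambda>x. x)"
    have mid: "(\<lambda>x. x) \<in> measurable P borel" unfolding P_def by simp
    have nn: "0 \<le> \<tau> y / T" if "y \<in> Y" for y using \<tau>[OF that] T by simp
    have em: "emeasure P (space P) = 1"
    proof -
      have "emeasure P (space P) = (\<Sum>y\<in>Y. ennreal (\<tau> y / T))"
        unfolding P_def by (subst emeasure_point_measure_finite) (auto simp: Y space_point_measure)
      also have "\<dots> = ennreal (\<Sum>y\<in>Y. \<tau> y / T)" by (rule sum_ennreal) (use nn in auto)
      also have "(\<Sum>y\<in>Y. \<tau> y / T) = 1" using T by (simp add: sum_divide_distrib[symmetric] T_def)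
      finally show ?thesis by simp
    qed
    then interpret P: prob_space P by (rule prob_spaceI)
    interpret \<mu>: prob_space \<mu> unfolding \<mu>_def by (rule P.prob_space_distr[OF mid])
    have rd: "real_distribution \<mu>" unfolding \<mu>_def by (rule real_distribution.intro) (auto simp: \<mu>.prob_space_axioms[unfolded \<mu>_def] real_distribution_axioms_def)
    have "measure \<mu> {p - 1<..q + 1} = measure P ((\<lambda>x. x) -` {p - 1<..q + 1} \<inter> space P)"
      unfolding \<mu>_def using mid by (rule measure_distr) auto
    also have "(\<lambda>x. x) -` {p - 1<..q + 1} \<inter> space P = space P"
      using Y(2) unfolding P_def by (force simp: space_point_measure)
    also have "measure P (space P) = 1" by (rule P.prob_space)
    finally have ms: "measure \<mu> {p - 1<..q + 1} = 1" .
    have "T * (LINT x|\<mu>. g x) = (\<Sum>y\<in>Y. \<tau> y * g y)" if g: "g \<in> borel_measurable borel" for g :: "real \<Rightarrow> real"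
    proof -
      have "(LINT x|\<mu>. g x) = (LINT x|P. g x)" unfolding \<mu>_def by (rule integral_distr[OF mid g])
      also have "\<dots> = (\<Sum>y\<in>Y. \<tau> y / T * g y)"
        unfolding P_def using Y nn by (subst lebesgue_integral_point_measure_finite) auto
      also have "T * \<dots> = (\<Sum>y\<in>Y. \<tau> y * g y)" using T by (simp add: sum_distrib_left)
      finally show ?thesis .
    qed
    then show ?thesis using rd ms unfolding T_def by blast
  qed
  show ?thesis
  proof (cases "Y = {}")
    case True
    obtain \<mu> where "real_distribution \<mu>" "measure \<mu> {p - 1<..q + 1} = 1"
      using *[of "{p}" "\<lambda>_. 1"] pq by auto
    with True show ?thesis by auto
  qed (use * Y \<tau> in blast)
qed

text \<open>Helly's selection theorem on a fixed compact interval, for masses that converge but need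
  not be 1.\<close>

lemma weak_limit_compact_support:
  fixes Y :: "nat \<Rightarrow> real set" and \<tau> :: "nat \<Rightarrow> real \<Rightarrow> real"
  assumes pq: "p \<le> q" and Y: "\<And>n. finite (Y n)" "\<And>n. Y n \<subseteq> {p..q}" and \<tau>: "\<And>n y. y \<in> Y n \<Longrightarrow> 0 < \<tau> n y"
    and T: "(\<lambda>n. \<Sum>y\<in>Y n. \<tau> n y) \<longlonglongrightarrow> T"
  shows "\<exists>r \<nu>. strict_mono r \<and> sets \<nu> = sets borel \<and> finite_measure \<nu> \<and>
     (\<forall>g. continuous_on {p..q} g \<longrightarrow> (\<lambda>n. \<Sum>y\<in>Y (r n). \<tau> (r n) y * g y) \<longlonglongrightarrow> (LINT x:{p..q}|\<nu>. g x))"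
proof -
  have "\<forall>n::nat. \<exists>\<mu>::real measure. real_distribution \<mu> \<and> measure \<mu> {p - 1<..q + 1} = 1 \<and>
     (\<forall>g. g \<in> borel_measurable borel \<longrightarrow> (\<Sum>y\<in>Y n. \<tau> n y) * (LINT x|\<mu>. g x) = (\<Sum>y\<in>Y n. \<tau> n y * (g y :: real)))" (is "\<forall>n. ?P n")
  proof
    fix n
    show "?P n" using real_distribution_finite_support[OF Y(1)[of n] Y(2)[of n] _ pq, of "\<tau> n"] \<tau> by blast
  qed
  then obtain \<mu> where \<mu>: "\<And>n. real_distribution (\<mu> n)" "\<And>n. measure (\<mu> n) {p - 1<..q + 1} = 1"
    "\<And>n g. g \<in> borel_measurable borel \<Longrightarrow> (\<Sum>y\<in>Y n. \<tau> n y) * (LINT x|\<mu> n. g x) = (\<Sum>y\<in>Y n. \<tau> n y * (g y :: real))"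
    by metis
  have "tight \<mu>" unfolding tight_def
  proof (intro conjI allI impI)
    fix e :: real assume "0 < e"
    then show "\<exists>a b. a < b \<and> (\<forall>n. 1 - e < measure (\<mu> n) {a<..b})"
      using pq by (intro exI[of _ "p - 1"] exI[of _ "q + 1"]) (auto simp: \<mu>(2))
  qed (rule \<mu>(1))
  from tight_imp_convergent_subsubsequence[OF this strict_mono_id]
  obtain r M where r: "strict_mono r" and M: "real_distribution M" and wc: "weak_conv_m (\<lambda>n. \<mu> (r n)) M"
    by (auto simp: comp_def)
  interpret M: real_distribution M by fact
  have T0: "0 \<le> T"
    by (rule LIMSEQ_le_const[OF T]) (meson sum_nonneg less_imp_le \<tau>)
  \<comment> \<open>Clamping to \<open>{p..q}\<close>: \<open>g \<circ> c\<close> extends a function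
    continuous on the interval to the line, and the image measure under \<open>c\<close> is carried
    by the interval without locating the mass of \<open>M\<close>.\<close>
  define c where "c = (\<lambda>x. max p (min q x))"
  have c: "continuous_on UNIV c" "\<And>x. c x \<in> {p..q}" "\<And>x. x \<in> {p..q} \<Longrightarrow> c x = x"
    unfolding c_def using pq by (auto intro!: continuous_intros)
  have cm: "c \<in> measurable M borel" using borel_measurable_continuous_onI[OF c(1)] by simp
  \<comment> \<open>The limit mass \<open>T\<close> is restored as a constant density; it may be
    zero.\<close>
  define \<nu> where "\<nu> = density (distr M borel c) (\<lambda>_. ennreal T)"
  have s\<nu>: "sets \<nu> = sets borel" unfolding \<nu>_def by simp
  interpret dM: prob_space "distr M borel c" by (rule M.prob_space_distr[OF cm])
  have "finite_measure \<nu>"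
  proof
    have "emeasure \<nu> (space \<nu>) = ennreal T * emeasure (distr M borel c) (space (distr M borel c))"
      unfolding \<nu>_def by (subst emeasure_density) (auto simp: nn_integral_cmult_indicator)
    also have "\<dots> \<noteq> \<infinity>" unfolding dM.emeasure_space_1 by simp
    finally show "emeasure \<nu> (space \<nu>) \<noteq> \<infinity>" .
  qed
  moreover have "(\<lambda>n. \<Sum>y\<in>Y (r n). \<tau> (r n) y * g y) \<longlonglongrightarrow> (LINT x:{p..q}|\<nu>. g x)"
    if g: "continuous_on {p..q} g" for g
  proof -
    define h where "h = (\<lambda>x. g (c x))"
    have hc: "continuous_on UNIV h"
      unfolding h_def by (rule continuous_on_compose2[OF g c(1)]) (use c(2) in auto)
    have "compact (g ` {p..q})" by (intro compact_continuous_image g) simp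
    then obtain B where B: "\<And>x. x \<in> {p..q} \<Longrightarrow> norm (g x) \<le> B"
      using compact_imp_bounded by (force simp: bounded_iff)
    have hm: "h \<in> borel_measurable borel" using hc by (rule borel_measurable_continuous_onI)
    interpret \<mu>: real_distribution "\<mu> (r n)" for n by (rule \<mu>(1))
    have "(\<lambda>n. LINT x|\<mu> (r n). h x) \<longlonglongrightarrow> (LINT x|M. h x)"
      by (rule weak_conv_imp_integral_bdd_continuous_conv[where B=B, OF \<mu>(1) M wc])
         (use hc c(2) B in \<open>auto simp: continuous_on_eq_continuous_at h_def\<close>)
    moreover have "(\<lambda>n. \<Sum>y\<in>Y (r n). \<tau> (r n) y) \<longlonglongrightarrow> T"
      using LIMSEQ_subseq_LIMSEQ[OF T r] by (simp add: comp_def)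
    ultimately have "(\<lambda>n. (\<Sum>y\<in>Y (r n). \<tau> (r n) y) * (LINT x|\<mu> (r n). h x)) \<longlonglongrightarrow> T * (LINT x|M. h x)"
      by (intro tendsto_mult)
    moreover have "(\<Sum>y\<in>Y (r n). \<tau> (r n) y) * (LINT x|\<mu> (r n). h x) = (\<Sum>y\<in>Y (r n). \<tau> (r n) y * g y)" for n
      unfolding \<mu>(3)[OF hm] using Y(2)[of "r n"] c(3) by (intro sum.cong) (auto simp: h_def)
    moreover have "T * (LINT x|M. h x) = (LINT x:{p..q}|\<nu>. g x)"
    proof -
      have m: "(\<lambda>x. indicator {p..q} x *\<^sub>R g x) \<in> borel_measurable borel"
        by (rule borel_measurable_continuous_on_indicator[OF _ g]) simp
      have "(LINT x:{p..q}|\<nu>. g x) = (LINT x|distr M borel c. T * (indicator {p..q} x *\<^sub>R g x))"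
        unfolding set_lebesgue_integral_def \<nu>_def using m T0 by (subst integral_density) auto
      also have "\<dots> = (LINT x|M. T * (indicator {p..q} (c x) *\<^sub>R g (c x)))"
        using m by (intro integral_distr[OF cm]) auto
      also have "\<dots> = T * (LINT x|M. h x)" unfolding h_def using c(2) by simp
      finally show ?thesis ..
    qed
    ultimately show ?thesis by simp
  qed
  ultimately show ?thesis using r s\<nu> by blast
qed


text \<open>The measure is approximated by discrete ones, whose reciprocals are known from
  \<open>discrete_reciprocal\<close>. The constants and total masses there stay bounded, so a
  subsequence converges weakly. Convergence alone does not exclude a limit of finite support; that
  is ruled out at the end.\<close>

lemma reciprocal_unit_density:
  assumes \<nu>: "fat \<nu> {p..q}"
  shows "\<exists>\<tau> a b. fat \<tau> {p..q} \<and>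
     (\<forall>z. z \<notin> {p..q} \<longrightarrow> 1 / ct \<nu> {p..q} (\<lambda>_. 1) z = a * z + b - ct \<tau> {p..q} (\<lambda>_. 1) z)"
proof -
  let ?D = "{p..q}"
  have \<nu>1: "sets \<nu> = sets borel" "finite_measure \<nu>" using \<nu> by (auto simp: fat_def)
  interpret \<nu>: finite_measure \<nu> by fact
  have pq: "p < q" using fat_infinite[OF \<nu>] by (auto simp: infinite_Icc_iff)
  define f where "f = ct \<nu> ?D (\<lambda>_. 1)"
  have f0: "f z \<noteq> 0" if "z \<notin> ?D" for z
    unfolding f_def by (rule ct_nonzero[OF \<nu>]) (use that in auto)
  \<comment> \<open>Rounding down to the grid of mesh \<open>1 / (n + 1)\<close> starting at
    \<open>p\<close>, so that the points of \<open>{p..q}\<close> stay in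
    \<open>{p..q}\<close>.\<close>
  define \<phi> where "\<phi> = (\<lambda>n x. p + real_of_int \<lfloor>(x - p) * (real n + 1)\<rfloor> / (real n + 1))"
  have \<phi>m: "\<phi> n \<in> borel_measurable borel" for n unfolding \<phi>_def by measurable
  have \<phi>le: "\<phi> n x \<le> x" "x - 1 / (real n + 1) \<le> \<phi> n x" for n x
  proof -
    have n: "0 < real n + 1" by simp
    have "real_of_int \<lfloor>(x - p) * (real n + 1)\<rfloor> \<le> (x - p) * (real n + 1)" by simp
    then show "\<phi> n x \<le> x" unfolding \<phi>_def using n by (simp add: field_simps)
    have "(x - p) * (real n + 1) - 1 \<le> real_of_int \<lfloor>(x - p) * (real n + 1)\<rfloor>" by linarith
    then have "((x - p) * (real n + 1) - 1) / (real n + 1) \<le> real_of_int \<lfloor>(x - p) * (real n + 1)\<rfloor> / (real n + 1)"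
      using n by (intro divide_right_mono) auto
    then show "x - 1 / (real n + 1) \<le> \<phi> n x" unfolding \<phi>_def using n by (simp add: diff_divide_distrib)
  qed
  have \<phi>D: "\<phi> n x \<in> ?D" if "x \<in> ?D" for n x
    using that \<phi>le(1)[of n x] by (auto simp: \<phi>_def intro!: divide_nonneg_nonneg)
  have \<phi>lim: "(\<lambda>n. \<phi> n x) \<longlonglongrightarrow> x" for x
  proof (rule tendsto_sandwich)
    show "(\<lambda>n. x - 1 / (real n + 1)) \<longlonglongrightarrow> x" by real_asymp
  qed (use \<phi>le in auto)
  have fin: "finite (\<phi> n ` ?D)" for n
  proof -
    have "\<phi> n ` ?D \<subseteq> (\<lambda>k. p + real_of_int k / (real n + 1)) ` {0..\<lfloor>(q - p) * (real n + 1)\<rfloor>}"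
      by (auto simp: \<phi>_def intro!: imageI floor_mono mult_right_mono)
    then show ?thesis by (rule finite_subset) auto
  qed
  define w where "w = (\<lambda>n v. measure \<nu> {x \<in> ?D. \<phi> n x = v})"
  \<comment> \<open>Grid points without mass are discarded since \<open>discrete_reciprocal\<close>
    requires strictly positive weights.\<close>
  define V where "V = (\<lambda>n. {v \<in> \<phi> n ` ?D. 0 < w n v})"
  have V: "finite (V n)" "V n \<subseteq> ?D" for n
    unfolding V_def using fin \<phi>D by auto
  have sumV: "(LINT x:?D|\<nu>. g (\<phi> n x)) = (\<Sum>v\<in>V n. w n v * g v)" for g :: "real \<Rightarrow> real" and n
  proof -
    have "(LINT x:?D|\<nu>. g (\<phi> n x)) = (\<Sum>v\<in>\<phi> n ` ?D. w n v * g v)"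
      unfolding w_def by (rule finite_measure_integral_finite_range[OF \<nu>1 _ \<phi>m fin]) simp
    also have "\<dots> = (\<Sum>v\<in>V n. w n v * g v)"
      unfolding V_def by (rule sum.mono_neutral_right) (use fin in \<open>auto simp: w_def less_le\<close>)
    finally show ?thesis .
  qed
  define m where "m = (LINT x:?D|\<nu>. 1 :: real)"
  have m: "0 < m"
    unfolding m_def by (rule set_integral_pos_fat[OF \<nu>]) auto
  have mV: "(\<Sum>v\<in>V n. w n v) = m" for n
    using sumV[of "\<lambda>_. 1" n] unfolding m_def by simp
  have Vne: "V n \<noteq> {}" for n using mV[of n] m by auto
  define fn where "fn = (\<lambda>n z. \<Sum>v\<in>V n. w n v / (z - v))"
  have fnlim: "(\<lambda>n. fn n z) \<longlonglongrightarrow> f z" if z: "z \<notin> ?D" for z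
  proof -
    obtain d where d: "0 < d" "\<And>t. t \<in> ?D \<Longrightarrow> d \<le> \<bar>z - t\<bar>"
    proof (cases "z < p")
      case True
      then show ?thesis by (intro that[of "p - z"]) auto
    next
      case False
      then have "q < z" using z by auto
      then show ?thesis by (intro that[of "z - q"]) auto
    qed
    have b: "\<bar>1 / (z - t)\<bar> \<le> 1 / d" if "t \<in> ?D" for t
      using d(1) d(2)[OF that] by (simp add: abs_divide frac_le)
    have e: "fn n z = (LINT x|\<nu>. indicat_real ?D x *\<^sub>R (1 / (z - \<phi> n x)))" for n
      using sumV[of "\<lambda>t. 1 / (z - t)" n] unfolding fn_def set_lebesgue_integral_def by simp
    show ?thesis unfolding e f_def ct_def set_lebesgue_integral_def
    proof (rule integral_dominated_convergence[where w="\<lambda>_. 1 / d"])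
      show "(\<lambda>x. indicat_real ?D x *\<^sub>R (1 / (z - x))) \<in> borel_measurable \<nu>"
        unfolding measurable_cong_sets[OF \<nu>1(1) refl] by measurable
      show "(\<lambda>x. indicat_real ?D x *\<^sub>R (1 / (z - \<phi> n x))) \<in> borel_measurable \<nu>" for n
        unfolding measurable_cong_sets[OF \<nu>1(1) refl] using \<phi>m[of n] by measurable
      show "AE x in \<nu>. (\<lambda>n. indicat_real ?D x *\<^sub>R (1 / (z - \<phi> n x))) \<longlonglongrightarrow> indicat_real ?D x *\<^sub>R (1 / (z - x))"
      proof (rule AE_I2)
        fix x
        show "(\<lambda>n. indicat_real ?D x *\<^sub>R (1 / (z - \<phi> n x))) \<longlonglongrightarrow> indicat_real ?D x *\<^sub>R (1 / (z - x))"
        proof (cases "x \<in> ?D")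
          case True
          then show ?thesis using z by (intro tendsto_intros \<phi>lim) auto
        qed auto
      qed
      show "AE x in \<nu>. norm (indicat_real ?D x *\<^sub>R (1 / (z - \<phi> n x))) \<le> 1 / d" for n
        using b \<phi>D[of _ n] d(1) by (intro AE_I2) (auto simp: indicator_def)
    qed auto
  qed
  have "\<forall>n. \<exists>Y \<tau> b. finite Y \<and> Y \<subseteq> ?D \<and> (\<forall>y\<in>Y. 0 < \<tau> y) \<and>
     (\<forall>z. z \<notin> ?D \<longrightarrow> 1 / fn n z = z / m + b - (\<Sum>y\<in>Y. \<tau> y / (z - y)))"
  proof
    fix n
    show "\<exists>Y \<tau> b. finite Y \<and> Y \<subseteq> ?D \<and> (\<forall>y\<in>Y. 0 < \<tau> y) \<and>
       (\<forall>z. z \<notin> ?D \<longrightarrow> 1 / fn n z = z / m + b - (\<Sum>y\<in>Y. \<tau> y / (z - y)))"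
      using discrete_reciprocal[OF V(1) Vne V(2), of n "w n"] unfolding mV fn_def by (auto simp: V_def)
  qed
  then obtain Y \<tau> b where Y: "\<And>n. finite (Y n)" "\<And>n. Y n \<subseteq> ?D" and \<tau>: "\<And>n y. y \<in> Y n \<Longrightarrow> 0 < \<tau> n y"
    and rec: "\<And>n z. z \<notin> ?D \<Longrightarrow> 1 / fn n z = z / m + b n - (\<Sum>y\<in>Y n. \<tau> n y / (z - y))"
    by metis
  define T where "T = (\<lambda>n. \<Sum>y\<in>Y n. \<tau> n y)"
  have Tnn: "0 \<le> T n" for n unfolding T_def using \<tau> by (intro sum_nonneg) (auto intro: less_imp_le)
  have glim: "(\<lambda>n. 1 / fn n z) \<longlonglongrightarrow> 1 / f z" if "z \<notin> ?D" for z
    using fnlim[OF that] f0[OF that] by (intro tendsto_intros)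
  \<comment> \<open>\<open>\<kappa>\<close> is the value at \<open>y = p\<close>, the smallest on
    the interval, of \<open>1 / (q + 1 - y) - 1 / (q + 2 - y)\<close>. Comparing the reciprocals at
    the two points \<open>q + 1\<close> and \<open>q + 2\<close> cancels the unknown
    \<open>b n\<close> and so bounds the total mass; one of the points then bounds
    \<open>b n\<close>.\<close>
  define \<kappa> where "\<kappa> = 1 / ((q + 1 - p) * (q + 2 - p))"
  have \<kappa>: "0 < \<kappa>" unfolding \<kappa>_def using pq by simp
  have q12: "q + 1 \<notin> ?D" "q + 2 \<notin> ?D" by auto
  have "Bseq (\<lambda>n. 1 / fn n (q + 2) - 1 / fn n (q + 1))"
    using tendsto_diff[OF glim glim, OF q12(2,1)] by (intro convergent_imp_Bseq convergentI)
  then obtain K where K: "\<And>n. \<bar>1 / fn n (q + 2) - 1 / fn n (q + 1)\<bar> \<le> K" unfolding Bseq_def by auto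
  have Tb: "T n \<le> K / \<kappa>" for n
  proof -
    have "\<tau> n y * \<kappa> \<le> \<tau> n y / (q + 1 - y) - \<tau> n y / (q + 2 - y)" if y: "y \<in> Y n" for y
    proof -
      have yD: "p \<le> y" "y \<le> q" using Y(2)[of n] y by auto
      have "\<kappa> \<le> 1 / ((q + 1 - y) * (q + 2 - y))"
        unfolding \<kappa>_def using yD by (intro divide_left_mono mult_mono mult_pos_pos) auto
      also have "\<dots> = 1 / (q + 1 - y) - 1 / (q + 2 - y)" using yD by (simp add: field_simps)
      finally have "\<tau> n y * \<kappa> \<le> \<tau> n y * (1 / (q + 1 - y) - 1 / (q + 2 - y))"
        using \<tau>[OF y] by (intro mult_left_mono) auto
      then show ?thesis by (simp add: right_diff_distrib)
    qed
    then have "T n * \<kappa> \<le> (\<Sum>y\<in>Y n. \<tau> n y / (q + 1 - y)) - (\<Sum>y\<in>Y n. \<tau> n y / (q + 2 - y))"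
      unfolding T_def sum_distrib_right sum_subtractf[symmetric] by (rule sum_mono)
    also have "\<dots> = 1 / fn n (q + 2) - 1 / fn n (q + 1) - 1 / m"
      unfolding rec[OF q12(1)] rec[OF q12(2)] by (simp add: add_divide_distrib)
    also have "\<dots> \<le> K" using K[of n] m by (smt (verit) divide_pos_pos)
    finally show ?thesis using \<kappa> by (simp add: field_simps)
  qed
  have S: "\<bar>\<Sum>y\<in>Y n. \<tau> n y / (q + 1 - y)\<bar> \<le> T n" for n
  proof -
    have "\<bar>\<Sum>y\<in>Y n. \<tau> n y / (q + 1 - y)\<bar> \<le> (\<Sum>y\<in>Y n. \<bar>\<tau> n y / (q + 1 - y)\<bar>)" by (rule sum_abs)
    also have "\<dots> \<le> T n" unfolding T_def
    proof (rule sum_mono)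
      fix y assume y: "y \<in> Y n"
      have "1 \<le> q + 1 - y" using Y(2)[of n] y by auto
      then have "\<tau> n y / (q + 1 - y) \<le> \<tau> n y / 1" using \<tau>[OF y] by (intro divide_left_mono) auto
      then show "\<bar>\<tau> n y / (q + 1 - y)\<bar> \<le> \<tau> n y" using \<tau>[OF y] \<open>1 \<le> q + 1 - y\<close> by simp
    qed
    finally show ?thesis .
  qed
  have "Bseq (\<lambda>n. 1 / fn n (q + 1))"
    using glim[OF q12(1)] by (intro convergent_imp_Bseq convergentI)
  then obtain K' where K': "\<And>n. \<bar>1 / fn n (q + 1)\<bar> \<le> K'" unfolding Bseq_def by auto
  have bb: "\<bar>b n\<bar> \<le> K' + \<bar>(q + 1) / m\<bar> + K / \<kappa>" for n
  proof -
    have "b n = 1 / fn n (q + 1) - (q + 1) / m + (\<Sum>y\<in>Y n. \<tau> n y / (q + 1 - y))"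
      using rec[OF q12(1), of n] by simp
    then show ?thesis using K'[of n] S[of n] Tb[of n] by linarith
  qed
  have "bounded (range (\<lambda>n. (T n, b n)))"
  proof (rule boundedI)
    fix x assume "x \<in> range (\<lambda>n. (T n, b n))"
    then obtain n where x: "x = (T n, b n)" by auto
    have "norm x \<le> norm (T n) + norm (b n)" unfolding x by (rule norm_Pair_le)
    also have "\<dots> \<le> K / \<kappa> + (K' + \<bar>(q + 1) / m\<bar> + K / \<kappa>)"
      using Tb[of n] Tnn[of n] bb[of n] by simp
    finally show "norm x \<le> K / \<kappa> + (K' + \<bar>(q + 1) / m\<bar> + K / \<kappa>)" .
  qed
  then obtain l r where r: "strict_mono (r :: nat \<Rightarrow> nat)" and l: "((\<lambda>n. (T n, b n)) \<circ> r) \<longlonglongrightarrow> l"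
    using bounded_imp_convergent_subsequence by blast
  have Tl: "(\<lambda>n. T (r n)) \<longlonglongrightarrow> fst l" and bl: "(\<lambda>n. b (r n)) \<longlonglongrightarrow> snd l"
    using tendsto_fst[OF l] tendsto_snd[OF l] by (auto simp: comp_def)
  obtain r' \<tau>' where r': "strict_mono r'" and \<tau>': "sets \<tau>' = sets borel" "finite_measure \<tau>'"
    and wl: "\<And>g. continuous_on ?D g \<Longrightarrow> (\<lambda>n. \<Sum>y\<in>Y (r (r' n)). \<tau> (r (r' n)) y * g y) \<longlonglongrightarrow> (LINT x:?D|\<tau>'. g x)"
    using weak_limit_compact_support[of p q "\<lambda>n. Y (r n)" "\<lambda>n. \<tau> (r n)" "fst l",
        OF less_imp_le[OF pq] Y(1) Y(2) \<tau> Tl[unfolded T_def]] by blast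
  interpret \<tau>': finite_measure \<tau>' by fact
  define \<beta> where "\<beta> = snd l"
  have main: "1 / f z = 1 / m * z + \<beta> - ct \<tau>' ?D (\<lambda>_. 1) z" if z: "z \<notin> ?D" for z
  proof (rule LIMSEQ_unique)
    have rr: "strict_mono (\<lambda>n. r (r' n))" using strict_mono_o[OF r r'] by (simp add: comp_def)
    show "(\<lambda>n. 1 / fn (r (r' n)) z) \<longlonglongrightarrow> 1 / f z"
      using LIMSEQ_subseq_LIMSEQ[OF glim[OF z] rr] by (simp add: comp_def)
    have "continuous_on ?D (\<lambda>y. 1 / (z - y))" using z by (intro continuous_intros) auto
    from wl[OF this] have "(\<lambda>n. \<Sum>y\<in>Y (r (r' n)). \<tau> (r (r' n)) y / (z - y)) \<longlonglongrightarrow> ct \<tau>' ?D (\<lambda>_. 1) z"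
      unfolding ct_def by simp
    moreover have "(\<lambda>n. b (r (r' n))) \<longlonglongrightarrow> \<beta>"
      using LIMSEQ_subseq_LIMSEQ[OF bl r'] by (simp add: comp_def \<beta>_def)
    ultimately show "(\<lambda>n. 1 / fn (r (r' n)) z) \<longlonglongrightarrow> 1 / m * z + \<beta> - ct \<tau>' ?D (\<lambda>_. 1) z"
      unfolding rec[OF z] by (auto intro!: tendsto_intros)
  qed
  \<comment> \<open>If the limit measure were carried by a finite set \<open>Z\<close>, its
    transform times \<open>B\<close>, the polynomial vanishing on \<open>Z\<close>, would be a
    polynomial. Then \<open>B = A f\<close> off the interval for a polynomial \<open>A\<close>, so
    the transform of \<open>A\<close> against \<open>\<nu>\<close> is a polynomial that tends to
    zero at infinity.\<close>
  have "emeasure \<tau>' (?D - Z) \<noteq> 0" if Z: "finite Z" for Z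
  proof
    assume 0: "emeasure \<tau>' (?D - Z) = 0"
    define B where "B = (\<Prod>y\<in>Z. [:- y, 1::real:])"
    have Bz: "poly B z = (\<Prod>y\<in>Z. z - y)" for z unfolding B_def by (simp add: poly_prod)
    have one: "continuous_on ?D (\<lambda>_. 1 :: real)" by simp
    have null: "?D - Z \<in> null_sets \<tau>'"
      using 0 Z \<tau>'(1) by (intro null_setsI) (auto simp: finite_imp_closed)
    obtain R where R: "\<And>z. z \<notin> ?D \<Longrightarrow> poly B z * ct \<tau>' ?D (\<lambda>_. 1) z = ct \<tau>' ?D (\<lambda>x. poly B x * 1) z + poly R z"
      using poly_times_ct[OF \<tau>' compact_Icc one, of B] by blast
    have ct0: "ct \<tau>' ?D (\<lambda>x. poly B x * 1) z = 0" for z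
    proof -
      have "AE x in \<tau>'. indicat_real ?D x *\<^sub>R (poly B x * 1 / (z - x)) = 0"
        using AE_not_in[OF null] by eventually_elim (use Z in \<open>auto simp: indicator_def Bz\<close>)
      then show ?thesis unfolding ct_def set_lebesgue_integral_def by (rule integral_eq_zero_AE)
    qed
    define A where "A = B * [:\<beta>, 1 / m:] - R"
    have BA: "poly B z = poly A z * f z" if z: "z \<notin> ?D" for z
    proof -
      have "poly B z / f z = poly B z * (1 / f z)" by simp
      also have "\<dots> = poly B z * (1 / m * z + \<beta>) - poly B z * ct \<tau>' ?D (\<lambda>_. 1) z"
        unfolding main[OF z] by (simp only: right_diff_distrib)
      also have "\<dots> = poly A z" unfolding R[OF z] ct0 A_def by (simp add: algebra_simps)
      finally have "poly B z / f z = poly A z" .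
      then show ?thesis using f0[OF z] by (simp add: field_simps)
    qed
    obtain R2 where R2: "\<And>z. z \<notin> ?D \<Longrightarrow> poly A z * f z = ct \<nu> ?D (\<lambda>x. poly A x * 1) z + poly R2 z"
      using poly_times_ct[OF \<nu>1 compact_Icc one, of A] unfolding f_def by blast
    have Ac: "continuous_on ?D (\<lambda>x. poly A x * 1)" by (intro continuous_intros)
    have ev: "\<forall>\<^sub>F z in at_top. z \<notin> ?D"
      using eventually_gt_at_top[of q] by eventually_elim auto
    have eqp: "\<forall>\<^sub>F z in at_top. ct \<nu> ?D (\<lambda>x. poly A x * 1) z = poly (B - R2) z"
      using ev by eventually_elim (use BA R2 in simp)
    then have "((\<lambda>z. poly (B - R2) z) \<longlongrightarrow> 0) at_top"
      using ct_tendsto_0[OF \<nu>1 compact_Icc Ac] tendsto_cong by blast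
    then have "B - R2 = 0" by (rule poly_tendsto_0_imp_zero)
    with eqp have z0: "\<forall>\<^sub>F z in at_top. ct \<nu> ?D (\<lambda>x. poly A x * 1) z = 0" by simp
    \<comment> \<open>A transform that vanishes near infinity has all moments zero; tested with
      \<open>A\<close> itself this says that \<open>A\<close> squared has integral zero against
      \<open>\<nu>\<close>, which fatness forbids.\<close>
    have "((\<lambda>z. z ^ Suc (degree A) * ct \<nu> ?D (\<lambda>x. poly A x * 1) z) \<longlongrightarrow> 0) at_top"
      by (rule tendsto_eventually) (use z0 in \<open>eventually_elim, simp\<close>)
    from vanishing_moments[OF \<nu>1 compact_Icc Ac this, of A]
    have int0: "(LINT x:?D|\<nu>. poly A x * (poly A x * 1)) = 0" by simp
    have "A \<noteq> 0"
    proof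
      assume "A = 0"
      have "infinite {q<..}" by (simp add: infinite_Ioi)
      then obtain z where z: "z \<in> {q<..} - Z" using Z by (metis finite_Diff2 finite.emptyI equals0I)
      then have "poly B z = 0" using BA[of z] \<open>A = 0\<close> by auto
      then show False using z Z unfolding Bz by auto
    qed
    then have "finite {x \<in> ?D. poly A x * (poly A x * 1) = 0}"
      using poly_roots_finite[of A] by (auto elim: finite_subset[rotated])
    then have "0 < (LINT x:?D|\<nu>. poly A x * (poly A x * 1))"
      by (intro set_integral_pos_fat[OF \<nu> compact_Icc]) (auto intro!: continuous_intros)
    with int0 show False by simp
  qed
  then have "fat \<tau>' ?D" unfolding fat_def using \<tau>' by auto
  with main show ?thesis unfolding f_def by blast
qed

text \<open>Reduction to density 1: the density \<open>e * \<rho>\<close>, positive for the right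
  sign \<open>e\<close>, is moved into the measure, and afterwards the measure of the reciprocal is
  divided by \<open>e * \<rho>\<close>. Thus the same \<open>\<rho>\<close> stands on both sides,
  which is the form needed for \<open>reciprocal_exchange\<close>.\<close>

lemma reciprocal_ct:
  assumes \<nu>: "fat \<nu> D" and D: "D = {p..q}" and \<rho>: "continuous_on D \<rho>" "\<And>x. x \<in> D \<Longrightarrow> \<rho> x \<noteq> 0"
  shows "\<exists>\<mu> a b. fat \<mu> D \<and> (\<forall>z. z \<notin> D \<longrightarrow> 1 / ct \<nu> D \<rho> z = a * z + b - ct \<mu> D \<rho> z)"
proof -
  have DD: "compact D" "connected D" unfolding D by auto
  have Db: "D \<in> sets borel" unfolding D by simp
  obtain e :: real where e: "e \<in> {1, -1}" "\<And>x. x \<in> D \<Longrightarrow> 0 < e * \<rho> x"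
    using connected_const_sign[OF DD(2) \<rho>] by force
  have dens: "fat (density M (\<lambda>x. ennreal (indicator D x * h x))) D \<and>
      (\<forall>g z. ct (density M (\<lambda>x. ennreal (indicator D x * h x))) D g z = ct M D (\<lambda>x. h x * g x) z \<or> \<not> continuous_on D g \<or> z \<in> D)"
    if M: "fat M D" and h: "continuous_on D h" "\<And>x. x \<in> D \<Longrightarrow> 0 < h x" for M h
  proof -
    have M1: "sets M = sets borel" "finite_measure M" using M by (auto simp: fat_def)
    interpret finite_measure M by fact
    have hm: "(\<lambda>x. indicator D x * h x) \<in> borel_measurable M"
      using set_integrable_compact[OF M1 DD(1) h(1)] by (auto simp: set_integrable_def)
    let ?N = "density M (\<lambda>x. ennreal (indicator D x * h x))"
    have fin: "finite_measure ?N"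
    proof
      have "emeasure ?N (space ?N) = (\<integral>\<^sup>+x. ennreal (indicator D x * h x) \<partial>M)"
        using hm by (subst emeasure_density) (auto intro!: nn_integral_cong)
      also have "\<dots> = ennreal (LINT x|M. indicator D x * h x)"
        using set_integrable_compact[OF M1 DD(1) h(1)]
        by (intro nn_integral_eq_integral) (auto simp: set_integrable_def indicator_def intro!: AE_I2 less_imp_le h(2))
      finally show "emeasure ?N (space ?N) \<noteq> \<infinity>" by simp
    qed
    have "emeasure ?N (D - Z) \<noteq> 0" if Z: "finite Z" for Z
    proof
      assume 0: "emeasure ?N (D - Z) = 0"
      have DZ: "D - Z \<in> sets M" using Db Z M1(1) by (auto simp: finite_imp_closed)
      have "AE x in M. x \<in> D - Z \<longrightarrow> ennreal (indicator D x * h x) = 0"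
        using 0 DZ hm null_sets_density_iff[of "\<lambda>x. ennreal (indicator D x * h x)" M "D - Z"]
        by (auto simp: null_sets_def)
      then have "AE x in M. x \<notin> D - Z"
        by eventually_elim (use h(2) in \<open>force simp: indicator_def ennreal_eq_0_iff\<close>)
      then have "emeasure M (D - Z) = 0" using DZ by (simp add: AE_iff_null_sets[symmetric] null_setsD1 AE_iff_null_sets)
      then show False using M Z unfolding fat_def by blast
    qed
    then have "fat ?N D" unfolding fat_def using fin M1 by auto
    moreover have "ct ?N D g z = ct M D (\<lambda>x. h x * g x) z" if g: "continuous_on D g" and z: "z \<notin> D" for g z
    proof -
      have "continuous_on D (\<lambda>x. g x / (z - x))" using z by (intro continuous_intros g) auto
      then have gm: "(\<lambda>x. indicator D x *\<^sub>R (g x / (z - x))) \<in> borel_measurable M"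
        using set_integrable_compact[OF M1 DD(1), of "\<lambda>x. g x / (z - x)"]
        unfolding set_integrable_def by (intro borel_measurable_integrable)
      have "ct ?N D g z = (LINT x|M. (indicator D x * h x) *\<^sub>R (indicator D x *\<^sub>R (g x / (z - x))))"
        unfolding ct_def set_lebesgue_integral_def
        by (rule integral_density[OF gm hm]) (auto simp: indicator_def intro!: AE_I2 less_imp_le h(2))
      also have "\<dots> = ct M D (\<lambda>x. h x * g x) z"
        unfolding ct_def set_lebesgue_integral_def
        by (intro Bochner_Integration.integral_cong) (auto simp: indicator_def)
      finally show ?thesis .
    qed
    ultimately show ?thesis by blast
  qed
  have ec: "continuous_on D (\<lambda>x. e * \<rho> x)" "continuous_on D (\<lambda>x. 1 / (e * \<rho> x))"
    using \<rho> e(1) by (auto intro!: continuous_intros)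
  define \<nu>' where "\<nu>' = density \<nu> (\<lambda>x. ennreal (indicator D x * (e * \<rho> x)))"
  have \<nu>': "fat \<nu>' D" and \<nu>'ct: "ct \<nu>' D (\<lambda>_. 1) z = ct \<nu> D (\<lambda>x. e * \<rho> x * 1) z" if "z \<notin> D" for z
    using dens[OF \<nu> ec(1) e(2)] that unfolding \<nu>'_def by (auto dest!: spec[of _ "\<lambda>_. 1"])
  have f\<nu>': "fat \<nu>' D" using dens[OF \<nu> ec(1) e(2)] unfolding \<nu>'_def by blast
  obtain \<tau> a b where \<tau>: "fat \<tau> D"
    and rec: "\<And>z. z \<notin> D \<Longrightarrow> 1 / ct \<nu>' D (\<lambda>_. 1) z = a * z + b - ct \<tau> D (\<lambda>_. 1) z"
    using reciprocal_unit_density[of \<nu>' p q] f\<nu>' unfolding D by blast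
  define \<mu> where "\<mu> = density \<tau> (\<lambda>x. ennreal (indicator D x * (1 / (e * \<rho> x))))"
  have pos: "0 < 1 / (e * \<rho> x)" if "x \<in> D" for x using e(2)[OF that] by simp
  have \<mu>: "fat \<mu> D" using dens[OF \<tau> ec(2) pos] unfolding \<mu>_def by blast
  have "1 / ct \<nu> D \<rho> z = e * a * z + e * b - ct \<mu> D \<rho> z" if z: "z \<notin> D" for z
  proof -
    have "ct \<mu> D \<rho> z = ct \<tau> D (\<lambda>x. 1 / (e * \<rho> x) * \<rho> x) z"
      using dens[OF \<tau> ec(2) pos] \<rho>(1) z unfolding \<mu>_def by blast
    also have "\<dots> = e * ct \<tau> D (\<lambda>_. 1) z"
    proof -
      have "ct \<tau> D (\<lambda>x. 1 / (e * \<rho> x) * \<rho> x) z = (LINT x:D|\<tau>. e * (1 / (z - x)))"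
        unfolding ct_def
      proof (rule set_lebesgue_integral_cong)
        show "D \<in> sets \<tau>" using Db \<tau> by (simp add: fat_def)
        have "1 / (e * \<rho> x) * \<rho> x = e" if "x \<in> D" for x using e(1) \<rho>(2)[OF that] by auto
        then show "\<forall>x. x \<in> D \<longrightarrow> 1 / (e * \<rho> x) * \<rho> x / (z - x) = e * (1 / (z - x))" by simp
      qed
      then show ?thesis by (simp add: ct_def del: times_divide_eq_right)
    qed
    finally have 1: "ct \<mu> D \<rho> z = e * ct \<tau> D (\<lambda>_. 1) z" .
    have "ct \<nu>' D (\<lambda>_. 1) z = e * ct \<nu> D \<rho> z"
      unfolding \<nu>'ct[OF z] by (simp add: ct_def mult.assoc flip: times_divide_eq_right)
    then have "1 / ct \<nu> D \<rho> z = e * (1 / ct \<nu>' D (\<lambda>_. 1) z)" using e(1) by auto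
    then show ?thesis unfolding rec[OF z] 1 by (simp add: algebra_simps)
  qed
  with \<mu> show ?thesis by blast
qed

section \<open>Exchange identities\<close>

definition finite_borel :: "real measure \<Rightarrow> bool" where
  "finite_borel M \<longleftrightarrow> sets M = sets borel \<and> finite_measure M"

lemma finite_borelD: "finite_borel M \<Longrightarrow> sets M = sets borel" "finite_borel M \<Longrightarrow> finite_measure M"
  by (auto simp: finite_borel_def)

lemma fat_finite_borel: "fat M D \<Longrightarrow> finite_borel M"
  by (auto simp: finite_borel_def fat_def)

lemma ct_cong:
  assumes "finite_borel M" "compact D" "\<And>x. x \<in> D \<Longrightarrow> \<rho> x = \<rho>' x"
  shows "ct M D \<rho> z = ct M D \<rho>' z"
  unfolding ct_def using assms
  by (intro set_lebesgue_integral_cong) (auto simp: finite_borel_def intro: borel_closed compact_imp_closed)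

lemma set_integral_cong_compact:
  fixes f g :: "real \<Rightarrow> real"
  assumes "finite_borel M" "compact D" "\<And>x. x \<in> D \<Longrightarrow> f x = g x"
  shows "(LINT x:D|M. f x) = (LINT x:D|M. g x)"
  using assms
  by (intro set_lebesgue_integral_cong) (auto simp: finite_borel_def intro: borel_closed compact_imp_closed)

lemma set_integrable_ct:
  assumes "finite_borel M" "compact D" "continuous_on D \<rho>" "z \<notin> D"
  shows "set_integrable M D (\<lambda>x. \<rho> x / (z - x))"
  by (rule set_integrable_compact) (use assms in \<open>auto simp: finite_borel_def intro!: continuous_intros\<close>)

lemma ct_add:
  assumes "finite_borel M" "compact D" "continuous_on D \<rho>" "continuous_on D \<rho>'" "z \<notin> D"
  shows "ct M D (\<lambda>x. \<rho> x + \<rho>' x) z = ct M D \<rho> z + ct M D \<rho>' z"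
  unfolding ct_def add_divide_distrib
  by (rule set_integral_add(2)) (use assms in \<open>auto intro: set_integrable_ct\<close>)

lemma ct_diff:
  assumes "finite_borel M" "compact D" "continuous_on D \<rho>" "continuous_on D \<rho>'" "z \<notin> D"
  shows "ct M D (\<lambda>x. \<rho> x - \<rho>' x) z = ct M D \<rho> z - ct M D \<rho>' z"
  unfolding ct_def diff_divide_distrib
  by (rule set_integral_diff(2)) (use assms in \<open>auto intro: set_integrable_ct\<close>)

lemma ct_cmult: "ct M D (\<lambda>x. c * \<rho> x) z = c * ct M D \<rho> z"
  by (simp add: ct_def flip: times_divide_eq_right)

lemma ct_affine:
  assumes M: "finite_borel M" and D: "compact D" and f: "continuous_on D \<rho>" and z: "z \<notin> D"
  shows "ct M D (\<lambda>x. \<rho> x * (a * x + b)) z = (a * z + b) * ct M D \<rho> z - a * (LINT x:D|M. \<rho> x)"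
proof -
  have "ct M D (\<lambda>x. \<rho> x * (a * x + b)) z = ct M D (\<lambda>x. a * (x * \<rho> x) + b * \<rho> x) z"
    by (simp add: algebra_simps)
  also have "\<dots> = a * ct M D (\<lambda>x. x * \<rho> x) z + b * ct M D \<rho> z"
    by (subst ct_add[OF M D _ _ z]) (auto intro!: continuous_intros f simp: ct_cmult)
  also have "ct M D (\<lambda>x. x * \<rho> x) z = z * ct M D \<rho> z - (LINT x:D|M. \<rho> x)"
    by (rule ct_mult_var[OF finite_borelD[OF M] D f z])
  finally show ?thesis by (simp add: algebra_simps)
qed

lemma ct_continuous_on:
  assumes "finite_borel M" "compact D" "continuous_on D \<rho>" "E \<inter> D = {}"
  shows "continuous_on E (ct M D \<rho>)"
  using ct_continuous[of M D \<rho>] assms by (auto simp: finite_borel_def elim!: continuous_on_subset)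

text \<open>The resolvent identity for the kernels \<open>1 / (z - x)\<close> and
  \<open>1 / (y - x)\<close>, integrated.\<close>

lemma ct_kernel_difference:
  assumes M: "finite_borel M" and D: "compact D" and f: "continuous_on D \<rho>"
    and z: "z \<notin> D" "y \<notin> D" "y \<noteq> z"
  shows "- ct M D (\<lambda>x. \<rho> x / (z - x)) y = (ct M D \<rho> z - ct M D \<rho> y) / (z - y)"
proof -
  have "- ct M D (\<lambda>x. \<rho> x / (z - x)) y = (LINT x:D|M. (- 1) * (\<rho> x / (z - x) / (y - x)))"
    unfolding ct_def by (subst set_integral_mult_right) simp
  also have "\<dots> = (LINT x:D|M. (\<rho> x / (z - x) - \<rho> x / (y - x)) / (z - y))"
  proof (rule set_integral_cong_compact[OF M D])
    fix x assume "x \<in> D"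
    then have ne: "z - x \<noteq> 0" "y - x \<noteq> 0" "(z - x) - (y - x) \<noteq> 0" using z by auto
    have "(- 1) * (r / A / B) = (r / A - r / B) / (A - B)" if "A \<noteq> 0" "B \<noteq> 0" "A - B \<noteq> 0" for r A B :: real
      using that by (simp add: field_simps)
    from this[OF ne, of "\<rho> x"]
    show "(- 1) * (\<rho> x / (z - x) / (y - x)) = (\<rho> x / (z - x) - \<rho> x / (y - x)) / (z - y)"
      by simp
  qed
  also have "\<dots> = (LINT x:D|M. \<rho> x / (z - x) - \<rho> x / (y - x)) / (z - y)"
    by simp
  also have "(LINT x:D|M. \<rho> x / (z - x) - \<rho> x / (y - x)) = ct M D \<rho> z - ct M D \<rho> y"
    unfolding ct_def by (rule set_integral_diff(2)) (use assms in \<open>auto intro: set_integrable_ct\<close>)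
  finally show ?thesis .
qed

text \<open>Fubini. The inner transform of \<open>\<rho> x / (z - x)\<close> is left unexpanded: for
  \<open>y \<noteq> z\<close> it is a difference quotient, but unlike that quotient it also makes
  sense at \<open>y = z\<close>, so \<open>z\<close> may lie in \<open>E\<close>.\<close>

lemma ct_ct_swap:
  assumes M: "finite_borel M" and D: "compact D" and f: "continuous_on D \<rho>"
    and N: "finite_borel N" and E: "compact E" and g: "continuous_on E \<phi>"
    and DE: "D \<inter> E = {}" and z: "z \<notin> D"
  shows "ct M D (\<lambda>x. \<rho> x * ct N E \<phi> x) z = (LINT y:E|N. \<phi> y * - ct M D (\<lambda>x. \<rho> x / (z - x)) y)"
proof -
  have "ct M D (\<lambda>x. \<rho> x * ct N E \<phi> x) z = (LINT x:D|M. (LINT y:E|N. (\<rho> x / (z - x)) * (\<phi> y / (x - y))))"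
    unfolding ct_def set_integral_mult_right by simp
  also have "\<dots> = (LINT y:E|N. (LINT x:D|M. (\<rho> x / (z - x)) * (\<phi> y / (x - y))))"
  proof (rule set_integral_Fubini[OF finite_borelD[OF M] D finite_borelD[OF N] E])
    have "continuous_on (D \<times> E) (\<lambda>p. \<rho> (fst p) / (z - fst p) * (\<phi> (snd p) / (fst p - snd p)))"
      by (intro continuous_intros continuous_on_compose2[OF f] continuous_on_compose2[OF g])
         (use z DE in auto)
    then show "continuous_on (D \<times> E) (\<lambda>(x, y). \<rho> x / (z - x) * (\<phi> y / (x - y)))"
      by (simp add: case_prod_beta)
  qed
  also have "\<dots> = (LINT y:E|N. \<phi> y * - ct M D (\<lambda>x. \<rho> x / (z - x)) y)"
  proof (rule set_integral_cong_compact[OF N E])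
    fix y assume "y \<in> E"
    have "(LINT x:D|M. (\<rho> x / (z - x)) * (\<phi> y / (x - y))) = (LINT x:D|M. (- \<phi> y) * (\<rho> x / (z - x) / (y - x)))"
    proof (rule set_integral_cong_compact[OF M D])
      fix x assume "x \<in> D"
      have "x - y = - (y - x)" by simp
      then show "(\<rho> x / (z - x)) * (\<phi> y / (x - y)) = (- \<phi> y) * (\<rho> x / (z - x) / (y - x))"
        by (metis (no_types, opaque_lifting) divide_minus_right minus_divide_left minus_mult_left mult.commute times_divide_eq_right)
    qed
    also have "\<dots> = - \<phi> y * ct M D (\<lambda>x. \<rho> x / (z - x)) y"
      unfolding ct_def by (rule set_integral_mult_right)
    finally show "(LINT x:D|M. (\<rho> x / (z - x)) * (\<phi> y / (x - y))) = \<phi> y * - ct M D (\<lambda>x. \<rho> x / (z - x)) y"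
      by simp
  qed
  finally show ?thesis .
qed

text \<open>The classical product formula for two measures: the product of the transforms is the
  transform of the first measure weighted by the second transform plus the same with the roles
  exchanged. It rests on \<open>1 / ((z - x) (z - y)) = 1 / ((z - x) (x - y)) + 1 / ((z - y) (y -
  x))\<close>.\<close>

lemma ct_product:
  assumes M: "finite_borel M" and D: "compact D" and f: "continuous_on D \<rho>"
    and N: "finite_borel N" and E: "compact E" and g: "continuous_on E \<phi>"
    and DE: "D \<inter> E = {}" and z: "z \<notin> D" "z \<notin> E"
  shows "ct M D \<rho> z * ct N E \<phi> z =
    ct M D (\<lambda>x. \<rho> x * ct N E \<phi> x) z + ct N E (\<lambda>y. \<phi> y * ct M D \<rho> y) z"
proof -
  have c: "continuous_on E (\<lambda>y. ct M D \<rho> z * \<phi> y)" "continuous_on E (\<lambda>y. \<phi> y * ct M D \<rho> y)"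
    using DE by (auto intro!: continuous_intros g ct_continuous_on[OF M D f])
  have "ct M D (\<lambda>x. \<rho> x * ct N E \<phi> x) z = ct N E (\<lambda>y. ct M D \<rho> z * \<phi> y - \<phi> y * ct M D \<rho> y) z"
    unfolding ct_ct_swap[OF M D f N E g DE z(1)] unfolding ct_def[of N]
  proof (rule set_integral_cong_compact[OF N E])
    fix y assume "y \<in> E"
    then have "y \<notin> D" "y \<noteq> z" using DE z by auto
    from ct_kernel_difference[OF M D f z(1) this]
    show "\<phi> y * - ct M D (\<lambda>x. \<rho> x / (z - x)) y = (ct M D \<rho> z * \<phi> y - \<phi> y * ct M D \<rho> y) / (z - y)"
      by (simp add: algebra_simps)
  qed
  also have "\<dots> = ct M D \<rho> z * ct N E \<phi> z - ct N E (\<lambda>y. \<phi> y * ct M D \<rho> y) z"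
    by (subst ct_diff[OF N E c z(2)]) (simp add: ct_cmult)
  finally show ?thesis by simp
qed

text \<open>For a function and its reciprocal with the same density \<open>\<rho>\<close>, division by the function
  trades one measure for the other. The diagonal \<open>y = z\<close> of the pointwise identity between the two
  kernels is reached by continuity, so that \<open>z\<close> may lie in the support of the inner measure.\<close>

lemma reciprocal_exchange:
  assumes M1: "finite_borel \<nu>\<^sub>1" and M2: "finite_borel \<nu>\<^sub>2" and D: "compact D" and r: "continuous_on D \<rho>"
    and N: "finite_borel N" and E: "compact E" and p: "continuous_on E \<phi>" and DE: "D \<inter> E = {}"
    and f0: "\<And>z. z \<notin> D \<Longrightarrow> f z \<noteq> 0"
    and f1: "\<And>z. z \<notin> D \<Longrightarrow> f z = c + ct \<nu>\<^sub>1 D \<rho> z"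
    and f2: "\<And>z. z \<notin> D \<Longrightarrow> 1 / f z = a * z + b - ct \<nu>\<^sub>2 D \<rho> z"
    and z: "z \<notin> D"
  shows "ct \<nu>\<^sub>1 D (\<lambda>x. \<rho> x * ct N E \<phi> x) z / f z =
    - a * (LINT y:E|N. \<phi> y * f y) + ct \<nu>\<^sub>2 D (\<lambda>s. \<rho> s * ct N E (\<lambda>y. \<phi> y * f y) s) z"
proof -
  define J1 where "J1 = (\<lambda>y. - ct \<nu>\<^sub>1 D (\<lambda>x. \<rho> x / (z - x)) y)"
  define J2 where "J2 = (\<lambda>y. - ct \<nu>\<^sub>2 D (\<lambda>x. \<rho> x / (z - x)) y)"
  have rz: "continuous_on D (\<lambda>x. \<rho> x / (z - x))" using z by (intro continuous_intros r) auto
  have oD: "open (- D)" using D by (simp add: compact_imp_closed open_Compl)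
  have cJ: "continuous_on (- D) J1" "continuous_on (- D) J2"
    unfolding J1_def J2_def by (intro continuous_intros ct_continuous_on[OF _ D rz] M1 M2; auto)+
  have "continuous_on (- D) (\<lambda>z. c + ct \<nu>\<^sub>1 D \<rho> z)"
    by (intro continuous_intros ct_continuous_on[OF M1 D r]) auto
  then have cf: "continuous_on (- D) f" by (rule continuous_on_cong[THEN iffD1, rotated 2]) (auto simp: f1)
  have K: "f y * J2 y = a * f y + J1 y / f z" if y: "y \<notin> D" for y
  proof -
    have ne: "f y * J2 y = a * f y + J1 y / f z" if y: "y \<notin> D" "y \<noteq> z" for y
    proof -
      have zy: "z - y \<noteq> 0" using y by simp
      have j1: "J1 y = (f z - f y) / (z - y)"
        unfolding J1_def ct_kernel_difference[OF M1 D r z y] using f1[OF z] f1[OF y(1)] by simp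
      have "J2 y = (ct \<nu>\<^sub>2 D \<rho> z - ct \<nu>\<^sub>2 D \<rho> y) / (z - y)"
        unfolding J2_def ct_kernel_difference[OF M2 D r z y] ..
      also have "ct \<nu>\<^sub>2 D \<rho> z - ct \<nu>\<^sub>2 D \<rho> y = a * (z - y) - (1 / f z - 1 / f y)"
        using f2[OF z] f2[OF y(1)] by (simp add: algebra_simps)
      finally have j2: "J2 y = a - (1 / f z - 1 / f y) / (z - y)" using zy by (simp add: diff_divide_distrib)
      show ?thesis unfolding j1 j2 using f0[OF z] f0[OF y(1)] zy by (simp add: field_simps)
    qed
    show ?thesis
    proof (cases "y = z")
      case True
      have "isCont (\<lambda>y. f y * J2 y - (a * f y + J1 y / f z)) z"
        using oD z by (intro continuous_on_interior[of "- D"] continuous_intros cJ cf) (auto simp: interior_open f0)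
      then have "((\<lambda>y. f y * J2 y - (a * f y + J1 y / f z)) \<longlongrightarrow> f z * J2 z - (a * f z + J1 z / f z)) (at z)"
        by (simp add: isCont_def)
      moreover have "((\<lambda>y. f y * J2 y - (a * f y + J1 y / f z)) \<longlongrightarrow> 0) (at z)"
      proof (rule tendsto_eventually)
        have "\<forall>\<^sub>F y in at z. y \<notin> D" using eventually_at_in_open'[OF oD] z by simp
        then show "\<forall>\<^sub>F y in at z. f y * J2 y - (a * f y + J1 y / f z) = 0"
          using eventually_neq_at_within[of z] by eventually_elim (simp add: ne)
      qed
      ultimately have "f z * J2 z - (a * f z + J1 z / f z) = 0"
        using tendsto_unique trivial_limit_at by blast
      then show ?thesis using True by simp
    qed (use ne y in simp)
  qed
  have cE: "continuous_on E f" "continuous_on E J1" "continuous_on E J2"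
    using DE by (auto intro: continuous_on_subset[OF cf] continuous_on_subset[OF cJ(1)] continuous_on_subset[OF cJ(2)])
  have "ct \<nu>\<^sub>2 D (\<lambda>s. \<rho> s * ct N E (\<lambda>y. \<phi> y * f y) s) z = (LINT y:E|N. (\<phi> y * f y) * J2 y)"
    unfolding J2_def by (rule ct_ct_swap[OF M2 D r N E _ DE z]) (intro continuous_intros p cE)
  also have "\<dots> = (LINT y:E|N. a * (\<phi> y * f y) + \<phi> y * J1 y / f z)"
  proof (rule set_integral_cong_compact[OF N E])
    fix y assume "y \<in> E"
    then have "y \<notin> D" using DE by auto
    from K[OF this] show "\<phi> y * f y * J2 y = a * (\<phi> y * f y) + \<phi> y * J1 y / f z"
      by (simp add: mult.assoc) (simp add: algebra_simps)
  qed
  also have "\<dots> = a * (LINT y:E|N. \<phi> y * f y) + (LINT y:E|N. \<phi> y * J1 y) / f z"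
    by (subst set_integral_add(2))
       (auto intro!: set_integrable_compact[OF finite_borelD[OF N] E] continuous_intros p cE simp: f0[OF z])
  also have "(LINT y:E|N. \<phi> y * J1 y) = ct \<nu>\<^sub>1 D (\<lambda>x. \<rho> x * ct N E \<phi> x) z"
    unfolding J1_def by (rule ct_ct_swap[OF M1 D r N E p DE z, symmetric])
  finally show ?thesis by simp
qed

text \<open>The label \<open>o\<close> is the one along which the new function is expanded,
  \<open>i\<close> is any other. \<open>FS\<close>, \<open>Fo\<close>, \<open>Fi\<close>,
  \<open>Foi\<close> stand for the old functions at \<open>S\<close>, \<open>S + o\<close>,
  \<open>S + i\<close>, \<open>S + i + o\<close>, and \<open>PS\<close>, \<open>Po\<close>,
  \<open>Pj\<close>, \<open>Poi\<close> for the new ones at the same sets. Dividing the defining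
  formula \<open>h3\<close> by \<open>f = Fi / Fo\<close> moves it from \<open>\<nu>o\<close> to
  \<open>\<nu>i\<close>; \<open>ct_product\<close> gives the three-term relation. The hypothesis
  \<open>h6\<close> kills the product of the two additive constants.\<close>

lemma exchange_small_base:
  assumes D: "compact D" and E: "compact E" and DE: "D \<inter> E = {}"
    and \<nu>o: "finite_borel \<nu>o" and \<nu>i: "finite_borel \<nu>i" and \<nu>oi: "finite_borel \<nu>oi"
    and cD: "continuous_on D FS" "continuous_on (- D) Fo" "continuous_on (- D) Fi"
    and cE: "continuous_on (- E) Foi" "continuous_on E Poi"
    and nz: "\<And>z. z \<notin> D \<Longrightarrow> Fo z \<noteq> 0" "\<And>z. z \<notin> D \<Longrightarrow> Fi z \<noteq> 0" "\<And>z. z \<notin> E \<Longrightarrow> Foi z \<noteq> 0"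
    and h1: "\<And>z. z \<notin> D \<Longrightarrow> Fi z / Fo z = c + ct \<nu>o D (\<lambda>x. FS x * Foi x) z"
    and h2: "\<And>z. z \<notin> D \<Longrightarrow> Fo z / Fi z = a * z + b - ct \<nu>i D (\<lambda>x. FS x * Foi x) z"
    and h3: "\<And>z. z \<notin> D \<Longrightarrow> PS z / Fo z = ct \<nu>o D (\<lambda>x. FS x * Po x) z"
    and h4: "\<And>z. z \<notin> E \<Longrightarrow> Po z / Foi z = b' + ct \<nu>oi E (\<lambda>y. Fo y * Poi y) z"
    and h5: "\<And>z. z \<notin> E \<Longrightarrow> Pj z / Foi z = ct \<nu>oi E (\<lambda>y. Fi y * Poi y) z"
    and h6: "c * b' = 0"
  shows "\<exists>b''. \<forall>z. z \<notin> D \<longrightarrow> PS z / Fi z = b'' + ct \<nu>i D (\<lambda>x. FS x * Pj x) z" (is ?A)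
    and "\<forall>z. z \<notin> D \<longrightarrow> z \<notin> E \<longrightarrow> Fo z * Pj z - Fi z * Po z + PS z * Foi z = 0" (is ?B)
proof -
  define f where "f = (\<lambda>z. Fi z / Fo z)"
  define \<phi> where "\<phi> = (\<lambda>y. Fo y * Poi y)"
  define \<rho> where "\<rho> = (\<lambda>x. FS x * Foi x)"
  have sub: "D \<subseteq> - E" "E \<subseteq> - D" using DE by auto
  have c\<rho>: "continuous_on D \<rho>" unfolding \<rho>_def
    by (intro continuous_intros cD continuous_on_subset[OF cE(1) sub(1)])
  have c\<phi>: "continuous_on E \<phi>" unfolding \<phi>_def
    by (intro continuous_intros cE continuous_on_subset[OF cD(2) sub(2)])
  have f0: "f z \<noteq> 0" if "z \<notin> D" for z unfolding f_def using nz that by simp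
  have \<phi>f: "\<phi> y * f y = Fi y * Poi y" if "y \<in> E" for y
    using nz(1)[of y] that DE by (auto simp: \<phi>_def f_def)
  have f1: "f z = c + ct \<nu>o D \<rho> z" if "z \<notin> D" for z using h1[OF that] by (simp only: f_def \<rho>_def)
  have f2: "1 / f z = a * z + b - ct \<nu>i D \<rho> z" if "z \<notin> D" for z
    using h2[OF that] by (simp add: f_def \<rho>_def)
  have \<rho>P: "ct \<nu>o D (\<lambda>x. FS x * Po x) z = b' * (f z - c) + ct \<nu>o D (\<lambda>x. \<rho> x * ct \<nu>oi E \<phi> x) z" if z: "z \<notin> D" for z
  proof -
    have "ct \<nu>o D (\<lambda>x. FS x * Po x) z = ct \<nu>o D (\<lambda>x. b' * \<rho> x + \<rho> x * ct \<nu>oi E \<phi> x) z"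
    proof (rule ct_cong[OF \<nu>o D])
      fix x assume "x \<in> D"
      then have xE: "x \<notin> E" using DE by auto
      have "Po x = Foi x * (b' + ct \<nu>oi E \<phi> x)"
        using h4[OF xE] nz(3)[OF xE] by (simp add: \<phi>_def field_simps)
      show "FS x * Po x = b' * \<rho> x + \<rho> x * ct \<nu>oi E \<phi> x" unfolding \<open>Po x = _\<close> \<rho>_def by (simp add: algebra_simps)
    qed
    also have "\<dots> = b' * ct \<nu>o D \<rho> z + ct \<nu>o D (\<lambda>x. \<rho> x * ct \<nu>oi E \<phi> x) z"
      by (subst ct_add[OF \<nu>o D _ _ z])
         (auto intro!: continuous_intros c\<rho> ct_continuous_on[OF \<nu>oi E c\<phi>] DE simp: ct_cmult)
    also have "ct \<nu>o D \<rho> z = f z - c" using h1[OF z] by (simp add: f_def \<rho>_def)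
    finally show ?thesis .
  qed
  have "PS z / Fi z = (b' - a * (LINT y:E|\<nu>oi. \<phi> y * f y)) + ct \<nu>i D (\<lambda>x. FS x * Pj x) z" if z: "z \<notin> D" for z
  proof -
    have "PS z / Fi z = (PS z / Fo z) / f z" unfolding f_def using nz(1)[OF z] by simp
    also have "\<dots> = (b' * f z + ct \<nu>o D (\<lambda>x. \<rho> x * ct \<nu>oi E \<phi> x) z) / f z"
      unfolding h3[OF z] \<rho>P[OF z] using h6 by (simp add: algebra_simps)
    also have "\<dots> = b' + ct \<nu>o D (\<lambda>x. \<rho> x * ct \<nu>oi E \<phi> x) z / f z"
      using f0[OF z] by (simp add: add_divide_distrib)
    also have "ct \<nu>o D (\<lambda>x. \<rho> x * ct \<nu>oi E \<phi> x) z / f z =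
        - a * (LINT y:E|\<nu>oi. \<phi> y * f y) + ct \<nu>i D (\<lambda>s. \<rho> s * ct \<nu>oi E (\<lambda>y. \<phi> y * f y) s) z"
      by (rule reciprocal_exchange[OF \<nu>o \<nu>i D c\<rho> \<nu>oi E c\<phi> DE f0 f1 f2 z])
    also have "ct \<nu>i D (\<lambda>s. \<rho> s * ct \<nu>oi E (\<lambda>y. \<phi> y * f y) s) z = ct \<nu>i D (\<lambda>x. FS x * Pj x) z"
    proof (rule ct_cong[OF \<nu>i D])
      fix s assume "s \<in> D"
      then have sE: "s \<notin> E" using DE by auto
      have "ct \<nu>oi E (\<lambda>y. \<phi> y * f y) s = Pj s / Foi s"
        unfolding h5[OF sE] by (rule ct_cong[OF \<nu>oi E \<phi>f])
      then show "\<rho> s * ct \<nu>oi E (\<lambda>y. \<phi> y * f y) s = FS s * Pj s"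
        using nz(3)[OF sE] by (simp add: \<rho>_def)
    qed
    finally show ?thesis by simp
  qed
  then show ?A by blast
  show ?B
  proof (intro allI impI)
    fix z assume z: "z \<notin> D" "z \<notin> E"
    have "ct \<nu>o D \<rho> z * ct \<nu>oi E \<phi> z = ct \<nu>o D (\<lambda>x. \<rho> x * ct \<nu>oi E \<phi> x) z + ct \<nu>oi E (\<lambda>y. \<phi> y * ct \<nu>o D \<rho> y) z"
      by (rule ct_product[OF \<nu>o D c\<rho> \<nu>oi E c\<phi> DE z])
    also have "ct \<nu>oi E (\<lambda>y. \<phi> y * ct \<nu>o D \<rho> y) z = ct \<nu>oi E (\<lambda>y. Fi y * Poi y - c * \<phi> y) z"
    proof (rule ct_cong[OF \<nu>oi E])
      fix y assume y: "y \<in> E"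
      then have yD: "y \<notin> D" using DE by auto
      have "ct \<nu>o D \<rho> y = f y - c" using h1[OF yD] by (simp add: f_def \<rho>_def)
      show "\<phi> y * ct \<nu>o D \<rho> y = Fi y * Poi y - c * \<phi> y"
        unfolding \<open>ct \<nu>o D \<rho> y = _\<close> using \<phi>f[OF y] by (simp add: algebra_simps)
    qed
    also have "\<dots> = Pj z / Foi z - c * ct \<nu>oi E \<phi> z"
      unfolding h5[OF z(2)]
      by (subst ct_diff[OF \<nu>oi E _ _ z(2)])
         (auto intro!: continuous_intros c\<phi> cE continuous_on_subset[OF cD(3) sub(2)] simp: ct_cmult)
    also have "ct \<nu>o D (\<lambda>x. \<rho> x * ct \<nu>oi E \<phi> x) z = PS z / Fo z - b' * (f z - c)"
      using \<rho>P[OF z(1)] h3[OF z(1)] by simp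
    finally have "ct \<nu>o D \<rho> z * ct \<nu>oi E \<phi> z = PS z / Fo z - b' * (f z - c) + (Pj z / Foi z - c * ct \<nu>oi E \<phi> z)" .
    moreover have "ct \<nu>o D \<rho> z = f z - c" using h1[OF z(1)] by (simp add: f_def \<rho>_def)
    moreover have "ct \<nu>oi E \<phi> z = Po z / Foi z - b'" using h4[OF z(2)] by (simp add: \<phi>_def)
    ultimately have e: "(f z - c) * (Po z / Foi z - b') = PS z / Fo z - b' * (f z - c) + (Pj z / Foi z - c * (Po z / Foi z - b'))"
      by simp
    have "u * P = A + B" if "(u - c) * (P - b') = A - b' * (u - c) + (B - c * (P - b'))" for u P A B :: real
      using that h6 by (auto simp: algebra_simps)
    from this[OF e] have "f z * (Po z / Foi z) = PS z / Fo z + Pj z / Foi z" .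
    then show "Fo z * Pj z - Fi z * Po z + PS z * Foi z = 0"
      unfolding f_def using nz(1)[OF z(1)] nz(3)[OF z(2)] by (simp add: field_simps)
  qed
qed

text \<open>Here the new function \<open>PS\<close> moves into the denominator: the expansion of
  \<open>Fl / Fo\<close> is divided by \<open>f = PS / Fo\<close>. The additive constant in
  \<open>h4\<close> has to be exactly this one, since it must cancel the multiple of
  \<open>1 / f\<close> that the affine part leaves behind.\<close>

lemma exchange_new_first:
  assumes D: "compact D" and E: "compact E" and DE: "D \<inter> E = {}"
    and \<nu>o: "finite_borel \<nu>o" and \<mu>S: "finite_borel \<mu>S" and \<mu>o: "finite_borel \<mu>o"
    and cD: "continuous_on D FS" "continuous_on (- D) Fo"
    and cE: "continuous_on (- E) Po" "continuous_on (- E) Pl" "continuous_on E Pol"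
    and nz: "\<And>z. z \<notin> D \<Longrightarrow> Fo z \<noteq> 0" "\<And>z. z \<notin> D \<Longrightarrow> PS z \<noteq> 0" "\<And>z. z \<notin> E \<Longrightarrow> Po z \<noteq> 0"
    and h1: "\<And>z. z \<notin> D \<Longrightarrow> Fl z / Fo z = cl + ct \<nu>o D (\<lambda>x. FS x * Fol x) z"
    and h2: "\<And>z. z \<notin> D \<Longrightarrow> PS z / Fo z = ct \<nu>o D (\<lambda>x. FS x * Po x) z"
    and h2': "\<And>z. z \<notin> D \<Longrightarrow> Fo z / PS z = \<alpha> * z + \<beta> - ct \<mu>S D (\<lambda>x. FS x * Po x) z"
    and h3: "\<And>z. z \<notin> E \<Longrightarrow> Fol z / Po z = a' * z + b' - ct \<mu>o E (\<lambda>y. Fo y * Pol y) z"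
    and h4: "\<And>z. z \<notin> E \<Longrightarrow> Pl z / Po z = (cl - a' * (LINT x:D|\<nu>o. FS x * Po x)) + ct \<mu>o E (\<lambda>y. PS y * Pol y) z"
  shows "\<exists>a b. \<forall>z. z \<notin> D \<longrightarrow> Fl z / PS z = a * z + b - ct \<mu>S D (\<lambda>x. FS x * Pl x) z"
proof -
  define f where "f = (\<lambda>z. PS z / Fo z)"
  define \<phi> where "\<phi> = (\<lambda>y. Fo y * Pol y)"
  define \<rho> where "\<rho> = (\<lambda>x. FS x * Po x)"
  define m where "m = (LINT x:D|\<nu>o. \<rho> x)"
  define \<kappa> where "\<kappa> = (LINT y:E|\<mu>o. \<phi> y * f y)"
  have sub: "D \<subseteq> - E" "E \<subseteq> - D" using DE by auto
  have c\<rho>: "continuous_on D \<rho>" unfolding \<rho>_def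
    by (intro continuous_intros cD continuous_on_subset[OF cE(1) sub(1)])
  have c\<phi>: "continuous_on E \<phi>" unfolding \<phi>_def
    by (intro continuous_intros cE continuous_on_subset[OF cD(2) sub(2)])
  have f0: "f z \<noteq> 0" if "z \<notin> D" for z unfolding f_def using nz that by simp
  have \<phi>f: "\<phi> y * f y = PS y * Pol y" if "y \<in> E" for y
    using nz(1)[of y] that DE by (auto simp: \<phi>_def f_def)
  have f1: "f z = 0 + ct \<nu>o D \<rho> z" if "z \<notin> D" for z using h2[OF that] by (simp add: f_def \<rho>_def)
  have f2: "1 / f z = \<alpha> * z + \<beta> - ct \<mu>S D \<rho> z" if "z \<notin> D" for z
    using h2'[OF that] by (simp add: f_def \<rho>_def)
  have c\<mu>: "continuous_on D (ct \<mu>o E \<phi>)" by (rule ct_continuous_on[OF \<mu>o E c\<phi> DE])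
  have "Fl z / PS z = (a' + (cl - a' * m) * \<alpha>) * z + (b' + \<alpha> * \<kappa> + (cl - a' * m) * \<beta>) - ct \<mu>S D (\<lambda>x. FS x * Pl x) z"
    if z: "z \<notin> D" for z
  proof -
    have fz: "ct \<nu>o D \<rho> z = f z" using h2[OF z] by (simp add: f_def \<rho>_def)
    note inv = f2[OF z]
    have "ct \<nu>o D (\<lambda>x. FS x * Fol x) z = ct \<nu>o D (\<lambda>x. \<rho> x * (a' * x + b') - \<rho> x * ct \<mu>o E \<phi> x) z"
    proof (rule ct_cong[OF \<nu>o D])
      fix x assume "x \<in> D"
      then have xE: "x \<notin> E" using DE by auto
      have "Fol x = Po x * (a' * x + b' - ct \<mu>o E \<phi> x)"
        using h3[OF xE] nz(3)[OF xE] by (simp add: \<phi>_def field_simps)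
      show "FS x * Fol x = \<rho> x * (a' * x + b') - \<rho> x * ct \<mu>o E \<phi> x" unfolding \<open>Fol x = _\<close> \<rho>_def by (simp add: algebra_simps)
    qed
    also have "\<dots> = ct \<nu>o D (\<lambda>x. \<rho> x * (a' * x + b')) z - ct \<nu>o D (\<lambda>x. \<rho> x * ct \<mu>o E \<phi> x) z"
      by (rule ct_diff[OF \<nu>o D _ _ z]) (intro continuous_intros c\<rho> c\<mu>)+
    also have "ct \<nu>o D (\<lambda>x. \<rho> x * (a' * x + b')) z = (a' * z + b') * f z - a' * m"
      unfolding ct_affine[OF \<nu>o D c\<rho> z] fz m_def ..
    finally have 1: "Fl z / Fo z = cl + (a' * z + b') * f z - a' * m - ct \<nu>o D (\<lambda>x. \<rho> x * ct \<mu>o E \<phi> x) z"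
      using h1[OF z] by simp
    have "ct \<nu>o D (\<lambda>x. \<rho> x * ct \<mu>o E \<phi> x) z / f z =
        - \<alpha> * \<kappa> + ct \<mu>S D (\<lambda>s. \<rho> s * ct \<mu>o E (\<lambda>y. \<phi> y * f y) s) z"
      unfolding \<kappa>_def
      by (rule reciprocal_exchange[OF \<nu>o \<mu>S D c\<rho> \<mu>o E c\<phi> DE f0 f1 f2 z])
    also have "ct \<mu>S D (\<lambda>s. \<rho> s * ct \<mu>o E (\<lambda>y. \<phi> y * f y) s) z =
        ct \<mu>S D (\<lambda>x. FS x * Pl x - (cl - a' * m) * \<rho> x) z"
    proof (rule ct_cong[OF \<mu>S D])
      fix s assume "s \<in> D"
      then have sE: "s \<notin> E" using DE by auto
      have "ct \<mu>o E (\<lambda>y. \<phi> y * f y) s = ct \<mu>o E (\<lambda>y. PS y * Pol y) s"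
        by (rule ct_cong[OF \<mu>o E \<phi>f])
      also have "\<dots> = Pl s / Po s - (cl - a' * m)" using h4[OF sE] by (simp add: m_def \<rho>_def)
      finally have e: "ct \<mu>o E (\<lambda>y. \<phi> y * f y) s = Pl s / Po s - (cl - a' * m)" .
      show "\<rho> s * ct \<mu>o E (\<lambda>y. \<phi> y * f y) s = FS s * Pl s - (cl - a' * m) * \<rho> s"
        unfolding e \<rho>_def using nz(3)[OF sE] by (simp add: algebra_simps)
    qed
    also have "\<dots> = ct \<mu>S D (\<lambda>x. FS x * Pl x) z - (cl - a' * m) * ct \<mu>S D \<rho> z"
      by (subst ct_diff[OF \<mu>S D _ _ z])
         (auto intro!: continuous_intros c\<rho> cD continuous_on_subset[OF cE(2) sub(1)] simp: ct_cmult)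
    also have "ct \<mu>S D \<rho> z = \<alpha> * z + \<beta> - 1 / f z" using inv by simp
    finally have 2: "ct \<nu>o D (\<lambda>x. \<rho> x * ct \<mu>o E \<phi> x) z / f z =
      - \<alpha> * \<kappa> + (ct \<mu>S D (\<lambda>x. FS x * Pl x) z - (cl - a' * m) * (\<alpha> * z + \<beta> - 1 / f z))" .
    have "Fl z / PS z = (Fl z / Fo z) / f z" unfolding f_def using nz(1)[OF z] by simp
    also have "\<dots> = (cl - a' * m) * (1 / f z) + (a' * z + b') - ct \<nu>o D (\<lambda>x. \<rho> x * ct \<mu>o E \<phi> x) z / f z"
      unfolding 1 using f0[OF z] by (simp add: field_simps)
    finally show ?thesis unfolding 2 by (simp add: algebra_simps)
  qed
  then show ?thesis by blast
qed

text \<open>Both numerator and denominator contain the new label. A direct computation determines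
  \<open>Pl / Pj\<close> everywhere off \<open>E\<close>, but only up to an unknown multiple of
  \<open>1 / g\<close>; the three-term relation determines it without such a term, but only where
  \<open>D\<close> is avoided as well. Comparing the two beyond \<open>R\<close> shows that the
  extra term is zero.\<close>

lemma exchange_new_common:
  assumes D: "compact D" and E: "compact E" and DE: "D \<inter> E = {}"
    and \<nu>i: "finite_borel \<nu>i" and \<nu>il: "finite_borel \<nu>il" and \<mu>i: "finite_borel \<mu>i"
    and cD: "continuous_on D FS" "continuous_on (- D) Fi" "continuous_on (- D) Fl" "continuous_on (- D) PS"
    and cE: "continuous_on (- E) Fil" "continuous_on (- E) Pj" "continuous_on E Pil"
    and nz: "\<And>z. z \<notin> D \<Longrightarrow> Fi z \<noteq> 0" "\<And>z. z \<notin> E \<Longrightarrow> Fil z \<noteq> 0" "\<And>z. z \<notin> E \<Longrightarrow> Pj z \<noteq> 0"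
    and h1: "\<And>z. z \<notin> D \<Longrightarrow> Fl z / Fi z = al * z + cl + s * ct \<nu>i D (\<lambda>x. FS x * Fil x) z"
    and h2: "\<And>z. z \<notin> D \<Longrightarrow> PS z / Fi z = b3 + ct \<nu>i D (\<lambda>x. FS x * Pj x) z"
    and h3: "\<And>z. z \<notin> E \<Longrightarrow> Pj z / Fil z = b1 + ct \<nu>il E (\<lambda>y. Fi y * Pil y) z"
    and h4: "\<And>z. z \<notin> E \<Longrightarrow> Fil z / Pj z = a' * z + b' - ct \<mu>i E (\<lambda>y. Fi y * Pil y) z"
    and h5: "\<And>z. z \<notin> E \<Longrightarrow> Pl z / Fil z = b2 + ct \<nu>il E (\<lambda>y. Fl y * Pil y) z"
    and h6: "\<And>z. z > R \<Longrightarrow> z \<notin> D \<and> z \<notin> E \<and> Fi z * Pl z - Fl z * Pj z + s * (PS z * Fil z) = 0"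
    and z: "z \<notin> E"
  shows "Pl z / Pj z = (al - s * b3 * a') * z + (cl - s * a' * (LINT x:D|\<nu>i. FS x * Pj x) - s * b3 * b')
     + s * ct \<mu>i E (\<lambda>y. PS y * Pil y) z"
proof -
  define g where "g = (\<lambda>z. Pj z / Fil z)"
  define \<rho> where "\<rho> = (\<lambda>y. Fi y * Pil y)"
  define \<psi> where "\<psi> = (\<lambda>x. FS x * Fil x)"
  define \<theta> where "\<theta> = (\<lambda>x. FS x * Pj x)"
  define mq where "mq = (LINT x:D|\<nu>i. \<theta> x)"
  define m' where "m' = (LINT y:E|\<nu>il. \<rho> y)"
  define RHS where "RHS = (\<lambda>z. (al - s * b3 * a') * z + (cl - s * a' * mq - s * b3 * b') + s * ct \<mu>i E (\<lambda>y. PS y * Pil y) z)"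
  have sub: "D \<subseteq> - E" "E \<subseteq> - D" and ED: "E \<inter> D = {}" using DE by auto
  have c\<rho>: "continuous_on E \<rho>" unfolding \<rho>_def
    by (intro continuous_intros cE continuous_on_subset[OF cD(2) sub(2)])
  have c\<psi>: "continuous_on D \<psi>" unfolding \<psi>_def
    by (intro continuous_intros cD continuous_on_subset[OF cE(1) sub(1)])
  have c\<theta>: "continuous_on D \<theta>" unfolding \<theta>_def
    by (intro continuous_intros cD continuous_on_subset[OF cE(2) sub(1)])
  have cPP: "continuous_on E (\<lambda>y. PS y * Pil y)"
    by (intro continuous_intros cE continuous_on_subset[OF cD(4) sub(2)])
  have g0: "g z \<noteq> 0" if "z \<notin> E" for z unfolding g_def using nz that by simp
  have \<psi>g: "\<psi> x * g x = \<theta> x" if "x \<in> D" for x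
    using nz(2)[of x] that DE by (auto simp: \<psi>_def \<theta>_def g_def)
  have gf1: "g z = b1 + ct \<nu>il E \<rho> z" if "z \<notin> E" for z using h3[OF that] by (simp only: g_def \<rho>_def)
  have gf2: "1 / g z = a' * z + b' - ct \<mu>i E \<rho> z" if "z \<notin> E" for z
    using h4[OF that] by (simp add: g_def \<rho>_def)
  have g1: "ct \<nu>il E \<rho> z = g z - b1" if "z \<notin> E" for z using h3[OF that] by (simp add: g_def \<rho>_def)
  have g2: "ct \<mu>i E \<rho> z = a' * z + b' - 1 / g z" if "z \<notin> E" for z using gf2[OF that] by simp
  have c\<psi>E: "continuous_on E (ct \<nu>i D \<psi>)" "continuous_on E (ct \<nu>i D \<theta>)"
    by (rule ct_continuous_on[OF \<nu>i D c\<psi> ED], rule ct_continuous_on[OF \<nu>i D c\<theta> ED])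
  have \<rho>\<theta>: "ct \<mu>i E (\<lambda>y. \<rho> y * ct \<nu>i D \<theta> y) z = ct \<mu>i E (\<lambda>y. PS y * Pil y) z - b3 * ct \<mu>i E \<rho> z" if z: "z \<notin> E" for z
  proof -
    have "ct \<mu>i E (\<lambda>y. \<rho> y * ct \<nu>i D \<theta> y) z = ct \<mu>i E (\<lambda>y. PS y * Pil y - b3 * \<rho> y) z"
    proof (rule ct_cong[OF \<mu>i E])
      fix y assume "y \<in> E"
      then have yD: "y \<notin> D" using DE by auto
      have "ct \<nu>i D \<theta> y = PS y / Fi y - b3" using h2[OF yD] by (simp add: \<theta>_def)
      show "\<rho> y * ct \<nu>i D \<theta> y = PS y * Pil y - b3 * \<rho> y"
        unfolding \<open>ct \<nu>i D \<theta> y = _\<close> \<rho>_def using nz(1)[OF yD] by (simp add: algebra_simps)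
    qed
    also have "\<dots> = ct \<mu>i E (\<lambda>y. PS y * Pil y) z - b3 * ct \<mu>i E \<rho> z"
      by (subst ct_diff[OF \<mu>i E cPP _ z]) (auto intro!: continuous_intros c\<rho> simp: ct_cmult)
    finally show ?thesis .
  qed
  have 1: "Pl z / Pj z = (b2 - cl * b1 - al * m' + s * b3 - al * b1 * z) / g z + RHS z" if z: "z \<notin> E" for z
  proof -
    have "ct \<nu>il E (\<lambda>y. Fl y * Pil y) z = ct \<nu>il E (\<lambda>y. \<rho> y * (al * y + cl) + s * (\<rho> y * ct \<nu>i D \<psi> y)) z"
    proof (rule ct_cong[OF \<nu>il E])
      fix y assume "y \<in> E"
      then have yD: "y \<notin> D" using DE by auto
      have "Fl y = Fi y * (al * y + cl + s * ct \<nu>i D \<psi> y)"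
        using h1[OF yD] nz(1)[OF yD] by (simp add: \<psi>_def field_simps)
      show "Fl y * Pil y = \<rho> y * (al * y + cl) + s * (\<rho> y * ct \<nu>i D \<psi> y)"
        unfolding \<open>Fl y = _\<close> \<rho>_def by (simp add: algebra_simps)
    qed
    also have "\<dots> = ct \<nu>il E (\<lambda>y. \<rho> y * (al * y + cl)) z + s * ct \<nu>il E (\<lambda>y. \<rho> y * ct \<nu>i D \<psi> y) z"
      by (subst ct_add[OF \<nu>il E _ _ z]) (auto intro!: continuous_intros c\<rho> c\<psi>E simp: ct_cmult)
    also have "ct \<nu>il E (\<lambda>y. \<rho> y * (al * y + cl)) z = (al * z + cl) * (g z - b1) - al * m'"
      unfolding ct_affine[OF \<nu>il E c\<rho> z] g1[OF z] m'_def ..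
    finally have e1: "Pl z / Fil z = b2 + ((al * z + cl) * (g z - b1) - al * m') + s * ct \<nu>il E (\<lambda>y. \<rho> y * ct \<nu>i D \<psi> y) z"
      using h5[OF z] by simp
    have "ct \<nu>il E (\<lambda>y. \<rho> y * ct \<nu>i D \<psi> y) z / g z =
        - a' * (LINT x:D|\<nu>i. \<psi> x * g x) + ct \<mu>i E (\<lambda>y. \<rho> y * ct \<nu>i D (\<lambda>x. \<psi> x * g x) y) z"
      by (rule reciprocal_exchange[OF \<nu>il \<mu>i E c\<rho> \<nu>i D c\<psi> ED g0 gf1 gf2 z])
    also have "(LINT x:D|\<nu>i. \<psi> x * g x) = mq"
      unfolding mq_def by (rule set_integral_cong_compact[OF \<nu>i D \<psi>g])
    also have "ct \<mu>i E (\<lambda>y. \<rho> y * ct \<nu>i D (\<lambda>x. \<psi> x * g x) y) z = ct \<mu>i E (\<lambda>y. \<rho> y * ct \<nu>i D \<theta> y) z"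
      by (rule ct_cong[OF \<mu>i E]) (simp add: ct_cong[OF \<nu>i D \<psi>g])
    finally have e2: "ct \<nu>il E (\<lambda>y. \<rho> y * ct \<nu>i D \<psi> y) z / g z =
      - a' * mq + (ct \<mu>i E (\<lambda>y. PS y * Pil y) z - b3 * (a' * z + b' - 1 / g z))"
      unfolding \<rho>\<theta>[OF z] g2[OF z] .
    have "Pl z / Pj z = (Pl z / Fil z) / g z" unfolding g_def using nz(2)[OF z] by simp
    also have "\<dots> = (b2 - cl * b1 - al * m' - al * b1 * z) / g z + (al * z + cl) + s * (ct \<nu>il E (\<lambda>y. \<rho> y * ct \<nu>i D \<psi> y) z / g z)"
      unfolding e1 using g0[OF z] by (simp add: field_simps)
    finally show ?thesis unfolding e2 RHS_def by (simp add: algebra_simps add_divide_distrib diff_divide_distrib)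
  qed
  \<comment> \<open>The three-term relation \<open>h6\<close> expresses the ratio through quotients
    by \<open>Fi\<close>; \<open>ct_product\<close> then moves the remaining transform from
    \<open>D\<close> to \<open>E\<close>.\<close>
  have 2: "Pl z / Pj z = RHS z" if zR: "z > R" for z
  proof -
    have z: "z \<notin> D" "z \<notin> E" and pl: "Fi z * Pl z - Fl z * Pj z + s * (PS z * Fil z) = 0"
      using h6[OF zR] by auto
    have "Pl z / Pj z = Fl z / Fi z - s * (PS z / Fi z) / g z"
    proof -
      have "Fi z * Pl z = Fl z * Pj z - s * (PS z * Fil z)" using pl by simp
      then have "Pl z = (Fl z * Pj z - s * (PS z * Fil z)) / Fi z" using nz(1)[OF z(1)] by (simp add: field_simps)
      then show ?thesis unfolding g_def using nz(1)[OF z(1)] nz(2)[OF z(2)] nz(3)[OF z(2)]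
        by (simp add: field_simps)
    qed
    moreover have "ct \<nu>i D \<psi> z = (a' * z + b') * (PS z / Fi z - b3) - a' * mq - ct \<nu>i D (\<lambda>x. \<theta> x * ct \<mu>i E \<rho> x) z"
    proof -
      have "ct \<nu>i D \<psi> z = ct \<nu>i D (\<lambda>x. \<theta> x * (a' * x + b') - \<theta> x * ct \<mu>i E \<rho> x) z"
      proof (rule ct_cong[OF \<nu>i D])
        fix x assume x: "x \<in> D"
        then have xE: "x \<notin> E" using DE by auto
        have "\<psi> x = \<theta> x * (1 / g x)" using \<psi>g[OF x] g0[OF xE] by (simp add: field_simps)
        show "\<psi> x = \<theta> x * (a' * x + b') - \<theta> x * ct \<mu>i E \<rho> x"
          unfolding \<open>\<psi> x = _\<close> gf2[OF xE] by (simp add: algebra_simps)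
      qed
      also have "\<dots> = ct \<nu>i D (\<lambda>x. \<theta> x * (a' * x + b')) z - ct \<nu>i D (\<lambda>x. \<theta> x * ct \<mu>i E \<rho> x) z"
        by (rule ct_diff[OF \<nu>i D _ _ z(1)]) (intro continuous_intros c\<theta> ct_continuous_on[OF \<mu>i E c\<rho> DE])+
      also have "ct \<nu>i D (\<lambda>x. \<theta> x * (a' * x + b')) z = (a' * z + b') * (PS z / Fi z - b3) - a' * mq"
        unfolding ct_affine[OF \<nu>i D c\<theta> z(1)] mq_def using h2[OF z(1)] by (simp add: \<theta>_def)
      finally show ?thesis .
    qed
    moreover have "ct \<nu>i D (\<lambda>x. \<theta> x * ct \<mu>i E \<rho> x) z =
        (PS z / Fi z - b3) * (a' * z + b' - 1 / g z) - (ct \<mu>i E (\<lambda>y. PS y * Pil y) z - b3 * (a' * z + b' - 1 / g z))"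
    proof -
      have "ct \<nu>i D \<theta> z * ct \<mu>i E \<rho> z = ct \<nu>i D (\<lambda>x. \<theta> x * ct \<mu>i E \<rho> x) z + ct \<mu>i E (\<lambda>y. \<rho> y * ct \<nu>i D \<theta> y) z"
        by (rule ct_product[OF \<nu>i D c\<theta> \<mu>i E c\<rho> DE z])
      moreover have "ct \<nu>i D \<theta> z = PS z / Fi z - b3" using h2[OF z(1)] by (simp add: \<theta>_def)
      ultimately show ?thesis unfolding \<rho>\<theta>[OF z(2)] g2[OF z(2)] by simp
    qed
    moreover have "Fl z / Fi z = al * z + cl + s * ct \<nu>i D \<psi> z" using h1[OF z(1)] by (simp add: \<psi>_def)
    ultimately show ?thesis unfolding RHS_def by (simp add: algebra_simps)
  qed
  \<comment> \<open>An affine function vanishing beyond \<open>R\<close> is zero. Two of its values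
    yield the slope, a third use the constant, and this needs no information on how the constants
    are related.\<close>
  have B: "b2 - cl * b1 - al * m' + s * b3 - al * b1 * z = 0" if "z > R" for z
    using 1[of z] 2[OF that] g0[of z] h6[OF that] by auto
  have "al * b1 = 0" using B[of "R + 1"] B[of "R + 2"] by (simp add: algebra_simps)
  then have "b2 - cl * b1 - al * m' + s * b3 = 0" using B[of "R + 1"] by simp
  with \<open>al * b1 = 0\<close> show ?thesis using 1[OF z] unfolding RHS_def mq_def \<theta>_def by simp
qed

section \<open>Families of minors\<close>

text \<open>The sign by which a minor changes when the columns \<open>i\<close> and \<open>l\<close>
  are put in increasing order.\<close>

definition sg :: "nat \<Rightarrow> nat \<Rightarrow> real" where
  "sg i l = (if i < l then 1 else - 1)"

text \<open>New minors are expanded along the smallest missing column. It is at most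
  \<open>card S\<close>, so as denominator label it never produces a slope, and it lies below all
  other missing labels, so the sign is +1.\<close>

definition mex :: "nat set \<Rightarrow> nat" where
  "mex S = (LEAST i. i \<notin> S)"

lemma mex_le: "i \<notin> S \<Longrightarrow> mex S \<le> i"
  unfolding mex_def by (rule Least_le)

lemma mex_notin: "i \<notin> S \<Longrightarrow> mex S \<notin> S"
  unfolding mex_def by (rule LeastI)

lemma mex_le_card:
  assumes "finite S" shows "mex S \<le> card S"
proof -
  have "{..<mex S} \<subseteq> S" unfolding mex_def using not_less_Least by blast
  from card_mono[OF assms this] show ?thesis by simp
qed

lemma mex_lessThan: "mex {..<i} = i"
  unfolding mex_def by (rule Least_equality) auto

text \<open>The decay exponent at infinity of the minor with column set \<open>K\<close>.\<close>

definition wt :: "nat set \<Rightarrow> nat" where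
  "wt K = card {k \<in> K. card K \<le> k}"

lemma wt_insert:
  assumes "finite S" "i \<notin> S"
  shows "wt (insert i S) = card {k \<in> S. Suc (card S) \<le> k} + (if Suc (card S) \<le> i then 1 else 0)"
proof -
  have c: "card (insert i S) = Suc (card S)" using assms by simp
  have "{k \<in> insert i S. Suc (card S) \<le> k} =
      (if Suc (card S) \<le> i then insert i {k \<in> S. Suc (card S) \<le> k} else {k \<in> S. Suc (card S) \<le> k})"
    by auto
  then show ?thesis unfolding wt_def c using assms by simp
qed

definition grows :: "nat set \<Rightarrow> (real \<Rightarrow> real) \<Rightarrow> bool" where
  "grows K f \<longleftrightarrow> (\<exists>L. L \<noteq> 0 \<and> ((\<lambda>z. z ^ wt K * f z) \<longlongrightarrow> L) at_top)"

lemma affine_tendsto: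
  fixes a b L :: real
  assumes "((\<lambda>z. a * z + b) \<longlongrightarrow> L) at_top"
  shows "a = 0" "b = L"
proof -
  have "((\<lambda>z. (a * z + b) - L) \<longlongrightarrow> L - L) at_top" by (intro tendsto_intros assms)
  then have "((\<lambda>z. poly [:b - L, a:] z) \<longlongrightarrow> 0) at_top" by (simp add: algebra_simps)
  from poly_tendsto_0_imp_zero[OF this] show "a = 0" "b = L" by auto
qed

lemma eventually_notin_compact:
  assumes "compact (D :: real set)" shows "\<forall>\<^sub>F z in at_top. z \<notin> D"
proof -
  obtain R where R: "\<And>x. x \<in> D \<Longrightarrow> \<bar>x\<bar> \<le> R" using compact_imp_bounded[OF assms] by (auto simp: bounded_iff)
  show ?thesis using eventually_gt_at_top[of R] by eventually_elim (use R in force)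
qed

text \<open>The exponents \<open>wt\<close> of the two members differ only by whether
  \<open>i\<close> and \<open>l\<close> exceed \<open>card S\<close>. Hence the ratio grows linearly
  if only \<open>i\<close> does, tends to a nonzero constant if both or neither do, and decays like
  \<open>1 / z\<close> if only \<open>l\<close> does. The Cauchy transform tends to zero, so slope
  and constant can be read off.\<close>

lemma ratio_coefficients:
  assumes S: "finite S" "i \<notin> S" "l \<notin> S" and D: "compact D"
    and g: "grows (insert i S) Fi" "grows (insert l S) Fl"
    and M: "finite_borel M" and r: "continuous_on D \<rho>"
    and e: "\<And>z. z \<notin> D \<Longrightarrow> Fl z / Fi z = a * z + b + s * ct M D \<rho> z"
  shows "a \<noteq> 0 \<Longrightarrow> l \<le> card S \<and> card S < i" and "i \<le> card S \<Longrightarrow> card S < l \<Longrightarrow> b = 0"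
proof -
  define c where "c = card {k \<in> S. Suc (card S) \<le> k}"
  define ni nl :: nat where "ni = (if Suc (card S) \<le> i then 1 else 0)" and "nl = (if Suc (card S) \<le> l then 1 else 0)"
  obtain Li Ll where L: "Li \<noteq> 0" "((\<lambda>z. z ^ (c + ni) * Fi z) \<longlongrightarrow> Li) at_top"
     "Ll \<noteq> 0" "((\<lambda>z. z ^ (c + nl) * Fl z) \<longlongrightarrow> Ll) at_top"
    using g unfolding grows_def wt_insert[OF S(1,2)] wt_insert[OF S(1,3)] c_def ni_def nl_def by blast
  have "((\<lambda>z. (z ^ (c + nl) * Fl z) / (z ^ (c + ni) * Fi z)) \<longlongrightarrow> Ll / Li) at_top"
    by (intro tendsto_intros L)
  moreover have "\<forall>\<^sub>F z in at_top. (z ^ (c + nl) * Fl z) / (z ^ (c + ni) * Fi z) = (z ^ nl * (Fl z / Fi z)) / z ^ ni"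
    using eventually_gt_at_top[of 0] by eventually_elim (simp add: power_add)
  ultimately have lim: "((\<lambda>z. (z ^ nl * (Fl z / Fi z)) / z ^ ni) \<longlongrightarrow> Ll / Li) at_top"
    by (simp add: tendsto_cong)
  have C: "((\<lambda>z. s * ct M D \<rho> z) \<longlongrightarrow> s * 0) at_top"
    by (intro tendsto_intros ct_tendsto_0 finite_borelD[OF M] D r)
  have ev: "\<forall>\<^sub>F z in at_top. Fl z / Fi z - s * ct M D \<rho> z = a * z + b"
    using eventually_notin_compact[OF D] by eventually_elim (simp add: e)
  have aff: "a = 0 \<and> b = K" if "((\<lambda>z. Fl z / Fi z) \<longlongrightarrow> K) at_top" for K
  proof -
    have "((\<lambda>z. Fl z / Fi z - s * ct M D \<rho> z) \<longlongrightarrow> K - s * 0) at_top" by (intro tendsto_diff that C)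
    then have "((\<lambda>z. a * z + b) \<longlongrightarrow> K) at_top" using tendsto_cong[OF ev] by simp
    from affine_tendsto[OF this] show ?thesis by simp
  qed
  have 1: "a = 0 \<and> b = 0" if "ni = 0" "nl = 1"
  proof (rule aff)
    have "((\<lambda>z. (z * (Fl z / Fi z)) * (1 / z)) \<longlongrightarrow> Ll / Li * 0) at_top"
    proof (intro tendsto_mult)
      show "((\<lambda>z. z * (Fl z / Fi z)) \<longlongrightarrow> Ll / Li) at_top" using lim that by simp
      show "((\<lambda>z. 1 / z :: real) \<longlongrightarrow> 0) at_top" by real_asymp
    qed
    moreover have "\<forall>\<^sub>F z in at_top. (z * (Fl z / Fi z)) * (1 / z) = Fl z / Fi z"
      using eventually_gt_at_top[of 0] by eventually_elim simp
    ultimately show "((\<lambda>z. Fl z / Fi z) \<longlongrightarrow> 0) at_top" by (simp add: tendsto_cong)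
  qed
  have 2: "a = 0" if "ni = nl"
  proof -
    have "\<forall>\<^sub>F z in at_top. (z ^ nl * (Fl z / Fi z)) / z ^ ni = Fl z / Fi z"
      using eventually_gt_at_top[of 0] by eventually_elim (simp add: that)
    then have "((\<lambda>z. Fl z / Fi z) \<longlongrightarrow> Ll / Li) at_top" using lim by (simp add: tendsto_cong)
    from aff[OF this] show ?thesis by simp
  qed
  show "a \<noteq> 0 \<Longrightarrow> l \<le> card S \<and> card S < i" 
    using 1 2 unfolding ni_def nl_def by (cases "Suc (card S) \<le> i"; cases "Suc (card S) \<le> l") auto
  show "i \<le> card S \<Longrightarrow> card S < l \<Longrightarrow> b = 0" using 1 unfolding ni_def nl_def by auto
qed

text \<open>The base label \<open>o\<close> is eliminated from two relations that contain it, with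
  the help of the three-term relation among the old minors; \<open>fo\<close> then cancels.\<close>

lemma plucker_transfer:
  fixes fo :: real
  assumes "fo * pi' - fi * po + ps * foi = 0" "fo * pj - fj * po + ps * foj = 0"
    "fo * fij * s - fi * foj + fj * foi = 0" "fo \<noteq> 0"
  shows "fi * pj - fj * pi' + s * (ps * fij) = 0"
proof -
  have "fo * (fi * pj - fj * pi' + s * (ps * fij)) = 0" using assms(1-3) by algebra
  with assms(4) show ?thesis by simp
qed

text \<open>The relation in which every member contains the new label, deduced from those in which
  only some do. First \<open>fi\<close> and then \<open>fij\<close> is cancelled, so only these two
  have to be nonzero.\<close>

lemma plucker_lift:
  fixes fi :: real
  assumes "fi * pj - fj * pi' + sij * (p0 * fij) = 0" "fi * pl - fl * pi' + sil * (p0 * fil) = 0"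
    "fij * pil - fil * pij + sjl * (pi' * fijl) = 0" "fij * pjl - fjl * pij + sil * (pj * fijl) = 0"
    "fi * fjl * sjl - fj * fil * sil + fl * fij * sij = 0" "fi \<noteq> 0" "fij \<noteq> 0"
  shows "pi' * pjl * sjl - pj * pil * sil + pl * pij * sij = 0"
proof -
  have b: "fi * (pi' * sjl * fjl - pj * sil * fil + pl * sij * fij) = 0" using assms(1,2,5) by algebra
  then have b': "pi' * sjl * fjl - pj * sil * fil + pl * sij * fij = 0" using assms(6) by simp
  have "fij * (pi' * pjl * sjl - pj * pil * sil + pl * pij * sij) = 0" using b' assms(3,4) by algebra
  with assms(7) show ?thesis by simp
qed

locale chain_intervals =
  fixes D :: "nat \<Rightarrow> real set"
  assumes interval: "\<exists>p q. D i = {p..q}" and disjoint: "D i \<inter> D (Suc i) = {}"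
    and bounded: "\<exists>R. \<forall>i. \<forall>x\<in>D i. x \<le> R"
begin

lemma compact_D: "compact (D i)" and connected_D: "connected (D i)"
  using interval[of i] by auto

lemma sub_compl: "D (Suc i) \<subseteq> - D i" "D i \<subseteq> - D (Suc i)"
  using disjoint[of i] by auto

text \<open>The measure is the one of the denominator. Slope and constant are left open; where they
  matter they are found from the growth at infinity.\<close>

definition exch :: "(nat set \<Rightarrow> real \<Rightarrow> real) \<Rightarrow> (nat set \<Rightarrow> real measure) \<Rightarrow> nat set \<Rightarrow> nat \<Rightarrow> nat \<Rightarrow> bool" where
  "exch F \<nu> S i l \<longleftrightarrow> (\<exists>a b. \<forall>z. z \<notin> D (Suc (card S)) \<longrightarrow>
     F (insert l S) z / F (insert i S) z =
     a * z + b + sg i l * ct (\<nu> (insert i S)) (D (Suc (card S))) (\<lambda>x. F S x * F (insert i (insert l S)) x) z)"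

definition plucker :: "(nat set \<Rightarrow> real \<Rightarrow> real) \<Rightarrow> nat set \<Rightarrow> nat \<Rightarrow> nat \<Rightarrow> nat \<Rightarrow> real \<Rightarrow> bool" where
  "plucker F S i j l z \<longleftrightarrow>
     F (insert i S) z * F (insert j (insert l S)) z * sg j l
     - F (insert j S) z * F (insert i (insert l S)) z * sg i l
     + F (insert l S) z * F (insert i (insert j S)) z * sg i j = 0"

text \<open>The functions \<open>F K\<close> behave like the minors with rows \<open>1, \<dots>, card K\<close> and columns \<open>K\<close> of the
  unitriangular matrix with rows \<open>(0, \<dots>, 0, 1, s\<^sub>i\<^sub>,\<^sub>i, s\<^sub>i\<^sub>,\<^sub>i\<^sub>+\<^sub>1, \<dots>)\<close> of Cauchy transforms; they extend
  continuously across all the intervals except \<open>D (card K)\<close>. Formally \<open>\<nu> K\<close> is the generating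
  measure divided by the square of \<open>F K\<close>.\<close>

definition minor_family :: "nat \<Rightarrow> (nat set \<Rightarrow> real \<Rightarrow> real) \<Rightarrow> (nat set \<Rightarrow> real measure) \<Rightarrow> bool" where
  "minor_family m F \<nu> \<longleftrightarrow>
    (\<forall>K\<subseteq>{..m}. continuous_on (- D (card K)) (F K) \<and> (\<forall>z. z \<notin> D (card K) \<longrightarrow> F K z \<noteq> 0) \<and> grows K (F K)) \<and>
    (\<forall>K\<subseteq>{..m}. K \<noteq> {} \<longrightarrow> K \<noteq> {..m} \<longrightarrow> fat (\<nu> K) (D (card K))) \<and>
    (\<forall>S i l. S \<subseteq> {..m} \<longrightarrow> i \<le> m \<longrightarrow> l \<le> m \<longrightarrow> i \<notin> S \<longrightarrow> l \<notin> S \<longrightarrow> i \<noteq> l \<longrightarrow> exch F \<nu> S i l) \<and>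
    (\<forall>S i j l z. S \<subseteq> {..m} \<longrightarrow> i \<le> m \<longrightarrow> j \<le> m \<longrightarrow> l \<le> m \<longrightarrow> i \<notin> S \<longrightarrow> j \<notin> S \<longrightarrow> l \<notin> S \<longrightarrow>
       i \<noteq> j \<longrightarrow> i \<noteq> l \<longrightarrow> j \<noteq> l \<longrightarrow> (\<forall>k. z \<notin> D k) \<longrightarrow> plucker F S i j l z)"

end

section \<open>Adjoining the column \<open>Suc m\<close> to a family of minors\<close>

text \<open>In contrast to \<open>minor_family\<close>, the full column set \<open>{..m}\<close>
  also carries a measure here: the generator that the new column brings in. \<open>\<Phi> S\<close>
  is the minor with columns \<open>S\<close> and \<open>Suc m\<close>; it is 1 for the full set
  because the matrix is unitriangular, and the recursion passes from \<open>S\<close> to the larger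
  set with \<open>mex S\<close> added.\<close>

locale label_extension = chain_intervals +
  fixes m :: nat and F :: "nat set \<Rightarrow> real \<Rightarrow> real" and \<nu> :: "nat set \<Rightarrow> real measure"
    and \<Phi> :: "nat set \<Rightarrow> real \<Rightarrow> real"
  assumes F_cont: "K \<subseteq> {..m} \<Longrightarrow> continuous_on (- D (card K)) (F K)"
    and F_nz: "K \<subseteq> {..m} \<Longrightarrow> z \<notin> D (card K) \<Longrightarrow> F K z \<noteq> 0"
    and F_grows: "K \<subseteq> {..m} \<Longrightarrow> grows K (F K)"
    and nu_fat: "K \<subseteq> {..m} \<Longrightarrow> K \<noteq> {} \<Longrightarrow> fat (\<nu> K) (D (card K))"
    and F_exch: "S \<subseteq> {..m} \<Longrightarrow> i \<le> m \<Longrightarrow> l \<le> m \<Longrightarrow> i \<notin> S \<Longrightarrow> l \<notin> S \<Longrightarrow> i \<noteq> l \<Longrightarrow> exch F \<nu> S i l"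
    and F_plucker: "S \<subseteq> {..m} \<Longrightarrow> i \<le> m \<Longrightarrow> j \<le> m \<Longrightarrow> l \<le> m \<Longrightarrow> i \<notin> S \<Longrightarrow> j \<notin> S \<Longrightarrow> l \<notin> S \<Longrightarrow>
       i \<noteq> j \<Longrightarrow> i \<noteq> l \<Longrightarrow> j \<noteq> l \<Longrightarrow> (\<And>k. z \<notin> D k) \<Longrightarrow> plucker F S i j l z"
    and Phi_top: "\<Phi> {..m} = (\<lambda>_. 1)"
    and Phi_rec: "S \<subset> {..m} \<Longrightarrow> \<Phi> S = (\<lambda>z. F (insert (mex S) S) z *
       ct (\<nu> (insert (mex S) S)) (D (Suc (card S))) (\<lambda>x. F S x * \<Phi> (insert (mex S) S) x) z)"
begin

lemma fin: "S \<subseteq> {..m} \<Longrightarrow> finite S"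
  by (meson finite_atMost finite_subset)

lemma card_ins: "S \<subseteq> {..m} \<Longrightarrow> i \<notin> S \<Longrightarrow> card (insert i S) = Suc (card S)"
  using fin by simp

lemma card_le: "S \<subseteq> {..m} \<Longrightarrow> card S \<le> Suc m"
  using card_mono[of "{..m}" S] by simp

lemma proper: "S \<subseteq> {..m} \<Longrightarrow> i \<le> m \<Longrightarrow> i \<notin> S \<Longrightarrow> S \<subset> {..m}"
  by auto

lemma mex_props:
  assumes "S \<subset> {..m}"
  shows "mex S \<notin> S" "mex S \<le> m" "mex S \<le> card S" "insert (mex S) S \<subseteq> {..m}"
proof -
  obtain i where i: "i \<le> m" "i \<notin> S" using assms by auto
  show "mex S \<notin> S" using mex_notin[OF i(2)] .
  show "mex S \<le> m" using mex_le[OF i(2)] i(1) by simp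
  then show "insert (mex S) S \<subseteq> {..m}" using assms by auto
  show "mex S \<le> card S" using fin assms by (intro mex_le_card) auto
qed

lemma downward_induct [consumes 1, case_names step]:
  assumes "S \<subseteq> {..m}"
    and "\<And>S. S \<subseteq> {..m} \<Longrightarrow> (\<And>i. i \<le> m \<Longrightarrow> i \<notin> S \<Longrightarrow> P (insert i S)) \<Longrightarrow> P S"
  shows "P S"
  using assms(1)
proof (induction "Suc m - card S" arbitrary: S)
  case 0
  then have "S = {..m}" using card_subset_eq[of "{..m}" S] card_le[of S] by simp
  then show ?case using assms(2)[of S] by auto
next
  case (Suc n)
  show ?case
    by (rule assms(2)[OF Suc.prems]) (use Suc card_ins in auto)
qed

lemma F_cont_D: "K \<subseteq> {..m} \<Longrightarrow> card K = Suc i \<or> Suc (card K) = i \<Longrightarrow> continuous_on (D i) (F K)"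
  using F_cont[of K] sub_compl by (metis continuous_on_subset)

lemma F_nz_D: "K \<subseteq> {..m} \<Longrightarrow> card K = Suc i \<or> Suc (card K) = i \<Longrightarrow> x \<in> D i \<Longrightarrow> F K x \<noteq> 0"
  using F_nz[of K] sub_compl by (metis ComplD subsetD)

text \<open>The density defining \<open>\<Phi> S\<close> contains \<open>\<Phi>\<close> of a larger
  set, so it is continuous and without zeros on the interval by induction, and
  \<open>ct_nonzero\<close> applies. For the growth, \<open>mex S\<close> is at most
  \<open>card S\<close> and does not count in \<open>wt\<close>, while \<open>Suc m\<close> always
  counts; the additional power of \<open>z\<close> is supplied by \<open>ct_asymp\<close>.\<close>

lemma Phi_basic:
  assumes "S \<subseteq> {..m}"
  shows "continuous_on (- D (Suc (card S))) (\<Phi> S) \<and> (\<forall>z. z \<notin> D (Suc (card S)) \<longrightarrow> \<Phi> S z \<noteq> 0) \<and>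
    grows (insert (Suc m) S) (\<Phi> S)"
  using assms
proof (induction rule: downward_induct)
  case (step S)
  show ?case
  proof (cases "S = {..m}")
    case True
    have "{k \<in> insert (Suc m) {..m}. card (insert (Suc m) {..m}) \<le> k} = {}" by auto
    then have "wt (insert (Suc m) {..m}) = 0" unfolding wt_def by (metis card.empty)
    then have "grows (insert (Suc m) {..m}) (\<lambda>_. 1)" unfolding grows_def by (intro exI[of _ 1]) simp
    then show ?thesis unfolding True Phi_top by simp
  next
    case False
    then have psub: "S \<subset> {..m}" using step.hyps by auto
    note o = mex_props[OF psub]
    let ?o = "mex S" and ?T = "insert (mex S) S" and ?r = "Suc (card S)"
    have cT: "card ?T = ?r" by (rule card_ins[OF step.hyps o(1)])
    note IH = step.IH[OF o(2,1), unfolded cT]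
    let ?\<rho> = "\<lambda>x. F S x * \<Phi> ?T x"
    have fT: "fat (\<nu> ?T) (D ?r)" using nu_fat[OF o(4)] cT by simp
    have c\<rho>: "continuous_on (D ?r) ?\<rho>"
      by (intro continuous_intros F_cont_D step.hyps continuous_on_subset[OF IH[THEN conjunct1] sub_compl(2)]) simp
    have n\<rho>: "?\<rho> x \<noteq> 0" if "x \<in> D ?r" for x
      using IH sub_compl(2)[of ?r] that F_nz_D[OF step.hyps, of ?r x] by auto
    have c: "ct (\<nu> ?T) (D ?r) ?\<rho> z \<noteq> 0" if "z \<notin> D ?r" for z
      by (rule ct_nonzero[OF fT compact_D connected_D c\<rho> n\<rho> that])
    have "continuous_on (- D ?r) (F ?T)" using F_cont[OF o(4)] cT by simp
    then have 1: "continuous_on (- D ?r) (\<Phi> S)" unfolding Phi_rec[OF psub]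
      by (intro continuous_intros ct_continuous_on[OF fat_finite_borel[OF fT] compact_D c\<rho>]) auto
    have 2: "\<Phi> S z \<noteq> 0" if "z \<notin> D ?r" for z
      unfolding Phi_rec[OF psub] using c[OF that] F_nz[OF o(4)] that cT by simp
    obtain L where L: "L \<noteq> 0" "((\<lambda>z. z ^ wt ?T * F ?T z) \<longlongrightarrow> L) at_top"
      using F_grows[OF o(4)] unfolding grows_def by blast
    have w: "wt (insert (Suc m) S) = Suc (wt ?T)"
    proof -
      have "Suc m \<notin> S" using step.hyps by auto
      moreover have "Suc (card S) \<le> Suc m" using psubset_card_mono[OF _ psub] by simp
      ultimately show ?thesis using o fin[OF step.hyps] by (simp add: wt_insert)
    qed
    have "((\<lambda>z. (z ^ wt ?T * F ?T z) * (z * ct (\<nu> ?T) (D ?r) ?\<rho> z)) \<longlongrightarrow> L * (LINT x:D ?r|\<nu> ?T. ?\<rho> x)) at_top"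
      by (intro tendsto_mult L ct_asymp[OF finite_borelD[OF fat_finite_borel[OF fT]] compact_D c\<rho>])
    then have "((\<lambda>z. z ^ wt (insert (Suc m) S) * \<Phi> S z) \<longlongrightarrow> L * (LINT x:D ?r|\<nu> ?T. ?\<rho> x)) at_top"
      unfolding w Phi_rec[OF psub] by (simp add: mult_ac)
    moreover have "(LINT x:D ?r|\<nu> ?T. ?\<rho> x) \<noteq> 0"
      by (rule set_integral_nonzero_fat[OF fT compact_D connected_D c\<rho> n\<rho>])
    ultimately have "grows (insert (Suc m) S) (\<Phi> S)" unfolding grows_def using L(1) by (metis mult_eq_0_iff)
    with 1 2 show ?thesis by blast
  qed
qed

lemmas Phi_cont = Phi_basic[THEN conjunct1]
lemmas Phi_nz = Phi_basic[THEN conjunct2, THEN conjunct1, rule_format]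
lemmas Phi_grows = Phi_basic[THEN conjunct2, THEN conjunct2]

lemma Phi_cont_D: "K \<subseteq> {..m} \<Longrightarrow> card K = i \<or> Suc (Suc (card K)) = i \<Longrightarrow> continuous_on (D i) (\<Phi> K)"
  using Phi_cont[of K] sub_compl by (metis continuous_on_subset)

lemma Phi_nz_D: "K \<subseteq> {..m} \<Longrightarrow> card K = i \<or> Suc (Suc (card K)) = i \<Longrightarrow> x \<in> D i \<Longrightarrow> \<Phi> K x \<noteq> 0"
  using Phi_nz[of K] sub_compl by (metis ComplD subsetD)

lemma nu_finite_borel: "K \<subseteq> {..m} \<Longrightarrow> K \<noteq> {} \<Longrightarrow> finite_borel (\<nu> K)"
  using nu_fat fat_finite_borel by blast

text \<open>For the base label the general exchange relation loses its slope, and for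
  \<open>card S < i\<close> also its constant.\<close>

lemma F_exch_base:
  assumes "S \<subseteq> {..m}" "i \<le> m" "i \<notin> S" "i \<noteq> mex S"
  shows "\<exists>c. (\<forall>z. z \<notin> D (Suc (card S)) \<longrightarrow> F (insert i S) z / F (insert (mex S) S) z =
      c + ct (\<nu> (insert (mex S) S)) (D (Suc (card S))) (\<lambda>x. F S x * F (insert i (insert (mex S) S)) x) z) \<and>
    (card S < i \<longrightarrow> c = 0)"
proof -
  note o = mex_props[OF proper[OF assms(1-3)]]
  let ?r = "Suc (card S)" and ?o = "mex S"
  obtain a c where e: "\<And>z. z \<notin> D ?r \<Longrightarrow> F (insert i S) z / F (insert ?o S) z =
      a * z + c + sg ?o i * ct (\<nu> (insert ?o S)) (D ?r) (\<lambda>x. F S x * F (insert ?o (insert i S)) x) z"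
    using F_exch[OF assms(1) o(2) assms(2) o(1) assms(3)] assms(4) unfolding exch_def by metis
  have iS: "insert i S \<subseteq> {..m}" "insert ?o (insert i S) \<subseteq> {..m}" using assms o by auto
  have ci: "card (insert ?o (insert i S)) = Suc ?r"
    using assms o fin[OF assms(1)] by simp
  have fb: "finite_borel (\<nu> (insert ?o S))" by (rule nu_finite_borel[OF o(4)]) simp
  have cont: "continuous_on (D ?r) (\<lambda>x. F S x * F (insert ?o (insert i S)) x)"
    by (intro continuous_intros F_cont_D assms(1) iS) (use ci in auto)
  note rc = ratio_coefficients[OF fin[OF assms(1)] o(1) assms(3) compact_D F_grows[OF o(4)] F_grows[OF iS(1)] fb cont e]
  have "a = 0" using rc(1) o(3) by auto
  moreover have "sg ?o i = 1" using mex_le[OF assms(3)] assms(4) by (simp add: sg_def)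
  ultimately show ?thesis
    using e rc(2) o(3) by (intro exI[of _ c]) (simp add: insert_commute)
qed

text \<open>Passes from the base label, for which the formula is the definition of
  \<open>\<Phi>\<close>, to all labels. Exchange relation and three-term relation come out of the
  same computation. The clause on the vanishing of \<open>b\<close> belongs to the induction because
  it delivers the hypothesis \<open>c * b' = 0\<close> for the next smaller set.\<close>

lemma Phi_exchange:
  assumes "S \<subseteq> {..m}"
  shows "\<forall>i. i \<le> m \<longrightarrow> i \<notin> S \<longrightarrow>
    (\<exists>b. (\<forall>z. z \<notin> D (Suc (card S)) \<longrightarrow> \<Phi> S z / F (insert i S) z =
        b + ct (\<nu> (insert i S)) (D (Suc (card S))) (\<lambda>x. F S x * \<Phi> (insert i S) x) z) \<and> (i \<le> card S \<longrightarrow> b = 0)) \<and>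
    (i \<noteq> mex S \<longrightarrow> (\<forall>z. z \<notin> D (Suc (card S)) \<longrightarrow> z \<notin> D (Suc (Suc (card S))) \<longrightarrow>
        F (insert (mex S) S) z * \<Phi> (insert i S) z - F (insert i S) z * \<Phi> (insert (mex S) S) z
          + \<Phi> S z * F (insert i (insert (mex S) S)) z = 0))"
  using assms
proof (induction rule: downward_induct)
  case (step S)
  show ?case
  proof (intro allI impI)
    fix i assume i: "i \<le> m" "i \<notin> S"
    have psub: "S \<subset> {..m}" by (rule proper[OF step.hyps i])
    note o = mex_props[OF psub]
    let ?r = "Suc (card S)" and ?o = "mex S"
    let ?iS = "insert i S" and ?oS = "insert (mex S) S" and ?ioS = "insert i (insert (mex S) S)"
    have sub: "?iS \<subseteq> {..m}" "?oS \<subseteq> {..m}" "?ioS \<subseteq> {..m}" using i o step.hyps by auto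
    have cards: "card ?iS = ?r" "card ?oS = ?r" using card_ins step.hyps i o by auto
    have rec: "\<Phi> S z / F ?oS z = ct (\<nu> ?oS) (D ?r) (\<lambda>x. F S x * \<Phi> ?oS x) z" if "z \<notin> D ?r" for z
      using F_nz[OF sub(2)] that cards unfolding Phi_rec[OF psub] by simp
    show "(\<exists>b. (\<forall>z. z \<notin> D ?r \<longrightarrow> \<Phi> S z / F ?iS z =
        b + ct (\<nu> ?iS) (D ?r) (\<lambda>x. F S x * \<Phi> ?iS x) z) \<and> (i \<le> card S \<longrightarrow> b = 0)) \<and>
      (i \<noteq> ?o \<longrightarrow> (\<forall>z. z \<notin> D ?r \<longrightarrow> z \<notin> D (Suc ?r) \<longrightarrow>
        F ?oS z * \<Phi> ?iS z - F ?iS z * \<Phi> ?oS z + \<Phi> S z * F ?ioS z = 0))"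
    proof (cases "i = ?o")
      case True
      then show ?thesis using rec by (auto intro!: exI[of _ 0])
    next
      case False
      have card2: "card ?ioS = Suc ?r" using False i o fin[OF step.hyps] by simp
      obtain c where c: "\<And>z. z \<notin> D ?r \<Longrightarrow> F ?iS z / F ?oS z = c + ct (\<nu> ?oS) (D ?r) (\<lambda>x. F S x * F ?ioS x) z"
        "card S < i \<Longrightarrow> c = 0"
        using F_exch_base[OF step.hyps i False] by blast
      obtain a b where h2: "\<And>z. z \<notin> D ?r \<Longrightarrow> F ?oS z / F ?iS z = a * z + b + sg i ?o * ct (\<nu> ?iS) (D ?r) (\<lambda>x. F S x * F ?ioS x) z"
        using F_exch[OF step.hyps i(1) o(2) i(2) o(1) False] unfolding exch_def by metis
      have sgo: "sg i ?o = - 1" using mex_le[OF i(2)] False by (simp add: sg_def)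
      have h2': "F ?oS z / F ?iS z = a * z + b - ct (\<nu> ?iS) (D ?r) (\<lambda>x. F S x * F ?ioS x) z" if "z \<notin> D ?r" for z
        using h2[OF that] unfolding sgo by simp
      have io: "i \<notin> ?oS" "?o \<notin> ?iS" using i o False by auto
      obtain b' where b': "\<And>z. z \<notin> D (Suc ?r) \<Longrightarrow> \<Phi> ?oS z / F ?ioS z = b' + ct (\<nu> ?ioS) (D (Suc ?r)) (\<lambda>x. F ?oS x * \<Phi> ?ioS x) z"
        "i \<le> ?r \<Longrightarrow> b' = 0"
        using step.IH[OF o(2,1), THEN spec[of _ i], THEN mp, OF i(1), THEN mp, OF io(1), THEN conjunct1, unfolded cards]
        by blast
      obtain b2 where b2: "\<And>z. z \<notin> D (Suc ?r) \<Longrightarrow> \<Phi> ?iS z / F ?ioS z = b2 + ct (\<nu> ?ioS) (D (Suc ?r)) (\<lambda>x. F ?iS x * \<Phi> ?ioS x) z"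
        "?o \<le> ?r \<Longrightarrow> b2 = 0"
        using step.IH[OF i, THEN spec[of _ ?o], THEN mp, OF o(2), THEN mp, OF io(2), THEN conjunct1,
            unfolded cards insert_commute[of ?o i S]]
        by blast
      have h5: "\<Phi> ?iS z / F ?ioS z = ct (\<nu> ?ioS) (D (Suc ?r)) (\<lambda>x. F ?iS x * \<Phi> ?ioS x) z" if "z \<notin> D (Suc ?r)" for z
        using b2 that o(3) by simp
      \<comment> \<open>For \<open>card S < i\<close> the old constant vanishes; otherwise
        \<open>i \<le> card S\<close>, which is below the cardinality of the larger set, and there
        the induction hypothesis gives \<open>b' = 0\<close>.\<close>
      have cb: "c * b' = 0" using c(2) b'(2) by (cases "card S < i") auto
      note main = exchange_small_base[OF compact_D compact_D disjoint
        nu_finite_borel[OF sub(2)] nu_finite_borel[OF sub(1)] nu_finite_borel[OF sub(3)]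
        F_cont_D[OF step.hyps] F_cont[OF sub(2), unfolded cards] F_cont[OF sub(1), unfolded cards]
        F_cont[OF sub(3), unfolded card2] Phi_cont_D[OF sub(3)]
        F_nz[OF sub(2), unfolded cards] F_nz[OF sub(1), unfolded cards] F_nz[OF sub(3), unfolded card2]
        c(1) h2' rec b'(1) h5 cb, simplified card2, simplified]
      obtain b'' where e: "\<And>z. z \<notin> D ?r \<Longrightarrow> \<Phi> S z / F ?iS z = b'' + ct (\<nu> ?iS) (D ?r) (\<lambda>x. F S x * \<Phi> ?iS x) z"
        using main(1) by blast
      have "b'' = 0" if "i \<le> card S"
      proof -
        have q: "Suc m \<notin> S" "card S < Suc m" using step.hyps psubset_card_mono[OF _ psub] by auto
        have cont: "continuous_on (D ?r) (\<lambda>x. F S x * \<Phi> ?iS x)"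
          by (intro continuous_intros F_cont_D Phi_cont_D step.hyps sub(1)) (use cards in auto)
        have e0: "\<Phi> S z / F ?iS z = 0 * z + b'' + 1 * ct (\<nu> ?iS) (D ?r) (\<lambda>x. F S x * \<Phi> ?iS x) z" if "z \<notin> D ?r" for z
          using e[OF that] by simp
        show ?thesis
          using ratio_coefficients(2)[OF fin[OF step.hyps] i(2) q(1) compact_D F_grows[OF sub(1)] Phi_grows[OF step.hyps]
            nu_finite_borel[OF sub(1)] cont e0 that q(2)] by simp
      qed
      then show ?thesis using e main(2) by blast
    qed
  qed
qed

end

context label_extension begin

lemma Phi_exch:
  assumes "S \<subseteq> {..m}" "i \<le> m" "i \<notin> S"
  shows "\<exists>b. \<forall>z. z \<notin> D (Suc (card S)) \<longrightarrow> \<Phi> S z / F (insert i S) z =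
        b + ct (\<nu> (insert i S)) (D (Suc (card S))) (\<lambda>x. F S x * \<Phi> (insert i S) x) z"
  using Phi_exchange[OF assms(1)] assms(2,3) by blast

text \<open>If one label is \<open>mex S\<close> this is already known up to sign; otherwise the two
  relations through \<open>mex S\<close> are combined by \<open>plucker_transfer\<close>.\<close>

lemma Phi_plucker:
  assumes S: "S \<subseteq> {..m}" and ij: "i \<le> m" "i \<notin> S" "j \<le> m" "j \<notin> S" "i \<noteq> j" and z: "\<And>k. z \<notin> D k"
  shows "F (insert i S) z * \<Phi> (insert j S) z - F (insert j S) z * \<Phi> (insert i S) z
      + sg i j * (\<Phi> S z * F (insert i (insert j S)) z) = 0"
proof -
  note o = mex_props[OF proper[OF S ij(1,2)]]
  have base: "F (insert (mex S) S) z * \<Phi> (insert k S) z - F (insert k S) z * \<Phi> (insert (mex S) S) z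
          + \<Phi> S z * F (insert k (insert (mex S) S)) z = 0" if "k \<le> m" "k \<notin> S" "k \<noteq> mex S" for k
    using Phi_exchange[OF S] that z by blast
  have lt: "mex S < k" if "k \<notin> S" "k \<noteq> mex S" for k using mex_le[OF that(1)] that(2) by simp
  consider "i = mex S" | "j = mex S" | "i \<noteq> mex S" "j \<noteq> mex S" by blast
  then show ?thesis
  proof cases
    case 1
    then show ?thesis using base[OF ij(3,4)] ij(5) lt[OF ij(4)] by (simp add: sg_def insert_commute)
  next
    case 2
    then have "sg i j = - 1" using lt[OF ij(2)] ij(5) by (simp add: sg_def)
    then show ?thesis using base[OF ij(1,2)] ij(5) 2 by simp
  next
    case 3
    have pl: "plucker F S (mex S) i j z"
      by (rule F_plucker[OF S o(2) ij(1,3) o(1) ij(2,4)]) (use 3 ij(5) z in auto)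
    then have pl': "F (insert (mex S) S) z * F (insert i (insert j S)) z * sg i j
       - F (insert i S) z * F (insert j (insert (mex S) S)) z + F (insert j S) z * F (insert i (insert (mex S) S)) z = 0"
      using lt[OF ij(2) 3(1)] lt[OF ij(4) 3(2)] unfolding plucker_def by (simp add: sg_def insert_commute)
    show ?thesis
      by (rule plucker_transfer[OF base[OF ij(1,2) 3(1)] base[OF ij(3,4) 3(2)] pl' F_nz[OF o(4) z]])
  qed
qed

text \<open>The measure attached to the columns \<open>S\<close> and \<open>Suc m\<close>. By
  definition \<open>\<Phi> S / F (insert (mex S) S)\<close> is a Cauchy transform, and
  \<open>\<mu> S\<close> is a measure of its reciprocal.\<close>

definition \<mu> :: "nat set \<Rightarrow> real measure" where
  "\<mu> S = (SOME N. fat N (D (Suc (card S))) \<and> (\<exists>a b. \<forall>z. z \<notin> D (Suc (card S)) \<longrightarrow>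
      F (insert (mex S) S) z / \<Phi> S z = a * z + b - ct N (D (Suc (card S))) (\<lambda>x. F S x * \<Phi> (insert (mex S) S) x) z))"

lemma mu:
  assumes "S \<subset> {..m}"
  shows "fat (\<mu> S) (D (Suc (card S)))"
    and "\<exists>a b. \<forall>z. z \<notin> D (Suc (card S)) \<longrightarrow>
      F (insert (mex S) S) z / \<Phi> S z = a * z + b - ct (\<mu> S) (D (Suc (card S))) (\<lambda>x. F S x * \<Phi> (insert (mex S) S) x) z"
proof -
  have S: "S \<subseteq> {..m}" using assms by auto
  note o = mex_props[OF assms]
  let ?r = "Suc (card S)" and ?T = "insert (mex S) S"
  have cT: "card ?T = ?r" by (rule card_ins[OF S o(1)])
  obtain p q where pq: "D ?r = {p..q}" using interval by blast
  have cont: "continuous_on (D ?r) (\<lambda>x. F S x * \<Phi> ?T x)"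
    by (intro continuous_intros F_cont_D Phi_cont_D S o(4)) (use cT in auto)
  have nz: "F S x * \<Phi> ?T x \<noteq> 0" if "x \<in> D ?r" for x
    using F_nz_D[OF S _ that] Phi_nz_D[OF o(4) _ that] cT by simp
  obtain N a b where N: "fat N (D ?r)"
    "\<And>z. z \<notin> D ?r \<Longrightarrow> 1 / ct (\<nu> ?T) (D ?r) (\<lambda>x. F S x * \<Phi> ?T x) z = a * z + b - ct N (D ?r) (\<lambda>x. F S x * \<Phi> ?T x) z"
    using reciprocal_ct[OF nu_fat[OF o(4), unfolded cT] pq cont nz] by auto
  have "F ?T z / \<Phi> S z = a * z + b - ct N (D ?r) (\<lambda>x. F S x * \<Phi> ?T x) z" if "z \<notin> D ?r" for z
    using N(2)[OF that] F_nz[OF o(4), unfolded cT, OF that] unfolding Phi_rec[OF assms] by simp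
  with N(1) have "\<exists>N. fat N (D ?r) \<and> (\<exists>a b. \<forall>z. z \<notin> D ?r \<longrightarrow>
      F ?T z / \<Phi> S z = a * z + b - ct N (D ?r) (\<lambda>x. F S x * \<Phi> ?T x) z)" by blast
  from someI_ex[OF this] show "fat (\<mu> S) (D ?r)"
    and "\<exists>a b. \<forall>z. z \<notin> D ?r \<longrightarrow>
      F ?T z / \<Phi> S z = a * z + b - ct (\<mu> S) (D ?r) (\<lambda>x. F S x * \<Phi> ?T x) z"
    unfolding \<mu>_def by auto
qed

lemma mu_finite_borel: "S \<subset> {..m} \<Longrightarrow> finite_borel (\<mu> S)"
  using mu(1) fat_finite_borel by blast

text \<open>The two kinds of relation depend on each other: the ratio of two new functions at
  \<open>S\<close> uses the ratio of an old to a new one at a larger set, and the ratio of an old to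
  a new one at \<open>S\<close> uses the ratio of two new ones over the base label.\<close>

lemma new_exchanges:
  assumes "S \<subseteq> {..m}"
  shows "(\<forall>l. l \<le> m \<longrightarrow> l \<notin> S \<longrightarrow> (\<exists>a b. \<forall>z. z \<notin> D (Suc (card S)) \<longrightarrow>
        F (insert l S) z / \<Phi> S z = a * z + b - ct (\<mu> S) (D (Suc (card S))) (\<lambda>x. F S x * \<Phi> (insert l S) x) z)) \<and>
     (\<forall>i l. i \<le> m \<longrightarrow> l \<le> m \<longrightarrow> i \<notin> S \<longrightarrow> l \<notin> S \<longrightarrow> i \<noteq> l \<longrightarrow> (\<exists>a b. \<forall>z. z \<notin> D (Suc (Suc (card S))) \<longrightarrow>
        \<Phi> (insert l S) z / \<Phi> (insert i S) z =
        a * z + b + sg i l * ct (\<mu> (insert i S)) (D (Suc (Suc (card S)))) (\<lambda>x. \<Phi> S x * \<Phi> (insert l (insert i S)) x) z))"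
  using assms
proof (induction rule: downward_induct)
  case (step S)
  let ?r = "Suc (card S)"
  \<comment> \<open>All coefficients are kept explicit, since the case of an old numerator needs the
    exact additive constant; there it is used with \<open>al = 0\<close> and
    \<open>b3 = 0\<close>.\<close>
  have B: "\<Phi> (insert l S) z / \<Phi> (insert i S) z =
      (al - sg i l * b3 * a') * z + (cl - sg i l * a' * (LINT x:D ?r|\<nu> (insert i S). F S x * \<Phi> (insert i S) x) - sg i l * b3 * b')
      + sg i l * ct (\<mu> (insert i S)) (D (Suc ?r)) (\<lambda>x. \<Phi> S x * \<Phi> (insert l (insert i S)) x) z"
    if i: "i \<le> m" "i \<notin> S" and l: "l \<le> m" "l \<notin> S" and il: "i \<noteq> l"
      and h1: "\<And>z. z \<notin> D ?r \<Longrightarrow> F (insert l S) z / F (insert i S) z =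
        al * z + cl + sg i l * ct (\<nu> (insert i S)) (D ?r) (\<lambda>x. F S x * F (insert l (insert i S)) x) z"
      and h2: "\<And>z. z \<notin> D ?r \<Longrightarrow> \<Phi> S z / F (insert i S) z = b3 + ct (\<nu> (insert i S)) (D ?r) (\<lambda>x. F S x * \<Phi> (insert i S) x) z"
      and h4: "\<And>z. z \<notin> D (Suc ?r) \<Longrightarrow> F (insert l (insert i S)) z / \<Phi> (insert i S) z =
        a' * z + b' - ct (\<mu> (insert i S)) (D (Suc ?r)) (\<lambda>x. F (insert i S) x * \<Phi> (insert l (insert i S)) x) z"
      and z: "z \<notin> D (Suc ?r)"
    for i l al cl b3 a' b' z
  proof -
    let ?iS = "insert i S" and ?lS = "insert l S" and ?ilS = "insert l (insert i S)"
    have sub: "?iS \<subseteq> {..m}" "?lS \<subseteq> {..m}" "?ilS \<subseteq> {..m}" using i l step.hyps by auto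
    have iS: "?iS \<subset> {..m}" using proper[OF sub(1) l(1)] l(2) il by simp
    have c: "card ?iS = ?r" "card ?lS = ?r" "card ?ilS = Suc ?r"
      using i l il fin[OF step.hyps] by auto
    obtain b1 where b1: "\<And>z. z \<notin> D (Suc ?r) \<Longrightarrow> \<Phi> ?iS z / F ?ilS z = b1 + ct (\<nu> ?ilS) (D (Suc ?r)) (\<lambda>x. F ?iS x * \<Phi> ?ilS x) z"
      using Phi_exch[OF sub(1) l(1)] l(2) il unfolding c by blast
    obtain b2 where b2: "\<And>z. z \<notin> D (Suc ?r) \<Longrightarrow> \<Phi> ?lS z / F ?ilS z = b2 + ct (\<nu> ?ilS) (D (Suc ?r)) (\<lambda>x. F ?lS x * \<Phi> ?ilS x) z"
      using Phi_exch[OF sub(2) i(1)] i(2) il unfolding c insert_commute[of i l S] by blast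
    obtain R where R: "\<And>k x. x \<in> D k \<Longrightarrow> x \<le> R" using bounded by blast
    have out: "z \<notin> D k" if "z > R" for z k using R[of z k] that by auto
    have h6: "z \<notin> D ?r \<and> z \<notin> D (Suc ?r) \<and> F ?iS z * \<Phi> ?lS z - F ?lS z * \<Phi> ?iS z + sg i l * (\<Phi> S z * F ?ilS z) = 0"
      if "z > R" for z
      using out[OF that] Phi_plucker[OF step.hyps i l il out[OF that]] by (simp add: insert_commute)
    show ?thesis
      by (rule exchange_new_common[OF compact_D compact_D disjoint
          nu_finite_borel[OF sub(1)] nu_finite_borel[OF sub(3)] mu_finite_borel[OF iS]
          F_cont_D[OF step.hyps] F_cont[OF sub(1), unfolded c] F_cont[OF sub(2), unfolded c] Phi_cont[OF step.hyps]
          F_cont[OF sub(3), unfolded c] Phi_cont[OF sub(1), unfolded c] Phi_cont_D[OF sub(3)]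
          F_nz[OF sub(1), unfolded c] F_nz[OF sub(3), unfolded c] Phi_nz[OF sub(1), unfolded c]
          h1 h2 b1 h4 b2 h6 z]) (auto simp: c)
  qed
  have IHA: "\<exists>a b. \<forall>z. z \<notin> D (Suc ?r) \<longrightarrow>
        F (insert l (insert i S)) z / \<Phi> (insert i S) z = a * z + b - ct (\<mu> (insert i S)) (D (Suc ?r)) (\<lambda>x. F (insert i S) x * \<Phi> (insert l (insert i S)) x) z"
    if "i \<le> m" "i \<notin> S" "l \<le> m" "l \<notin> S" "i \<noteq> l" for i l
    using step.IH[OF that(1,2)] that(3-5) unfolding card_ins[OF step.hyps that(2)] by auto
  show ?case
  proof (intro conjI allI impI)
    fix l assume l: "l \<le> m" "l \<notin> S"
    have psub: "S \<subset> {..m}" by (rule proper[OF step.hyps l])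
    note o = mex_props[OF psub]
    let ?o = "mex S"
    let ?oS = "insert ?o S" and ?lS = "insert l S" and ?olS = "insert l (insert ?o S)"
    show "\<exists>a b. \<forall>z. z \<notin> D ?r \<longrightarrow> F ?lS z / \<Phi> S z = a * z + b - ct (\<mu> S) (D ?r) (\<lambda>x. F S x * \<Phi> ?lS x) z"
    proof (cases "l = ?o")
      case True
      then show ?thesis using mu(2)[OF psub] by simp
    next
      case False
      have sub: "?oS \<subseteq> {..m}" "?lS \<subseteq> {..m}" "?olS \<subseteq> {..m}" using o l step.hyps by auto
      have oS: "?oS \<subset> {..m}" using proper[OF sub(1) l(1)] l(2) False by simp
      have c: "card ?oS = ?r" "card ?lS = ?r" "card ?olS = Suc ?r"
        using o l False fin[OF step.hyps] by auto
      have sg1: "sg ?o l = 1" using mex_le[OF l(2)] False by (simp add: sg_def)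
      obtain cl where cl: "\<And>z. z \<notin> D ?r \<Longrightarrow> F ?lS z / F ?oS z = cl + ct (\<nu> ?oS) (D ?r) (\<lambda>x. F S x * F ?olS x) z"
        using F_exch_base[OF step.hyps l False] by blast
      have h2: "\<Phi> S z / F ?oS z = ct (\<nu> ?oS) (D ?r) (\<lambda>x. F S x * \<Phi> ?oS x) z" if "z \<notin> D ?r" for z
        using F_nz[OF sub(1)] that c unfolding Phi_rec[OF psub] by simp
      obtain \<alpha> \<beta> where h2': "\<And>z. z \<notin> D ?r \<Longrightarrow> F ?oS z / \<Phi> S z = \<alpha> * z + \<beta> - ct (\<mu> S) (D ?r) (\<lambda>x. F S x * \<Phi> ?oS x) z"
        using mu(2)[OF psub] by blast
      obtain a' b' where h3: "\<And>z. z \<notin> D (Suc ?r) \<Longrightarrow> F ?olS z / \<Phi> ?oS z =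
          a' * z + b' - ct (\<mu> ?oS) (D (Suc ?r)) (\<lambda>x. F ?oS x * \<Phi> ?olS x) z"
        using IHA[OF o(2,1) l False[symmetric]] by blast
      have h4: "\<Phi> ?lS z / \<Phi> ?oS z = (cl - a' * (LINT x:D ?r|\<nu> ?oS. F S x * \<Phi> ?oS x)) +
          ct (\<mu> ?oS) (D (Suc ?r)) (\<lambda>x. \<Phi> S x * \<Phi> ?olS x) z" if "z \<notin> D (Suc ?r)" for z
        using B[OF o(2,1) l False[symmetric], of 0 cl 0 a' b' z] cl h2 h3 that unfolding sg1 by simp
      show ?thesis
        by (rule exchange_new_first[OF compact_D compact_D disjoint nu_finite_borel[OF sub(1)]
            mu_finite_borel[OF psub] mu_finite_borel[OF oS]
            F_cont_D[OF step.hyps] F_cont[OF sub(1), unfolded c] Phi_cont[OF sub(1), unfolded c] Phi_cont[OF sub(2), unfolded c]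
            Phi_cont_D[OF sub(3)] F_nz[OF sub(1), unfolded c] Phi_nz[OF step.hyps] Phi_nz[OF sub(1), unfolded c]
            cl h2 h2' h3 h4]) (auto simp: c)
    qed
  next
    fix i l assume i: "i \<le> m" and l: "l \<le> m" and i': "i \<notin> S" and l': "l \<notin> S" and il: "i \<noteq> l"
    obtain al cl where h1: "\<And>z. z \<notin> D ?r \<Longrightarrow> F (insert l S) z / F (insert i S) z =
        al * z + cl + sg i l * ct (\<nu> (insert i S)) (D ?r) (\<lambda>x. F S x * F (insert l (insert i S)) x) z"
      using F_exch[OF step.hyps i l i' l' il] unfolding exch_def insert_commute[of i l S] by blast
    obtain b3 where h2: "\<And>z. z \<notin> D ?r \<Longrightarrow> \<Phi> S z / F (insert i S) z = b3 + ct (\<nu> (insert i S)) (D ?r) (\<lambda>x. F S x * \<Phi> (insert i S) x) z"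
      using Phi_exch[OF step.hyps i i'] by blast
    obtain a' b' where h4: "\<And>z. z \<notin> D (Suc ?r) \<Longrightarrow> F (insert l (insert i S)) z / \<Phi> (insert i S) z =
        a' * z + b' - ct (\<mu> (insert i S)) (D (Suc ?r)) (\<lambda>x. F (insert i S) x * \<Phi> (insert l (insert i S)) x) z"
      using IHA[OF i i' l l' il] by blast
    show "\<exists>a b. \<forall>z. z \<notin> D (Suc ?r) \<longrightarrow> \<Phi> (insert l S) z / \<Phi> (insert i S) z =
        a * z + b + sg i l * ct (\<mu> (insert i S)) (D (Suc ?r)) (\<lambda>x. \<Phi> S x * \<Phi> (insert l (insert i S)) x) z"
      using B[OF i i' l l' il h1 h2 h4] by blast
  qed
qed

definition F' :: "nat set \<Rightarrow> real \<Rightarrow> real" where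
  "F' K = (if Suc m \<in> K then \<Phi> (K - {Suc m}) else F K)"

definition \<nu>' :: "nat set \<Rightarrow> real measure" where
  "\<nu>' K = (if Suc m \<in> K then \<mu> (K - {Suc m}) else \<nu> K)"

lemma F'_old: "K \<subseteq> {..m} \<Longrightarrow> F' K = F K" and nu'_old: "K \<subseteq> {..m} \<Longrightarrow> \<nu>' K = \<nu> K"
  by (auto simp: F'_def \<nu>'_def)

lemma F'_new: "K \<subseteq> {..m} \<Longrightarrow> F' (insert (Suc m) K) = \<Phi> K"
  and nu'_new: "K \<subseteq> {..m} \<Longrightarrow> \<nu>' (insert (Suc m) K) = \<mu> K"
proof -
  assume "K \<subseteq> {..m}"
  then have "insert (Suc m) K - {Suc m} = K" by auto
  then show "F' (insert (Suc m) K) = \<Phi> K" "\<nu>' (insert (Suc m) K) = \<mu> K" by (auto simp: F'_def \<nu>'_def)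
qed

lemma split_label:
  assumes "K \<subseteq> {..Suc m}"
  obtains "K \<subseteq> {..m}" | L where "L \<subseteq> {..m}" "K = insert (Suc m) L"
proof (cases "Suc m \<in> K")
  case True
  show ?thesis by (rule that(2)[of "K - {Suc m}"]) (use assms True in \<open>auto simp: le_Suc_eq\<close>)
next
  case False
  show ?thesis by (rule that(1)) (use assms False in \<open>auto simp: le_Suc_eq\<close>)
qed

lemma card_new: "L \<subseteq> {..m} \<Longrightarrow> card (insert (Suc m) L) = Suc (card L)"
  by (rule card_insert_disjoint[OF fin]) auto

lemma exch_new:
  assumes S: "S \<subseteq> {..Suc m}" and i: "i \<le> Suc m" "i \<notin> S" and l: "l \<le> Suc m" "l \<notin> S" and il: "i \<noteq> l"
  shows "exch F' \<nu>' S i l"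
  using S
proof (cases rule: split_label)
  case 1
  consider "i = Suc m" "l \<le> m" | "l = Suc m" "i \<le> m" | "i \<le> m" "l \<le> m" using i(1) l(1) il by force
  then show ?thesis
  proof cases
    case a: 1
    have sub: "insert l S \<subseteq> {..m}" using 1 a by auto
    have sgl: "sg (Suc m) l = - 1" using a by (simp add: sg_def)
    obtain a' b where "\<And>z. z \<notin> D (Suc (card S)) \<Longrightarrow>
        F (insert l S) z / \<Phi> S z = a' * z + b - ct (\<mu> S) (D (Suc (card S))) (\<lambda>x. F S x * \<Phi> (insert l S) x) z"
      using new_exchanges[OF 1, THEN conjunct1, rule_format, OF a(2) l(2)] by blast
    then show ?thesis unfolding exch_def a(1) F'_old[OF 1] F'_old[OF sub] F'_new[OF 1] F'_new[OF sub] nu'_new[OF 1] sgl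
      by (intro exI[of _ a'] exI[of _ b]) simp
  next
    case a: 2
    have sub: "insert i S \<subseteq> {..m}" using 1 a by auto
    have sgl: "sg i (Suc m) = 1" using a by (simp add: sg_def)
    obtain b where "\<And>z. z \<notin> D (Suc (card S)) \<Longrightarrow> \<Phi> S z / F (insert i S) z =
        b + ct (\<nu> (insert i S)) (D (Suc (card S))) (\<lambda>x. F S x * \<Phi> (insert i S) x) z"
      using Phi_exch[OF 1 a(2) i(2)] by blast
    then show ?thesis unfolding exch_def a(1) insert_commute[of i "Suc m" S]
        F'_old[OF 1] F'_old[OF sub] F'_new[OF 1] F'_new[OF sub] nu'_old[OF sub] sgl
      by (intro exI[of _ 0] exI[of _ b]) simp
  next
    case a: 3
    have sub: "insert i S \<subseteq> {..m}" "insert l S \<subseteq> {..m}" "insert i (insert l S) \<subseteq> {..m}" using 1 a by auto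
    show ?thesis using F_exch[OF 1 a i(2) l(2) il]
      unfolding exch_def F'_old[OF 1] F'_old[OF sub(1)] F'_old[OF sub(2)] F'_old[OF sub(3)] nu'_old[OF sub(1)] .
  qed
next
  case (2 L)
  have il': "i \<le> m" "l \<le> m" "i \<notin> L" "l \<notin> L" using i l 2 by (auto simp: le_Suc_eq)
  have sub: "insert i L \<subseteq> {..m}" "insert l L \<subseteq> {..m}" "insert l (insert i L) \<subseteq> {..m}" using 2 il' by auto
  have com: "insert i (insert (Suc m) L) = insert (Suc m) (insert i L)" "insert l (insert (Suc m) L) = insert (Suc m) (insert l L)"
    "insert i (insert (Suc m) (insert l L)) = insert (Suc m) (insert l (insert i L))" by auto
  have "\<exists>a b. \<forall>z. z \<notin> D (Suc (Suc (card L))) \<longrightarrow> \<Phi> (insert l L) z / \<Phi> (insert i L) z =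
        a * z + b + sg i l * ct (\<mu> (insert i L)) (D (Suc (Suc (card L)))) (\<lambda>x. \<Phi> L x * \<Phi> (insert l (insert i L)) x) z"
    using new_exchanges[OF 2(1), THEN conjunct2, rule_format, OF il' il] .
  then show ?thesis
    unfolding exch_def 2(2) com F'_new[OF sub(1)] F'_new[OF sub(2)] F'_new[OF sub(3)] F'_new[OF 2(1)] nu'_new[OF sub(1)]
      card_new[OF 2(1)] .
qed

text \<open>If \<open>Suc m\<close> is one of the three exchanged labels, the claim is
  \<open>Phi_plucker\<close>; if it belongs to \<open>S\<close>, all members are new and
  \<open>plucker_lift\<close> reduces the claim to mixed relations.\<close>

lemma plucker_new:
  assumes S: "S \<subseteq> {..Suc m}" and i: "i \<le> Suc m" "i \<notin> S" and j: "j \<le> Suc m" "j \<notin> S" and l: "l \<le> Suc m" "l \<notin> S"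
    and d: "i \<noteq> j" "i \<noteq> l" "j \<noteq> l" and z: "\<And>k. z \<notin> D k"
  shows "plucker F' S i j l z"
  using S
proof (cases rule: split_label)
  case 1
  have F2: "F' (insert a S) = F (insert a S)" "F' (insert a (insert b S)) = F (insert a (insert b S))"
    "F' (insert (Suc m) (insert a S)) = \<Phi> (insert a S)" "F' (insert a (insert (Suc m) S)) = \<Phi> (insert a S)"
    if "a \<le> m" "b \<le> m" for a b
    using F'_old[of "insert a S"] F'_old[of "insert a (insert b S)"] F'_new[of "insert a S"] 1 that
    by (auto simp: insert_commute)
  have sgm: "sg (Suc m) a = - 1" "sg a (Suc m) = 1" if "a \<le> m" for a using that by (auto simp: sg_def)
  have sga: "sg a b = - sg b a" if "a \<noteq> b" for a b using that by (auto simp: sg_def)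
  consider "i = Suc m" "j \<le> m" "l \<le> m" | "j = Suc m" "i \<le> m" "l \<le> m" | "l = Suc m" "i \<le> m" "j \<le> m" | "i \<le> m" "j \<le> m" "l \<le> m"
    using i(1) j(1) l(1) d by force
  then show ?thesis
  proof cases
    case a: 1
    then show ?thesis
      using Phi_plucker[OF 1 a(2) j(2) a(3) l(2) d(3) z] F2[of j l] F2[of l j] F'_new[OF 1]
      unfolding plucker_def a(1) by (simp add: sgm algebra_simps)
  next
    case a: 2
    then show ?thesis
      using Phi_plucker[OF 1 a(2) i(2) a(3) l(2) d(2) z] F2[of i l] F2[of l i] F'_new[OF 1]
      unfolding plucker_def a(1) by (simp add: sgm algebra_simps)
  next
    case a: 3
    then show ?thesis
      using Phi_plucker[OF 1 a(2) i(2) a(3) j(2) d(1) z] F2[of i j] F2[of j i] F'_new[OF 1]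
      unfolding plucker_def a(1) by (simp add: sgm algebra_simps)
  next
    case a: 4
    then show ?thesis
      using F_plucker[OF 1 a i(2) j(2) l(2) d z] F2 unfolding plucker_def by simp
  qed
next
  case (2 L)
  have le: "i \<le> m" "j \<le> m" "l \<le> m" "i \<notin> L" "j \<notin> L" "l \<notin> L" using i j l 2 by (auto simp: le_Suc_eq)
  have F1: "F' (insert a (insert (Suc m) L)) = \<Phi> (insert a L)"
    "F' (insert a (insert b (insert (Suc m) L))) = \<Phi> (insert a (insert b L))" if "a \<le> m" "b \<le> m" for a b
    using F'_new[of "insert a L"] F'_new[of "insert a (insert b L)"] 2(1) that by (auto simp: insert_commute)
  have subi: "insert i L \<subseteq> {..m}" "insert j L \<subseteq> {..m}" "insert i (insert j L) \<subseteq> {..m}" using le 2(1) by auto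
  have P1: "F (insert i L) z * \<Phi> (insert j L) z - F (insert j L) z * \<Phi> (insert i L) z
      + sg i j * (\<Phi> L z * F (insert i (insert j L)) z) = 0"
    by (rule Phi_plucker[OF 2(1) le(1,4,2,5) d(1) z])
  have P2: "F (insert i L) z * \<Phi> (insert l L) z - F (insert l L) z * \<Phi> (insert i L) z
      + sg i l * (\<Phi> L z * F (insert i (insert l L)) z) = 0"
    by (rule Phi_plucker[OF 2(1) le(1,4,3,6) d(2) z])
  have P3: "F (insert i (insert j L)) z * \<Phi> (insert i (insert l L)) z - F (insert i (insert l L)) z * \<Phi> (insert i (insert j L)) z
      + sg j l * (\<Phi> (insert i L) z * F (insert i (insert j (insert l L))) z) = 0"
    using Phi_plucker[OF subi(1) le(2) _ le(3) _ d(3) z] le d by (simp add: insert_commute)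
  have P4: "F (insert i (insert j L)) z * \<Phi> (insert j (insert l L)) z - F (insert j (insert l L)) z * \<Phi> (insert i (insert j L)) z
      + sg i l * (\<Phi> (insert j L) z * F (insert i (insert j (insert l L))) z) = 0"
    using Phi_plucker[OF subi(2) le(1) _ le(3) _ d(2) z] le d by (simp add: insert_commute)
  have P5: "F (insert i L) z * F (insert j (insert l L)) z * sg j l - F (insert j L) z * F (insert i (insert l L)) z * sg i l
      + F (insert l L) z * F (insert i (insert j L)) z * sg i j = 0"
    using F_plucker[OF 2(1) le d z] unfolding plucker_def .
  show ?thesis
    unfolding plucker_def 2(2) F1[OF le(1,1)] F1[OF le(2,2)] F1[OF le(3,3)] F1(2)[OF le(2,3)] F1(2)[OF le(1,3)] F1(2)[OF le(1,2)]
    by (rule plucker_lift[OF P1 P2 P3 P4 P5 F_nz[OF subi(1) z] F_nz[OF subi(3) z]])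
qed

lemma extended_family: "minor_family (Suc m) F' \<nu>'"
  unfolding minor_family_def
proof (intro conjI allI impI)
  fix K assume "K \<subseteq> {..Suc m}"
  then have "continuous_on (- D (card K)) (F' K) \<and> (\<forall>z. z \<notin> D (card K) \<longrightarrow> F' K z \<noteq> 0) \<and> grows K (F' K)"
  proof (cases rule: split_label)
    case 1
    then show ?thesis using F_cont F_nz F_grows by (simp add: F'_old)
  next
    case (2 L)
    show ?thesis unfolding 2(2) F'_new[OF 2(1)] card_new[OF 2(1)] by (rule Phi_basic[OF 2(1)])
  qed
  then show "continuous_on (- D (card K)) (F' K)" "grows K (F' K)" "\<And>z. z \<notin> D (card K) \<Longrightarrow> F' K z \<noteq> 0" by blast+
next
  fix K assume K: "K \<subseteq> {..Suc m}" "K \<noteq> {}" "K \<noteq> {..Suc m}"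
  from K(1) show "fat (\<nu>' K) (D (card K))"
  proof (cases rule: split_label)
    case 1
    then show ?thesis using nu_fat K(2) by (simp add: nu'_old)
  next
    case (2 L)
    have "L \<noteq> {..m}" using K(3) 2(2) atMost_Suc by auto
    then have "L \<subset> {..m}" using 2(1) by auto
    from mu(1)[OF this] show ?thesis unfolding 2(2) nu'_new[OF 2(1)] card_new[OF 2(1)] .
  qed
next
  fix S i l assume "S \<subseteq> {..Suc m}" "i \<le> Suc m" "l \<le> Suc m" "i \<notin> S" "l \<notin> S" "i \<noteq> l"
  then show "exch F' \<nu>' S i l" by (intro exch_new)
next
  fix S i j l z
  assume "S \<subseteq> {..Suc m}" "i \<le> Suc m" "j \<le> Suc m" "l \<le> Suc m" "i \<notin> S" "j \<notin> S" "l \<notin> S"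
    "i \<noteq> j" "i \<noteq> l" "j \<noteq> l" "\<forall>k. z \<notin> D k"
  then show "plucker F' S i j l z" by (intro plucker_new) auto
qed

end

section \<open>Construction of the family from given generators\<close>

context chain_intervals begin

lemma minor_familyD:
  assumes "minor_family m F \<nu>"
  shows "K \<subseteq> {..m} \<Longrightarrow> continuous_on (- D (card K)) (F K)"
    and "K \<subseteq> {..m} \<Longrightarrow> z \<notin> D (card K) \<Longrightarrow> F K z \<noteq> 0"
    and "K \<subseteq> {..m} \<Longrightarrow> grows K (F K)"
    and "K \<subseteq> {..m} \<Longrightarrow> K \<noteq> {} \<Longrightarrow> K \<noteq> {..m} \<Longrightarrow> fat (\<nu> K) (D (card K))"
    and "S \<subseteq> {..m} \<Longrightarrow> i \<le> m \<Longrightarrow> l \<le> m \<Longrightarrow> i \<notin> S \<Longrightarrow> l \<notin> S \<Longrightarrow> i \<noteq> l \<Longrightarrow> exch F \<nu> S i l"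
    and "S \<subseteq> {..m} \<Longrightarrow> i \<le> m \<Longrightarrow> j \<le> m \<Longrightarrow> l \<le> m \<Longrightarrow> i \<notin> S \<Longrightarrow> j \<notin> S \<Longrightarrow> l \<notin> S \<Longrightarrow>
       i \<noteq> j \<Longrightarrow> i \<noteq> l \<Longrightarrow> j \<noteq> l \<Longrightarrow> (\<And>k. z \<notin> D k) \<Longrightarrow> plucker F S i j l z"
  using assms unfolding minor_family_def by (simp_all del: subset_eq)

text \<open>The recursion for \<open>\<Phi>\<close> runs through growing sets, so it is organised by
  a counter for the labels still missing; at 0 the set is full and the value is 1.\<close>

primrec add_label :: "(nat set \<Rightarrow> real \<Rightarrow> real) \<Rightarrow> (nat set \<Rightarrow> real measure) \<Rightarrow> nat \<Rightarrow> nat set \<Rightarrow> real \<Rightarrow> real" where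
  "add_label F \<nu> 0 S = (\<lambda>_. 1)"
| "add_label F \<nu> (Suc k) S = (\<lambda>z. F (insert (mex S) S) z *
      ct (\<nu> (insert (mex S) S)) (D (Suc (card S))) (\<lambda>x. F S x * add_label F \<nu> k (insert (mex S) S) x) z)"

text \<open>The clauses beyond \<open>minor_family\<close> pin the family down to the given
  generators: minors on an initial segment of columns are 1, and \<open>F {p}\<close> is the
  iterated Cauchy transform over the generators \<open>1, \<dots>, p\<close>.\<close>

definition initial_family :: "(nat \<Rightarrow> real measure) \<Rightarrow> nat \<Rightarrow> (nat set \<Rightarrow> real \<Rightarrow> real) \<Rightarrow> (nat set \<Rightarrow> real measure) \<Rightarrow> bool" where
  "initial_family M m F \<nu> \<longleftrightarrow> minor_family m F \<nu> \<and> (\<forall>i\<le>Suc m. F {..<i} = (\<lambda>_. 1)) \<and>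
     (\<forall>i\<in>{1..m}. \<nu> {..<i} = M i) \<and>
     (\<forall>p\<le>m. \<forall>i<p. \<forall>z. z \<notin> D (Suc i) \<longrightarrow>
        F (insert p {..<i}) z = ct (M (Suc i)) (D (Suc i)) (F (insert p {..<Suc i})) z)"

lemma initial_family_step:
  assumes fam: "initial_family M m F \<nu>" and M: "fat (M (Suc m)) (D (Suc m))"
  shows "\<exists>F \<nu>. initial_family M (Suc m) F \<nu>"
proof -
  \<comment> \<open>Only the full set receives a new measure. No exchange relation with two distinct
    missing labels has the full set as its denominator, so the old relations survive.\<close>
  define \<nu>1 where "\<nu>1 = \<nu>({..m} := M (Suc m))"
  define \<Phi> where "\<Phi> = (\<lambda>S. add_label F \<nu>1 (Suc m - card S) S)"
  have mf: "minor_family m F \<nu>" using fam by (simp add: initial_family_def)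
  have ext: "label_extension D m F \<nu>1 \<Phi>"
  proof (unfold_locales, goal_cases)
    case (4 K)
    then show ?case using minor_familyD(4)[OF mf] M unfolding \<nu>1_def by (cases "K = {..m}") auto
  next
    case (5 S i l)
    have "insert i S \<noteq> {..m}" using 5 by auto
    moreover have "exch F \<nu> S i l" using 5 by (intro minor_familyD(5)[OF mf])
    ultimately show ?case unfolding exch_def \<nu>1_def by simp
  next
    case (6 S i j l z)
    then show ?case by (intro minor_familyD(6)[OF mf]) auto
  next
    case 7
    show ?case unfolding \<Phi>_def by (simp add: fun_eq_iff)
  next
    case (8 S)
    have fin: "finite S" using 8 finite_subset by blast
    have "card S < Suc m" using psubset_card_mono[OF _ 8] by simp
    moreover obtain i where "i \<notin> S" using 8 by auto
    then have "mex S \<notin> S" by (rule mex_notin)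
    ultimately show ?case using fin unfolding \<Phi>_def by (simp add: Suc_diff_le)
  qed (use minor_familyD[OF mf] in auto)
  interpret label_extension D m F \<nu>1 \<Phi> by (rule ext)
  have ini: "F {..<i} = (\<lambda>_. 1)" if "i \<le> Suc m" for i using fam that by (simp add: initial_family_def)
  have "initial_family M (Suc m) F' \<nu>'"
    unfolding initial_family_def
  proof (intro conjI allI impI ballI)
    show "minor_family (Suc m) F' \<nu>'" by (rule extended_family)
    show "F' {..<i} = (\<lambda>_. 1)" if "i \<le> Suc (Suc m)" for i
    proof (cases "i = Suc (Suc m)")
      case True
      have "{..<Suc (Suc m)} = insert (Suc m) {..m}" by auto
      then show ?thesis using F'_new[of "{..m}"] Phi_top True by simp
    next
      case False
      then have "{..<i} \<subseteq> {..m}" using that by auto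
      then show ?thesis using F'_old ini[of i] that False by simp
    qed
    show "\<nu>' {..<i} = M i" if "i \<in> {1..Suc m}" for i
    proof -
      have "{..<i} \<subseteq> {..m}" using that by auto
      then have e: "\<nu>' {..<i} = \<nu>1 {..<i}" by (rule nu'_old)
      show ?thesis
      proof (cases "i = Suc m")
        case True
        have "\<nu>1 {..<i} = M i" unfolding \<nu>1_def True lessThan_Suc_atMost by simp
        with e show ?thesis by simp
      next
        case False
        then have "{..<i} \<noteq> {..m}" by (simp add: lessThan_Suc_atMost[symmetric])
        then have "\<nu>1 {..<i} = M i" using fam that False unfolding \<nu>1_def initial_family_def by simp
        with e show ?thesis by simp
      qed
    qed
    fix p i z assume p: "p \<le> Suc m" and i: "i < p" and z: "z \<notin> D (Suc i)"
    show "F' (insert p {..<i}) z = ct (M (Suc i)) (D (Suc i)) (F' (insert p {..<Suc i})) z"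
    proof (cases "p = Suc m")
      case True
      have im: "i \<le> m" using i True by simp
      then have sub': "{..<i} \<subseteq> {..m}" "{..<Suc i} \<subseteq> {..m}" "i \<in> {..m}" "i \<notin> {..<i}" by auto
      then have sub: "{..<i} \<subset> {..m}" "{..<i} \<subseteq> {..m}" "{..<Suc i} \<subseteq> {..m}" by blast+
      have e1: "\<nu>1 {..<Suc i} = M (Suc i)"
      proof -
        have "\<nu>' {..<Suc i} = \<nu>1 {..<Suc i}" by (rule nu'_old[OF sub(3)])
        show ?thesis
        proof (cases "i = m")
          case True
          show ?thesis unfolding True lessThan_Suc_atMost by (simp add: \<nu>1_def)
        next
          case False
          then have "{..<Suc i} \<noteq> {..m}" by (simp add: lessThan_Suc_atMost)
          then have "\<nu>1 {..<Suc i} = \<nu> {..<Suc i}" unfolding \<nu>1_def by simp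
          also have "\<dots> = M (Suc i)" using fam im False unfolding initial_family_def by simp
          finally show ?thesis .
        qed
      qed
      have ins: "insert i {..<i} = {..<Suc i}" by auto
      have F1: "F {..<i} = (\<lambda>_. 1)" "F {..<Suc i} = (\<lambda>_. 1)" using ini i True by auto
      show ?thesis unfolding True F'_new[OF sub(2)] F'_new[OF sub(3)] Phi_rec[OF sub(1)] mex_lessThan ins F1 e1
        by simp
    next
      case False
      then have "insert p {..<i} \<subseteq> {..m}" "insert p {..<Suc i} \<subseteq> {..m}" using p i by auto
      then show ?thesis using fam p i z False by (simp add: F'_old initial_family_def)
    qed
  qed
  then show ?thesis by blast
qed

lemma initial_family_exists:
  assumes "\<And>i. i \<in> {1..m} \<Longrightarrow> fat (M i) (D i)"
  shows "\<exists>F \<nu>. initial_family M m F \<nu>"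
  using assms
proof (induction m)
  case 0
  have K0: "K = {} \<or> K = {0}" if "K \<subseteq> {..0::nat}" for K using that by auto
  have "grows K (\<lambda>_. 1)" if "K \<subseteq> {..0}" for K
  proof -
    have "wt K = 0" using K0[OF that] by (auto simp: wt_def)
    then show ?thesis unfolding grows_def by (intro exI[of _ 1]) simp
  qed
  then have "minor_family 0 (\<lambda>_ _. 1) (\<lambda>_. M 0)"
    unfolding minor_family_def using K0 by auto
  then show ?case unfolding initial_family_def by (intro exI[of _ "\<lambda>_ _. 1"] exI[of _ "\<lambda>_. M 0"]) auto
next
  case (Suc m)
  then obtain F \<nu> where "initial_family M m F \<nu>" by auto
  then show ?case by (rule initial_family_step) (use Suc.prems in auto)
qed

end

section \<open>The AT property\<close>

lemma not_orthogonal: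
  fixes f :: "real \<Rightarrow> real"
  assumes M: "fat M D" and D: "compact D" "is_interval D" and f: "continuous_on D f"
    and fin: "finite {x \<in> D. f x = 0}" and k: "card {x \<in> D. f x = 0} < k"
  shows "\<exists>h. degree h < k \<and> 0 < (LINT x:D|M. poly h x * f x)"
proof -
  obtain C s where C: "C \<subseteq> {x \<in> D. f x = 0}" and s: "s \<in> {1, - 1::real}"
    and nn: "\<And>t. t \<in> D \<Longrightarrow> 0 \<le> s * f t * (\<Prod>c\<in>C. t - c)"
    using sign_change_set[OF D(2) f fin] by blast
  have finC: "finite C" using C fin finite_subset by blast
  define h where "h = smult s (\<Prod>c\<in>C. [:- c, 1:])"
  have hx: "poly h x = s * (\<Prod>c\<in>C. x - c)" for x unfolding h_def by (simp add: poly_prod)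
  have "degree h \<le> card C"
    unfolding h_def using degree_prod_sum_le[OF finC, of "\<lambda>c. [:- c, 1:]"]
    by (intro order_trans[OF degree_smult_le]) (simp add: comp_def)
  also have "\<dots> < k" using card_mono[OF fin C] k by simp
  finally have deg: "degree h < k" .
  have "{x \<in> D. poly h x * f x = 0} \<subseteq> {x \<in> D. f x = 0}"
    using s C finC by (auto simp: hx)
  then have "finite {x \<in> D. poly h x * f x = 0}" using fin finite_subset by blast
  then have "0 < (LINT x:D|M. poly h x * f x)"
    by (intro set_integral_pos_fat[OF M D(1)]) (use nn in \<open>auto intro!: continuous_intros f simp: hx mult_ac\<close>)
  with deg show ?thesis by blast
qed

context chain_intervals begin

text \<open>The maximal degree is attained at a label at most \<open>c\<close> whenever possible. So
  if the chosen label exceeds \<open>c\<close>, all labels up to \<open>c\<close> have strictly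
  smaller degree, which makes room for an affine factor.\<close>

lemma best_label:
  fixes n :: "nat \<Rightarrow> nat"
  assumes "finite J" "J \<noteq> {}"
  obtains i where "i \<in> J" "\<And>l. l \<in> J \<Longrightarrow> n l \<le> n i" "\<And>l. l \<in> J \<Longrightarrow> l \<le> c \<Longrightarrow> c < i \<Longrightarrow> n l < n i"
proof -
  define X where "X = Max (n ` J)"
  have X: "n l \<le> X" if "l \<in> J" for l unfolding X_def using that assms by simp
  have "X \<in> n ` J" unfolding X_def using assms by (intro Max_in) auto
  then obtain i00 where i00: "i00 \<in> J" "n i00 = X" by auto
  show ?thesis
  proof (cases "\<exists>i\<in>J. i \<le> c \<and> n i = X")
    case True
    then obtain i where "i \<in> J" "i \<le> c" "n i = X" by auto
    then show ?thesis using X by (intro that[of i]) auto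
  next
    case False
    then show ?thesis using i00 X by (intro that[of i00]) (force simp: less_le)+
  qed
qed

text \<open>Suppose there are at least \<open>?N\<close> zeros. After division by the denominator
  function, the combination at these zeros is summed against \<open>h / W'\<close>, which is a sum
  of residues. The polynomial part contributes nothing, the Cauchy transforms turn into an integral
  of \<open>h\<close> against a combination \<open>G\<close> with one label fewer. By induction
  \<open>G\<close> has so few zeros that some admissible \<open>h\<close> makes the integral
  positive.\<close>

theorem at_system_zero_bound:
  assumes fam: "minor_family m F \<nu>" and S: "S \<subset> {..m}"
    and deg: "\<And>l. l \<in> {..m} - S \<Longrightarrow> p l = 0 \<or> degree (p l) < n l"
    and nz: "\<exists>l\<in>{..m} - S. p l \<noteq> 0"
    and Z: "finite Z" "Z \<inter> D (Suc (card S)) = {}"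
      "\<And>z. z \<in> Z \<Longrightarrow> (\<Sum>l\<in>{..m} - S. poly (p l) z * F (insert l S) z) = 0"
  shows "card Z < (\<Sum>l\<in>{..m} - S. n l)"
  using S deg nz Z
proof (induction "card ({..m} - S)" arbitrary: S p Z rule: less_induct)
  case less
  let ?J = "{..m} - S" and ?r = "Suc (card S)" and ?N = "\<Sum>l\<in>{..m} - S. n l"
  have S: "S \<subseteq> {..m}" "finite S" using less.prems(1) finite_subset by auto
  obtain b0 where b0: "b0 \<in> ?J" "\<And>l. l \<in> ?J \<Longrightarrow> n l \<le> n b0" "\<And>l. l \<in> ?J \<Longrightarrow> l \<le> card S \<Longrightarrow> card S < b0 \<Longrightarrow> n l < n b0"
    by (rule best_label[of ?J n "card S"]) (use less.prems(1) in auto)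
  let ?T = "insert b0 S" and ?J' = "?J - {b0}"
  have T: "?T \<subseteq> {..m}" "card ?T = ?r" "{..m} - ?T = ?J'" using b0(1) S by auto
  have Nsplit: "?N = n b0 + (\<Sum>l\<in>?J'. n l)" using b0(1) by (simp add: sum.remove)
  have FT: "F ?T z \<noteq> 0" if "z \<in> Z" for z
  proof -
    have "z \<notin> D (card ?T)" using that less.prems(5) T(2) by auto
    then show ?thesis by (rule minor_familyD(2)[OF fam T(1)])
  qed
  show ?case
  proof (cases "\<forall>l\<in>?J'. p l = 0")
    case True
    then have po: "p b0 \<noteq> 0" using less.prems(3) b0(1) by auto
    have "poly (p b0) z = 0" if "z \<in> Z" for z
    proof -
      have "(\<Sum>l\<in>?J. poly (p l) z * F (insert l S) z) = poly (p b0) z * F ?T z + (\<Sum>l\<in>?J'. poly (p l) z * F (insert l S) z)"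
        using b0(1) by (intro sum.remove) auto
      also have "(\<Sum>l\<in>?J'. poly (p l) z * F (insert l S) z) = 0" using True by (intro sum.neutral) auto
      finally show ?thesis using less.prems(6)[OF that] FT[OF that] by simp
    qed
    then have "card Z \<le> card {x. poly (p b0) x = 0}"
      using poly_roots_finite[OF po] by (intro card_mono) auto
    also have "\<dots> \<le> degree (p b0)" by (rule card_poly_roots_bound[OF po])
    also have "\<dots> < n b0" using less.prems(2)[OF b0(1)] po by simp
    finally show ?thesis using Nsplit by simp
  next
    case False
    then obtain l0 where l0: "l0 \<in> ?J'" "p l0 \<noteq> 0" by auto
    have Tp: "?T \<subset> {..m}" using T(1) l0(1) by auto
    have fT: "fat (\<nu> ?T) (D ?r)" using minor_familyD(4)[OF fam T(1)] T(2) Tp by auto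
    note fb = fat_finite_borel[OF fT]
    define \<rho> where "\<rho> = (\<lambda>l x. F S x * F (insert b0 (insert l S)) x)"
    have FSc: "continuous_on (D ?r) (F S)"
      by (rule continuous_on_subset[OF minor_familyD(1)[OF fam S(1)] sub_compl(1)])
    have F2: "continuous_on (D ?r) (F (insert b0 (insert l S)))" if "l \<in> ?J'" for l
    proof -
      have "insert b0 (insert l S) \<subseteq> {..m}" "card (insert b0 (insert l S)) = Suc ?r" using that b0(1) S by auto
      then show ?thesis
        using continuous_on_subset[OF minor_familyD(1)[OF fam]] sub_compl(2)[of ?r] by metis
    qed
    have c\<rho>: "continuous_on (D ?r) (\<rho> l)" if "l \<in> ?J'" for l
      unfolding \<rho>_def by (intro continuous_intros FSc F2 that)
    have "\<forall>l\<in>?J'. \<exists>a b. (\<forall>z. z \<notin> D ?r \<longrightarrow> F (insert l S) z / F ?T z = a * z + b + sg b0 l * ct (\<nu> ?T) (D ?r) (\<rho> l) z)"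
    proof
      fix l assume l: "l \<in> ?J'"
      then have "exch F \<nu> S b0 l" using S(1) b0(1) by (intro minor_familyD(5)[OF fam]) auto
      then show "\<exists>a b. (\<forall>z. z \<notin> D ?r \<longrightarrow> F (insert l S) z / F ?T z = a * z + b + sg b0 l * ct (\<nu> ?T) (D ?r) (\<rho> l) z)"
        unfolding exch_def \<rho>_def .
    qed
    then obtain a b where ab: "\<And>l z. l \<in> ?J' \<Longrightarrow> z \<notin> D ?r \<Longrightarrow>
        F (insert l S) z / F ?T z = a l * z + b l + sg b0 l * ct (\<nu> ?T) (D ?r) (\<rho> l) z" by metis
    have a0: "n l < n b0" if l: "l \<in> ?J'" and "a l \<noteq> 0" for l
    proof -
      have g: "grows ?T (F ?T)" "grows (insert l S) (F (insert l S))"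
        using T(1) l S(1) by (auto intro!: minor_familyD(3)[OF fam])
      show ?thesis
        using ratio_coefficients(1)[OF S(2) _ _ compact_D g fb c\<rho>[OF l] ab[OF l] \<open>a l \<noteq> 0\<close>] b0 l by auto
    qed
    \<comment> \<open>The signs are absorbed into the coefficient polynomials, so \<open>G\<close>
      is a combination of the same kind over the larger set \<open>?T\<close>.\<close>
    define G where "G = (\<lambda>x. \<Sum>l\<in>?J'. poly (smult (sg b0 l) (p l)) x * F (insert l ?T) x)"
    have sgn0: "sg b0 l \<noteq> 0" for l by (simp add: sg_def)
    have bound: "card Z' < (\<Sum>l\<in>?J'. n l)" if Z': "finite Z'" "Z' \<subseteq> D ?r" "\<And>z. z \<in> Z' \<Longrightarrow> G z = 0" for Z'
    proof -
      have "card Z' < (\<Sum>l\<in>{..m} - ?T. n l)"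
      proof (rule less.hyps[of ?T "\<lambda>l. smult (sg b0 l) (p l)"])
        show "card ({..m} - ?T) < card ?J" unfolding T(3) using b0(1) by (intro card_Diff1_less) auto
        show "Z' \<inter> D (Suc (card ?T)) = {}" using Z'(2) sub_compl(2)[of ?r] unfolding T(2) by auto
        show "smult (sg b0 l) (p l) = 0 \<or> degree (smult (sg b0 l) (p l)) < n l" if "l \<in> {..m} - ?T" for l
          using less.prems(2)[of l] that T(3) by (auto simp: sgn0)
        show "\<exists>l\<in>{..m} - ?T. smult (sg b0 l) (p l) \<noteq> 0" using l0 unfolding T(3) by (auto simp: sgn0)
        show "(\<Sum>l\<in>{..m} - ?T. poly (smult (sg b0 l) (p l)) z * F (insert l ?T) z) = 0" if "z \<in> Z'" for z
          using Z'(3)[OF that] unfolding T(3) G_def .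
      qed (use Tp Z' in auto)
      then show ?thesis unfolding T(3) .
    qed
    have fing: "finite {x \<in> D ?r. G x = 0}"
    proof (rule ccontr)
      assume "infinite {x \<in> D ?r. G x = 0}"
      then obtain Z' where "finite Z'" "card Z' = (\<Sum>l\<in>?J'. n l)" "Z' \<subseteq> {x \<in> D ?r. G x = 0}"
        using infinite_arbitrarily_large by blast
      with bound[of Z'] show False by auto
    qed
    have cardg: "card {x \<in> D ?r. G x = 0} < (\<Sum>l\<in>?J'. n l)" by (rule bound[OF fing]) auto
    show ?thesis
    proof (rule ccontr)
      assume "\<not> ?thesis"
      then have N: "?N \<le> card Z" by simp
      \<comment> \<open>The degree available for \<open>h\<close>: at least the number of dimensions
        left for the other labels, hence more than the number of zeros of \<open>G\<close>.\<close>
      define k where "k = card Z - n b0"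
      have k: "(\<Sum>l\<in>?J'. n l) \<le> k" "card Z = k + n b0" unfolding k_def using N Nsplit by auto
      define W where "W = (\<lambda>x. \<Prod>z\<in>Z. x - z)"
      define W' where "W' = (\<lambda>z. \<Prod>y\<in>Z - {z}. z - y)"
      have W0: "W x \<noteq> 0" if "x \<in> D ?r" for x
        unfolding W_def using less.prems(4,5) that by auto
      have Wc: "continuous_on (D ?r) W" unfolding W_def by (intro continuous_intros)
      have Gc: "continuous_on (D ?r) G" unfolding G_def
        using F2 by (intro continuous_intros) (auto simp: insert_commute)
      define f where "f = (\<lambda>x. F S x * G x / W x)"
      have fc: "continuous_on (D ?r) f" unfolding f_def using W0 by (intro continuous_intros FSc Gc Wc) auto
      have FS0: "F S x \<noteq> 0" if "x \<in> D ?r" for x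
      proof -
        have "x \<notin> D (card S)" using that sub_compl(1)[of "card S"] by auto
        then show ?thesis by (rule minor_familyD(2)[OF fam S(1)])
      qed
      have zf: "{x \<in> D ?r. f x = 0} = {x \<in> D ?r. G x = 0}"
        unfolding f_def using FS0 W0 by auto
      have "is_interval (D ?r)" using interval[of ?r] by (auto simp: is_interval_cc)
      then obtain h where h: "degree h < k" "0 < (LINT x:D ?r|\<nu> ?T. poly h x * f x)"
        using not_orthogonal[OF fT compact_D _ fc, of k] fing cardg k(1) unfolding zf by auto
      \<comment> \<open>The part without Cauchy transforms, multiplied by \<open>h\<close>. Its
        degree is at most \<open>(k - 1) + (n b0 - 1)\<close>, that is \<open>card Z - 2\<close>,
        just enough for the residue sum to vanish; the choice of \<open>b0\<close> is what keeps the
        affine factors within \<open>n b0 - 1\<close>.\<close>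
      define g where "g = h * (p b0 + (\<Sum>l\<in>?J'. p l * [:b l, a l:]))"
      have dpl: "degree (p l * [:b l, a l:]) \<le> n b0 - 1" if l: "l \<in> ?J'" for l
      proof (cases "p l = 0")
        case False
        then have d: "degree (p l) < n l" using less.prems(2)[of l] l by auto
        show ?thesis
        proof (cases "a l = 0")
          case True
          have "degree (p l * [:b l, a l:]) \<le> degree (p l) + degree [:b l, a l:]" by (rule degree_mult_le)
          also have "\<dots> \<le> n b0 - 1" using True d b0(2)[of l] l by auto
          finally show ?thesis .
        next
          case False
          have "degree (p l * [:b l, a l:]) \<le> degree (p l) + degree [:b l, a l:]" by (rule degree_mult_le)
          also have "\<dots> \<le> n b0 - 1" using d a0[OF l False] by auto
          finally show ?thesis .
        qed
      qed simp
      have dpo: "degree (p b0) \<le> n b0 - 1" using less.prems(2)[OF b0(1)] by auto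
      have no: "0 < n b0"
      proof -
        have "0 < n l0" using less.prems(2)[of l0] l0 by auto
        then show ?thesis using b0(2)[of l0] l0 by auto
      qed
      have "degree g \<le> degree h + (n b0 - 1)"
        unfolding g_def
        by (rule order_trans[OF degree_mult_le])
           (intro add_left_mono degree_add_le dpo degree_sum_le, use dpl in auto)
      then have dg: "degree g + 1 < card Z" using h(1) k(2) no by simp
      have r1: "(\<Sum>z\<in>Z. poly g z / W' z) = 0"
        unfolding W'_def by (rule partial_fractions_residue_sum[OF less.prems(4) dg])
      \<comment> \<open>Under the integral the sum over \<open>Z\<close> is the partial fraction
        expansion of \<open>h * p l\<close> over \<open>W\<close>, evaluated at the integration
        variable.\<close>
      have r2: "(\<Sum>z\<in>Z. poly (h * p l) z / W' z * ct (\<nu> ?T) (D ?r) (\<rho> l) z) = - (LINT x:D ?r|\<nu> ?T. poly (h * p l) x * \<rho> l x / W x)"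
        if l: "l \<in> ?J'" for l
      proof -
        have dhp: "degree (h * p l) < card Z"
        proof (cases "p l = 0")
          case True then show ?thesis using h(1) k(2) by simp
        next
          case False
          have "degree (h * p l) \<le> degree h + degree (p l)" by (rule degree_mult_le)
          also have "\<dots> < k + n b0" using h(1) less.prems(2)[of l] False l b0(2)[of l] by auto
          finally show ?thesis using k(2) by simp
        qed
        have zD: "z \<notin> D ?r" if "z \<in> Z" for z using that less.prems(5) by auto
        have "(\<Sum>z\<in>Z. poly (h * p l) z / W' z * ct (\<nu> ?T) (D ?r) (\<rho> l) z) =
            (\<Sum>z\<in>Z. LINT x:D ?r|\<nu> ?T. poly (h * p l) z / W' z * (\<rho> l x / (z - x)))"
          unfolding ct_def by (simp only: set_integral_mult_right)
        also have "\<dots> = (LINT x:D ?r|\<nu> ?T. \<Sum>z\<in>Z. poly (h * p l) z / W' z * (\<rho> l x / (z - x)))"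
          by (rule set_integral_sum[symmetric]) (intro set_integrable_mult_right impI set_integrable_ct[OF fb compact_D c\<rho>[OF l]] zD)
        also have "\<dots> = (LINT x:D ?r|\<nu> ?T. - (poly (h * p l) x * \<rho> l x / W x))"
        proof (rule set_integral_cong_compact[OF fb compact_D])
          fix x assume x: "x \<in> D ?r"
          then have xZ: "x \<notin> Z" using zD by auto
          have "(\<Sum>z\<in>Z. poly (h * p l) z / W' z * (\<rho> l x / (z - x))) =
              - \<rho> l x * (\<Sum>z\<in>Z. poly (h * p l) z / (W' z * (x - z)))"
            unfolding sum_distrib_left
          proof (intro sum.cong refl)
            fix z assume "z \<in> Z"
            have "poly (h * p l) z / W' z * (\<rho> l x / (z - x)) = \<rho> l x * (poly (h * p l) z / (W' z * (z - x)))" by simp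
            also have "W' z * (z - x) = - (W' z * (x - z))" by (simp add: algebra_simps)
            finally show "poly (h * p l) z / W' z * (\<rho> l x / (z - x)) = - \<rho> l x * (poly (h * p l) z / (W' z * (x - z)))"
              by simp
          qed
          also have "(\<Sum>z\<in>Z. poly (h * p l) z / (W' z * (x - z))) = poly (h * p l) x / W x"
            unfolding W_def W'_def by (rule partial_fractions[OF less.prems(4) dhp xZ])
          finally show "(\<Sum>z\<in>Z. poly (h * p l) z / W' z * (\<rho> l x / (z - x))) = - (poly (h * p l) x * \<rho> l x / W x)"
            by (simp add: mult.commute)
        qed
        also have "\<dots> = - (LINT x:D ?r|\<nu> ?T. poly (h * p l) x * \<rho> l x / W x)"
          using W0 by (intro set_integral_uminus set_integrable_compact[OF finite_borelD[OF fb] compact_D] continuous_intros c\<rho> l Wc) auto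
        finally show ?thesis .
      qed
      have L0: "poly g z / W' z + (\<Sum>l\<in>?J'. sg b0 l * (poly (h * p l) z / W' z * ct (\<nu> ?T) (D ?r) (\<rho> l) z)) = 0" if z: "z \<in> Z" for z
      proof -
        have zD: "z \<notin> D ?r" using z less.prems(5) by auto
        have "0 = (\<Sum>l\<in>?J. poly (p l) z * F (insert l S) z) / F ?T z" using less.prems(6)[OF z] by simp
        also have "\<dots> = poly (p b0) z + (\<Sum>l\<in>?J'. poly (p l) z * (F (insert l S) z / F ?T z))"
          using b0(1) FT[OF z] by (simp add: sum.remove add_divide_distrib sum_divide_distrib)
        also have "\<dots> = poly (p b0) z + (\<Sum>l\<in>?J'. poly (p l * [:b l, a l:]) z + sg b0 l * (poly (p l) z * ct (\<nu> ?T) (D ?r) (\<rho> l) z))"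
          using ab[OF _ zD] by (intro arg_cong2[where f="(+)"] refl sum.cong) (simp add: algebra_simps)
        finally have e: "poly (p b0) z + (\<Sum>l\<in>?J'. poly (p l * [:b l, a l:]) z)
            + (\<Sum>l\<in>?J'. sg b0 l * (poly (p l) z * ct (\<nu> ?T) (D ?r) (\<rho> l) z)) = 0" by (simp add: sum.distrib)
        have "poly g z / W' z + (\<Sum>l\<in>?J'. sg b0 l * (poly (h * p l) z / W' z * ct (\<nu> ?T) (D ?r) (\<rho> l) z)) =
          poly h z / W' z * (poly (p b0) z + (\<Sum>l\<in>?J'. poly (p l * [:b l, a l:]) z)
            + (\<Sum>l\<in>?J'. sg b0 l * (poly (p l) z * ct (\<nu> ?T) (D ?r) (\<rho> l) z)))"
          unfolding g_def poly_mult poly_add poly_sum distrib_left sum_distrib_left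
          by (simp add: mult_ac add_divide_distrib sum_divide_distrib)
        then show ?thesis unfolding e by simp
      qed
      have "0 = (\<Sum>z\<in>Z. poly g z / W' z + (\<Sum>l\<in>?J'. sg b0 l * (poly (h * p l) z / W' z * ct (\<nu> ?T) (D ?r) (\<rho> l) z)))"
        using L0 by simp
      also have "\<dots> = (\<Sum>l\<in>?J'. sg b0 l * (\<Sum>z\<in>Z. poly (h * p l) z / W' z * ct (\<nu> ?T) (D ?r) (\<rho> l) z))"
        unfolding sum.distrib r1 sum_distrib_left by (simp add: sum.swap[of _ Z])
      also have "\<dots> = (\<Sum>l\<in>?J'. - (LINT x:D ?r|\<nu> ?T. sg b0 l * (poly (h * p l) x * \<rho> l x / W x)))"
        using r2 by (intro sum.cong) (simp_all add: set_integral_mult_right del: times_divide_eq_right)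
      also have "\<dots> = - (LINT x:D ?r|\<nu> ?T. \<Sum>l\<in>?J'. sg b0 l * (poly (h * p l) x * \<rho> l x / W x))"
        unfolding sum_negf using W0
        by (subst set_integral_sum) (auto intro!: set_integrable_compact[OF finite_borelD[OF fb] compact_D] continuous_intros c\<rho> Wc)
      also have "(LINT x:D ?r|\<nu> ?T. \<Sum>l\<in>?J'. sg b0 l * (poly (h * p l) x * \<rho> l x / W x)) = (LINT x:D ?r|\<nu> ?T. poly h x * f x)"
      proof (rule set_integral_cong_compact[OF fb compact_D])
        fix x assume "x \<in> D ?r"
        show "(\<Sum>l\<in>?J'. sg b0 l * (poly (h * p l) x * \<rho> l x / W x)) = poly h x * f x"
          unfolding f_def G_def \<rho>_def sum_distrib_left sum_divide_distrib
          by (intro sum.cong refl) (simp add: mult_ac insert_commute)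
      qed
      finally show False using h(2) by simp
    qed
  qed
qed

end

text \<open>In a Haar space of dimension \<open>N\<close> an element with \<open>N - 1\<close> zeros changes sign at each of them:
  otherwise a small perturbation would split one zero into two.\<close>

lemma haar_sign_change:
  fixes V :: "(real \<Rightarrow> real) set"
  assumes lin: "\<And>f g c. f \<in> V \<Longrightarrow> g \<in> V \<Longrightarrow> (\<lambda>x. f x + c * g x) \<in> V"
    and cont: "\<And>f. f \<in> V \<Longrightarrow> continuous_on I f" and I: "open I"
    and bound: "\<And>f x Z. f \<in> V \<Longrightarrow> x \<in> I \<Longrightarrow> f x \<noteq> 0 \<Longrightarrow> finite Z \<Longrightarrow> Z \<subseteq> I \<Longrightarrow> (\<And>z. z \<in> Z \<Longrightarrow> f z = 0) \<Longrightarrow> card Z < N"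
    and f: "f \<in> V" and B: "finite B" "B \<subseteq> I" "Suc (card B) = N" "\<And>x. x \<in> I \<Longrightarrow> f x = 0 \<longleftrightarrow> x \<in> B"
    and g: "g \<in> V" "\<And>x. x \<in> B - {c} \<Longrightarrow> g x = 0" "g c \<noteq> 0" and c: "c \<in> B"
    and C': "finite C'" "C' \<subseteq> B" "c \<notin> C'" and s: "s \<noteq> 0"
    and nn: "\<And>t. t \<in> I \<Longrightarrow> 0 \<le> s * f t * (\<Prod>c\<in>C'. t - c)"
  shows False
proof -
  have cI: "c \<in> I" using c B(2) by auto
  define k where "k = (\<lambda>t. s * (\<Prod>c\<in>C'. t - c))"
  have kc: "k c \<noteq> 0" unfolding k_def using s C' by auto
  define U where "U = I - (B - {c})"
  have "open U" unfolding U_def using I B(1) by (intro open_Diff finite_imp_closed) auto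
  moreover have "c \<in> U" unfolding U_def using cI by auto
  ultimately obtain d where d: "0 < d" "cball c d \<subseteq> U" using open_contains_cball by blast
  define a b where "a = c - d" and "b = c + d"
  have ab: "a < c" "c < b" "{a..b} \<subseteq> U" using d unfolding a_def b_def cball_eq_atLeastAtMost by auto
  have abI: "{a..b} \<subseteq> I" using ab(3) unfolding U_def by auto
  have k0: "k t \<noteq> 0" if "t \<in> {a..b}" for t
  proof (cases "t = c")
    case False
    then have "t \<notin> B" using that ab(3) unfolding U_def by auto
    then show ?thesis unfolding k_def using s C' by auto
  qed (use kc in simp)
  have kcont: "continuous_on {a..b} k" unfolding k_def by (intro continuous_intros)
  obtain e :: real where e: "e \<noteq> 0" "\<And>t. t \<in> {a..b} \<Longrightarrow> 0 < e * k t"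
    using connected_const_sign[OF connected_Icc kcont k0] by (metis mult_1 mult_minus1 neg_0_less_iff_less zero_neq_neg_one zero_neq_one)
  have ef: "0 \<le> e * f t" if t: "t \<in> {a..b}" for t
  proof -
    have "0 \<le> k t * f t" using nn[of t] t abI unfolding k_def by (auto simp: mult_ac)
    then have "0 \<le> (e * e) * (k t * f t)" by simp
    then have "0 \<le> (e * k t) * (e * f t)" by (simp add: mult_ac)
    then show ?thesis using e(2)[OF t] by (simp add: zero_le_mult_iff)
  qed
  have efp: "0 < e * f t" if "t \<in> {a..b}" "t \<noteq> c" for t
  proof -
    have "t \<notin> B" using that ab(3) unfolding U_def by auto
    then have "f t \<noteq> 0" using B(4)[of t] that abI by auto
    then show ?thesis using ef[OF that(1)] e(1) by (simp add: less_le)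
  qed
  have aI: "a \<in> {a..b}" "b \<in> {a..b}" "c \<in> {a..b}" using ab by auto
  define G where "G = \<bar>g a\<bar> + \<bar>g b\<bar> + 1"
  \<comment> \<open>The size of the perturbation: at both ends it stays below the value of
    \<open>f\<close>, so the sign there is preserved, while \<open>\<sigma>\<close> is given the
    sign that makes the perturbed function negative at \<open>c\<close>, after multiplication by
    \<open>e\<close>.\<close>
  define q where "q = min (e * f a) (e * f b) / G"
  have G: "0 < G" unfolding G_def by simp
  have q: "0 < q" unfolding q_def using efp[OF aI(1)] efp[OF aI(2)] ab G by simp
  define \<sigma> where "\<sigma> = - q / (e * g c) * \<bar>g c\<bar>"
  define h where "h = (\<lambda>x. f x + \<sigma> * g x)"
  have hV: "h \<in> V" unfolding h_def by (rule lin[OF f g(1)])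
  have \<sigma>e: "\<bar>e * \<sigma>\<bar> = q" unfolding \<sigma>_def using e(1) g(3) q by (simp add: abs_mult abs_divide)
  have hc: "e * h c < 0"
  proof -
    have "f c = 0" using B(4)[OF cI] c by simp
    then have "e * h c = e * \<sigma> * g c" unfolding h_def by simp
    also have "\<dots> = - q * \<bar>g c\<bar>" unfolding \<sigma>_def using e(1) g(3) by simp
    finally show ?thesis using q g(3) by simp
  qed
  have hpos: "0 < e * h t" if t: "t = a \<or> t = b" for t
  proof -
    have "\<bar>g t\<bar> < G" using t unfolding G_def by auto
    then have "\<bar>e * \<sigma> * g t\<bar> < q * G" unfolding abs_mult[of "e * \<sigma>"] \<sigma>e using q by simp
    also have "q * G \<le> e * f t" unfolding q_def using t G by auto
    finally show ?thesis unfolding h_def by (simp add: algebra_simps)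
  qed
  have hcont: "continuous_on I h" by (rule cont[OF hV])
  have "continuous_on {a..c} (\<lambda>x. e * h x)" "continuous_on {c..b} (\<lambda>x. e * h x)"
    using abI ab by (auto intro!: continuous_intros continuous_on_subset[OF hcont])
  then obtain x1 x2 where x: "a \<le> x1" "x1 \<le> c" "e * h x1 = 0" "c \<le> x2" "x2 \<le> b" "e * h x2 = 0"
    using IVT2'[of "\<lambda>x. e * h x" c 0 a] IVT'[of "\<lambda>x. e * h x" c 0 b] hc hpos ab less_imp_le
    by (metis (no_types, lifting))
  have xne: "x1 \<noteq> c" "x2 \<noteq> c" using x hc by auto
  have h0: "h x1 = 0" "h x2 = 0" using x e(1) by auto
  have xU: "x1 \<in> {a..b}" "x2 \<in> {a..b}" using x ab by auto
  define Z where "Z = insert x1 (insert x2 (B - {c}))"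
  have "x1 \<in> U" "x2 \<in> U" using xU ab(3) by blast+
  then have "x1 \<notin> B - {c}" "x2 \<notin> B - {c}" unfolding U_def by blast+
  moreover have "x1 \<noteq> x2" using x xne by auto
  ultimately have "card Z = Suc (Suc (card (B - {c})))" unfolding Z_def using B(1) by simp
  then have "card Z = N" using B(3) card_Suc_Diff1[OF B(1) c] by simp
  moreover have "card Z < N"
  proof (rule bound[OF hV cI])
    show "h c \<noteq> 0" using hc by auto
    show "finite Z" "Z \<subseteq> I" unfolding Z_def using B xU abI by auto
    show "h z = 0" if "z \<in> Z" for z
    proof -
      have "h z = 0" if "z \<in> B - {c}" for z unfolding h_def using g(2)[OF that] B(4)[of z] B(2) that by auto
      then show ?thesis using that h0 unfolding Z_def by auto
    qed
  qed
  ultimately show False by simp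
qed

text \<open>\<open>C\<close> is filled up outside \<open>J\<close> to \<open>N - 1\<close> points.
  An element vanishing there has no further zeros, and by \<open>haar_sign_change\<close> it changes
  sign at each point of \<open>C\<close>. The added points lie off \<open>J\<close>, so their
  factors have a constant sign on \<open>J\<close>.\<close>

lemma haar_sign_pattern:
  fixes V :: "(real \<Rightarrow> real) set"
  assumes lin: "\<And>f g c. f \<in> V \<Longrightarrow> g \<in> V \<Longrightarrow> (\<lambda>x. f x + c * g x) \<in> V"
    and cont: "\<And>f. f \<in> V \<Longrightarrow> continuous_on I f" and I: "open I" "is_interval I"
    and bound: "\<And>f x Z. f \<in> V \<Longrightarrow> x \<in> I \<Longrightarrow> f x \<noteq> 0 \<Longrightarrow> finite Z \<Longrightarrow> Z \<subseteq> I \<Longrightarrow> (\<And>z. z \<in> Z \<Longrightarrow> f z = 0) \<Longrightarrow> card Z < N"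
    and exist: "\<And>Z. finite Z \<Longrightarrow> Z \<subseteq> I \<Longrightarrow> card Z < N \<Longrightarrow> \<exists>f\<in>V. (\<exists>x\<in>I. f x \<noteq> 0) \<and> (\<forall>z\<in>Z. f z = 0)"
    and J: "is_interval J" "J \<subseteq> I" "infinite (I - J)" and C: "finite C" "C \<subseteq> J" "card C < N"
  shows "\<exists>f\<in>V. \<exists>s\<in>{1, -1::real}. (\<forall>t\<in>J. 0 \<le> s * f t * (\<Prod>c\<in>C. t - c)) \<and> (\<forall>t\<in>J. f t = 0 \<longleftrightarrow> t \<in> C)"
proof -
  obtain E where E: "finite E" "card E = N - 1 - card C" "E \<subseteq> I - J"
    using infinite_arbitrarily_large[OF J(3)] by blast
  define B where "B = C \<union> E"
  have B: "finite B" "B \<subseteq> I" unfolding B_def using C E J by auto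
  have cardB: "Suc (card B) = N" unfolding B_def using C E by (subst card_Un_disjoint) auto
  obtain f x where f: "f \<in> V" "x \<in> I" "f x \<noteq> 0" "\<And>z. z \<in> B \<Longrightarrow> f z = 0"
    using exist[OF B] cardB by auto
  have zf: "f y = 0 \<longleftrightarrow> y \<in> B" if y: "y \<in> I" for y
  proof
    assume 0: "f y = 0"
    show "y \<in> B"
    proof (rule ccontr)
      assume yB: "y \<notin> B"
      have "card (insert y B) < N" by (rule bound[OF f(1-3)]) (use B y 0 f(4) in auto)
      then show False using cardB B yB by simp
    qed
  qed (use f in auto)
  have ZI: "{t \<in> I. f t = 0} = B" using zf B by auto
  obtain C' s where C': "C' \<subseteq> B" and s: "s \<in> {1, -1::real}" and nn: "\<And>t. t \<in> I \<Longrightarrow> 0 \<le> s * f t * (\<Prod>c\<in>C'. t - c)"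
    using sign_change_set[OF I(2) cont[OF f(1)]] B(1) unfolding ZI by blast
  have finC': "finite C'" using C' B finite_subset by blast
  have "C \<subseteq> C'"
  proof
    fix c assume c: "c \<in> C"
    show "c \<in> C'"
    proof (rule ccontr)
      assume c': "c \<notin> C'"
      have cB: "c \<in> B" using c B_def by auto
      have "infinite (I - J - E)" using J(3) E(1) by simp
      then obtain e where e: "e \<in> I" "e \<notin> J" "e \<notin> E" by (metis DiffE finite.emptyI ex_in_conv)
      let ?Z = "insert e (B - {c})"
      have eB: "e \<notin> B" "e \<noteq> c" using e C c unfolding B_def by auto
      have cZ: "card ?Z = card B" using B eB cB by (simp add: card_Diff_singleton card_gt_0_iff) (metis Suc_pred card_gt_0_iff empty_iff)
      have Zc: "finite ?Z" "?Z \<subseteq> I" "card ?Z < N" using B e(1) cZ cardB by auto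
      obtain g y where g: "g \<in> V" "y \<in> I" "g y \<noteq> 0" "\<And>z. z \<in> ?Z \<Longrightarrow> g z = 0"
        using exist[OF Zc] by blast
      have gB: "g x = 0" if "x \<in> B - {c}" for x using g(4)[of x] that by blast
      have s0: "s \<noteq> 0" using s by auto
      have gc: "g c \<noteq> 0"
      proof
        assume 0: "g c = 0"
        have "card (insert c ?Z) < N" by (rule bound[OF g(1-3)]) (use B e cB g(4) 0 in auto)
        moreover have "c \<notin> ?Z" using eB by auto
        ultimately show False using cardB cZ B by simp
      qed
      show False
        by (rule haar_sign_change[OF lin cont I(1) bound f(1) B cardB zf g(1) gB gc cB finC' C' c' s0 nn])
    qed
  qed
  then have C'E: "C' = C \<union> (C' \<inter> E)" "C \<inter> (C' \<inter> E) = {}" using C' B_def C E by auto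
  have pr: "(\<Prod>c\<in>C'. t - c) = (\<Prod>c\<in>C. t - c) * (\<Prod>c\<in>C' \<inter> E. t - c)" for t
    by (subst C'E(1), rule prod.union_disjoint) (use C'E(2) C(1) finC' in auto)
  define k where "k = (\<lambda>t. \<Prod>c\<in>C' \<inter> E. t - c)"
  have "continuous_on J k" unfolding k_def by (intro continuous_intros)
  moreover have "k t \<noteq> 0" if "t \<in> J" for t unfolding k_def using that E finC' by auto
  ultimately obtain e :: real where e: "e \<in> {1, -1}" "\<And>t. t \<in> J \<Longrightarrow> 0 < e * k t"
    using connected_const_sign[of J k] J(1) unfolding is_interval_connected_1[symmetric]
    by (metis insertI1 insertI2 mult_1 mult_minus1 neg_0_less_iff_less)
  have "0 \<le> (e * s) * f t * (\<Prod>c\<in>C. t - c)" if t: "t \<in> J" for t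
  proof -
    have "0 \<le> s * f t * ((\<Prod>c\<in>C. t - c) * k t)" using nn[of t] t J(2) unfolding pr k_def by auto
    also have "\<dots> = (e * k t) * ((e * s) * f t * (\<Prod>c\<in>C. t - c))" using e(1) by auto
    finally show ?thesis using e(2)[OF t] by (simp add: zero_le_mult_iff)
  qed
  moreover have "f t = 0 \<longleftrightarrow> t \<in> C" if "t \<in> J" for t
    using zf[of t] that J(2) E unfolding B_def by auto
  moreover have "e * s \<in> {1, -1}" using e(1) s by auto
  ultimately show ?thesis using f(1) by blast
qed

section \<open>Zeros of functions orthogonal to an AT system\<close>

lemma interval_neighbourhood:
  fixes p q a b :: real
  assumes "p \<le> q" "{p..q} \<inter> {a..b} = {}"
  obtains e where "0 < e" "{p - e<..<q + e} \<inter> {a..b} = {}"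
proof (cases "a \<le> b")
  case False
  then show ?thesis by (intro that[of 1]) auto
next
  case True
  have "b < p \<or> q < a"
  proof (rule ccontr)
    assume "\<not> (b < p \<or> q < a)"
    then have "max p a \<in> {p..q} \<inter> {a..b}" using assms(1) True by auto
    with assms(2) show False by auto
  qed
  then show ?thesis
  proof
    assume "b < p" then show ?thesis using assms(1) by (intro that[of "p - b"]) auto
  next
    assume "q < a" then show ?thesis using assms(1) by (intro that[of "a - q"]) auto
  qed
qed

context chain_intervals begin

text \<open>With fewer zeros than the dimension, some element of the system has exactly the sign
  changes of \<open>\<Psi>\<close>, and the product of both has constant sign and finitely many
  zeros, against orthogonality.\<close>

theorem at_system_orthogonal_zeros:
  assumes fam: "minor_family m F \<nu>" and S: "S \<subset> {..m}"
    and pq: "p \<le> q" "{p..q} \<inter> D (Suc (card S)) = {}" and M: "fat M {p..q}"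
    and \<Psi>: "continuous_on {p..q} \<Psi>"
    and orth: "\<And>P. (\<And>l. l \<in> {..m} - S \<Longrightarrow> P l = 0 \<or> degree (P l) < n l) \<Longrightarrow>
       (LINT x:{p..q}|M. \<Psi> x * (\<Sum>l\<in>{..m} - S. poly (P l) x * F (insert l S) x)) = 0"
  shows "\<exists>Z\<subseteq>{p..q}. finite Z \<and> card Z = (\<Sum>l\<in>{..m} - S. n l) \<and> (\<forall>z\<in>Z. \<Psi> z = 0)"
proof (rule ccontr)
  let ?J = "{..m} - S" and ?N = "\<Sum>l\<in>{..m} - S. n l" and ?r = "Suc (card S)"
  assume neg: "\<not> ?thesis"
  have S': "S \<subseteq> {..m}" "finite S" using S finite_subset by auto
  let ?Z0 = "{x \<in> {p..q}. \<Psi> x = 0}"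
  have fin: "finite ?Z0"
  proof (rule ccontr)
    assume "infinite ?Z0"
    then obtain Z where "finite Z" "card Z = ?N" "Z \<subseteq> ?Z0" using infinite_arbitrarily_large by blast
    with neg show False by blast
  qed
  have card: "card ?Z0 < ?N"
  proof (rule ccontr)
    assume "\<not> ?thesis"
    then obtain Z where "Z \<subseteq> ?Z0" "card Z = ?N" by (meson linorder_not_less obtain_subset_with_card_n)
    with neg fin show False using finite_subset by blast
  qed
  obtain a b where Dr: "D ?r = {a..b}" using interval by blast
  obtain e where e: "0 < e" "{p - e<..<q + e} \<inter> {a..b} = {}"
    using interval_neighbourhood[OF pq(1) pq(2)[unfolded Dr]] by blast
  \<comment> \<open>An open interval around \<open>{p..q}\<close> that still avoids the excluded
    interval: the perturbation argument works on an open set, and the auxiliary zeros need room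
    outside \<open>{p..q}\<close>.\<close>
  define I where "I = {p - e<..<q + e}"
  have ID: "I \<inter> D ?r = {}" unfolding I_def Dr by (rule e(2))
  define ok where "ok = (\<lambda>P :: nat \<Rightarrow> real poly. \<forall>l\<in>?J. P l = 0 \<or> degree (P l) < n l)"
  define form where "form = (\<lambda>P x. \<Sum>l\<in>?J. poly (P l) x * F (insert l S) x)"
  define V where "V = {form P |P. ok P}"
  have Fc: "continuous_on I (F (insert l S))" if "l \<in> ?J" for l
  proof -
    have "insert l S \<subseteq> {..m}" "card (insert l S) = ?r" using that S' by auto
    then have "continuous_on (- D ?r) (F (insert l S))" using minor_familyD(1)[OF fam] by metis
    then show ?thesis by (rule continuous_on_subset) (use ID in auto)
  qed
  have cont: "continuous_on I f" if "f \<in> V" for f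
    using that unfolding V_def form_def by (auto intro!: continuous_intros Fc)
  have lin: "(\<lambda>x. f x + c * g x) \<in> V" if fg: "f \<in> V" "g \<in> V" for f g c
  proof -
    obtain P R where PR: "f = form P" "ok P" "g = form R" "ok R" using fg unfolding V_def by blast
    have "(\<lambda>x. f x + c * g x) = form (\<lambda>l. P l + smult c (R l))"
      unfolding PR form_def by (auto simp: sum.distrib sum_distrib_left algebra_simps)
    moreover have "ok (\<lambda>l. P l + smult c (R l))"
      unfolding ok_def
    proof
      fix l assume l: "l \<in> ?J"
      then have 1: "P l = 0 \<or> degree (P l) < n l" "R l = 0 \<or> degree (R l) < n l" using PR unfolding ok_def by auto
      show "P l + smult c (R l) = 0 \<or> degree (P l + smult c (R l)) < n l"
      proof (cases "n l = 0")
        case True then show ?thesis using 1 by auto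
      next
        case False
        then have "degree (P l) < n l" "degree (smult c (R l)) < n l"
          using 1 by (auto intro: le_less_trans[OF degree_smult_le])
        then show ?thesis by (auto intro: degree_add_less)
      qed
    qed
    ultimately show ?thesis unfolding V_def by blast
  qed
  have bound0: "card Z < ?N" if "ok P" "\<exists>l\<in>?J. P l \<noteq> 0" "finite Z" "Z \<subseteq> I" "\<And>z. z \<in> Z \<Longrightarrow> form P z = 0" for P Z
    by (rule at_system_zero_bound[OF fam S, of P]) (use that ID in \<open>auto simp: ok_def form_def\<close>)
  have bound: "card Z < ?N" if fV: "f \<in> V" and "x \<in> I" and fx: "f x \<noteq> 0" and Z: "finite Z" "Z \<subseteq> I" "\<And>z. z \<in> Z \<Longrightarrow> f z = 0" for f x Z
  proof -
    obtain P where P: "f = form P" "ok P" using fV unfolding V_def by blast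
    have "\<exists>l\<in>?J. P l \<noteq> 0"
    proof (rule ccontr)
      assume "\<not> ?thesis"
      then have "form P x = 0" unfolding form_def by (intro sum.neutral) auto
      with fx P show False by simp
    qed
    then show ?thesis by (rule bound0[OF P(2)]) (use Z P in auto)
  qed
  have infI: "infinite I" unfolding I_def using e(1) pq(1) by (simp add: infinite_Ioo)
  have exist: "\<exists>f\<in>V. (\<exists>x\<in>I. f x \<noteq> 0) \<and> (\<forall>z\<in>Z. f z = 0)" if Z: "finite Z" "Z \<subseteq> I" "card Z < ?N" for Z
  proof -
    let ?X = "SIGMA l:?J. {..<n l}"
    have "card ?X = ?N" by simp
    then obtain c where c: "\<exists>i\<in>?X. c i \<noteq> 0" "\<forall>z\<in>Z. (\<Sum>i\<in>?X. c i * (case i of (l, k) \<Rightarrow> \<lambda>z. z ^ k * F (insert l S) z) z) = 0"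
      using exists_nontrivial_vanishing_combination[OF Z(1), of ?X "\<lambda>i. case i of (l, k) \<Rightarrow> \<lambda>z. z ^ k * F (insert l S) z"] Z(3) by auto
    define P where "P = (\<lambda>l. \<Sum>k<n l. monom (c (l, k)) k)"
    have coeffP: "coeff (P l) k = (if k < n l then c (l, k) else 0)" for l k
      unfolding P_def by (simp add: coeff_sum coeff_monom)
    have okP: "ok P" unfolding ok_def
    proof
      fix l assume "l \<in> ?J"
      show "P l = 0 \<or> degree (P l) < n l"
      proof (cases "n l = 0")
        case True then show ?thesis by (simp add: P_def)
      next
        case False
        then show ?thesis by (intro disjI2 degree_lessI) (auto simp: coeffP)
      qed
    qed
    have nzP: "\<exists>l\<in>?J. P l \<noteq> 0"
    proof -
      obtain l k where lk: "l \<in> ?J" "k < n l" "c (l, k) \<noteq> 0" using c(1) by auto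
      then have "coeff (P l) k \<noteq> 0" unfolding coeffP by simp
      then show ?thesis using lk(1) by force
    qed
    have fz: "form P z = 0" if "z \<in> Z" for z
    proof -
      have "form P z = (\<Sum>l\<in>?J. \<Sum>k<n l. c (l, k) * (z ^ k * F (insert l S) z))"
        unfolding form_def P_def by (simp add: poly_sum poly_monom sum_distrib_right mult.assoc)
      also have "\<dots> = (\<Sum>i\<in>?X. c i * (case i of (l, k) \<Rightarrow> \<lambda>z. z ^ k * F (insert l S) z) z)"
        by (subst sum.Sigma) (auto intro!: sum.cong)
      finally show ?thesis using c(2) that by simp
    qed
    have "\<exists>x\<in>I. form P x \<noteq> 0"
    proof (rule ccontr)
      assume "\<not> ?thesis"
      then have 0: "form P x = 0" if "x \<in> I" for x using that by auto
      obtain Z' where Z': "finite Z'" "card Z' = ?N" "Z' \<subseteq> I" using infinite_arbitrarily_large[OF infI] by blast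
      then have "card Z' < ?N" by (intro bound0[OF okP nzP]) (auto intro: 0)
      with Z' show False by simp
    qed
    then show ?thesis using okP fz unfolding V_def by blast
  qed
  have JI: "{p..q} \<subseteq> I" unfolding I_def using e(1) by auto
  have infIJ: "infinite (I - {p..q})"
  proof -
    have "{p - e<..<p} \<subseteq> I - {p..q}" unfolding I_def using pq(1) e(1) by auto
    moreover have "infinite {p - e<..<p}" using e(1) by (simp add: infinite_Ioo)
    ultimately show ?thesis using finite_subset by blast
  qed
  obtain C s where C: "C \<subseteq> ?Z0" and s: "s \<in> {1, -1::real}"
    and nn: "\<And>t. t \<in> {p..q} \<Longrightarrow> 0 \<le> s * \<Psi> t * (\<Prod>c\<in>C. t - c)"
    using sign_change_set[OF is_interval_cc \<Psi> fin] by blast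
  have finC: "finite C" using C fin finite_subset by blast
  have cardC: "card C < ?N" using card_mono[OF fin C] card by simp
  have "\<exists>f\<in>V. \<exists>s\<in>{1, -1::real}. (\<forall>t\<in>{p..q}. 0 \<le> s * f t * (\<Prod>c\<in>C. t - c)) \<and> (\<forall>t\<in>{p..q}. f t = 0 \<longleftrightarrow> t \<in> C)"
  proof (rule haar_sign_pattern[where I=I and N="?N"])
    show "(\<lambda>x. f x + c * g x) \<in> V" if "f \<in> V" "g \<in> V" for f g c by (rule lin[OF that])
    show "continuous_on I f" if "f \<in> V" for f by (rule cont[OF that])
    show "card Z < ?N" if "f \<in> V" "x \<in> I" "f x \<noteq> 0" "finite Z" "Z \<subseteq> I" "\<And>z. z \<in> Z \<Longrightarrow> f z = 0" for f x Z
      by (rule bound[OF that])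
    show "\<exists>f\<in>V. (\<exists>x\<in>I. f x \<noteq> 0) \<and> (\<forall>z\<in>Z. f z = 0)" if "finite Z" "Z \<subseteq> I" "card Z < ?N" for Z
      by (rule exist[OF that])
    show "open I" "is_interval I" unfolding I_def by (auto simp: is_interval_oo)
    show "C \<subseteq> {p..q}" using C by auto
  qed (use JI infIJ finC cardC in \<open>auto simp: is_interval_cc\<close>)
  then obtain f s' where f: "f \<in> V" and s': "s' \<in> {1, -1::real}"
    and nn': "\<And>t. t \<in> {p..q} \<Longrightarrow> 0 \<le> s' * f t * (\<Prod>c\<in>C. t - c)" and fz: "\<And>t. t \<in> {p..q} \<Longrightarrow> f t = 0 \<longleftrightarrow> t \<in> C"
    by blast
  obtain P where P: "f = form P" "ok P" using f unfolding V_def by blast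
  have 0: "(LINT x:{p..q}|M. \<Psi> x * f x) = 0"
    unfolding P(1) form_def by (rule orth) (use P(2) in \<open>auto simp: ok_def\<close>)
  have c\<Psi>f: "continuous_on {p..q} (\<lambda>x. (s * s') * (\<Psi> x * f x))"
    by (intro continuous_intros \<Psi> continuous_on_subset[OF cont[OF f] JI])
  have "0 < (LINT x:{p..q}|M. (s * s') * (\<Psi> x * f x))"
  proof (rule set_integral_pos_fat[OF M compact_Icc c\<Psi>f])
    fix t assume t: "t \<in> {p..q}"
    show "0 \<le> (s * s') * (\<Psi> t * f t)"
    proof (cases "t \<in> C")
      case True then show ?thesis using fz[OF t] by simp
    next
      case False
      then have "0 < (\<Prod>c\<in>C. t - c)\<^sup>2" using finC by (auto simp: zero_less_power2)
      moreover have "0 \<le> (s * s') * (\<Psi> t * f t) * (\<Prod>c\<in>C. t - c)\<^sup>2"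
        using mult_nonneg_nonneg[OF nn[OF t] nn'[OF t]] by (simp add: power2_eq_square mult_ac)
      ultimately show ?thesis by (simp add: zero_le_mult_iff)
    qed
  next
    have "{x \<in> {p..q}. s * s' * (\<Psi> x * f x) = 0} \<subseteq> ?Z0 \<union> C" using s s' fz by auto
    then show "finite {x \<in> {p..q}. s * s' * (\<Psi> x * f x) = 0}" using fin finC finite_subset by blast
  qed
  also have "\<dots> = (s * s') * (LINT x:{p..q}|M. \<Psi> x * f x)" by (rule set_integral_mult_right)
  finally show False using 0 by simp
qed

end

section \<open>Nikishin systems\<close>

lemma borel_measurable_completion_AE:
  fixes f g :: "real \<Rightarrow> 'b::topological_space"
  assumes g: "g \<in> borel_measurable M" and ae: "AE x in M. f x = g x"
  shows "f \<in> borel_measurable (completion M)"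
proof (rule measurableI)
  obtain N where N: "{x \<in> space M. f x \<noteq> g x} \<subseteq> N" "N \<in> null_sets M"
    using ae by (auto elim!: AE_E simp: null_sets_def)
  fix A :: "'b set" assume A: "A \<in> sets borel"
  have "f -` A \<inter> space M = (g -` A \<inter> space M - N) \<union> (f -` A \<inter> space M \<inter> N)" using N(1) by auto
  then show "f -` A \<inter> space (completion M) \<in> sets (completion M)"
    unfolding space_completion
    by (rule sets_completionI[OF _ _ N(2)]) (use measurable_sets[OF g A] N(2) in auto)
qed auto

text \<open>The integrand is known only on \<open>D\<close>. Off \<open>D\<close>, where for
  instance a Cauchy kernel may hit its pole, it changes nothing because the complement is a null
  set.\<close>

lemma integral_completion_support:
  fixes f :: "real \<Rightarrow> 'b::{banach, second_countable_topology}"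
  assumes M: "sets M = sets borel" and D: "D \<in> sets borel" and null: "emeasure M (- D) = 0"
    and f: "continuous_on D f"
  shows "integral\<^sup>L (completion M) f = (LINT x:D|M. f x)"
proof -
  have g: "(\<lambda>x. indicator D x *\<^sub>R f x) \<in> borel_measurable M"
    using borel_measurable_continuous_on_indicator[OF D f] unfolding measurable_cong_sets[OF M refl] .
  have "- D \<in> null_sets M" using null D M by auto
  from AE_not_in[OF this] have ae: "AE x in M. f x = indicator D x *\<^sub>R f x"
    by eventually_elim simp
  have "integral\<^sup>L (completion M) f = integral\<^sup>L (completion M) (\<lambda>x. indicator D x *\<^sub>R f x)"
    by (rule integral_cong_AE[OF borel_measurable_completion_AE[OF g ae] measurable_completion[OF g] AE_completion[OF ae]])
  also have "\<dots> = (LINT x:D|M. f x)" unfolding set_lebesgue_integral_def by (rule integral_completion[OF g])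
  finally show ?thesis .
qed

text \<open>By the Lindelof property the complement of the support is covered by countably many open
  null sets, so the complement of the hull is null. For fatness, infinitely many support points
  remain after removal of a finite \<open>Z\<close>, and \<open>- Z\<close> is an open neighbourhood
  of each.\<close>

lemma cs_class_properties:
  assumes s: "s \<in> cs_class \<Delta>"
  shows "\<exists>p q. p \<le> q \<and> \<Delta> = {p..q}" and "fat (mabs s) \<Delta>" and "emeasure (mabs s) (- \<Delta>) = 0"
    and "msign s = 1 \<or> msign s = - 1"
proof -
  let ?M = "mabs s" and ?S = "msupp s"
  have s': "msign s = 1 \<or> msign s = - 1" "sets ?M = sets borel" "finite_measure ?M" "compact ?S" "infinite ?S" "\<Delta> = convex hull ?S"
    using s unfolding cs_class_def by auto
  show "msign s = 1 \<or> msign s = - 1" by (rule s'(1))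
  have c: "compact \<Delta>" unfolding s'(6) by (rule compact_convex_hull[OF s'(4)])
  have "connected \<Delta>" unfolding s'(6) by (intro convex_connected convex_convex_hull)
  then obtain p q where pq: "\<Delta> = {p..q}" using c connected_compact_interval_1 by blast
  have sub: "?S \<subseteq> \<Delta>" unfolding s'(6) by (rule hull_subset)
  have "\<Delta> \<noteq> {}" using s'(5) sub by auto
  then show "\<exists>p q. p \<le> q \<and> \<Delta> = {p..q}" using pq by auto
  define \<F> where "\<F> = {U. open U \<and> emeasure ?M U = 0}"
  obtain \<F>' where F': "\<F>' \<subseteq> \<F>" "countable \<F>'" "\<Union>\<F>' = \<Union>\<F>"
    using Lindelof[of \<F>] unfolding \<F>_def by auto
  have "\<Union>\<F>' \<in> null_sets ?M"
  proof -
    have "(\<Union>U\<in>\<F>'. U) \<in> null_sets ?M"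
      using F'(1) s'(2) by (intro null_sets_UN'[OF F'(2)]) (auto simp: \<F>_def null_sets_def)
    then show ?thesis by simp
  qed
  moreover have "- \<Delta> \<subseteq> \<Union>\<F>'"
  proof
    fix x assume "x \<in> - \<Delta>"
    then have "x \<notin> ?S" using sub by auto
    then obtain U where "open U" "x \<in> U" "emeasure ?M U = 0" unfolding msupp_def by auto
    then show "x \<in> \<Union>\<F>'" unfolding F'(3) \<F>_def by auto
  qed
  moreover have "- \<Delta> \<in> sets ?M" using s'(2) pq by simp
  ultimately have null: "- \<Delta> \<in> null_sets ?M" by (metis null_sets_subset)
  then show "emeasure ?M (- \<Delta>) = 0" by auto
  have "emeasure ?M (\<Delta> - Z) \<noteq> 0" if Z: "finite Z" for Z
  proof
    assume 0: "emeasure ?M (\<Delta> - Z) = 0"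
    have m: "\<Delta> - Z \<in> sets ?M" using s'(2) pq finite_imp_closed[OF Z] by (auto intro!: sets.Diff borel_closed)
    have "infinite (?S - Z)" using s'(5) Z by simp
    then obtain x where x: "x \<in> ?S" "x \<notin> Z" by (metis DiffE finite.emptyI ex_in_conv)
    have "open (- Z)" using Z by (simp add: finite_imp_closed open_Compl)
    then have "emeasure ?M (- Z) \<noteq> 0" using x unfolding msupp_def by auto
    moreover have "emeasure ?M (- Z) \<le> emeasure ?M ((\<Delta> - Z) \<union> - \<Delta>)"
      using m null by (intro emeasure_mono) auto
    moreover have "emeasure ?M ((\<Delta> - Z) \<union> - \<Delta>) = 0"
      using m null 0 by (subst emeasure_Un_null_set) auto
    ultimately show False by simp
  qed
  then show "fat ?M \<Delta>" unfolding fat_def using s' by auto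
qed

lemma cauchy_transform_of_real:
  "cauchy_transform s (complex_of_real z) = complex_of_real (cauchy_transform s z)"
proof -
  have "(\<lambda>x. 1 / (complex_of_real z - of_real x)) = (\<lambda>x. complex_of_real (1 / (z - x)))"
    by (auto simp flip: of_real_diff)
  then show ?thesis unfolding cauchy_transform_def cs_integral_def
    by (simp add: scaleR_conv_of_real integral_complex_of_real del: of_real_divide)
qed

lemma cauchy_transform_measurable:
  assumes M: "sets (mabs s) = sets borel" "finite_measure (mabs s)"
  shows "(cauchy_transform s :: real \<Rightarrow> real) \<in> borel_measurable borel"
proof -
  interpret finite_measure "mabs s" by fact
  have m: "(\<lambda>t. 1 / (x - t)) \<in> borel_measurable (mabs s)" for x :: real
    unfolding measurable_cong_sets[OF M(1) refl] by measurable
  have e: "cauchy_transform s x = msign s * (LINT t|mabs s. 1 / (x - t))" for x :: real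
    unfolding cauchy_transform_def cs_integral_def using integral_completion[OF m[of x]] by simp
  have "(\<lambda>(x, t). 1 / (x - t :: real)) \<in> borel_measurable (borel \<Otimes>\<^sub>M borel)" by measurable
  then have "(\<lambda>(x, t). 1 / (x - t :: real)) \<in> borel_measurable (borel \<Otimes>\<^sub>M mabs s)"
    unfolding measurable_cong_sets[OF sets_pair_measure_cong[OF refl M(1)] refl] .
  then have "(\<lambda>x. LINT t|mabs s. 1 / (x - t :: real)) \<in> borel_measurable borel"
    by (intro borel_measurable_lebesgue_integral) simp
  then show ?thesis unfolding e[abs_def] by simp
qed

section \<open>Iterated measures of a Nikishin system and their densities\<close>

locale nikishin =
  fixes m :: nat and \<Delta> :: "nat \<Rightarrow> real set" and \<sigma> :: "nat \<Rightarrow> cs_measure"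
  assumes generators: "nikishin_generators m \<Delta> \<sigma>"
begin

abbreviation M :: "nat \<Rightarrow> real measure" where "M j \<equiv> mabs (\<sigma> j)"

lemma generator:
  assumes "j \<le> m"
  shows "\<exists>p q. p \<le> q \<and> \<Delta> j = {p..q}" "fat (M j) (\<Delta> j)" "emeasure (M j) (- \<Delta> j) = 0"
    "msign (\<sigma> j) = 1 \<or> msign (\<sigma> j) = - 1" "compact (\<Delta> j)" "connected (\<Delta> j)" "\<Delta> j \<in> sets borel"
    "sets (M j) = sets borel" "finite_measure (M j)" "finite_borel (M j)"
proof -
  have c: "\<sigma> j \<in> cs_class (\<Delta> j)" using generators assms unfolding nikishin_generators_def by auto
  show 1: "\<exists>p q. p \<le> q \<and> \<Delta> j = {p..q}" and f: "fat (M j) (\<Delta> j)" and "emeasure (M j) (- \<Delta> j) = 0"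
    and "msign (\<sigma> j) = 1 \<or> msign (\<sigma> j) = - 1"
    using cs_class_properties[OF c] by auto
  show "compact (\<Delta> j)" "connected (\<Delta> j)" "\<Delta> j \<in> sets borel" using 1 by auto
  show "sets (M j) = sets borel" "finite_measure (M j)" "finite_borel (M j)" using f fat_finite_borel by (auto simp: fat_def)
qed

lemma adjacent: "j < m \<Longrightarrow> \<Delta> j \<inter> \<Delta> (Suc j) = {}"
  using generators unfolding nikishin_generators_def by auto

text \<open>The signed density of \<open>s\<^sub>i\<^sub>,\<^sub>k\<close> with respect to \<open>|\<sigma>\<^sub>i|\<close>.\<close>

definition dens :: "nat \<Rightarrow> nat \<Rightarrow> real \<Rightarrow> real" where
  "dens i k x = msign (\<sigma> i) * (if i < k then cauchy_transform (nik \<sigma> (Suc i) k) x else 1)"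

text \<open>All clauses go through one induction: continuity and constant sign of the density of
  \<open>s\<^sub>i\<^sub>+\<^sub>1\<^sub>,\<^sub>k\<close> make its transform continuous and nonzero
  on \<open>\<Delta> i\<close>, and this transform is the density at the next level.\<close>

lemma nik_properties:
  assumes "k \<le> m" "i \<le> k"
  shows "(msign (nik \<sigma> i k) = 1 \<or> msign (nik \<sigma> i k) = - 1) \<and>
    sets (mabs (nik \<sigma> i k)) = sets borel \<and> finite_measure (mabs (nik \<sigma> i k)) \<and>
    emeasure (mabs (nik \<sigma> i k)) (- \<Delta> i) = 0 \<and> continuous_on (\<Delta> i) (dens i k) \<and>
    (\<forall>x\<in>\<Delta> i. 0 < msign (nik \<sigma> i k) * dens i k x) \<and>
    (\<forall>g. continuous_on (\<Delta> i) g \<longrightarrow> cs_integral (nik \<sigma> i k) g = (LINT x:\<Delta> i|M i. dens i k x * g x)) \<and>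
    (\<forall>z. z \<notin> \<Delta> i \<longrightarrow> cauchy_transform (nik \<sigma> i k) z = ct (M i) (\<Delta> i) (dens i k) z)"
  using assms
proof (induction "k - i" arbitrary: i)
  case 0
  then have i: "i = k" "i \<le> m" by auto
  note G = generator[OF i(2)]
  have n: "nik \<sigma> i k = \<sigma> i" using i(1) by (simp add: nik.simps)
  have d: "dens i k = (\<lambda>_. msign (\<sigma> i))" unfolding dens_def using i(1) by simp
  have I: "cs_integral (\<sigma> i) g = (LINT x:\<Delta> i|M i. msign (\<sigma> i) * g x)" if "continuous_on (\<Delta> i) g" for g :: "real \<Rightarrow> real"
    unfolding cs_integral_def integral_completion_support[OF G(8,7,3) that] by simp
  have T: "cauchy_transform (\<sigma> i) z = ct (M i) (\<Delta> i) (\<lambda>_. msign (\<sigma> i)) z" if "z \<notin> \<Delta> i" for z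
  proof -
    have "continuous_on (\<Delta> i) (\<lambda>x. 1 / (z - of_real x))" using that by (intro continuous_intros) auto
    from I[OF this] show ?thesis unfolding cauchy_transform_def ct_def by simp
  qed
  show ?case unfolding n d using G I T by auto
next
  case (Suc n)
  then have ik: "i < k" "i < m" "i \<le> m" "Suc i \<le> m" by auto
  note G = generator[OF ik(3)] and G' = generator[OF ik(4)]
  define b where "b = nik \<sigma> (Suc i) k"
  define T where "T = (cauchy_transform b :: real \<Rightarrow> real)"
  have IH: "(msign b = 1 \<or> msign b = - 1) \<and> sets (mabs b) = sets borel \<and> finite_measure (mabs b) \<and>
    emeasure (mabs b) (- \<Delta> (Suc i)) = 0 \<and> continuous_on (\<Delta> (Suc i)) (dens (Suc i) k) \<and>
    (\<forall>x\<in>\<Delta> (Suc i). 0 < msign b * dens (Suc i) k x) \<and>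
    (\<forall>g. continuous_on (\<Delta> (Suc i)) g \<longrightarrow> cs_integral b g = (LINT x:\<Delta> (Suc i)|M (Suc i). dens (Suc i) k x * g x)) \<and>
    (\<forall>z. z \<notin> \<Delta> (Suc i) \<longrightarrow> T z = ct (M (Suc i)) (\<Delta> (Suc i)) (dens (Suc i) k) z)"
    unfolding b_def T_def by (rule Suc.hyps(1)) (use Suc ik in auto)
  have n: "nik \<sigma> i k = cs_prod (\<sigma> i) b" using ik(1) by (simp add: nik.simps[of \<sigma> i] b_def)
  let ?s = "cs_prod (\<sigma> i) b"
  have d: "dens i k = (\<lambda>x. msign (\<sigma> i) * T x)" unfolding dens_def T_def b_def using ik(1) by (simp add: fun_eq_iff)
  have dj: "\<Delta> i \<inter> \<Delta> (Suc i) = {}" by (rule adjacent[OF ik(2)])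
  have Tm: "T \<in> borel_measurable borel" unfolding T_def using IH by (intro cauchy_transform_measurable) auto
  have "continuous_on (\<Delta> i) (ct (M (Suc i)) (\<Delta> (Suc i)) (dens (Suc i) k))"
    by (rule ct_continuous_on[OF G'(10,5) _ dj]) (use IH in auto)
  moreover have Teq: "T x = ct (M (Suc i)) (\<Delta> (Suc i)) (dens (Suc i) k) x" if "x \<in> \<Delta> i" for x
    using IH that dj by auto
  ultimately have Tc: "continuous_on (\<Delta> i) T" by (simp cong: continuous_on_cong)
  have T0: "T x \<noteq> 0" if "x \<in> \<Delta> i" for x
    unfolding Teq[OF that] by (rule ct_nonzero[OF G'(2,5,6)]) (use IH that dj in force)+
  \<comment> \<open>\<open>e\<close> is the sign of the transform on \<open>\<Delta> i\<close>.
    Since the transform does not change sign, it is also the sign of its integral, which is how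
    \<open>cs_prod\<close> determines the sign of the product.\<close>
  obtain e :: real where e: "e \<in> {1, -1}" "\<And>x. x \<in> \<Delta> i \<Longrightarrow> 0 < e * T x"
    using connected_const_sign[OF G(6) Tc T0] by force
  have absT: "\<bar>T x\<bar> = e * T x" if "x \<in> \<Delta> i" for x using e(1) e(2)[OF that] by auto
  have "0 < (LINT x:\<Delta> i|M i. e * T x)"
  proof (rule set_integral_pos_fat[OF G(2,5)])
    have "{x \<in> \<Delta> i. e * T x = 0} = {}" using e(2) by force
    then show "finite {x \<in> \<Delta> i. e * T x = 0}" by (simp only: finite.emptyI)
  qed (use e(2) in \<open>auto intro!: continuous_intros Tc less_imp_le\<close>)
  then have eI: "0 < e * (LINT x:\<Delta> i|M i. T x)" by simp
  have "cs_integral (\<sigma> i) T = msign (\<sigma> i) * (LINT x:\<Delta> i|M i. T x)"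
    unfolding cs_integral_def integral_completion_support[OF G(8,7,3) Tc] by simp
  then have sgn: "msign ?s = msign (\<sigma> i) * e"
    using eI e(1) G(4) unfolding cs_prod_def T_def[symmetric] by (auto simp: sgn_mult sgn_if)
  have mab: "mabs ?s = density (M i) (\<lambda>x. ennreal \<bar>T x\<bar>)" unfolding cs_prod_def T_def[symmetric] by simp
  have Tm': "(\<lambda>x. \<bar>T x\<bar>) \<in> borel_measurable (M i)"
    unfolding measurable_cong_sets[OF G(8) refl] using Tm by measurable
  have nullM: "- \<Delta> i \<in> null_sets (M i)" using G(3,7,8) by auto
  have sets: "sets (mabs ?s) = sets borel" unfolding mab using G(8) by simp
  have null: "emeasure (mabs ?s) (- \<Delta> i) = 0"
  proof -
    have "- \<Delta> i \<in> sets (M i)" using G(7,8) by auto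
    then have "emeasure (mabs ?s) (- \<Delta> i) = (\<integral>\<^sup>+x\<in>- \<Delta> i. ennreal \<bar>T x\<bar> \<partial>M i)"
      unfolding mab using Tm' by (intro emeasure_density) auto
    also have "\<dots> = 0" by (rule nn_integral_null_set[OF nullM])
    finally show ?thesis .
  qed
  have intT: "set_integrable (M i) (\<Delta> i) (\<lambda>x. \<bar>T x\<bar>)"
    by (intro set_integrable_compact[OF G(8,9,5)] continuous_intros Tc)
  have fin: "finite_measure (mabs ?s)"
  proof
    have "emeasure (mabs ?s) (space (mabs ?s)) = (\<integral>\<^sup>+x. ennreal \<bar>T x\<bar> \<partial>M i)"
      unfolding mab using Tm' by (subst emeasure_density) (auto intro!: nn_integral_cong)
    also have "\<dots> = (\<integral>\<^sup>+x. ennreal (indicator (\<Delta> i) x *\<^sub>R \<bar>T x\<bar>) \<partial>M i)"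
      using AE_not_in[OF nullM] by (intro nn_integral_cong_AE, eventually_elim) (auto simp: indicator_def)
    also have "\<dots> = ennreal (LINT x:\<Delta> i|M i. \<bar>T x\<bar>)"
      unfolding set_lebesgue_integral_def using intT
      by (intro nn_integral_eq_integral) (auto simp: set_integrable_def)
    finally show "emeasure (mabs ?s) (space (mabs ?s)) \<noteq> \<infinity>" by simp
  qed
  have I: "cs_integral ?s g = (LINT x:\<Delta> i|M i. dens i k x * g x)" if g: "continuous_on (\<Delta> i) g" for g :: "real \<Rightarrow> real"
  proof -
    have gm: "(\<lambda>x. indicator (\<Delta> i) x *\<^sub>R g x) \<in> borel_measurable (M i)"
      using borel_measurable_continuous_on_indicator[OF G(7) g] unfolding measurable_cong_sets[OF G(8) refl] .
    have "cs_integral ?s g = msign ?s * (LINT x:\<Delta> i|mabs ?s. g x)"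
      unfolding cs_integral_def integral_completion_support[OF sets G(7) null g] by simp
    also have "(LINT x:\<Delta> i|mabs ?s. g x) = (LINT x|M i. \<bar>T x\<bar> *\<^sub>R (indicator (\<Delta> i) x *\<^sub>R g x))"
      unfolding set_lebesgue_integral_def mab by (rule integral_density[OF gm Tm']) auto
    also have "\<dots> = (LINT x:\<Delta> i|M i. e * (T x * g x))"
      unfolding set_lebesgue_integral_def using absT
      by (intro Bochner_Integration.integral_cong) (auto simp: indicator_def)
    also have "\<dots> = e * (LINT x:\<Delta> i|M i. T x * g x)" by (rule set_integral_mult_right)
    also have "msign ?s * (e * (LINT x:\<Delta> i|M i. T x * g x)) = msign (\<sigma> i) * (LINT x:\<Delta> i|M i. T x * g x)"
      unfolding sgn using e(1) by auto
    also have "\<dots> = (LINT x:\<Delta> i|M i. dens i k x * g x)" unfolding d by (simp add: mult.assoc)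
    finally show ?thesis .
  qed
  have C: "cauchy_transform ?s z = ct (M i) (\<Delta> i) (dens i k) z" if "z \<notin> \<Delta> i" for z
  proof -
    have "continuous_on (\<Delta> i) (\<lambda>x. 1 / (z - of_real x))" using that by (intro continuous_intros) auto
    from I[OF this] show ?thesis unfolding cauchy_transform_def ct_def by simp
  qed
  have pos: "0 < msign ?s * dens i k x" if "x \<in> \<Delta> i" for x
    unfolding sgn d using e(2)[OF that] G(4) by auto
  have sg: "msign ?s = 1 \<or> msign ?s = - 1" unfolding sgn using e(1) G(4) by auto
  have cont: "continuous_on (\<Delta> i) (dens i k)" unfolding d by (intro continuous_intros Tc)
  show ?case unfolding n
    by (intro conjI allI impI ballI) (fact sg sets fin null cont | erule pos I C)+
qed

text \<open>Padding with empty sets, which trivially satisfy the conditions on a chain, turns the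
  finitely many intervals into an infinite sequence.\<close>

definition D :: "nat \<Rightarrow> real set" where
  "D i = (if i \<le> m then \<Delta> i else {})"

sublocale chain_intervals D
proof
  fix i
  show "\<exists>p q. D i = {p..q}" 
  proof (cases "i \<le> m")
    case False
    show ?thesis by (intro exI[of _ 1] exI[of _ 0]) (simp add: D_def False)
  qed (use generator(1)[of i] in \<open>auto simp: D_def\<close>)
  show "D i \<inter> D (Suc i) = {}" unfolding D_def using adjacent[of i] by auto
next
  have "bounded (\<Union>i\<le>m. \<Delta> i)" using generator(5) by (auto intro: compact_imp_bounded)
  then obtain R where "\<And>x. x \<in> (\<Union>i\<le>m. \<Delta> i) \<Longrightarrow> \<bar>x\<bar> \<le> R" by (auto simp: bounded_iff)
  then have "x \<le> R" if "i \<le> m" "x \<in> \<Delta> i" for i x using that by (meson UN_I abs_le_D1 atMost_iff)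
  then show "\<exists>R. \<forall>i. \<forall>x\<in>D i. x \<le> R" unfolding D_def by (intro exI[of _ R]) auto
qed

lemma family_exists: "\<exists>F \<nu>. initial_family M m F \<nu>"
  by (rule initial_family_exists) (use generator(2) in \<open>auto simp: D_def\<close>)

text \<open>Both sides are iterated Cauchy transforms over the same intervals; the constant arises
  because \<open>dens\<close> carries the signs of the generators while the family is built from
  positive measures.\<close>

lemma dens_eq_minor:
  assumes F: "initial_family M m F \<nu>" and k: "k \<le> m"
  shows "\<exists>c. c \<noteq> 0 \<and> (\<forall>x\<in>\<Delta> 0. dens 0 k x = c * F {k} x)"
proof -
  have T: "\<exists>c. c \<noteq> 0 \<and> (\<forall>z. z \<notin> \<Delta> (Suc i) \<longrightarrow> cauchy_transform (nik \<sigma> (Suc i) k) z = c * F (insert k {..<i}) z)"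
    if "i < k" for i
    using that
  proof (induction "k - i" arbitrary: i)
    case (Suc n)
    have im: "Suc i \<le> m" "Suc i \<le> k" using Suc.prems k by auto
    note G = generator[OF im(1)]
    have C: "cauchy_transform (nik \<sigma> (Suc i) k) z = ct (M (Suc i)) (\<Delta> (Suc i)) (dens (Suc i) k) z" if "z \<notin> \<Delta> (Suc i)" for z
      using nik_properties[OF k im(2)] that by blast
    have FF: "F (insert k {..<i}) z = ct (M (Suc i)) (\<Delta> (Suc i)) (F (insert k {..<Suc i})) z" if "z \<notin> \<Delta> (Suc i)" for z
      using F k Suc.prems that im(1) unfolding initial_family_def D_def by auto
    obtain c where c: "c \<noteq> 0" "\<And>x. x \<in> \<Delta> (Suc i) \<Longrightarrow> dens (Suc i) k x = c * F (insert k {..<Suc i}) x"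
    proof (cases "Suc i < k")
      case True
      have dj: "\<Delta> (Suc i) \<inter> \<Delta> (Suc (Suc i)) = {}" using adjacent[of "Suc i"] True k by auto
      obtain c where "c \<noteq> 0" "\<And>z. z \<notin> \<Delta> (Suc (Suc i)) \<Longrightarrow> cauchy_transform (nik \<sigma> (Suc (Suc i)) k) z = c * F (insert k {..<Suc i}) z"
        using Suc.hyps(1)[OF _ True] Suc.hyps(2) by fastforce
      then show ?thesis using True dj G(4)
        by (intro that[of "msign (\<sigma> (Suc i)) * c"]) (auto simp: dens_def)
    next
      case False
      then have ki: "k = Suc i" using Suc.prems by auto
      then have "insert k {..<Suc i} = {..<Suc k}" by auto
      then have "F (insert k {..<Suc i}) = (\<lambda>_. 1)" using F k unfolding initial_family_def by auto
      then show ?thesis using ki G(4) by (intro that[of "msign (\<sigma> (Suc i))"]) (auto simp: dens_def)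
    qed
    have "cauchy_transform (nik \<sigma> (Suc i) k) z = c * F (insert k {..<i}) z" if "z \<notin> \<Delta> (Suc i)" for z
      unfolding C[OF that] FF[OF that] ct_cmult[symmetric] by (rule ct_cong[OF G(10,5) c(2)])
    then show ?case using c(1) by blast
  qed simp
  show ?thesis
  proof (cases "0 < k")
    case True
    obtain c where c: "c \<noteq> 0" "\<And>z. z \<notin> \<Delta> (Suc 0) \<Longrightarrow> cauchy_transform (nik \<sigma> (Suc 0) k) z = c * F (insert k {..<0}) z"
      using T[OF True] by blast
    have dj: "\<Delta> 0 \<inter> \<Delta> (Suc 0) = {}" using adjacent[of 0] True k by auto
    have "cauchy_transform (nik \<sigma> (Suc 0) k) x = c * F {k} x" if "x \<in> \<Delta> 0" for x
      using c(2)[of x] that dj by auto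
    then show ?thesis
      using c(1) generator(4)[of 0] True
      by (intro exI[of _ "msign (\<sigma> 0) * c"]) (auto simp: dens_def)
  next
    case False
    then have "{k} = {..<Suc 0}" "k = 0" by auto
    then have "F {k} = (\<lambda>_. 1)" using F unfolding initial_family_def by (metis Suc_le_mono le0)
    then show ?thesis using \<open>k = 0\<close> generator(4)[of 0] by (intro exI[of _ "msign (\<sigma> 0)"]) (auto simp: dens_def)
  qed
qed

end

section \<open>Type II denominators and the quadrature formula\<close>

lemma poly_eq_off_compact:
  fixes p q :: "real poly"
  assumes D: "compact D" and e: "\<And>z. z \<notin> D \<Longrightarrow> poly p z = poly q z"
  shows "p = q"
proof -
  have "((\<lambda>z. poly (p - q) z) \<longlongrightarrow> 0) at_top"
  proof (rule tendsto_eventually)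
    show "\<forall>\<^sub>F z in at_top. poly (p - q) z = 0"
      using eventually_notin_compact[OF D] by eventually_elim (simp add: e)
  qed
  then have "p - q = 0" by (rule poly_tendsto_0_imp_zero)
  then show ?thesis by simp
qed

text \<open>The product of \<open>V\<close> with the transform has a polynomial part; the decay
  forces it to be \<open>R\<close>, since two polynomials with a difference tending to zero agree.
  What remains is a Cauchy transform of known decay, and \<open>vanishing_moments\<close>
  applies.\<close>

lemma cauchy_remainder:
  assumes M: "finite_borel M" and D: "compact D" and v: "continuous_on D v"
    and lim: "((\<lambda>r. r ^ n * (poly V r * ct M D v r - poly R r)) \<longlongrightarrow> 0) at_top"
  shows "z \<notin> D \<Longrightarrow> poly V z * ct M D v z = ct M D (\<lambda>x. poly V x * v x) z + poly R z"
    and "p = 0 \<or> degree p < n \<Longrightarrow> (LINT x:D|M. poly p x * (poly V x * v x)) = 0"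
proof -
  have M': "sets M = sets borel" "finite_measure M" using M by (auto simp: finite_borel_def)
  have Vv: "continuous_on D (\<lambda>x. poly V x * v x)" by (intro continuous_intros v)
  obtain R0 where R0: "\<And>z. z \<notin> D \<Longrightarrow> poly V z * ct M D v z = ct M D (\<lambda>x. poly V x * v x) z + poly R0 z"
    using poly_times_ct[OF M' D v, of V] by blast
  have e: "\<forall>\<^sub>F r in at_top. poly V r * ct M D v r - poly R r = ct M D (\<lambda>x. poly V x * v x) r + poly (R0 - R) r"
    using eventually_notin_compact[OF D] by eventually_elim (simp add: R0)
  have "((\<lambda>r. poly V r * ct M D v r - poly R r) \<longlongrightarrow> 0) at_top"
  proof (rule Lim_null_comparison[OF _ tendsto_norm_zero[OF lim]])
    show "\<forall>\<^sub>F r in at_top. norm (poly V r * ct M D v r - poly R r) \<le> norm (r ^ n * (poly V r * ct M D v r - poly R r))"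
      using eventually_ge_at_top[of 1]
    proof eventually_elim
      case (elim r)
      have "1 * \<bar>poly V r * ct M D v r - poly R r\<bar> \<le> \<bar>r ^ n\<bar> * \<bar>poly V r * ct M D v r - poly R r\<bar>"
        using elim by (intro mult_right_mono) auto
      then show ?case by (simp add: abs_mult)
    qed
  qed
  from tendsto_diff[OF Lim_transform_eventually[OF this e] ct_tendsto_0[OF M' D Vv]]
  have "R0 - R = 0" by (intro poly_tendsto_0_imp_zero) simp
  then have RR: "R = R0" by simp
  show *: "poly V z * ct M D v z = ct M D (\<lambda>x. poly V x * v x) z + poly R z" if "z \<notin> D" for z
    using R0[OF that] RR by simp
  have "\<forall>\<^sub>F r in at_top. r ^ n * (poly V r * ct M D v r - poly R r) = r ^ n * ct M D (\<lambda>x. poly V x * v x) r"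
    using e by eventually_elim (simp add: RR)
  from Lim_transform_eventually[OF lim this]
  show "p = 0 \<or> degree p < n \<Longrightarrow> (LINT x:D|M. poly p x * (poly V x * v x)) = 0"
    by (rule vanishing_moments[OF M' D Vv])
qed

text \<open>\<open>R(z)\<close> is the integral of \<open>(W(z) - W(x)) / (z - x)\<close> against
  \<open>v\<close>, and at a root \<open>x0\<close> of \<open>W\<close> this quotient is
  \<open>q(x)\<close>.\<close>

lemma cauchy_remainder_at_root:
  assumes M: "finite_borel M" and D: "compact D" and v: "continuous_on D v"
    and W: "W = [:- x0, 1:] * q"
    and R: "\<And>z. z \<notin> D \<Longrightarrow> poly W z * ct M D v z = ct M D (\<lambda>x. poly W x * v x) z + poly R z"
  shows "poly R x0 = (LINT x:D|M. poly q x * v x)"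
proof -
  have M': "sets M = sets borel" "finite_measure M" using M by (auto simp: finite_borel_def)
  have qv: "continuous_on D (\<lambda>x. poly q x * v x)" by (intro continuous_intros v)
  let ?I = "LINT x:D|M. poly q x * v x"
  obtain R' where R': "\<And>z. z \<notin> D \<Longrightarrow> poly q z * ct M D v z = ct M D (\<lambda>x. poly q x * v x) z + poly R' z"
    using poly_times_ct[OF M' D v, of q] by blast
  have "poly R z = poly ([:?I:] + [:- x0, 1:] * R') z" if z: "z \<notin> D" for z
  proof -
    have "ct M D (\<lambda>x. poly W x * v x) z = ct M D (\<lambda>x. (poly q x * v x) * (1 * x + - x0)) z"
      unfolding W by (simp add: algebra_simps)
    also have "\<dots> = (1 * z + - x0) * ct M D (\<lambda>x. poly q x * v x) z - 1 * ?I"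
      by (rule ct_affine[OF M D qv z])
    finally have "ct M D (\<lambda>x. poly W x * v x) z = (z - x0) * ct M D (\<lambda>x. poly q x * v x) z - ?I" by simp
    moreover have "poly W z * ct M D v z = (z - x0) * (poly q z * ct M D v z)" unfolding W by (simp add: algebra_simps)
    ultimately show ?thesis using R[OF z] R'[OF z] by (simp add: algebra_simps)
  qed
  then have "R = [:?I:] + [:- x0, 1:] * R'" by (rule poly_eq_off_compact[OF D])
  then show ?thesis by simp
qed

definition node_poly :: "real set \<Rightarrow> real poly" where
  "node_poly Z = (\<Prod>z\<in>Z. [:- z, 1:])"

lemma poly_node_poly: "poly (node_poly Z) x = (\<Prod>z\<in>Z. x - z)"
  by (simp add: node_poly_def poly_prod)

lemma degree_node_poly [simp]: "degree (node_poly Z) = card Z"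
  by (simp add: node_poly_def degree_prod_sum_eq)

lemma coeff_node_poly [simp]: "coeff (node_poly Z) (card Z) = 1"
  using lead_coeff_prod[of "\<lambda>z. [:- z, 1:]" Z] by (simp flip: node_poly_def)

lemma node_poly_nonzero [simp]: "node_poly Z \<noteq> 0"
  using coeff_node_poly[of Z] by force

lemma node_poly_remove: "finite Z \<Longrightarrow> x \<in> Z \<Longrightarrow> node_poly Z = [:- x, 1:] * node_poly (Z - {x})"
  unfolding node_poly_def by (rule prod.remove)

lemma lagrange_integral:
  assumes M: "finite_borel M" and D: "compact D" and v: "continuous_on D v" and Z: "finite Z"
    and p: "degree p < card Z"
  shows "(LINT x:D|M. poly p x * v x) =
    (\<Sum>z\<in>Z. (LINT x:D|M. (\<Prod>y\<in>Z - {z}. (x - y) / (z - y)) * v x) * poly p z)"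
proof -
  have M': "sets M = sets borel" "finite_measure M" using M by (auto simp: finite_borel_def)
  have "(LINT x:D|M. poly p x * v x) = (LINT x:D|M. \<Sum>z\<in>Z. poly p z * ((\<Prod>y\<in>Z - {z}. (x - y) / (z - y)) * v x))"
  proof (rule set_integral_cong_compact[OF M D])
    fix x
    show "poly p x * v x = (\<Sum>z\<in>Z. poly p z * ((\<Prod>y\<in>Z - {z}. (x - y) / (z - y)) * v x))"
      by (subst lagrange_interpolation[OF Z p, of x]) (simp add: sum_distrib_right mult.assoc)
  qed
  also have "\<dots> = (\<Sum>z\<in>Z. LINT x:D|M. poly p z * ((\<Prod>y\<in>Z - {z}. (x - y) / (z - y)) * v x))"
    by (intro set_integral_sum set_integrable_compact[OF M' D] continuous_intros v) auto
  finally show ?thesis by (simp add: mult.commute)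
qed

lemma node_poly_division:
  assumes "p = 0 \<or> degree p < card Z + n"
  obtains d r where "\<And>x. poly p x = poly d x * poly (node_poly Z) x + poly r x"
    "d = 0 \<or> degree d < n" "r = 0 \<or> degree r < card Z"
proof -
  let ?W = "node_poly Z" and ?d = "p div node_poly Z" and ?r = "p mod node_poly Z"
  have pe: "poly p x = poly ?d x * poly ?W x + poly ?r x" for x
    by (metis div_mult_mod_eq poly_add poly_mult)
  have r: "?r = 0 \<or> degree ?r < card Z" using degree_mod_less[of ?W p] by simp
  have d: "?d = 0 \<or> degree ?d < n"
  proof (rule disjCI)
    assume d0: "\<not> degree ?d < n"
    show "?d = 0"
    proof (rule ccontr)
      assume nz: "?d \<noteq> 0"
      then have dd: "degree (?d * ?W) = degree ?d + card Z" by (simp add: degree_mult_eq)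
      have "degree p = degree ?d + card Z"
      proof (cases "?r = 0")
        case False
        then have "degree ?r < degree (?d * ?W)" using r dd by simp
        then show ?thesis using degree_add_eq_left[of ?r "?d * ?W"] dd by simp
      next
        case True
        then show ?thesis using dd div_mult_mod_eq[of p ?W] by simp
      qed
      then show False using assms d0 nz by auto
    qed
  qed
  show thesis by (rule that[OF pe d r])
qed

text \<open>Division by the node polynomial: the quotient has degree below \<open>n\<close> and
  drops out by orthogonality, the remainder agrees with \<open>p\<close> at the nodes and is
  integrated exactly by interpolation.\<close>

lemma gauss_quadrature:
  assumes M: "finite_borel M" and D: "compact D" and v: "continuous_on D v" and Z: "finite Z"
    and orth: "\<And>p. p = 0 \<or> degree p < n \<Longrightarrow> (LINT x:D|M. poly p x * (poly (node_poly Z) x * v x)) = 0"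
    and p: "p = 0 \<or> degree p < card Z + n"
  shows "(LINT x:D|M. poly p x * v x) =
    (\<Sum>z\<in>Z. (LINT x:D|M. (\<Prod>y\<in>Z - {z}. (x - y) / (z - y)) * v x) * poly p z)"
proof -
  have M': "sets M = sets borel" "finite_measure M" using M by (auto simp: finite_borel_def)
  let ?W = "node_poly Z"
  obtain d r where pe: "\<And>x. poly p x = poly d x * poly ?W x + poly r x"
    and d: "d = 0 \<or> degree d < n" and r: "r = 0 \<or> degree r < card Z"
    using node_poly_division[OF p] by metis
  have "(LINT x:D|M. poly p x * v x) = (LINT x:D|M. poly d x * (poly ?W x * v x) + poly r x * v x)"
    unfolding pe by (simp add: algebra_simps)
  also have "\<dots> = (LINT x:D|M. poly d x * (poly ?W x * v x)) + (LINT x:D|M. poly r x * v x)"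
    by (intro set_integral_add set_integrable_compact[OF M' D] continuous_intros v)
  also have "\<dots> = (LINT x:D|M. poly r x * v x)" using orth[OF d] by simp
  also have "\<dots> = (\<Sum>z\<in>Z. (LINT x:D|M. (\<Prod>y\<in>Z - {z}. (x - y) / (z - y)) * v x) * poly r z)"
  proof (cases "r = 0")
    case False
    then show ?thesis using r by (intro lagrange_integral[OF M D v Z]) simp
  qed (simp add: set_lebesgue_integral_def)
  also have "\<dots> = (\<Sum>z\<in>Z. (LINT x:D|M. (\<Prod>y\<in>Z - {z}. (x - y) / (z - y)) * v x) * poly p z)"
  proof (rule sum.cong)
    fix z assume "z \<in> Z"
    then have "poly ?W z = 0" using Z by (auto simp: poly_node_poly prod_zero_iff)
    then have "poly p z = poly r z" using pe[of z] by simp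
    then show "(LINT x:D|M. (\<Prod>y\<in>Z - {z}. (x - y) / (z - y)) * v x) * poly r z = (LINT x:D|M. (\<Prod>y\<in>Z - {z}. (x - y) / (z - y)) * v x) * poly p z"
      by simp
  qed simp
  finally show ?thesis .
qed

section \<open>Reduction of the complex polynomials to real ones\<close>

lemma poly_of_real_parts:
  "Re (poly Q (complex_of_real r)) = poly (map_poly Re Q) r"
  "Im (poly Q (complex_of_real r)) = poly (map_poly Im Q) r"
  by (induction Q) (auto simp: map_poly_pCons)

lemma complex_poly_real_multiple:
  fixes W :: "real poly"
  assumes "map_poly Re Q = smult (Re c) W" "map_poly Im Q = smult (Im c) W"
  shows "Q = smult c (map_poly of_real W)"
proof (rule poly_eqI)
  fix j
  have "Re (coeff Q j) = Re c * coeff W j" "Im (coeff Q j) = Im c * coeff W j"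
    using arg_cong[OF assms(1), of "\<lambda>p. coeff p j"] arg_cong[OF assms(2), of "\<lambda>p. coeff p j"]
    by (simp_all add: coeff_map_poly)
  then show "coeff Q j = coeff (smult c (map_poly of_real W)) j"
    by (intro complex_eqI) (simp_all add: coeff_map_poly)
qed

lemma poly_smult_map_of_real:
  "poly (smult c (map_poly complex_of_real W)) (of_real x) = c * of_real (poly W x)"
  "pderiv (smult c (map_poly complex_of_real W)) = smult c (map_poly complex_of_real (pderiv W))"
proof -
  have "poly (map_poly complex_of_real W) (of_real x) = of_real (poly W x)"
    by (induction W) (auto simp: map_poly_pCons)
  then show "poly (smult c (map_poly complex_of_real W)) (of_real x) = c * of_real (poly W x)" by simp
  show "pderiv (smult c (map_poly complex_of_real W)) = smult c (map_poly complex_of_real (pderiv W))"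
    by (rule poly_eqI) (simp add: coeff_pderiv coeff_map_poly)
qed

text \<open>On the real axis the transform is real, so real and imaginary parts can be taken
  coefficientwise. The order \<open>n k + 1\<close> leaves one factor \<open>1 / r\<close> after
  multiplication by \<open>r ^ n k\<close>.\<close>

lemma type_II_real_line:
  assumes t: "type_II m \<sigma> n Q P" and k: "k \<le> m" and h: "h = Re \<or> h = Im"
  shows "((\<lambda>r. r ^ n k * (poly (map_poly h Q) r * cauchy_transform (nik \<sigma> 0 k) r - poly (map_poly h (P k)) r)) \<longlongrightarrow> 0) at_top"
proof -
  define f where "f z = poly Q z * cauchy_transform (nik \<sigma> 0 k) z - poly (P k) z" for z
  have "f \<in> O[at_infinity](\<lambda>z. 1 / z ^ (n k + 1))"
    using t k unfolding type_II_def f_def by auto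
  then obtain c where c: "0 < c" "\<forall>\<^sub>F z in at_infinity. norm (f z) \<le> c * norm (1 / z ^ (n k + 1))"
    by (elim landau_o.bigE) auto
  have ev: "\<forall>\<^sub>F r in at_top. norm (f (complex_of_real r)) \<le> c * norm (1 / complex_of_real r ^ (n k + 1))"
    by (rule eventually_compose_filterlim[OF c(2)])
      (rule filterlim_mono[OF filterlim_of_real_at_infinity]; simp add: at_top_le_at_infinity)
  have h': "h (f (complex_of_real r)) = poly (map_poly h Q) r * cauchy_transform (nik \<sigma> 0 k) r - poly (map_poly h (P k)) r" for r
    using h unfolding f_def cauchy_transform_of_real by (auto simp: poly_of_real_parts)
  have hn: "\<bar>h z\<bar> \<le> norm z" for z using h abs_Re_le_cmod abs_Im_le_cmod by auto
  have "((\<lambda>r. r ^ n k * h (f (complex_of_real r))) \<longlongrightarrow> 0) at_top"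
  proof (rule Lim_null_comparison)
    show "\<forall>\<^sub>F r in at_top. norm (r ^ n k * h (f (complex_of_real r))) \<le> c / r"
      using ev eventually_gt_at_top[of 0]
    proof eventually_elim
      case (elim r)
      have "norm (r ^ n k * h (f (complex_of_real r))) \<le> r ^ n k * norm (f (complex_of_real r))"
        using elim(2) hn by (auto simp: abs_mult intro!: mult_left_mono)
      also have "\<dots> \<le> r ^ n k * (c * (1 / r ^ (n k + 1)))"
        using elim by (intro mult_left_mono) (auto simp: norm_divide norm_power norm_mult)
      also have "\<dots> = c / r" using elim(2) by (simp add: field_simps)
      finally show ?case .
    qed
    show "((\<lambda>r. c / r) \<longlongrightarrow> 0) at_top" by real_asymp
  qed
  then show ?thesis unfolding h' .
qed

section \<open>Type II denominators: zeros, uniqueness and coefficients\<close>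

context nikishin
begin

lemma zero_le_m: "0 \<le> m" by simp

lemmas generator0 = generator[OF zero_le_m]

lemma dens0:
  assumes "k \<le> m"
  shows "continuous_on (\<Delta> 0) (dens 0 k)" and "x \<in> \<Delta> 0 \<Longrightarrow> 0 < msign (nik \<sigma> 0 k) * dens 0 k x"
    and "z \<notin> \<Delta> 0 \<Longrightarrow> cauchy_transform (nik \<sigma> 0 k) z = ct (M 0) (\<Delta> 0) (dens 0 k) z"
    and "continuous_on (\<Delta> 0) g \<Longrightarrow> cs_integral (nik \<sigma> 0 k) g = (LINT x:\<Delta> 0|M 0. dens 0 k x * g x)"
  using nik_properties[OF assms le0] by blast+

definition orth :: "(nat \<Rightarrow> nat) \<Rightarrow> real poly \<Rightarrow> bool" where
  "orth n W \<longleftrightarrow> (\<forall>k\<le>m. \<forall>p. p = 0 \<or> degree p < n k \<longrightarrow>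
     (LINT x:\<Delta> 0|M 0. poly p x * (poly W x * dens 0 k x)) = 0)"

lemma orthD: "orth n W \<Longrightarrow> k \<le> m \<Longrightarrow> p = 0 \<or> degree p < n k \<Longrightarrow>
    (LINT x:\<Delta> 0|M 0. poly p x * (poly W x * dens 0 k x)) = 0"
  unfolding orth_def by blast

text \<open>The densities span, up to constants, the first level \<open>S = {}\<close> of the
  family, and this system lives on \<open>\<Delta> 0\<close>, away from \<open>D 1\<close>.\<close>

lemma orth_zeros:
  assumes W: "orth n W"
  shows "\<exists>Z\<subseteq>\<Delta> 0. finite Z \<and> card Z = mi_norm m n \<and> (\<forall>z\<in>Z. poly W z = 0)"
proof -
  obtain F \<nu> where F: "initial_family M m F \<nu>" using family_exists by blast
  then have fam: "minor_family m F \<nu>" unfolding initial_family_def by blast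
  have "\<forall>k. \<exists>c. k \<le> m \<longrightarrow> c \<noteq> 0 \<and> (\<forall>x\<in>\<Delta> 0. dens 0 k x = c * F {k} x)"
    using dens_eq_minor[OF F] by blast
  then obtain c where c: "\<And>k. k \<le> m \<Longrightarrow> c k \<noteq> 0" "\<And>k x. k \<le> m \<Longrightarrow> x \<in> \<Delta> 0 \<Longrightarrow> dens 0 k x = c k * F {k} x"
    by metis
  obtain p q where pq: "p \<le> q" "\<Delta> 0 = {p..q}" using generator0(1) by blast
  have d01: "\<Delta> 0 \<inter> D 1 = {}" unfolding D_def using adjacent[of 0] by auto
  have FF: "F {l} x = dens 0 l x / c l" if "l \<le> m" "x \<in> \<Delta> 0" for l x
    using c(1)[OF that(1)] c(2)[OF that] by simp
  have zeros: "(LINT x:{p..q}|M 0. poly W x * (\<Sum>l\<in>{..m} - {}. poly (P l) x * F (insert l {}) x)) = 0"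
    if P: "\<And>l. l \<in> {..m} - {} \<Longrightarrow> P l = 0 \<or> degree (P l) < n l" for P :: "nat \<Rightarrow> real poly"
  proof -
    have "(LINT x:\<Delta> 0|M 0. poly W x * (\<Sum>l\<in>{..m} - {}. poly (P l) x * F (insert l {}) x)) =
      (LINT x:\<Delta> 0|M 0. \<Sum>l\<le>m. 1 / c l * (poly (P l) x * (poly W x * dens 0 l x)))"
      by (rule set_integral_cong_compact[OF generator0(10,5)]) (simp add: FF sum_distrib_left algebra_simps)
    also have "\<dots> = (\<Sum>l\<le>m. LINT x:\<Delta> 0|M 0. 1 / c l * (poly (P l) x * (poly W x * dens 0 l x)))"
      by (intro set_integral_sum set_integrable_compact[OF generator0(8,9,5)] continuous_intros dens0(1)) auto
    also have "\<dots> = (\<Sum>l\<le>m. 1 / c l * 0)"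
    proof (rule sum.cong)
      fix l assume l: "l \<in> {..m}"
      show "(LINT x:\<Delta> 0|M 0. 1 / c l * (poly (P l) x * (poly W x * dens 0 l x))) = 1 / c l * 0"
        unfolding set_integral_mult_right using orthD[OF W _ P[of l]] l by simp
    qed simp
    finally show ?thesis unfolding pq(2) by simp
  qed
  have "\<exists>Z\<subseteq>{p..q}. finite Z \<and> card Z = (\<Sum>l\<in>{..m} - {}. n l) \<and> (\<forall>z\<in>Z. poly W z = 0)"
  proof (rule at_system_orthogonal_zeros[OF fam _ pq(1)])
    show "{p..q} \<inter> D (Suc (card {})) = {}" using d01 pq(2) by simp
    show "fat (M 0) {p..q}" using generator0(2) pq(2) by simp
    show "continuous_on {p..q} (poly W)" by (intro continuous_intros)
  qed (use zeros in auto)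
  then show ?thesis unfolding pq(2) mi_norm_def by simp
qed

text \<open>The difference is orthogonal too, hence has \<open>mi_norm m n\<close> zeros, but its
  degree is smaller because the top coefficients cancel.\<close>

lemma orth_unique:
  assumes V: "orth n V" "degree V \<le> mi_norm m n" and W: "orth n W" "degree W \<le> mi_norm m n"
    and c: "coeff V (mi_norm m n) = coeff W (mi_norm m n)"
  shows "V = W"
proof -
  have "orth n (V - W)"
    unfolding orth_def
  proof (intro allI impI)
    fix k and p :: "real poly" assume k: "k \<le> m" and p: "p = 0 \<or> degree p < n k"
    have "(LINT x:\<Delta> 0|M 0. poly p x * (poly (V - W) x * dens 0 k x)) =
      (LINT x:\<Delta> 0|M 0. poly p x * (poly V x * dens 0 k x) - poly p x * (poly W x * dens 0 k x))"
      by (simp add: algebra_simps)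
    also have "\<dots> = 0 - 0"
      by (subst set_integral_diff)
        (auto intro!: set_integrable_compact[OF generator0(8,9,5)] continuous_intros dens0(1)[OF k]
          simp: orthD[OF V(1) k p] orthD[OF W(1) k p])
    finally show "(LINT x:\<Delta> 0|M 0. poly p x * (poly (V - W) x * dens 0 k x)) = 0" by simp
  qed
  from orth_zeros[OF this] obtain Z where Z: "card Z = mi_norm m n" "\<And>z. z \<in> Z \<Longrightarrow> poly (V - W) z = 0"
    by blast
  show ?thesis
    by (rule poly_eqI_degree_lead_coeff[OF c, of Z]) (use Z V W in auto)
qed

lemma orth_smult: "orth n W \<Longrightarrow> orth n (smult c W)"
proof -
  have "(LINT x:\<Delta> 0|M 0. poly p x * (poly (smult c W) x * dens 0 k x)) =
    c * (LINT x:\<Delta> 0|M 0. poly p x * (poly W x * dens 0 k x))" for p k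
    by (subst set_integral_mult_right[symmetric]) (simp add: algebra_simps)
  then show "orth n W \<Longrightarrow> orth n (smult c W)" unfolding orth_def by simp
qed

lemma orth_node_poly:
  assumes W: "orth n W" "W \<noteq> 0" "degree W \<le> mi_norm m n"
  obtains Z where "Z \<subseteq> \<Delta> 0" "finite Z" "card Z = mi_norm m n" "orth n (node_poly Z)"
    "\<And>V. orth n V \<Longrightarrow> degree V \<le> mi_norm m n \<Longrightarrow> V = smult (coeff V (mi_norm m n)) (node_poly Z)"
proof -
  obtain Z where Z: "Z \<subseteq> \<Delta> 0" "finite Z" "card Z = mi_norm m n" "\<And>z. z \<in> Z \<Longrightarrow> poly W z = 0"
    using orth_zeros[OF W(1)] by blast
  let ?c = "coeff W (mi_norm m n)"
  have WZ: "W = smult ?c (node_poly Z)"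
    by (rule poly_eqI_degree_lead_coeff[where n = "mi_norm m n" and A = Z])
      (use Z W(3) coeff_node_poly[of Z] in \<open>auto simp: poly_node_poly\<close>)
  then have c: "?c \<noteq> 0" using W(2) by (metis smult_0_left)
  have o: "orth n (node_poly Z)" using orth_smult[OF W(1), of "1 / ?c"] c by (subst (asm) WZ) simp
  show thesis
  proof (rule that[OF Z(1-3) o])
    fix V assume V: "orth n V" "degree V \<le> mi_norm m n"
    show "V = smult (coeff V (mi_norm m n)) (node_poly Z)"
      by (rule orth_unique[OF V orth_smult[OF o]]) (use Z(3) coeff_node_poly[of Z] in auto)
  qed
qed

text \<open>The interpolatory weight, that is the integral of the Lagrange basis polynomial of the
  node; \<open>type_II_nodes\<close> identifies it with the coefficient from the partial fractions
  of \<open>P k / Q\<close>.\<close>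

definition node_weight :: "nat \<Rightarrow> real set \<Rightarrow> real \<Rightarrow> real" where
  "node_weight k Z x = (LINT t:\<Delta> 0|M 0. (\<Prod>y\<in>Z - {x}. (t - y) / (x - y)) * dens 0 k t)"

text \<open>Real and imaginary part of \<open>Q\<close> are both orthogonal, hence multiples of one
  node polynomial \<open>W\<close>, and \<open>Q\<close> is \<open>W\<close> times a complex
  constant. \<open>P k\<close> is the same constant times the polynomial part belonging to
  \<open>W\<close>, so the constant cancels in the coefficients.\<close>

lemma type_II_nodes:
  assumes t: "type_II m \<sigma> n Q P"
  shows "nodes Q \<subseteq> \<Delta> 0" "finite (nodes Q)" "card (nodes Q) = mi_norm m n" "orth n (node_poly (nodes Q))"
    "k \<le> m \<Longrightarrow> x \<in> nodes Q \<Longrightarrow> quad_coeff Q (P k) x = of_real (node_weight k (nodes Q) x)"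
proof -
  let ?N = "mi_norm m n"
  have Q: "Q \<noteq> 0" "degree Q \<le> ?N" using t unfolding type_II_def by auto
  have lim: "((\<lambda>r. r ^ n k * (poly (map_poly h Q) r * ct (M 0) (\<Delta> 0) (dens 0 k) r - poly (map_poly h (P k)) r)) \<longlongrightarrow> 0) at_top"
    if k: "k \<le> m" and h: "h = Re \<or> h = Im" for h k
  proof (rule Lim_transform_eventually[OF type_II_real_line[OF t k h]])
    show "\<forall>\<^sub>F r in at_top. r ^ n k * (poly (map_poly h Q) r * cauchy_transform (nik \<sigma> 0 k) r - poly (map_poly h (P k)) r) =
       r ^ n k * (poly (map_poly h Q) r * ct (M 0) (\<Delta> 0) (dens 0 k) r - poly (map_poly h (P k)) r)"
      using eventually_notin_compact[OF generator0(5)] by eventually_elim (simp add: dens0(3)[OF k])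
  qed
  note rem = cauchy_remainder[OF generator0(10,5) dens0(1) lim]
  have Qo: "orth n (map_poly h Q)" if h: "h = Re \<or> h = Im" for h
    unfolding orth_def using rem(2)[OF _ _ h] by blast
  have Qd: "degree (map_poly h Q) \<le> ?N" if "h = Re \<or> h = Im" for h :: "complex \<Rightarrow> real"
    using that Q(2) by (intro degree_le) (auto simp: coeff_map_poly coeff_eq_0)
  obtain h where h: "h = Re \<or> h = Im" "map_poly h Q \<noteq> 0"
  proof -
    have "map_poly Re Q \<noteq> 0 \<or> map_poly Im Q \<noteq> 0"
      using complex_poly_real_multiple[of Q 0 0] Q(1) by auto
    then show thesis using that by auto
  qed
  obtain Z where Z: "Z \<subseteq> \<Delta> 0" "finite Z" "card Z = ?N" "orth n (node_poly Z)"
    and ZV: "\<And>V. orth n V \<Longrightarrow> degree V \<le> ?N \<Longrightarrow> V = smult (coeff V ?N) (node_poly Z)"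
    using orth_node_poly[OF Qo[OF h(1)] h(2) Qd[OF h(1)]] by blast
  define W where "W = node_poly Z"
  define c where "c = coeff Q ?N"
  have Qh: "map_poly h Q = smult (h c) W" if "h = Re \<or> h = Im" for h
    using ZV[OF Qo[OF that] Qd[OF that]] that unfolding W_def c_def by (auto simp: coeff_map_poly)
  have Qc: "Q = smult c (map_poly of_real W)"
    by (rule complex_poly_real_multiple) (simp_all add: Qh)
  have c0: "c \<noteq> 0" using Qc Q(1) by auto
  have nodes: "nodes Q = Z"
    unfolding nodes_def Qc poly_smult_map_of_real using Z(2) c0 by (auto simp: W_def poly_node_poly)
  show "nodes Q \<subseteq> \<Delta> 0" "finite (nodes Q)" "card (nodes Q) = ?N" "orth n (node_poly (nodes Q))"
    unfolding nodes using Z by auto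
  show "quad_coeff Q (P k) x = of_real (node_weight k (nodes Q) x)" if k: "k \<le> m" and x: "x \<in> nodes Q"
  proof -
    have x: "x \<in> Z" using x nodes by simp
    let ?v = "dens 0 k" and ?ct = "ct (M 0) (\<Delta> 0)"
    obtain R where R: "\<And>z. z \<notin> \<Delta> 0 \<Longrightarrow> poly W z * ?ct ?v z = ?ct (\<lambda>x. poly W x * ?v x) z + poly R z"
      using poly_times_ct[OF generator0(8,9,5) dens0(1)[OF k], of W] by blast
    have Ph: "map_poly h (P k) = smult (h c) R" if h: "h = Re \<or> h = Im" for h
    proof (rule poly_eq_off_compact[OF generator0(5)])
      fix z assume z: "z \<notin> \<Delta> 0"
      have "h c * (poly W z * ?ct ?v z) = poly (map_poly h Q) z * ?ct ?v z" unfolding Qh[OF h] by simp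
      also have "\<dots> = ?ct (\<lambda>x. poly (map_poly h Q) x * ?v x) z + poly (map_poly h (P k)) z"
        by (rule rem(1)[OF k k h z])
      also have "?ct (\<lambda>x. poly (map_poly h Q) x * ?v x) z = h c * ?ct (\<lambda>x. poly W x * ?v x) z"
        unfolding Qh[OF h] ct_cmult[symmetric] by (simp add: mult.assoc)
      finally show "poly (map_poly h (P k)) z = poly (smult (h c) R) z"
        using R[OF z] by (simp add: algebra_simps)
    qed
    have Pc: "P k = smult c (map_poly of_real R)"
      by (rule complex_poly_real_multiple) (simp_all add: Ph)
    define q where "q = node_poly (Z - {x})"
    have Wq: "W = [:- x, 1:] * q" unfolding W_def q_def by (rule node_poly_remove[OF Z(2) x])
    have Rx: "poly R x = (LINT t:\<Delta> 0|M 0. poly q t * ?v t)"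
      by (rule cauchy_remainder_at_root[OF generator0(10,5) dens0(1)[OF k] Wq R])
    have dW: "poly (pderiv W) x = poly q x" unfolding Wq pderiv_mult poly_add poly_mult by (simp add: pderiv_pCons)
    have "quad_coeff Q (P k) x = c * of_real (poly R x) / (c * of_real (poly q x))"
      unfolding quad_coeff_def by (subst Qc, subst Pc) (simp only: poly_smult_map_of_real dW)
    also have "\<dots> = of_real (poly R x / poly q x)" using c0 by simp
    also have "poly R x / poly q x = node_weight k Z x"
      unfolding Rx node_weight_def q_def poly_node_poly prod_dividef by simp
    finally show ?thesis unfolding nodes .
  qed
qed

end

section \<open>Signs of the quadrature weights\<close>

lemma continuous_on_ratio:
  fixes f g :: "real \<Rightarrow> real"
  assumes "continuous_on D f" "continuous_on D g" "\<And>x. x \<in> D \<Longrightarrow> g x \<noteq> 0"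
  shows "continuous_on D (\<lambda>x. f x / g x)"
  using assms by (intro continuous_on_divide) auto

lemma poly_node_poly_nonzero: "finite Z \<Longrightarrow> x \<notin> Z \<Longrightarrow> poly (node_poly Z) x \<noteq> 0"
  by (auto simp: poly_node_poly)

lemma ct_pairing:
  assumes M: "finite_borel M" and D: "compact D" and w: "continuous_on D w"
    and N: "finite_borel N" and E: "compact E" and g: "continuous_on E g" and DE: "D \<inter> E = {}"
  shows "(LINT x:E|N. ct M D w x * g x) = (LINT t:D|M. w t * - ct N E g t)"
proof -
  have "(LINT x:E|N. ct M D w x * g x) = (LINT x:E|N. (LINT t:D|M. w t / (x - t) * g x))"
    unfolding ct_def by (simp only: set_integral_mult_left)
  also have "\<dots> = (LINT t:D|M. (LINT x:E|N. w t / (x - t) * g x))"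
  proof (rule set_integral_Fubini[OF finite_borelD[OF N] E finite_borelD[OF M] D])
    have "continuous_on (E \<times> D) (\<lambda>p. w (snd p) / (fst p - snd p) * g (fst p))"
      using DE by (intro continuous_intros continuous_on_compose2[OF w] continuous_on_compose2[OF g]) auto
    then show "continuous_on (E \<times> D) (\<lambda>(x, t). w t / (x - t) * g x)" by (simp add: case_prod_beta)
  qed
  also have "\<dots> = (LINT t:D|M. w t * - ct N E g t)"
  proof (rule set_integral_cong_compact[OF M D])
    fix t
    have "(LINT x:E|N. w t / (x - t) * g x) = (LINT x:E|N. (- w t) * (g x / (t - x)))"
      by (rule set_integral_cong_compact[OF N E]) (simp flip: divide_minus_right)
    also have "\<dots> = w t * - ct N E g t" unfolding ct_def set_integral_mult_right by simp
    finally show "(LINT x:E|N. w t / (x - t) * g x) = w t * - ct N E g t" .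
  qed
  finally show ?thesis .
qed

text \<open>Division of \<open>h\<close> by the polynomial of \<open>Y\<close>: the quotient is
  treated by \<open>orth\<close>. The remainder over that polynomial splits into partial fractions,
  each of which integrates to a value of the transform at a point of \<open>Y\<close>.\<close>

lemma orthogonal_quotient:
  assumes M: "finite_borel M" and D: "compact D" and w: "continuous_on D w"
    and Y: "finite Y" "Y \<inter> D = {}" and ct: "\<And>\<xi>. \<xi> \<in> Y \<Longrightarrow> ct M D w \<xi> = 0"
    and orth: "\<And>p. p = 0 \<or> degree p < n \<Longrightarrow> (LINT x:D|M. poly p x * w x) = 0"
    and h: "h = 0 \<or> degree h < card Y + n"
  shows "(LINT x:D|M. poly h x * (w x / poly (node_poly Y) x)) = 0"
proof -
  have M': "sets M = sets borel" "finite_measure M" using M by (auto simp: finite_borel_def)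
  let ?W = "node_poly Y"
  obtain d r where he: "\<And>x. poly h x = poly d x * poly ?W x + poly r x"
    and d: "d = 0 \<or> degree d < n" and r: "r = 0 \<or> degree r < card Y"
    using node_poly_division[OF h] by metis
  have nY: "x \<notin> Y" if "x \<in> D" for x using that Y(2) by auto
  have nz: "poly ?W x \<noteq> 0" if "x \<in> D" for x using poly_node_poly_nonzero[OF Y(1) nY[OF that]] .
  have wx: "set_integrable M D (\<lambda>x. w x / (x - \<xi>))" if "\<xi> \<in> Y" for \<xi>
    using that Y(2) by (intro set_integrable_compact[OF M' D] continuous_on_ratio w continuous_intros) auto
  have "(LINT x:D|M. poly h x * (w x / poly ?W x)) = (LINT x:D|M. poly d x * w x + poly r x / poly ?W x * w x)"
    by (rule set_integral_cong_compact[OF M D]) (simp add: he nz add_divide_distrib ring_distribs)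
  also have "\<dots> = (LINT x:D|M. poly d x * w x) + (LINT x:D|M. poly r x / poly ?W x * w x)"
    by (intro set_integral_add set_integrable_compact[OF M' D] continuous_on_mult continuous_on_ratio w continuous_intros nz)
  also have "(LINT x:D|M. poly r x / poly ?W x * w x) = 0"
  proof (cases "r = 0")
    case False
    then have dr: "degree r < card Y" using r by simp
    have "(LINT x:D|M. poly r x / poly ?W x * w x) =
      (LINT x:D|M. \<Sum>\<xi>\<in>Y. poly r \<xi> / (\<Prod>y\<in>Y - {\<xi>}. \<xi> - y) * (w x / (x - \<xi>)))"
    proof (rule set_integral_cong_compact[OF M D])
      fix x assume "x \<in> D"
      from partial_fractions[OF Y(1) dr nY[OF this]]
      have "poly r x / poly ?W x = (\<Sum>\<xi>\<in>Y. poly r \<xi> / ((\<Prod>y\<in>Y - {\<xi>}. \<xi> - y) * (x - \<xi>)))"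
        by (simp add: poly_node_poly)
      then show "poly r x / poly ?W x * w x = (\<Sum>\<xi>\<in>Y. poly r \<xi> / (\<Prod>y\<in>Y - {\<xi>}. \<xi> - y) * (w x / (x - \<xi>)))"
        by (simp add: sum_distrib_right)
    qed
    also have "\<dots> = (\<Sum>\<xi>\<in>Y. LINT x:D|M. poly r \<xi> / (\<Prod>y\<in>Y - {\<xi>}. \<xi> - y) * (w x / (x - \<xi>)))"
      by (intro set_integral_sum set_integrable_mult_right wx)
    also have "\<dots> = (\<Sum>\<xi>\<in>Y. 0)"
    proof (rule sum.cong)
      fix \<xi> assume \<xi>: "\<xi> \<in> Y"
      have "(LINT x:D|M. w x / (x - \<xi>)) = (LINT x:D|M. - (w x / (\<xi> - x)))"
        by (rule set_integral_cong_compact[OF M D]) (simp flip: divide_minus_right)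
      also have "\<dots> = - ct M D w \<xi>" unfolding ct_def set_lebesgue_integral_def by simp
      finally have "(LINT x:D|M. w x / (x - \<xi>)) = 0" using ct[OF \<xi>] by simp
      then show "(LINT x:D|M. poly r \<xi> / (\<Prod>y\<in>Y - {\<xi>}. \<xi> - y) * (w x / (x - \<xi>))) = 0"
        by (subst set_integral_mult_right) simp
    qed simp
    finally show ?thesis by simp
  qed (simp add: set_lebesgue_integral_def)
  finally show ?thesis using orth[OF d] by simp
qed

text \<open>With \<open>q = node_poly (Z - {x0})\<close>, the polynomial \<open>q W - \<kappa> q\<^sup>2\<close>, \<open>W = node_poly Y\<close>, is a multiple of
  \<open>node_poly Z\<close> for the right \<open>\<kappa>\<close>, so that \<open>\<integral> q v = \<kappa> \<integral> q\<^sup>2 v / W\<close>.\<close>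

lemma positive_node_integral:
  assumes M: "fat M D" and D: "compact D" and v: "continuous_on D v" and s: "\<And>x. x \<in> D \<Longrightarrow> 0 < s * v x"
    and Z: "finite Z" "Z \<subseteq> D" "x0 \<in> Z" and Y: "finite Y" "card Y \<le> card Z"
    and e: "\<And>x. x \<in> D \<Longrightarrow> 0 < e * poly (node_poly Y) x"
    and orth: "\<And>h. h = 0 \<or> degree h < card Z \<Longrightarrow>
       (LINT x:D|M. poly h x * (poly (node_poly Z) x * v x / poly (node_poly Y) x)) = 0"
  shows "0 < s * ((LINT x:D|M. poly (node_poly (Z - {x0})) x * v x) / poly (node_poly (Z - {x0})) x0)"
proof -
  note fb = fat_finite_borel[OF M]
  have M': "sets M = sets borel" "finite_measure M" using M by (auto simp: fat_def)
  define q where "q = node_poly (Z - {x0})"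
  define Wk where "Wk = node_poly Y"
  have nz: "poly Wk x \<noteq> 0" if "x \<in> D" for x using e[OF that] unfolding Wk_def by auto
  have qx: "poly q x0 \<noteq> 0" unfolding q_def using Z by (intro poly_node_poly_nonzero) auto
  \<comment> \<open>Chosen so that \<open>Wk - \<kappa> q\<close> vanishes at \<open>x0\<close>;
    after multiplication by \<open>q\<close> it is then divisible by the whole node
    polynomial.\<close>
  define \<kappa> where "\<kappa> = poly Wk x0 / poly q x0"
  have "poly (Wk - smult \<kappa> q) x0 = 0" unfolding \<kappa>_def using qx by simp
  then obtain R where R: "Wk - smult \<kappa> q = [:- x0, 1:] * R" unfolding poly_eq_0_iff_dvd by (rule dvdE)
  have W: "node_poly Z = [:- x0, 1:] * q" unfolding q_def by (rule node_poly_remove[OF Z(1,3)])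
  have "R = 0 \<or> degree R < card Z"
  proof (rule disjCI)
    assume d: "\<not> degree R < card Z"
    show "R = 0"
    proof (rule ccontr)
      assume "R \<noteq> 0"
      then have "degree (Wk - smult \<kappa> q) = Suc (degree R)" unfolding R by (subst degree_mult_eq) auto
      moreover have "degree (Wk - smult \<kappa> q) \<le> card Z"
        using Y(2) card_Diff1_le[of Z x0] by (intro degree_diff_le order.trans[OF degree_smult_le]) (auto simp: Wk_def q_def)
      ultimately show False using d by simp
    qed
  qed
  note 0 = orth[OF this, folded Wk_def]
  have key: "poly q x * v x = poly R x * (poly (node_poly Z) x * v x / poly Wk x) + \<kappa> * ((poly q x)\<^sup>2 * v x / poly Wk x)"
    if "x \<in> D" for x
  proof -
    have "poly Wk x - \<kappa> * poly q x = (x - x0) * poly R x"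
      using arg_cong[OF R, of "\<lambda>p. poly p x"] by (simp add: algebra_simps)
    then have "poly q x * poly Wk x = poly R x * ((x - x0) * poly q x) + \<kappa> * (poly q x)\<^sup>2"
      by (simp add: power2_eq_square) (metis (no_types, opaque_lifting) diff_add_cancel distrib_left mult.commute mult.left_commute)
    moreover have "poly q x * v x = (poly q x * poly Wk x) * v x / poly Wk x" using nz[OF that] by simp
    ultimately have eq: "poly q x * v x = (poly R x * ((x - x0) * poly q x) + \<kappa> * (poly q x)\<^sup>2) * v x / poly Wk x"
      by simp
    note eq
    also have "(poly R x * ((x - x0) * poly q x) + \<kappa> * (poly q x)\<^sup>2) * v x / poly Wk x = poly R x * ((x - x0) * poly q x * v x / poly Wk x) + \<kappa> * ((poly q x)\<^sup>2 * v x / poly Wk x)"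
      by (simp add: add_divide_distrib distrib_right mult.assoc)
    also have "(x - x0) * poly q x = poly (node_poly Z) x" unfolding W by (simp add: algebra_simps)
    finally show ?thesis .
  qed
  let ?I = "LINT x:D|M. (poly q x)\<^sup>2 * v x / poly Wk x"
  have "(LINT x:D|M. poly q x * v x) = (LINT x:D|M. poly R x * (poly (node_poly Z) x * v x / poly Wk x) + \<kappa> * ((poly q x)\<^sup>2 * v x / poly Wk x))"
    by (rule set_integral_cong_compact[OF fb D key])
  also have "\<dots> = (LINT x:D|M. poly R x * (poly (node_poly Z) x * v x / poly Wk x)) + (LINT x:D|M. \<kappa> * ((poly q x)\<^sup>2 * v x / poly Wk x))"
    by (intro set_integral_add set_integrable_compact[OF M' D] continuous_on_mult[OF continuous_on_const]
        continuous_on_mult[OF continuous_on_poly] continuous_on_ratio continuous_intros v nz)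
  finally have I: "(LINT x:D|M. poly q x * v x) = \<kappa> * ?I"
    unfolding 0 set_integral_mult_right by (simp only: add_0)
  have "0 < (LINT x:D|M. (s * e) * ((poly q x)\<^sup>2 * v x / poly Wk x))"
  proof (rule set_integral_pos_fat[OF M D])
    have pos: "0 < s * e * (v x / poly Wk x)" if "x \<in> D" for x
    proof -
      have "s * e * (v x / poly Wk x) = (s * v x) * (e * poly Wk x) / (poly Wk x)\<^sup>2"
        using nz[OF that] by (simp add: power2_eq_square field_simps)
      then show ?thesis using s[OF that] e[OF that] nz[OF that] by (simp add: Wk_def)
    qed
    have eq: "(s * e) * ((poly q x)\<^sup>2 * v x / poly Wk x) = (poly q x)\<^sup>2 * (s * e * (v x / poly Wk x))" for x by simp
    show "0 \<le> (s * e) * ((poly q x)\<^sup>2 * v x / poly Wk x)" if "x \<in> D" for x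
      unfolding eq by (rule mult_nonneg_nonneg[OF zero_le_power2 less_imp_le[OF pos[OF that]]])
    have "{x \<in> D. (s * e) * ((poly q x)\<^sup>2 * v x / poly Wk x) = 0} \<subseteq> {x. poly q x = 0}"
      unfolding eq using pos by force
    then show "finite {x \<in> D. (s * e) * ((poly q x)\<^sup>2 * v x / poly Wk x) = 0}"
      by (rule finite_subset) (simp add: poly_roots_finite q_def)
    show "continuous_on D (\<lambda>x. (s * e) * ((poly q x)\<^sup>2 * v x / poly Wk x))"
      by (intro continuous_on_mult[OF continuous_on_const] continuous_on_ratio continuous_intros v nz)
  qed
  then have "0 < (s * e) * ?I" by (subst (asm) set_integral_mult_right)
  moreover have "0 < e * poly Wk x0" using e[of x0] Z unfolding Wk_def by auto
  ultimately have "0 < ((s * e) * ?I) * (e * poly Wk x0)" by (rule mult_pos_pos)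
  then have p: "0 < e\<^sup>2 * (s * (?I * poly Wk x0))" by (simp add: power2_eq_square algebra_simps)
  then have "0 < s * (?I * poly Wk x0)" by (metis zero_less_mult_iff not_less zero_le_power2)
  then have "0 < s * (?I * poly Wk x0) / (poly q x0)\<^sup>2" using qx by simp
  then show ?thesis unfolding q_def[symmetric] I \<kappa>_def by (simp add: power2_eq_square algebra_simps)
qed

context nikishin
begin

lemma mi_norm_step:
  assumes "k \<le> m"
  shows "(\<Sum>l\<in>{..m} - {k}. n l) + n k = mi_norm m n"
  unfolding mi_norm_def using assms by (subst sum.remove[of "{..m}" k]) auto

text \<open>The remainder function \<open>\<Psi>\<close> is orthogonal on \<open>D 1\<close>, with
  respect to \<open>\<nu> {k}\<close>, to the AT system with base set \<open>{k}\<close>; exchanging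
  the integrals turns this into orthogonality of \<open>W\<close>. The particular multi-index
  matters because the ratios of densities contain an affine part, which must not push the degrees
  beyond those allowed for index \<open>k\<close>.\<close>

lemma remainder_zeros:
  assumes W: "orth (step_index n) W" and k: "k \<le> m"
  shows "\<exists>Y. finite Y \<and> Y \<inter> \<Delta> 0 = {} \<and> card Y + step_index n k = mi_norm m (step_index n) \<and>
    (\<forall>\<xi>\<in>Y. ct (M 0) (\<Delta> 0) (\<lambda>t. poly W t * dens 0 k t) \<xi> = 0)"
proof (cases "m = 0")
  \<comment> \<open>There is no second interval; the only index is \<open>k = 0\<close>, no zeros
    are required and \<open>Y\<close> is empty.\<close>
  case True
  then show ?thesis using k by (intro exI[of _ "{}"]) (auto simp: mi_norm_def)
next
  case False
  let ?n = "step_index n" and ?v = "dens 0 k"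
  define w where "w = (\<lambda>t. poly W t * ?v t)"
  obtain F \<nu> where F: "initial_family M m F \<nu>" using family_exists by blast
  then have fam: "minor_family m F \<nu>" and F0: "F {} = (\<lambda>_. 1)" unfolding initial_family_def by auto
  have "\<forall>k. \<exists>c. k \<le> m \<longrightarrow> c \<noteq> 0 \<and> (\<forall>x\<in>\<Delta> 0. dens 0 k x = c * F {k} x)"
    using dens_eq_minor[OF F] by blast
  then obtain c where c: "\<And>k. k \<le> m \<Longrightarrow> c k \<noteq> 0" "\<And>k x. k \<le> m \<Longrightarrow> x \<in> \<Delta> 0 \<Longrightarrow> dens 0 k x = c k * F {k} x"
    by metis
  have D1: "D 1 = \<Delta> 1" unfolding D_def using False by auto
  obtain p q where pq: "p \<le> q" "D 1 = {p..q}" using generator(1)[of 1] False D1 by auto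
  have d01: "\<Delta> 0 \<inter> D 1 = {}" unfolding D1 using adjacent[of 0] False by auto
  have d12: "D 1 \<inter> D 2 = {}" using disjoint[of 1] by (simp add: numeral_2_eq_2)
  have wc: "continuous_on (\<Delta> 0) w" unfolding w_def by (intro continuous_intros dens0(1)[OF k])
  define \<Psi> where "\<Psi> = ct (M 0) (\<Delta> 0) w"
  have \<Psi>c: "continuous_on (D 1) \<Psi>" unfolding \<Psi>_def
    by (rule ct_continuous_on[OF generator0(10,5) wc]) (use d01 in auto)
  have km: "{k} \<noteq> {..m}" using False by (metis atMost_iff le0 order_refl singletonD)
  have fatk: "fat (\<nu> {k}) (D 1)"
    using minor_familyD(4)[OF fam, of "{k}"] k km by auto
  note fbk = fat_finite_borel[OF fatk]
  have cD1: "compact (D 1)" by (rule compact_D)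
  have Fkl: "continuous_on (D 1) (F {k, l})" if "l \<le> m" "l \<noteq> k" for l
    using minor_familyD(1)[OF fam, of "{k, l}"] that k d12
    by (auto simp: numeral_2_eq_2 elim!: continuous_on_subset)
  have one: "(LINT x:D 1|\<nu> {k}. \<Psi> x * (poly P x * F {k, l} x)) = 0"
    if l: "l \<le> m" "l \<noteq> k" and P: "P = 0 \<or> degree P < ?n l" for l P
  proof -
    have "exch F \<nu> {} k l" using minor_familyD(5)[OF fam] k l by auto
    then obtain a b where ab: "\<And>z. z \<notin> D 1 \<Longrightarrow> F {l} z / F {k} z = a * z + b + sg k l * ct (\<nu> {k}) (D 1) (F {k, l}) z"
      unfolding exch_def F0 by auto
    note rc = ratio_coefficients[OF _ _ _ cD1 minor_familyD(3)[OF fam] minor_familyD(3)[OF fam] fbk Fkl[OF l], of "{}" k l a b "sg k l"]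
    \<comment> \<open>Case distinction at infinity for \<open>S = {}\<close>: only the label 0 is
      not larger than \<open>card S\<close>. So the slope occurs only for \<open>l = 0\<close> and
      \<open>k > 0\<close>, where the degree may rise from \<open>n - 1\<close> to \<open>n\<close>,
      and the constant is absent exactly where \<open>P\<close> may have degree \<open>n\<close>
      while only degrees below \<open>n\<close> are allowed for \<open>k = 0\<close>.\<close>
    have a0: "a \<noteq> 0 \<Longrightarrow> l = 0 \<and> 0 < k" and b0: "k = 0 \<Longrightarrow> 0 < l \<Longrightarrow> b = 0"
      using rc ab k l by auto
    obtain R where R: "R = 0 \<or> degree R < degree P"
      and PR: "\<And>z. z \<notin> D 1 \<Longrightarrow> poly P z * ct (\<nu> {k}) (D 1) (F {k, l}) z = ct (\<nu> {k}) (D 1) (\<lambda>x. poly P x * F {k, l} x) z + poly R z"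
      using poly_times_ct[OF finite_borelD[OF fbk] cD1 Fkl[OF l], of P] by blast
    have int: "set_integrable (M 0) (\<Delta> 0) (\<lambda>t. poly p t * (poly W t * dens 0 j t))" if "j \<le> m" for p j
      by (intro set_integrable_compact[OF generator0(8,9,5)] continuous_intros dens0(1) that)
    have PFc: "continuous_on (D 1) (\<lambda>x. poly P x * F {k, l} x)" by (intro continuous_intros Fkl[OF l])
    have "(LINT x:D 1|\<nu> {k}. \<Psi> x * (poly P x * F {k, l} x)) =
      (LINT t:\<Delta> 0|M 0. w t * - ct (\<nu> {k}) (D 1) (\<lambda>x. poly P x * F {k, l} x) t)"
      unfolding \<Psi>_def by (rule ct_pairing[OF generator0(10,5) wc fbk cD1 PFc d01])
    also have "\<dots> = (LINT t:\<Delta> 0|M 0. - (sg k l * c k / c l) * (poly P t * (poly W t * dens 0 l t)) +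
        (sg k l * (poly (P * [:b, a:]) t * (poly W t * ?v t)) + poly R t * (poly W t * ?v t)))"
    proof (rule set_integral_cong_compact[OF generator0(10,5)])
      fix t assume t: "t \<in> \<Delta> 0"
      then have t1: "t \<notin> D 1" using d01 by auto
      have s2: "sg k l * sg k l = 1" by (simp add: sg_def)
      have "sg k l * (F {l} t / F {k} t - (a * t + b)) = (sg k l * sg k l) * ct (\<nu> {k}) (D 1) (F {k, l}) t"
        unfolding ab[OF t1] by (simp add: algebra_simps)
      then have ctk: "ct (\<nu> {k}) (D 1) (F {k, l}) t = sg k l * (F {l} t / F {k} t - (a * t + b))" unfolding s2 by simp
      have Fk: "F {k} t \<noteq> 0" using minor_familyD(2)[OF fam, of "{k}" t] k t1 by auto
      have vF: "?v t * (F {l} t / F {k} t) = c k / c l * dens 0 l t"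
        unfolding c(2)[OF k t] c(2)[OF l(1) t] using Fk c(1)[OF l(1)] by simp
      have "w t * - ct (\<nu> {k}) (D 1) (\<lambda>x. poly P x * F {k, l} x) t =
        - (poly W t * ?v t * (poly P t * (sg k l * (F {l} t / F {k} t - (a * t + b))) - poly R t))"
        using PR[OF t1] unfolding ctk w_def by simp
      also have "\<dots> = - sg k l * poly P t * poly W t * (?v t * (F {l} t / F {k} t)) +
        (sg k l * (poly P t * (a * t + b) * (poly W t * ?v t)) + poly R t * (poly W t * ?v t))"
        by (simp only: ring_distribs right_diff_distrib) simp
      finally show "w t * - ct (\<nu> {k}) (D 1) (\<lambda>x. poly P x * F {k, l} x) t =
        - (sg k l * c k / c l) * (poly P t * (poly W t * dens 0 l t)) +
        (sg k l * (poly (P * [:b, a:]) t * (poly W t * ?v t)) + poly R t * (poly W t * ?v t))"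
        unfolding vF by (simp add: algebra_simps)
    qed
    also have "\<dots> = - (sg k l * c k / c l) * (LINT t:\<Delta> 0|M 0. poly P t * (poly W t * dens 0 l t)) +
       (sg k l * (LINT t:\<Delta> 0|M 0. poly (P * [:b, a:]) t * (poly W t * ?v t)) + (LINT t:\<Delta> 0|M 0. poly R t * (poly W t * ?v t)))"
      by (subst set_integral_add(2), (intro set_integral_add(1) set_integrable_mult_right int k l(1))+,
          subst set_integral_add(2), (intro set_integral_add(1) set_integrable_mult_right int k l(1))+,
          simp only: set_integral_mult_right)
    also have "(LINT t:\<Delta> 0|M 0. poly P t * (poly W t * dens 0 l t)) = 0" by (rule orthD[OF W l(1) P])
    \<comment> \<open>\<open>R\<close> has smaller degree than \<open>P\<close>, hence degree below
      \<open>n\<close>, which is admissible for every \<open>k\<close>.\<close>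
    also have "(LINT t:\<Delta> 0|M 0. poly R t * (poly W t * ?v t)) = 0"
      by (rule orthD[OF W k]) (use R P in \<open>auto simp: step_index_def split: if_splits\<close>)
    also have "(LINT t:\<Delta> 0|M 0. poly (P * [:b, a:]) t * (poly W t * ?v t)) = 0"
    proof (rule orthD[OF W k])
      show "P * [:b, a:] = 0 \<or> degree (P * [:b, a:]) < ?n k"
      proof (cases "P = 0 \<or> [:b, a:] = 0")
        case False
        then have dP: "degree P < ?n l" using P by auto
        have dd: "degree (P * [:b, a:]) = degree P + degree [:b, a:]"
          by (rule degree_mult_eq) (use False in auto)
        show ?thesis
        proof (cases "a = 0")
          case True
          then have "b \<noteq> 0" using False by auto
          then have "k \<noteq> 0" using b0 l by auto
          then show ?thesis using dP dd True by (auto simp: step_index_def split: if_splits)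
        next
          case False
          then show ?thesis using a0 dP dd by (auto simp: step_index_def)
        qed
      qed auto
    qed
    finally show ?thesis by simp
  qed
  have zeros: "(LINT x:D 1|\<nu> {k}. \<Psi> x * (\<Sum>l\<in>{..m} - {k}. poly (P l) x * F (insert l {k}) x)) = 0"
    if P: "\<And>l. l \<in> {..m} - {k} \<Longrightarrow> P l = 0 \<or> degree (P l) < ?n l" for P :: "nat \<Rightarrow> real poly"
  proof -
    have "(LINT x:D 1|\<nu> {k}. \<Psi> x * (\<Sum>l\<in>{..m} - {k}. poly (P l) x * F (insert l {k}) x)) =
      (LINT x:D 1|\<nu> {k}. \<Sum>l\<in>{..m} - {k}. \<Psi> x * (poly (P l) x * F {k, l} x))"
      by (simp add: sum_distrib_left insert_commute)
    also have "\<dots> = (\<Sum>l\<in>{..m} - {k}. LINT x:D 1|\<nu> {k}. \<Psi> x * (poly (P l) x * F {k, l} x))"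
      by (intro set_integral_sum set_integrable_compact[OF finite_borelD[OF fbk] cD1] continuous_intros \<Psi>c Fkl) auto
    also have "\<dots> = 0" using one P by (intro sum.neutral) auto
    finally show ?thesis .
  qed
  have "\<exists>Y\<subseteq>{p..q}. finite Y \<and> card Y = (\<Sum>l\<in>{..m} - {k}. ?n l) \<and> (\<forall>z\<in>Y. \<Psi> z = 0)"
  proof (rule at_system_orthogonal_zeros[OF fam _ pq(1)])
    show "{k} \<subset> {..m}" using k km by auto
    show "{p..q} \<inter> D (Suc (card {k})) = {}" using d12 pq(2) by (simp add: numeral_2_eq_2)
    show "fat (\<nu> {k}) {p..q}" using fatk pq(2) by simp
    show "continuous_on {p..q} \<Psi>" using \<Psi>c pq(2) by simp
  qed (use zeros pq(2) in auto)
  then obtain Y where Y: "Y \<subseteq> D 1" "finite Y" "card Y = (\<Sum>l\<in>{..m} - {k}. ?n l)" "\<And>z. z \<in> Y \<Longrightarrow> \<Psi> z = 0"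
    unfolding pq(2) by blast
  show ?thesis
    using Y d01 mi_norm_step[OF k, of ?n] by (intro exI[of _ Y]) (auto simp: \<Psi>_def w_def)
qed

lemma node_weight_positive:
  assumes W: "orth (step_index n) (node_poly Z)" and Z: "Z \<subseteq> \<Delta> 0" "finite Z" "card Z = mi_norm m (step_index n)"
    and k: "k \<le> m" and x: "x \<in> Z"
  shows "0 < msign (nik \<sigma> 0 k) * node_weight k Z x"
proof -
  let ?W = "node_poly Z" and ?v = "dens 0 k"
  obtain Y where Y: "finite Y" "Y \<inter> \<Delta> 0 = {}" "card Y + step_index n k = card Z"
    "\<And>\<xi>. \<xi> \<in> Y \<Longrightarrow> ct (M 0) (\<Delta> 0) (\<lambda>t. poly ?W t * ?v t) \<xi> = 0"
    using remainder_zeros[OF W k] unfolding Z(3) by blast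
  have wc: "continuous_on (\<Delta> 0) (\<lambda>t. poly ?W t * ?v t)" by (intro continuous_intros dens0(1)[OF k])
  have "continuous_on (\<Delta> 0) (poly (node_poly Y))" by (intro continuous_intros)
  moreover have "poly (node_poly Y) t \<noteq> 0" if "t \<in> \<Delta> 0" for t
    by (rule poly_node_poly_nonzero[OF Y(1)]) (use Y(2) that in auto)
  ultimately obtain e where e: "\<And>t. t \<in> \<Delta> 0 \<Longrightarrow> 0 < e * poly (node_poly Y) t"
    using connected_const_sign[OF generator0(6)] by (metis mult_1 mult_minus1 neg_0_less_iff_less)
  have "0 < msign (nik \<sigma> 0 k) * ((LINT t:\<Delta> 0|M 0. poly (node_poly (Z - {x})) t * ?v t) / poly (node_poly (Z - {x})) x)"
  proof (rule positive_node_integral[OF generator0(2,5) dens0(1)[OF k] dens0(2)[OF k] Z(2,1) x Y(1) _ e])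
    show "card Y \<le> card Z" using Y(3) by simp
    fix h :: "real poly" assume "h = 0 \<or> degree h < card Z"
    then have h: "h = 0 \<or> degree h < card Y + step_index n k" using Y(3) by simp
    show "(LINT x:\<Delta> 0|M 0. poly h x * (poly ?W x * ?v x / poly (node_poly Y) x)) = 0"
      by (rule orthogonal_quotient[OF generator0(10,5) wc Y(1,2,4) orthD[OF W k] h])
  qed
  also have "(LINT t:\<Delta> 0|M 0. poly (node_poly (Z - {x})) t * ?v t) / poly (node_poly (Z - {x})) x = node_weight k Z x"
    unfolding node_weight_def poly_node_poly prod_dividef by simp
  finally show ?thesis .
qed

end

section \<open>Riemann-Stieltjes integrable functions\<close>

text \<open>The least \<open>L\<close>-Lipschitz majorant of \<open>f\<close> on the interval, a
  sup-convolution with a cone; applied to \<open>- f\<close> and negated it gives the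
  minorant.\<close>

definition lip_env :: "real \<Rightarrow> real \<Rightarrow> (real \<Rightarrow> real) \<Rightarrow> real \<Rightarrow> real \<Rightarrow> real" where
  "lip_env a b f L x = (SUP y\<in>{a..b}. f y - L * \<bar>x - y\<bar>)"

lemma lip_env_upper:
  assumes f: "\<And>y. y \<in> {a..b} \<Longrightarrow> f y \<le> B" and L: "0 \<le> L" and y: "y \<in> {a..b}"
  shows "f y - L * \<bar>x - y\<bar> \<le> lip_env a b f L x"
  unfolding lip_env_def
proof (rule cSUP_upper[OF y])
  have "f z - L * \<bar>x - z\<bar> \<le> B" if "z \<in> {a..b}" for z
    using f[OF that] mult_nonneg_nonneg[OF L, of "\<bar>x - z\<bar>"] by linarith
  then show "bdd_above ((\<lambda>y. f y - L * \<bar>x - y\<bar>) ` {a..b})" by (rule bdd_aboveI2)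
qed

lemma lip_env_least:
  assumes "a \<le> b" "\<And>y. y \<in> {a..b} \<Longrightarrow> f y - L * \<bar>x - y\<bar> \<le> K"
  shows "lip_env a b f L x \<le> K"
  unfolding lip_env_def using assms by (intro cSUP_least) auto

lemma continuous_lip_env:
  assumes ab: "a \<le> b" and f: "\<And>y. y \<in> {a..b} \<Longrightarrow> f y \<le> B" and L: "0 \<le> L"
  shows "continuous_on X (lip_env a b f L)"
proof -
  have le: "lip_env a b f L x \<le> lip_env a b f L x' + L * \<bar>x - x'\<bar>" for x x'
  proof (rule lip_env_least[OF ab])
    fix y assume y: "y \<in> {a..b}"
    have "L * \<bar>x' - y\<bar> \<le> L * (\<bar>x - y\<bar> + \<bar>x - x'\<bar>)" by (intro mult_left_mono L) auto
    moreover have "f y - L * \<bar>x' - y\<bar> \<le> lip_env a b f L x'" by (rule lip_env_upper[OF f L y])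
    ultimately show "f y - L * \<bar>x - y\<bar> \<le> lip_env a b f L x' + L * \<bar>x - x'\<bar>"
      by (simp add: distrib_left)
  qed
  have "L-lipschitz_on X (lip_env a b f L)"
  proof (rule lipschitz_onI[OF _ L])
    fix x y
    show "dist (lip_env a b f L x) (lip_env a b f L y) \<le> L * dist x y"
      using le[of x y] le[of y x] by (simp add: dist_real_def abs_minus_commute abs_le_iff)
  qed
  then show ?thesis by (rule lipschitz_on_continuous_on)
qed

text \<open>A finite measure has at most countably many atoms, so near each equidistant point there
  is a point without mass.\<close>

lemma nonatomic_grid:
  assumes M: "finite_measure M" "sets M = sets borel" and ab: "a < b" and d: "0 < (\<delta>::real)"
  obtains K :: nat and x where "x 0 = a" "x K = b" "\<And>i. i < K \<Longrightarrow> x i < x (Suc i) \<and> x (Suc i) - x i < \<delta>"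
    "\<And>i. 0 < i \<Longrightarrow> i < K \<Longrightarrow> measure M {x i} = 0" "0 < K"
proof -
  interpret finite_measure M by fact
  \<comment> \<open>The points are moved to the left by less than \<open>h / 2\<close>, so the gaps
    stay between \<open>h / 2\<close> and \<open>3 * h / 2\<close>; hence
    \<open>2 * h < \<delta>\<close> suffices.\<close>
  obtain K :: nat where K: "2 * (b - a) / \<delta> < real K" using reals_Archimedean2 by blast
  have K0: "0 < K" using K ab d by (metis diff_gt_0_iff_gt divide_pos_pos gr0I less_trans mult_pos_pos not_less_iff_gr_or_eq of_nat_0 zero_less_numeral)
  define h where "h = (b - a) / K"
  have h: "0 < h" "h * K = b - a" using ab K0 by (auto simp: h_def)
  have "2 * (b - a) < \<delta> * K" using K d by (simp add: field_simps)
  then have hd: "2 * h < \<delta>" using K0 by (simp add: h_def field_simps)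
  have "\<exists>y. a + real i * h - h / 2 < y \<and> y < a + real i * h \<and> measure M {y} = 0" for i
  proof -
    have "\<exists>y\<in>{a + real i * h - h / 2<..<a + real i * h}. y \<notin> {y. measure M {y} \<noteq> 0}"
      using h(1) by (intro open_minus_countable countable_support) auto
    then show ?thesis by auto
  qed
  then obtain y where y: "\<And>i. a + real i * h - h / 2 < y i" "\<And>i. y i < a + real i * h" "\<And>i. measure M {y i} = 0"
    by metis
  define x where "x i = (if i = 0 then a else if i = K then b else y i)" for i
  have b: "b = a + real K * h" using h(2) by (simp add: mult.commute)
  have low: "a + real i * h - h / 2 \<le> x i" for i
    using y(1)[of i] h(1) b unfolding x_def by (auto intro: less_imp_le)
  have up: "x i \<le> a + real i * h" for i
    using y(2)[of i] b unfolding x_def by (auto intro: less_imp_le)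
  show thesis
  proof (rule that[of x K])
    fix i assume i: "i < K"
    have s: "a + real (Suc i) * h = a + real i * h + h" by (simp add: algebra_simps)
    show "x i < x (Suc i) \<and> x (Suc i) - x i < \<delta>"
      using up[of i] low[of "Suc i"] low[of i] up[of "Suc i"] h(1) hd unfolding s by linarith
  qed (use K0 y(3) in \<open>auto simp: x_def\<close>)
qed

lemma nonatom_small_neighbourhood:
  assumes M: "finite_measure M" "sets M = sets borel" and c: "measure M {c :: real} = 0" and e: "0 < (e::real)"
  shows "\<forall>\<^sub>F \<eta> in at_right 0. measure M {c - \<eta>..c + \<eta>} < e"
proof -
  interpret finite_measure M by fact
  let ?A = "\<lambda>n::nat. {c - 1 / real (Suc n)..c + 1 / real (Suc n)}"
  have "(\<lambda>n. measure M (?A n)) \<longlonglongrightarrow> measure M (\<Inter>n. ?A n)"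
  proof (rule finite_Lim_measure_decseq)
    show "range ?A \<subseteq> sets M" unfolding M(2) by auto
    show "decseq ?A" unfolding decseq_def
    proof (intro allI impI)
      fix m n :: nat assume "m \<le> n"
      then have "1 / real (Suc n) \<le> 1 / real (Suc m)" by (intro divide_left_mono) auto
      then show "?A n \<subseteq> ?A m" by (intro atLeastatMost_subset_iff[THEN iffD2] disjI2 conjI) linarith+
    qed
  qed
  also have "(\<Inter>n. ?A n) = {c}"
  proof -
    have "y = c" if y: "\<And>n::nat. c - 1 / real (Suc n) \<le> y \<and> y \<le> c + 1 / real (Suc n)" for y
    proof (rule ccontr)
      assume "y \<noteq> c"
      then have "0 < \<bar>y - c\<bar>" by simp
      then obtain n :: nat where "inverse (real (Suc n)) < \<bar>y - c\<bar>" using reals_Archimedean by blast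
      then show False using y[of n] by (simp add: inverse_eq_divide) linarith
    qed
    then show ?thesis by auto
  qed
  finally have "(\<lambda>n. measure M (?A n)) \<longlonglongrightarrow> 0" using c by simp
  then have "\<forall>\<^sub>F n in sequentially. measure M (?A n) < e" using e by (rule order_tendstoD)
  then obtain n where n: "measure M (?A n) < e" by (auto simp: eventually_sequentially)
  show ?thesis unfolding eventually_at_right_field
  proof (intro exI[of _ "1 / real (Suc n)"] conjI allI impI)
    fix \<eta> assume \<eta>: "0 < \<eta>" "\<eta> < 1 / real (Suc n)"
    have "measure M {c - \<eta>..c + \<eta>} \<le> measure M (?A n)"
      by (rule finite_measure_mono) (use \<eta> M(2) in auto)
    then show "measure M {c - \<eta>..c + \<eta>} < e" using n by simp
  qed simp
qed

definition pdistr :: "real measure \<Rightarrow> real \<Rightarrow> real \<Rightarrow> real" where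
  "pdistr M a x = (if x \<le> a then 0 else measure M {..x})"

text \<open>The integrability condition holds for all tags simultaneously, so tags that nearly
  attain the suprema can be compared with tags that nearly attain the infima on one
  partition.\<close>

lemma riemann_stieltjes_oscillation:
  fixes a b :: real and f \<phi> :: "real \<Rightarrow> real"
  assumes rs: "\<forall>\<epsilon>>0. \<exists>\<delta>>0. \<forall>N x t. x 0 = a \<and> x N = b \<and>
      (\<forall>i<N. x i \<le> x (Suc i) \<and> x (Suc i) - x i < \<delta> \<and> t i \<in> {x i..x (Suc i)}) \<longrightarrow>
      \<bar>(\<Sum>i<N. (\<phi> (x (Suc i)) - \<phi> (x i)) * f (t i)) - I\<bar> < \<epsilon>"
    and \<phi>: "mono \<phi>" and B: "\<And>y. y \<in> {a..b} \<Longrightarrow> \<bar>f y\<bar> \<le> B" and e: "0 < (e::real)"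
  shows "\<exists>\<delta>>0. \<forall>N x. x 0 = a \<and> x N = b \<and> (\<forall>i<N. x i \<le> x (Suc i) \<and> x (Suc i) - x i < \<delta>) \<longrightarrow>
    (\<Sum>i<N. (\<phi> (x (Suc i)) - \<phi> (x i)) * ((SUP y\<in>{x i..x (Suc i)}. f y) - (INF y\<in>{x i..x (Suc i)}. f y))) < e"
proof -
  define T where "T = \<phi> b - \<phi> a"
  \<comment> \<open>The tags miss the extrema by \<open>e2\<close>, which costs at most
    \<open>e / 2\<close> in total; the two Riemann sums account for \<open>e / 4\<close>
    each.\<close>
  define e2 where "e2 = e / (4 * (\<bar>T\<bar> + 1))"
  have e2: "0 < e2" using e by (simp add: e2_def add_nonneg_pos)
  have e4: "0 < e / 4" using e by simp
  obtain \<delta> where \<delta>: "0 < \<delta>" "\<forall>N x t. x 0 = a \<and> x N = b \<and>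
      (\<forall>i<N. x i \<le> x (Suc i) \<and> x (Suc i) - x i < \<delta> \<and> t i \<in> {x i..x (Suc i)}) \<longrightarrow>
      \<bar>(\<Sum>i<N. (\<phi> (x (Suc i)) - \<phi> (x i)) * f (t i)) - I\<bar> < e / 4"
    using rs[THEN spec, THEN mp, OF e4] by (elim exE conjE) (rule that)
  show ?thesis
  proof (intro exI[of _ \<delta>] conjI \<delta>(1) allI impI, elim conjE)
    fix N and x :: "nat \<Rightarrow> real"
    assume x: "x 0 = a" "x N = b" "\<forall>i<N. x i \<le> x (Suc i) \<and> x (Suc i) - x i < \<delta>"
    let ?C = "\<lambda>i. {x i..x (Suc i)}" and ?d = "\<lambda>i. \<phi> (x (Suc i)) - \<phi> (x i)"
    let ?S = "\<lambda>i. SUP y\<in>?C i. f y" and ?I = "\<lambda>i. INF y\<in>?C i. f y"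
    have inc: "x i \<le> x j" if "i \<le> j" "j \<le> N" for i j
      using that
    proof (induction j)
      case (Suc j)
      then show ?case using x(3)[THEN spec, of j] by (cases "i = Suc j") auto
    qed simp
    have sub: "?C i \<subseteq> {a..b}" if "i < N" for i
      using inc[of 0 i] inc[of "Suc i" N] that x by auto
    have d0: "0 \<le> ?d i" if "i < N" for i using x(3) that \<phi> by (simp add: mono_def)
    have "\<exists>t\<in>?C i. ?S i - e2 < f t" if i: "i < N" for i
    proof -
      have "?C i \<noteq> {}" using x(3) i by auto
      then show ?thesis using less_cSupD[of "f ` ?C i" "?S i - e2"] e2 by auto
    qed
    then obtain t where t: "\<And>i. i < N \<Longrightarrow> t i \<in> ?C i" "\<And>i. i < N \<Longrightarrow> ?S i - e2 < f (t i)" by metis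
    have "\<exists>s\<in>?C i. f s < ?I i + e2" if i: "i < N" for i
    proof -
      have "?C i \<noteq> {}" using x(3) i by auto
      then show ?thesis using cInf_lessD[of "f ` ?C i" "?I i + e2"] e2 by auto
    qed
    then obtain s where s: "\<And>i. i < N \<Longrightarrow> s i \<in> ?C i" "\<And>i. i < N \<Longrightarrow> f (s i) < ?I i + e2" by metis
    have 1: "\<bar>(\<Sum>i<N. ?d i * f (t i)) - I\<bar> < e / 4"
      by (rule \<delta>(2)[THEN spec[of _ N], THEN spec[of _ x], THEN spec[of _ t], THEN mp]) (use x t in auto)
    have 2: "\<bar>(\<Sum>i<N. ?d i * f (s i)) - I\<bar> < e / 4"
      by (rule \<delta>(2)[THEN spec[of _ N], THEN spec[of _ x], THEN spec[of _ s], THEN mp]) (use x s in auto)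
    have "(\<Sum>i<N. ?d i * (?S i - ?I i)) \<le> (\<Sum>i<N. ?d i * (f (t i) - f (s i) + 2 * e2))"
      using t(2) s(2) by (intro sum_mono mult_left_mono d0) (auto, force)
    also have "\<dots> = (\<Sum>i<N. ?d i * f (t i)) - (\<Sum>i<N. ?d i * f (s i)) + 2 * e2 * (\<Sum>i<N. ?d i)"
      by (simp add: ring_distribs sum.distrib sum_subtractf sum_distrib_left mult_ac)
    also have "(\<Sum>i<N. ?d i) = T" unfolding T_def x(1,2)[symmetric] by (rule sum_lessThan_telescope)
    also have "2 * e2 * T \<le> 2 * e2 * (\<bar>T\<bar> + 1)" using e2 by (intro mult_left_mono) auto
    also have "\<dots> = e / 2"
    proof -
      have "\<bar>T\<bar> + 1 \<noteq> 0" using abs_ge_zero[of T] by linarith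
      then show ?thesis unfolding e2_def by (simp add: field_simps)
    qed
    finally show "(\<Sum>i<N. ?d i * (?S i - ?I i)) < e" using 1 2 by linarith
  qed
qed

text \<open>The partition points are chosen off the atoms, so that the neighbourhoods where the Lipschitz envelopes
  see two cells at once have small measure.\<close>

lemma riemann_stieltjes_squeeze:
  assumes M: "finite_measure M" "sets M = sets borel" and ab: "a < b"
    and rs: "\<forall>\<epsilon>>0. \<exists>\<delta>>0. \<forall>N x t. x 0 = a \<and> x N = b \<and>
      (\<forall>i<N. x i \<le> x (Suc i) \<and> x (Suc i) - x i < \<delta> \<and> t i \<in> {x i..x (Suc i)}) \<longrightarrow>
      \<bar>(\<Sum>i<N. (pdistr M a (x (Suc i)) - pdistr M a (x i)) * f (t i)) - I\<bar> < \<epsilon>"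
    and B: "\<And>y. y \<in> {a..b} \<Longrightarrow> \<bar>f y\<bar> \<le> B" and e: "0 < e"
  shows "\<exists>g h. continuous_on {a..b} g \<and> continuous_on {a..b} h \<and> (\<forall>x\<in>{a..b}. g x \<le> f x \<and> f x \<le> h x) \<and>
    (LINT x:{a..b}|M. h x - g x) < e"
proof -
  interpret finite_measure M by fact
  let ?F = "pdistr M a"
  have [measurable]: "{..u} \<in> sets M" "{u<..v} \<in> sets M" "{u..v} \<in> sets M" for u v :: real using M(2) by auto
  have B0: "0 \<le> B" using B[of a] ab by auto
  have mono: "mono ?F"
    unfolding mono_def pdistr_def by (auto intro!: finite_measure_mono)
  have "\<exists>\<delta>>0. \<forall>N x. x 0 = a \<and> x N = b \<and> (\<forall>i<N. x i \<le> x (Suc i) \<and> x (Suc i) - x i < \<delta>) \<longrightarrow>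
    (\<Sum>i<N. (?F (x (Suc i)) - ?F (x i)) * ((SUP y\<in>{x i..x (Suc i)}. f y) - (INF y\<in>{x i..x (Suc i)}. f y))) < e / 2"
    by (rule riemann_stieltjes_oscillation[OF rs mono _ half_gt_zero[OF e]]) (rule B)
  then obtain \<delta> where \<delta>: "0 < \<delta>" "\<forall>N x. x 0 = a \<and> x N = b \<and> (\<forall>i<N. x i \<le> x (Suc i) \<and> x (Suc i) - x i < \<delta>) \<longrightarrow>
    (\<Sum>i<N. (?F (x (Suc i)) - ?F (x i)) * ((SUP y\<in>{x i..x (Suc i)}. f y) - (INF y\<in>{x i..x (Suc i)}. f y))) < e / 2"
    by (elim exE conjE) (rule that)
  obtain K x where x: "x 0 = a" "x K = b" "\<And>i. i < K \<Longrightarrow> x i < x (Suc i) \<and> x (Suc i) - x i < \<delta>"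
    "\<And>i. 0 < i \<Longrightarrow> i < K \<Longrightarrow> measure M {x i} = 0" "0 < K"
    using nonatomic_grid[OF M ab \<delta>(1)] by metis
  define S where "S i = (SUP y\<in>{x i..x (Suc i)}. f y)" for i
  define J where "J i = (INF y\<in>{x i..x (Suc i)}. f y)" for i
  have osc: "(\<Sum>i<K. (?F (x (Suc i)) - ?F (x i)) * (S i - J i)) < e / 2"
    unfolding S_def J_def by (rule \<delta>(2)[THEN spec, THEN spec, THEN mp]) (use x in \<open>auto intro: less_imp_le\<close>)
  have inc: "x i \<le> x j" if "i \<le> j" "j \<le> K" for i j
    using that
  proof (induction j)
    case (Suc j)
    then show ?case using x(3)[of j] by (cases "i = Suc j") auto
  qed simp
  have sub: "{x i..x (Suc i)} \<subseteq> {a..b}" if "i < K" for i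
    using inc[of 0 i] inc[of "Suc i" K] that x by auto
  have fS: "f y \<le> S i" and fJ: "J i \<le> f y" if "i < K" "y \<in> {x i..x (Suc i)}" for i y
  proof -
    have bd: "- B \<le> f z \<and> f z \<le> B" if "z \<in> {x i..x (Suc i)}" for z
      using sub[OF \<open>i < K\<close>] B[of z] that by (auto simp: abs_le_iff)
    show "f y \<le> S i" unfolding S_def using bd by (intro cSUP_upper that bdd_aboveI2[of _ _ B]) auto
    show "J i \<le> f y" unfolding J_def using bd by (intro cINF_lower that bdd_belowI2[of _ "- B"]) auto
  qed
  \<comment> \<open>Fewer than \<open>K\<close> neighbourhoods, each costing at most
    \<open>2 * B * e3\<close>, add up to at most \<open>e / 2\<close>; \<open>B + 1\<close> avoids
    division by zero when \<open>B = 0\<close>.\<close>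
  define e3 where "e3 = e / (4 * (B + 1) * K)"
  have e3: "0 < e3" using e B0 x(5) by (simp add: e3_def)
  have "\<forall>\<^sub>F \<eta> in at_right 0. \<forall>i\<in>{1..<K}. measure M {x i - \<eta>..x i + \<eta>} < e3"
    by (intro eventually_ball_finite ballI nonatom_small_neighbourhood[OF M _ e3] x(4)) auto
  then have "\<forall>\<^sub>F \<eta> in at_right 0. (\<forall>i\<in>{1..<K}. measure M {x i - \<eta>..x i + \<eta>} < e3) \<and> 0 < \<eta>"
    by (intro eventually_conj eventually_at_right_less)
  then obtain \<eta> where \<eta>: "\<And>i. i \<in> {1..<K} \<Longrightarrow> measure M {x i - \<eta>..x i + \<eta>} < e3" "0 < \<eta>"
    using eventually_happens'[OF trivial_limit_at_right_real] by blast
  \<comment> \<open>At distance \<open>\<eta>\<close> the penalty is \<open>2 * B\<close>, more than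
    any oscillation of \<open>f\<close>; so only points within \<open>\<eta>\<close> influence an
    envelope.\<close>
  define L where "L = 2 * B / \<eta>"
  have L: "0 \<le> L" "L * \<eta> = 2 * B" using \<eta>(2) B0 by (auto simp: L_def)
  define h where "h = lip_env a b f L"
  define g where "g x = - lip_env a b (\<lambda>y. - f y) L x" for x
  have fB: "f y \<le> B" "- f y \<le> B" if "y \<in> {a..b}" for y using B[OF that] by auto
  have a_le_b: "a \<le> b" using ab by simp
  have hc: "continuous_on {a..b} h" unfolding h_def by (rule continuous_lip_env[OF a_le_b fB(1) L(1)])
  have gc: "continuous_on {a..b} g" unfolding g_def
    by (intro continuous_intros continuous_lip_env[OF a_le_b fB(2) L(1)])
  have gfh: "g y \<le> f y \<and> f y \<le> h y" if "y \<in> {a..b}" for y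
  proof -
    have "f y - L * \<bar>y - y\<bar> \<le> h y" unfolding h_def by (rule lip_env_upper[OF fB(1) L(1) that])
    moreover have "- f y - L * \<bar>y - y\<bar> \<le> lip_env a b (\<lambda>y. - f y) L y" by (rule lip_env_upper[OF fB(2) L(1) that])
    ultimately show ?thesis unfolding g_def by simp
  qed
  have hB: "h y \<le> B" for y unfolding h_def
    by (rule lip_env_least[OF a_le_b]) (use fB(1) mult_nonneg_nonneg[OF L(1) abs_ge_zero] in \<open>smt (verit)\<close>)
  have gB: "- B \<le> g y" for y
  proof -
    have "lip_env a b (\<lambda>y. - f y) L y \<le> B"
      by (rule lip_env_least[OF a_le_b]) (use fB(2) mult_nonneg_nonneg[OF L(1) abs_ge_zero] in \<open>smt (verit)\<close>)
    then show ?thesis unfolding g_def by simp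
  qed
  \<comment> \<open>The first cell includes its left end point and everything before it, in
    accordance with the value 0 of \<open>pdistr\<close> at \<open>a\<close>, so that a mass at
    \<open>a\<close> is counted.\<close>
  define C where "C i = (if i = 0 then {..x (Suc 0)} else {x i<..x (Suc i)})" for i
  define E where "E i = {x i - \<eta>..x i + \<eta>}" for i
  have CE: "C i \<in> sets M" "E i \<in> sets M" for i unfolding C_def E_def by auto
  have FC: "?F (x (Suc i)) - ?F (x i) = measure M (C i)" if i: "i < K" for i
  proof (cases "i = 0")
    case True
    then show ?thesis using x(1) x(3)[OF i] by (simp add: pdistr_def C_def)
  next
    case False
    have "a < x i" using x(1) x(3)[of 0] inc[of 1 i] False i by auto
    then have "?F (x (Suc i)) - ?F (x i) = measure M {..x (Suc i)} - measure M {..x i}"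
      using x(3)[OF i] by (simp add: pdistr_def)
    also have "\<dots> = measure M ({..x (Suc i)} - {..x i})"
      by (rule finite_measure_Diff[symmetric]) (use x(3)[OF i] in auto)
    also have "{..x (Suc i)} - {..x i} = C i" unfolding C_def using False by auto
    finally show ?thesis .
  qed
  \<comment> \<open>The majorant of \<open>h - g\<close>: the oscillation of the cell containing the
    point if the point is far from the inner partition points, and the crude bound
    \<open>2 * B\<close> near them.\<close>
  let ?R = "\<lambda>y. (\<Sum>i<K. (S i - J i) * indicator (C i) y) + (\<Sum>i\<in>{1..<K}. 2 * B * indicator (E i) y)"
  have SJ: "0 \<le> S i - J i" if "i < K" for i
    using fS[OF that, of "x i"] fJ[OF that, of "x i"] x(3)[OF that] by auto
  have pt: "indicator {a..b} y *\<^sub>R (h y - g y) \<le> ?R y" for y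
  proof (cases "y \<in> {a..b}")
    case False
    have "0 \<le> ?R y" using SJ B0 by (intro add_nonneg_nonneg sum_nonneg) auto
    then show ?thesis using False by simp
  next
    case True
    show ?thesis
    proof (cases "\<exists>i\<in>{1..<K}. y \<in> E i")
      case True
      then obtain i where i: "i \<in> {1..<K}" "y \<in> E i" by blast
      have "h y - g y \<le> 2 * B" using hB[of y] gB[of y] by simp
      also have "\<dots> = 2 * B * indicator (E i) y" using i by simp
      also have "\<dots> \<le> (\<Sum>i\<in>{1..<K}. 2 * B * indicator (E i) y)"
        using i(1) B0 by (intro member_le_sum) auto
      also have "\<dots> \<le> ?R y" using SJ by (intro le_add_same_cancel2[THEN iffD2] sum_nonneg mult_nonneg_nonneg) auto
      finally show ?thesis using \<open>y \<in> {a..b}\<close> by simp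
    next
      case far: False
      define i where "i = (LEAST i. y \<le> x (Suc i))"
      have K1: "Suc (K - 1) = K" using x(5) by simp
      have ex: "y \<le> x (Suc (K - 1))" using \<open>y \<in> {a..b}\<close> x(2) K1 by simp
      have yi: "y \<le> x (Suc i)" unfolding i_def by (rule LeastI[of "\<lambda>i. y \<le> x (Suc i)", OF ex])
      have iK: "i < K" using Least_le[of "\<lambda>i. y \<le> x (Suc i)", OF ex] x(5) unfolding i_def by linarith
      have xi: "x i < y" if "i \<noteq> 0"
        using not_less_Least[of "i - 1" "\<lambda>i. y \<le> x (Suc i)"] that unfolding i_def[symmetric] by auto
      have yC: "y \<in> C i" using yi xi unfolding C_def by auto
      have cell: "z \<in> {x i..x (Suc i)}" if z: "z \<in> {a..b}" "\<bar>y - z\<bar> \<le> \<eta>" for z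
      proof -
        have "x i \<le> z"
        proof (cases "i = 0")
          case False
          then have "y \<notin> E i" using far iK by auto
          then show ?thesis using xi[OF False] z(2) unfolding E_def by auto
        qed (use z x(1) in auto)
        moreover have "z \<le> x (Suc i)"
        proof (cases "Suc i = K")
          case False
          then have "y \<notin> E (Suc i)" using far iK by auto
          then show ?thesis using yi z(2) unfolding E_def by auto
        qed (use z x(2) in auto)
        ultimately show ?thesis by simp
      qed
      have mid: "- B \<le> S i" "J i \<le> B"
        using fS[OF iK, of "x i"] fJ[OF iK, of "x i"] x(3)[OF iK] fB[of "x i"] sub[OF iK] by fastforce+
      have "h y \<le> S i" unfolding h_def
      proof (rule lip_env_least[OF a_le_b])
        fix z assume z: "z \<in> {a..b}"
        show "f z - L * \<bar>y - z\<bar> \<le> S i"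
        proof (cases "\<bar>y - z\<bar> \<le> \<eta>")
          case True
          show ?thesis using fS[OF iK cell[OF z True]] mult_nonneg_nonneg[OF L(1), of "\<bar>y - z\<bar>"] by simp
        next
          case False
          then have "L * \<eta> \<le> L * \<bar>y - z\<bar>" using L(1) by (intro mult_left_mono) auto
          then show ?thesis using fB(1)[OF z] mid(1) L(2) by linarith
        qed
      qed
      moreover have "- g y \<le> - J i" unfolding g_def minus_minus
      proof (rule lip_env_least[OF a_le_b])
        fix z assume z: "z \<in> {a..b}"
        show "- f z - L * \<bar>y - z\<bar> \<le> - J i"
        proof (cases "\<bar>y - z\<bar> \<le> \<eta>")
          case True
          show ?thesis using fJ[OF iK cell[OF z True]] mult_nonneg_nonneg[OF L(1), of "\<bar>y - z\<bar>"] by simp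
        next
          case False
          then have "L * \<eta> \<le> L * \<bar>y - z\<bar>" using L(1) by (intro mult_left_mono) auto
          then show ?thesis using fB(2)[OF z] mid(2) L(2) by linarith
        qed
      qed
      ultimately have "h y - g y \<le> (S i - J i) * indicator (C i) y" using yC by simp
      also have "\<dots> \<le> (\<Sum>i<K. (S i - J i) * indicator (C i) y)"
        using iK SJ by (intro member_le_sum) auto
      also have "\<dots> \<le> ?R y" using B0 by (simp add: sum_nonneg)
      finally show ?thesis using \<open>y \<in> {a..b}\<close> by simp
    qed
  qed
  have ind: "integrable M (\<lambda>y. c * indicator A y :: real)" if "A \<in> sets M" for c A
    using that by (intro integrable_mult_right) (simp add: emeasure_eq_measure)
  have "(LINT y:{a..b}|M. h y - g y) \<le> (LINT y|M. ?R y)"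
    unfolding set_lebesgue_integral_def
  proof (rule integral_mono)
    show "integrable M (\<lambda>y. indicator {a..b} y *\<^sub>R (h y - g y))"
      using set_integrable_compact[OF M(2,1), of "{a..b}" "\<lambda>y. h y - g y"] hc gc
      unfolding set_integrable_def by (auto intro!: continuous_intros)
    show "integrable M ?R" by (intro Bochner_Integration.integrable_add Bochner_Integration.integrable_sum ind CE)
  qed (rule pt)
  also have "\<dots> = (\<Sum>i<K. (S i - J i) * measure M (C i)) + (\<Sum>i\<in>{1..<K}. 2 * B * measure M (E i))"
    by (subst Bochner_Integration.integral_add; (intro Bochner_Integration.integrable_sum ind CE)?)
      (subst (1 2) Bochner_Integration.integral_sum; (intro ind CE)?; simp add: CE sets.Int_space_eq2)
  also have "(\<Sum>i<K. (S i - J i) * measure M (C i)) = (\<Sum>i<K. (?F (x (Suc i)) - ?F (x i)) * (S i - J i))"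
    by (intro sum.cong) (auto simp: FC)
  also have "(\<Sum>i\<in>{1..<K}. 2 * B * measure M (E i)) \<le> (\<Sum>i\<in>{1..<K}. 2 * B * e3)"
    using \<eta>(1) B0 unfolding E_def by (intro sum_mono mult_left_mono) (auto intro: less_imp_le)
  also have "\<dots> \<le> K * (2 * B * e3)" using B0 e3 by (simp add: mult_right_mono)
  also have "\<dots> = e / 2 * (B / (B + 1))"
  proof -
    have "c * (2 * B * (e / (4 * r * c))) = e / 2 * (B / r)" if "c \<noteq> 0" "r \<noteq> 0" for c r :: real
      using that by (simp add: field_simps)
    from this[of "real K" "B + 1"] show ?thesis unfolding e3_def using x(5) B0 by linarith
  qed
  also have "\<dots> \<le> e / 2 * 1" using e B0 by (intro mult_left_mono) auto
  finally have "(LINT y:{a..b}|M. h y - g y) < e" using osc by simp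
  then show ?thesis using hc gc gfh by blast
qed

lemma integrable_completion_support:
  fixes f :: "real \<Rightarrow> real"
  assumes M: "sets M = sets borel" "finite_measure M" and D: "compact D" and null: "emeasure M (- D) = 0"
    and f: "continuous_on D f"
  shows "integrable (completion M) f"
proof -
  have g: "integrable M (\<lambda>x. indicator D x *\<^sub>R f x)"
    using set_integrable_compact[OF M D f] unfolding set_integrable_def .
  have "D \<in> sets borel" using D by (intro borel_closed compact_imp_closed)
  then have "- D \<in> null_sets M" using null M(1) by auto
  from AE_not_in[OF this] have ae: "AE x in M. f x = indicator D x *\<^sub>R f x"
    by eventually_elim simp
  have "integrable (completion M) f \<longleftrightarrow> integrable (completion M) (\<lambda>x. indicator D x *\<^sub>R f x)"
    by (rule integrable_cong_AE[OF borel_measurable_completion_AE[OF borel_measurable_integrable[OF g] ae]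
          measurable_completion[OF borel_measurable_integrable[OF g]] AE_completion[OF ae]])
  then show ?thesis using g integrable_completion[OF borel_measurable_integrable[OF g]] by simp
qed

text \<open>Integrability of both parts is required because a non-integrable function has integral 0
  by convention, which would break additivity.\<close>

lemma cs_integral_complex:
  assumes "integrable (completion (mabs s)) (\<lambda>x. Re (f x))" "integrable (completion (mabs s)) (\<lambda>x. Im (f x))"
  shows "cs_integral s f = of_real (cs_integral s (\<lambda>x. Re (f x))) + \<i> * of_real (cs_integral s (\<lambda>x. Im (f x)))"
proof -
  let ?M = "completion (mabs s)"
  have i: "integrable ?M (\<lambda>x. complex_of_real (Re (f x)))" "integrable ?M (\<lambda>x. complex_of_real (Im (f x)))"
    using assms by (auto intro: integrable_of_real)
  have "f = (\<lambda>x. of_real (Re (f x)) + \<i> * of_real (Im (f x)))" by (simp add: fun_eq_iff flip: complex_eq)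
  then have "integral\<^sup>L ?M f = integral\<^sup>L ?M (\<lambda>x. of_real (Re (f x)) + \<i> * of_real (Im (f x)))" by simp
  also have "\<dots> = integral\<^sup>L ?M (\<lambda>x. of_real (Re (f x))) + \<i> * integral\<^sup>L ?M (\<lambda>x. of_real (Im (f x)))"
    using i by (simp add: Bochner_Integration.integral_add)
  finally show ?thesis unfolding cs_integral_def integral_complex_of_real
    by (simp add: scaleR_conv_of_real algebra_simps)
qed

section \<open>Convergence of quadrature formulas with nonnegative weights\<close>

text \<open>Exactness for the constant 1 bounds the sum of the weights, so a uniform polynomial
  approximation of \<open>g\<close> changes sums and integral by comparable small amounts.\<close>

lemma quadrature_converges_continuous:
  fixes w :: "nat \<Rightarrow> real \<Rightarrow> real" and N :: "nat \<Rightarrow> real set"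
  assumes M: "sets M = sets borel" "finite_measure M"
    and N: "\<And>n. N n \<subseteq> {a..b}" and w: "\<And>n x. x \<in> N n \<Longrightarrow> 0 \<le> w n x"
    and exact: "\<And>p. \<forall>\<^sub>F n in sequentially. (\<Sum>x\<in>N n. w n x * poly p x) = (LINT x:{a..b}|M. poly p x)"
    and g: "continuous_on {a..b} g"
  shows "(\<lambda>n. \<Sum>x\<in>N n. w n x * g x) \<longlonglongrightarrow> (LINT x:{a..b}|M. g x)"
proof (rule LIMSEQ_I, goal_cases)
  case (1 r)
  have int: "set_integrable M {a..b} f" if "continuous_on {a..b} f" for f :: "real \<Rightarrow> real"
    by (rule set_integrable_compact[OF M compact_Icc that])
  define T where "T = (LINT x:{a..b}|M. (1::real))"
  have T: "0 \<le> T" unfolding T_def set_lebesgue_integral_def by (intro integral_nonneg_AE) simp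
  \<comment> \<open>\<open>T\<close> is the total mass. Approximation enters twice, in the sum and
    in the integral, each time with \<open>e * T < r / 3\<close>.\<close>
  define e where "e = r / (3 * (T + 1))"
  have e: "0 < e" using 1 T by (simp add: e_def)
  obtain q where q: "real_polynomial_function q" "\<And>x. x \<in> {a..b} \<Longrightarrow> \<bar>g x - q x\<bar> < e"
    using Stone_Weierstrass_real_polynomial_function[OF compact_Icc g e] by blast
  obtain c and d :: nat where cd: "q = (\<lambda>x. \<Sum>i\<le>d. c i * x ^ i)"
    using real_polynomial_function_imp_sum[OF q(1)] by blast
  define p where "p = (\<Sum>i\<le>d. monom (c i) i)"
  have pq: "poly p x = q x" for x unfolding p_def cd by (simp add: poly_sum poly_monom)
  have near: "\<bar>g x - poly p x\<bar> \<le> e" if "x \<in> {a..b}" for x using q(2)[OF that] pq by simp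
  have const: "(LINT x:{a..b}|M. c) = c * T" for c :: real
    unfolding T_def set_integral_mult_right[symmetric] by simp
  have pc: "continuous_on {a..b} (poly p)" by (intro continuous_intros)
  have "(LINT x:{a..b}|M. poly p x) \<le> (LINT x:{a..b}|M. g x + e)"
    by (rule set_integral_mono) (use near in \<open>force intro!: int continuous_intros g pc simp: abs_le_iff\<close>)+
  moreover have "(LINT x:{a..b}|M. g x) \<le> (LINT x:{a..b}|M. poly p x + e)"
    by (rule set_integral_mono) (use near in \<open>force intro!: int continuous_intros g pc simp: abs_le_iff\<close>)+
  moreover have "(LINT x:{a..b}|M. g x + e) = (LINT x:{a..b}|M. g x) + e * T"
    by (subst set_integral_add(2)) (auto intro!: int g simp: const)
  moreover have "(LINT x:{a..b}|M. poly p x + e) = (LINT x:{a..b}|M. poly p x) + e * T"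
    by (subst set_integral_add(2)) (auto intro!: int pc simp: const)
  ultimately have I: "\<bar>(LINT x:{a..b}|M. poly p x) - (LINT x:{a..b}|M. g x)\<bar> \<le> e * T" by simp
  have "\<forall>\<^sub>F n in sequentially. norm ((\<Sum>x\<in>N n. w n x * g x) - (LINT x:{a..b}|M. g x)) < r"
    using exact[of p] exact[of 1]
  proof eventually_elim
    case (elim n)
    have "\<bar>(\<Sum>x\<in>N n. w n x * g x) - (\<Sum>x\<in>N n. w n x * poly p x)\<bar> = \<bar>\<Sum>x\<in>N n. w n x * (g x - poly p x)\<bar>"
      by (simp add: right_diff_distrib sum_subtractf)
    also have "\<dots> \<le> (\<Sum>x\<in>N n. \<bar>w n x * (g x - poly p x)\<bar>)" by (rule sum_abs)
    also have "\<dots> \<le> (\<Sum>x\<in>N n. w n x * e)"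
    proof (rule sum_mono)
      fix x assume x: "x \<in> N n"
      have "\<bar>w n x * (g x - poly p x)\<bar> = w n x * \<bar>g x - poly p x\<bar>" using w[OF x] by (simp add: abs_mult)
      also have "\<dots> \<le> w n x * e" using N[of n] x by (intro mult_left_mono near w) auto
      finally show "\<bar>w n x * (g x - poly p x)\<bar> \<le> w n x * e" .
    qed
    also have "\<dots> = e * T" using elim(2) unfolding T_def by (simp add: mult.commute flip: sum_distrib_left)
    finally have "\<bar>(\<Sum>x\<in>N n. w n x * g x) - (LINT x:{a..b}|M. g x)\<bar> \<le> 2 * (e * T)"
      using I elim(1) by linarith
    also have "\<dots> < r"
    proof -
      have "e * T < e * (T + 1)" using e by simp
      moreover have "e * (T + 1) = r / 3"
      proof -
        have "r / (3 * c) * c = r / 3" if "c \<noteq> 0" for c :: real using that by simp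
        from this[of "T + 1"] show ?thesis unfolding e_def using T by linarith
      qed
      ultimately show ?thesis using 1 by linarith
    qed
    finally show ?case by simp
  qed
  then show ?case by (simp add: eventually_sequentially)
qed

text \<open>The supremum of the minorants and the infimum of the majorants are Borel functions with
  equal integrals enclosing \<open>f\<close>, so all three agree almost everywhere. This makes
  \<open>f\<close> measurable for the completion, though perhaps not Borel measurable.\<close>

lemma squeeze_integrable:
  fixes f :: "real \<Rightarrow> real"
  assumes M: "sets M = sets borel" "finite_measure M" and null: "emeasure M (- {a..b}) = 0"
    and sq: "\<And>e. 0 < e \<Longrightarrow> \<exists>g h. continuous_on {a..b} g \<and> continuous_on {a..b} h \<and>
      (\<forall>x\<in>{a..b}. g x \<le> f x \<and> f x \<le> h x) \<and> (LINT x:{a..b}|M. h x - g x) < e"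
  shows "integrable (completion M) f"
    and "continuous_on {a..b} g \<Longrightarrow> (\<And>x. x \<in> {a..b} \<Longrightarrow> g x \<le> f x) \<Longrightarrow> (LINT x:{a..b}|M. g x) \<le> integral\<^sup>L (completion M) f"
    and "continuous_on {a..b} g \<Longrightarrow> (\<And>x. x \<in> {a..b} \<Longrightarrow> f x \<le> g x) \<Longrightarrow> integral\<^sup>L (completion M) f \<le> (LINT x:{a..b}|M. g x)"
proof -
  let ?i = "\<lambda>g x. indicator {a..b} x * g x :: real"
  have si: "(LINT x:{a..b}|M. g x) = integral\<^sup>L M (?i g)" for g :: "real \<Rightarrow> real"
    unfolding set_lebesgue_integral_def by simp
  have int: "integrable M (?i g)" if "continuous_on {a..b} g" for g :: "real \<Rightarrow> real"
    using set_integrable_compact[OF M compact_Icc that] unfolding set_integrable_def by simp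
  have "\<forall>n. \<exists>g h. continuous_on {a..b} g \<and> continuous_on {a..b} h \<and>
      (\<forall>x\<in>{a..b}. g x \<le> f x \<and> f x \<le> h x) \<and> (LINT x:{a..b}|M. h x - g x) < 1 / real (Suc n)"
    by (intro allI sq) simp
  then obtain g h where gh: "\<And>n. continuous_on {a..b} (g n)" "\<And>n. continuous_on {a..b} (h n)"
    "\<And>n x. x \<in> {a..b} \<Longrightarrow> g n x \<le> f x" "\<And>n x. x \<in> {a..b} \<Longrightarrow> f x \<le> h n x"
    "\<And>n. (LINT x:{a..b}|M. h n x - g n x) < 1 / real (Suc n)"
    by metis
  have gf: "?i (g n) x \<le> ?i f x" and fh: "?i f x \<le> ?i (h n) x" for n x
    using gh(3,4) by (auto simp: indicator_def)
  have bg: "bdd_above (range (\<lambda>n. ?i (g n) x))" for x using gf by (intro bdd_aboveI2) auto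
  have bh: "bdd_below (range (\<lambda>n. ?i (h n) x))" for x using fh by (intro bdd_belowI2) auto
  define G where "G x = (SUP n. ?i (g n) x)" for x
  define H where "H x = (INF n. ?i (h n) x)" for x
  have gG: "?i (g n) x \<le> G x" for n x unfolding G_def by (rule cSUP_upper[OF UNIV_I bg])
  have Hh: "H x \<le> ?i (h n) x" for n x unfolding H_def by (rule cINF_lower[OF bh UNIV_I])
  have Gf: "G x \<le> ?i f x" for x unfolding G_def by (rule cSUP_least) (use gf in auto)
  have fH: "?i f x \<le> H x" for x unfolding H_def by (rule cINF_greatest) (use fh in auto)
  have Gm: "G \<in> borel_measurable M" unfolding G_def
    by (rule borel_measurable_cSUP) (use int gh(1) bg in \<open>auto intro: borel_measurable_integrable\<close>)
  have Hm: "H \<in> borel_measurable M" unfolding H_def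
    by (rule borel_measurable_cINF) (use int gh(2) bh in \<open>auto intro: borel_measurable_integrable\<close>)
  have "integrable M (\<lambda>x. \<bar>?i (g 0) x\<bar> + \<bar>?i (h 0) x\<bar>)"
    by (intro Bochner_Integration.integrable_add integrable_abs int gh)
  moreover have "\<bar>G x\<bar> \<le> \<bar>?i (g 0) x\<bar> + \<bar>?i (h 0) x\<bar> \<and> \<bar>H x\<bar> \<le> \<bar>?i (g 0) x\<bar> + \<bar>?i (h 0) x\<bar>" for x
    using gG[of x 0] Hh[of x 0] Gf[of x] fH[of x] by linarith
  ultimately have Gi: "integrable M G" and Hi: "integrable M H"
    by (auto intro!: Bochner_Integration.integrable_bound[OF _ Gm] Bochner_Integration.integrable_bound[OF _ Hm])
  have GH: "G x \<le> H x" for x using Gf[of x] fH[of x] by simp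
  have "(LINT x|M. H x - G x) \<le> 1 / real (Suc n)" for n
  proof -
    have "(LINT x|M. H x - G x) \<le> (LINT x|M. ?i (h n) x - ?i (g n) x)"
    proof (rule integral_mono)
      show "H x - G x \<le> ?i (h n) x - ?i (g n) x" for x using gG[of x n] Hh[of x n] by linarith
    qed (intro Bochner_Integration.integrable_diff Gi Hi int gh)+
    also have "\<dots> = (LINT x:{a..b}|M. h n x - g n x)" unfolding si by (simp add: right_diff_distrib)
    finally show ?thesis using gh(5)[of n] by simp
  qed
  then have "(LINT x|M. H x - G x) \<le> 0"
    by (intro LIMSEQ_le_const[OF LIMSEQ_Suc[OF lim_1_over_n]]) auto
  moreover have "0 \<le> (LINT x|M. H x - G x)" using GH by (intro integral_nonneg_AE) simp
  ultimately have "(LINT x|M. H x - G x) = 0" by simp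
  then have "AE x in M. H x - G x = 0"
    using GH by (subst (asm) integral_nonneg_eq_0_iff_AE) (auto intro: Gi Hi)
  moreover have "- {a..b} \<in> null_sets M" using null M by auto
  from AE_not_in[OF this] have "AE x in M. x \<in> {a..b}" by simp
  ultimately have ae: "AE x in M. f x = G x"
  proof eventually_elim
    case (elim x)
    then show ?case using Gf[of x] fH[of x] by simp
  qed
  note fm = borel_measurable_completion_AE[OF Gm ae]
  have "integrable (completion M) G" using Gi integrable_completion[OF Gm] by simp
  then show "integrable (completion M) f"
    using integrable_cong_AE[OF fm measurable_completion[OF Gm] AE_completion[OF ae]] by simp
  have fG: "integral\<^sup>L (completion M) f = integral\<^sup>L M G"
    using integral_cong_AE[OF fm measurable_completion[OF Gm] AE_completion[OF ae]] integral_completion[OF Gm] by simp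
  have inab: "AE x in M. x \<in> {a..b}" by fact
  show "(LINT x:{a..b}|M. g x) \<le> integral\<^sup>L (completion M) f"
    if "continuous_on {a..b} g" "\<And>x. x \<in> {a..b} \<Longrightarrow> g x \<le> f x" for g
    unfolding fG si
  proof (rule integral_mono_AE[OF int[OF that(1)] Gi])
    show "AE x in M. ?i g x \<le> G x" using ae inab
    proof eventually_elim
      case (elim x)
      then show ?case using that(2)[of x] by simp
    qed
  qed
  show "integral\<^sup>L (completion M) f \<le> (LINT x:{a..b}|M. g x)"
    if "continuous_on {a..b} g" "\<And>x. x \<in> {a..b} \<Longrightarrow> f x \<le> g x" for g
    unfolding fG si
  proof (rule integral_mono_AE[OF Gi int[OF that(1)]])
    show "AE x in M. G x \<le> ?i g x" using ae inab
    proof eventually_elim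
      case (elim x)
      then show ?case using that(2)[of x] by simp
    qed
  qed
qed

lemma quadrature_converges_squeeze:
  fixes w :: "nat \<Rightarrow> real \<Rightarrow> real" and N :: "nat \<Rightarrow> real set" and f :: "real \<Rightarrow> real"
  assumes M: "sets M = sets borel" "finite_measure M" and null: "emeasure M (- {a..b}) = 0"
    and sq: "\<And>e. 0 < e \<Longrightarrow> \<exists>g h. continuous_on {a..b} g \<and> continuous_on {a..b} h \<and>
      (\<forall>x\<in>{a..b}. g x \<le> f x \<and> f x \<le> h x) \<and> (LINT x:{a..b}|M. h x - g x) < e"
    and N: "\<And>n. N n \<subseteq> {a..b}" and w: "\<And>n x. x \<in> N n \<Longrightarrow> 0 \<le> w n x"
    and exact: "\<And>p. \<forall>\<^sub>F n in sequentially. (\<Sum>x\<in>N n. w n x * poly p x) = (LINT x:{a..b}|M. poly p x)"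
  shows "(\<lambda>n. \<Sum>x\<in>N n. w n x * f x) \<longlonglongrightarrow> integral\<^sup>L (completion M) f"
proof (rule LIMSEQ_I, goal_cases)
  case (1 r)
  obtain g h where gh: "continuous_on {a..b} g" "continuous_on {a..b} h"
    "\<And>x. x \<in> {a..b} \<Longrightarrow> g x \<le> f x" "\<And>x. x \<in> {a..b} \<Longrightarrow> f x \<le> h x"
    "(LINT x:{a..b}|M. h x - g x) < r / 2"
    using sq[OF half_gt_zero[OF 1]] by metis
  have "(LINT x:{a..b}|M. h x - g x) = (LINT x:{a..b}|M. h x) - (LINT x:{a..b}|M. g x)"
    by (intro set_integral_diff set_integrable_compact[OF M compact_Icc] gh)
  then have close: "(LINT x:{a..b}|M. h x) - (LINT x:{a..b}|M. g x) < r / 2" using gh(5) by simp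
  have I: "(LINT x:{a..b}|M. g x) \<le> integral\<^sup>L (completion M) f" "integral\<^sup>L (completion M) f \<le> (LINT x:{a..b}|M. h x)"
    by (rule squeeze_integrable(2)[OF M null _ gh(1)], erule sq, erule gh(3))
      (rule squeeze_integrable(3)[OF M null _ gh(2)], erule sq, erule gh(4))
  have lim: "(\<lambda>n. \<Sum>x\<in>N n. w n x * u x) \<longlonglongrightarrow> (LINT x:{a..b}|M. u x)" if "continuous_on {a..b} u" for u
    by (rule quadrature_converges_continuous[OF M N _ exact that]) (rule w)
  have ev: "\<forall>\<^sub>F n in sequentially. \<bar>(\<Sum>x\<in>N n. w n x * u x) - (LINT x:{a..b}|M. u x)\<bar> < r / 2"
    if "continuous_on {a..b} u" for u
    using LIMSEQ_D[OF lim[OF that], of "r / 2"] 1 unfolding eventually_sequentially by auto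
  have "\<forall>\<^sub>F n in sequentially. norm ((\<Sum>x\<in>N n. w n x * f x) - integral\<^sup>L (completion M) f) < r"
    using ev[OF gh(1)] ev[OF gh(2)]
  proof eventually_elim
    case (elim n)
    have "(\<Sum>x\<in>N n. w n x * g x) \<le> (\<Sum>x\<in>N n. w n x * f x)" "(\<Sum>x\<in>N n. w n x * f x) \<le> (\<Sum>x\<in>N n. w n x * h x)"
      using N[of n] by (auto intro!: sum_mono mult_left_mono w gh(3,4))
    then show ?case using elim I close unfolding real_norm_def by linarith
  qed
  then show ?case by (simp add: eventually_sequentially)
qed

section \<open>The quadrature formula for complex polynomials and the limit theorem\<close>

context nikishin
begin

lemma cs_integral_poly:
  assumes k: "k \<le> m"
  shows "cs_integral (nik \<sigma> 0 k) (\<lambda>x. poly p (complex_of_real x)) =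
    of_real (LINT x:\<Delta> 0|M 0. poly (map_poly Re p) x * dens 0 k x) +
    \<i> * of_real (LINT x:\<Delta> 0|M 0. poly (map_poly Im p) x * dens 0 k x)"
proof -
  let ?s = "nik \<sigma> 0 k"
  have s: "sets (mabs ?s) = sets borel" "finite_measure (mabs ?s)" "emeasure (mabs ?s) (- \<Delta> 0) = 0"
    using nik_properties[OF k le0] by blast+
  have i: "integrable (completion (mabs ?s)) (poly q)" for q
    by (rule integrable_completion_support[OF s(1,2) generator0(5) s(3)]) (intro continuous_intros)
  have "cs_integral ?s (poly q) = (LINT x:\<Delta> 0|M 0. poly q x * dens 0 k x)" for q
    by (subst dens0(4)[OF k]) (auto intro!: continuous_intros simp: mult.commute)
  then show ?thesis
    using cs_integral_complex[of ?s "\<lambda>x. poly p (complex_of_real x)"] i by (simp add: poly_of_real_parts)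
qed

lemma node_weight_quadrature:
  assumes Z: "finite Z" "card Z = mi_norm m n" "orth n (node_poly Z)" and k: "k \<le> m"
    and p: "p = 0 \<or> degree p < mi_norm m n + n k"
  shows "(LINT x:\<Delta> 0|M 0. poly p x * dens 0 k x) = (\<Sum>z\<in>Z. node_weight k Z z * poly p z)"
proof -
  have p': "p = 0 \<or> degree p < card Z + n k" using p Z(2) by simp
  show ?thesis unfolding node_weight_def
    by (rule gauss_quadrature[OF generator0(10,5) dens0(1)[OF k] Z(1) _ p']) (rule orthD[OF Z(3) k])
qed

lemma quadrature_exact:
  assumes t: "type_II m \<sigma> n Q P" and k: "k \<le> m" and p: "p = 0 \<or> degree p < mi_norm m n + n k"
  shows "cs_integral (nik \<sigma> 0 k) (\<lambda>x. poly p (of_real x)) =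
    (\<Sum>x\<in>nodes Q. quad_coeff Q (P k) x * poly p (of_real x))"
proof -
  note N = type_II_nodes[OF t]
  have d: "map_poly h p = 0 \<or> degree (map_poly h p) < mi_norm m n + n k" if "h = Re \<or> h = Im" for h :: "complex \<Rightarrow> real"
  proof (cases "p = 0")
    case False
    have "degree (map_poly h p) \<le> degree p" using that by (intro degree_le) (auto simp: coeff_map_poly coeff_eq_0)
    then show ?thesis using False p by auto
  qed simp
  note q = node_weight_quadrature[OF N(2-4) k d[OF disjI1[OF refl]]] node_weight_quadrature[OF N(2-4) k d[OF disjI2[OF refl]]]
  have "(\<Sum>x\<in>nodes Q. quad_coeff Q (P k) x * poly p (of_real x)) =
     (\<Sum>x\<in>nodes Q. of_real (node_weight k (nodes Q) x * poly (map_poly Re p) x) +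
        \<i> * of_real (node_weight k (nodes Q) x * poly (map_poly Im p) x))"
  proof (rule sum.cong)
    fix x assume x: "x \<in> nodes Q"
    show "quad_coeff Q (P k) x * poly p (of_real x) = of_real (node_weight k (nodes Q) x * poly (map_poly Re p) x) +
        \<i> * of_real (node_weight k (nodes Q) x * poly (map_poly Im p) x)"
      unfolding N(5)[OF k x] by (intro complex_eqI) (simp_all add: poly_of_real_parts)
  qed simp
  then show ?thesis
    unfolding cs_integral_poly[OF k] by (simp only: q of_real_sum sum.distrib sum_distrib_left)
qed

lemma mi_norm_step_index: "n \<le> mi_norm m (step_index n)"
  using mi_norm_step[of 0 "step_index n"] by (simp add: step_index_def)

text \<open>Everything is multiplied by the sign of the measure: the weights become positive, the
  measure becomes \<open>|s\<^sub>0\<^sub>,\<^sub>k|\<close>, and the squeeze argument for positive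
  measures applies. Exactness for a fixed polynomial holds as soon as \<open>n\<close> exceeds its
  degree.\<close>

lemma quadrature_converges_real:
  fixes f :: "real \<Rightarrow> real"
  assumes t: "\<And>n. type_II m \<sigma> (step_index n) (Q n) (P n)" and k: "k \<le> m"
    and B: "\<And>y. y \<in> \<Delta> 0 \<Longrightarrow> \<bar>f y\<bar> \<le> B" and rs: "rs_integrable (nik \<sigma> 0 k) (\<Delta> 0) f"
  shows "integrable (completion (mabs (nik \<sigma> 0 k))) f"
    and "(\<lambda>n. \<Sum>x\<in>nodes (Q n). node_weight k (nodes (Q n)) x * f x) \<longlonglongrightarrow> cs_integral (nik \<sigma> 0 k) f"
proof -
  let ?s = "msign (nik \<sigma> 0 k)" and ?M = "mabs (nik \<sigma> 0 k)"
  have s: "?s = 1 \<or> ?s = - 1" "sets ?M = sets borel" "finite_measure ?M" "emeasure ?M (- \<Delta> 0) = 0"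
    using nik_properties[OF k le0] by blast+
  have ss: "?s * ?s = 1" using s(1) by auto
  have ss': "?s * (?s * z) = z" for z using ss by (metis mult.assoc mult_1)
  obtain a b where ab: "a \<le> b" "\<Delta> 0 = {a..b}" using generator0(1) by blast
  have "infinite (\<Delta> 0)" using fat_infinite[OF generator0(2)] .
  then have ab': "a < b" using ab by (cases "a = b") auto
  have SI: "Inf (\<Delta> 0) = a" "Sup (\<Delta> 0) = b" using ab by auto
  have df: "distr_fun (nik \<sigma> 0 k) a x = ?s * pdistr ?M a x" for x unfolding distr_fun_def pdistr_def by simp
  obtain I where I: "\<forall>\<epsilon>>0. \<exists>\<delta>>0. \<forall>N x t. x 0 = a \<and> x N = b \<and>
      (\<forall>i<N. x i \<le> x (Suc i) \<and> x (Suc i) - x i < \<delta> \<and> t i \<in> {x i..x (Suc i)}) \<longrightarrow>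
      norm ((\<Sum>i<N. (?s * pdistr ?M a (x (Suc i)) - ?s * pdistr ?M a (x i)) *\<^sub>R f (t i)) - I) < \<epsilon>"
    using rs unfolding rs_integrable_def SI df by (elim exE) (rule that)
  have eq: "norm ((\<Sum>i<N. (?s * pdistr ?M a (x (Suc i)) - ?s * pdistr ?M a (x i)) *\<^sub>R f (t i)) - I) =
     \<bar>(\<Sum>i<N. (pdistr ?M a (x (Suc i)) - pdistr ?M a (x i)) * f (t i)) - ?s * I\<bar>" for N :: nat and x t
  proof -
    let ?S = "\<Sum>i<N. (pdistr ?M a (x (Suc i)) - pdistr ?M a (x i)) * f (t i)"
    have "(\<Sum>i<N. (?s * pdistr ?M a (x (Suc i)) - ?s * pdistr ?M a (x i)) *\<^sub>R f (t i)) - I = ?s * (?S - ?s * I)"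
      unfolding right_diff_distrib ss' by (simp add: sum_distrib_left algebra_simps)
    then show ?thesis using s(1) by (auto simp: abs_mult)
  qed
  note rs' = I[unfolded eq]
  have sq: "\<exists>g h. continuous_on {a..b} g \<and> continuous_on {a..b} h \<and>
      (\<forall>x\<in>{a..b}. g x \<le> f x \<and> f x \<le> h x) \<and> (LINT x:{a..b}|?M. h x - g x) < e" if "0 < e" for e
    by (rule riemann_stieltjes_squeeze[OF s(3,2) ab' rs' _ that]) (use B ab(2) in auto)
  have null: "emeasure ?M (- {a..b}) = 0" using s(4) ab(2) by simp
  show "integrable (completion ?M) f" by (rule squeeze_integrable(1)[OF s(2,3) null sq])
  note N = type_II_nodes[OF t]
  have exact: "\<forall>\<^sub>F n in sequentially. (\<Sum>x\<in>nodes (Q n). (?s * node_weight k (nodes (Q n)) x) * poly p x) = (LINT x:{a..b}|?M. poly p x)" for p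
    using eventually_gt_at_top[of "degree p"]
  proof eventually_elim
    case (elim n)
    have d: "degree p < mi_norm m (step_index n) + step_index n k" using elim mi_norm_step_index[of n] by linarith
    have pc: "continuous_on (\<Delta> 0) (poly p)" by (intro continuous_intros)
    have "(\<Sum>x\<in>nodes (Q n). (?s * node_weight k (nodes (Q n)) x) * poly p x) = ?s * (LINT x:\<Delta> 0|M 0. poly p x * dens 0 k x)"
      using node_weight_quadrature[OF N(2-4) k disjI2[OF d]] by (simp add: sum_distrib_left mult.assoc)
    also have "(LINT x:\<Delta> 0|M 0. poly p x * dens 0 k x) = cs_integral (nik \<sigma> 0 k) (poly p)"
      by (subst dens0(4)[OF k pc]) (simp add: mult.commute)
    also have "\<dots> = ?s * (LINT x:\<Delta> 0|?M. poly p x)"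
      unfolding cs_integral_def integral_completion_support[OF s(2) generator0(7) s(4) pc] by simp
    finally show ?case unfolding ss' ab(2) .
  qed
  have "(\<lambda>n. \<Sum>x\<in>nodes (Q n). (?s * node_weight k (nodes (Q n)) x) * f x) \<longlonglongrightarrow> integral\<^sup>L (completion ?M) f"
  proof (rule quadrature_converges_squeeze[OF s(2,3) null sq _ _ exact])
    show "nodes (Q n) \<subseteq> {a..b}" for n using N(1)[of n] ab(2) by simp
    show "0 \<le> ?s * node_weight k (nodes (Q n)) x" if "x \<in> nodes (Q n)" for n x
      using node_weight_positive[OF N(4,1,2,3) k that] by simp
  qed
  from tendsto_mult_left[OF this, of ?s]
  show "(\<lambda>n. \<Sum>x\<in>nodes (Q n). node_weight k (nodes (Q n)) x * f x) \<longlonglongrightarrow> cs_integral (nik \<sigma> 0 k) f"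
    unfolding cs_integral_def by (simp add: sum_distrib_left mult.assoc ss')
qed

text \<open>Taking real or imaginary parts commutes with the real-weighted sums and does not
  increase the norm, so the same \<open>\<delta>\<close> works.\<close>

lemma rs_integrable_part:
  assumes h: "h = Re \<or> h = Im" and rs: "rs_integrable s X f"
  shows "rs_integrable s X (\<lambda>x. h (f x))"
proof -
  obtain I where I: "\<forall>\<epsilon>>0. \<exists>\<delta>>0. \<forall>N x t. x 0 = Inf X \<and> x N = Sup X \<and>
      (\<forall>i<N. x i \<le> x (Suc i) \<and> x (Suc i) - x i < \<delta> \<and> t i \<in> {x i..x (Suc i)}) \<longrightarrow>
      norm ((\<Sum>i<N. (distr_fun s (Inf X) (x (Suc i)) - distr_fun s (Inf X) (x i)) *\<^sub>R f (t i)) - I) < \<epsilon>"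
    using rs unfolding rs_integrable_def by (elim exE) (rule that)
  have le: "norm ((\<Sum>i<N. (distr_fun s (Inf X) (x (Suc i)) - distr_fun s (Inf X) (x i)) *\<^sub>R h (f (t i))) - h I) \<le>
     norm ((\<Sum>i<N. (distr_fun s (Inf X) (x (Suc i)) - distr_fun s (Inf X) (x i)) *\<^sub>R f (t i)) - I)" (is "norm ?l \<le> norm ?r")
    for N :: nat and x t
  proof -
    have "?l = h ?r" using h by auto
    then show ?thesis using h abs_Re_le_cmod abs_Im_le_cmod by auto
  qed
  show ?thesis unfolding rs_integrable_def
  proof (rule exI[of _ "h I"], intro allI impI)
    fix \<epsilon> :: real assume \<epsilon>: "0 < \<epsilon>"
    obtain \<delta> where \<delta>: "0 < \<delta>" "\<forall>N x t. x 0 = Inf X \<and> x N = Sup X \<and>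
      (\<forall>i<N. x i \<le> x (Suc i) \<and> x (Suc i) - x i < \<delta> \<and> t i \<in> {x i..x (Suc i)}) \<longrightarrow>
      norm ((\<Sum>i<N. (distr_fun s (Inf X) (x (Suc i)) - distr_fun s (Inf X) (x i)) *\<^sub>R f (t i)) - I) < \<epsilon>"
      using I[THEN spec, THEN mp, OF \<epsilon>] by (elim exE conjE) (rule that)
    show "\<exists>\<delta>>0. \<forall>N x t. x 0 = Inf X \<and> x N = Sup X \<and>
      (\<forall>i<N. x i \<le> x (Suc i) \<and> x (Suc i) - x i < \<delta> \<and> t i \<in> {x i..x (Suc i)}) \<longrightarrow>
      norm ((\<Sum>i<N. (distr_fun s (Inf X) (x (Suc i)) - distr_fun s (Inf X) (x i)) *\<^sub>R h (f (t i))) - h I) < \<epsilon>"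
      by (intro exI[of _ \<delta>] conjI \<delta>(1) allI impI)
        (rule le_less_trans[OF le \<delta>(2)[THEN spec, THEN spec, THEN spec, THEN mp]])
  qed
qed

lemma quadrature_converges:
  fixes f :: "real \<Rightarrow> complex"
  assumes t: "\<And>n. type_II m \<sigma> (step_index n) (Q n) (P n)" and k: "k \<le> m"
    and B: "bounded (f ` \<Delta> 0)" and rs: "rs_integrable (nik \<sigma> 0 k) (\<Delta> 0) f"
  shows "(\<lambda>n. \<Sum>x\<in>nodes (Q n). quad_coeff (Q n) (P n k) x * f x) \<longlonglongrightarrow> cs_integral (nik \<sigma> 0 k) f"
proof -
  obtain C where C: "\<And>y. y \<in> \<Delta> 0 \<Longrightarrow> norm (f y) \<le> C" using B by (auto simp: bounded_iff)
  have bd: "\<bar>Re (f y)\<bar> \<le> C" "\<bar>Im (f y)\<bar> \<le> C" if "y \<in> \<Delta> 0" for y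
    using C[OF that] abs_Re_le_cmod[of "f y"] abs_Im_le_cmod[of "f y"] by auto
  have rsp: "rs_integrable (nik \<sigma> 0 k) (\<Delta> 0) (\<lambda>x. Re (f x))" "rs_integrable (nik \<sigma> 0 k) (\<Delta> 0) (\<lambda>x. Im (f x))"
    by (rule rs_integrable_part[OF _ rs]; simp)+
  have re: "integrable (completion (mabs (nik \<sigma> 0 k))) (\<lambda>x. Re (f x))"
    "(\<lambda>n. \<Sum>x\<in>nodes (Q n). node_weight k (nodes (Q n)) x * Re (f x)) \<longlonglongrightarrow> cs_integral (nik \<sigma> 0 k) (\<lambda>x. Re (f x))"
    by (rule quadrature_converges_real(1)[where Q = Q and P = P, OF t k _ rsp(1)], erule bd(1))
      (rule quadrature_converges_real(2)[where Q = Q and P = P, OF t k _ rsp(1)], erule bd(1))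
  have im: "integrable (completion (mabs (nik \<sigma> 0 k))) (\<lambda>x. Im (f x))"
    "(\<lambda>n. \<Sum>x\<in>nodes (Q n). node_weight k (nodes (Q n)) x * Im (f x)) \<longlonglongrightarrow> cs_integral (nik \<sigma> 0 k) (\<lambda>x. Im (f x))"
    by (rule quadrature_converges_real(1)[where Q = Q and P = P, OF t k _ rsp(2)], erule bd(2))
      (rule quadrature_converges_real(2)[where Q = Q and P = P, OF t k _ rsp(2)], erule bd(2))
  note N = type_II_nodes[OF t]
  let ?w = "\<lambda>n x. node_weight k (nodes (Q n)) x"
  have e: "(\<Sum>x\<in>nodes (Q n). quad_coeff (Q n) (P n k) x * f x) =
      of_real (\<Sum>x\<in>nodes (Q n). ?w n x * Re (f x)) + \<i> * of_real (\<Sum>x\<in>nodes (Q n). ?w n x * Im (f x))" for n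
  proof -
    have "(\<Sum>x\<in>nodes (Q n). quad_coeff (Q n) (P n k) x * f x) =
       (\<Sum>x\<in>nodes (Q n). of_real (?w n x * Re (f x)) + \<i> * of_real (?w n x * Im (f x)))"
      using N(5)[OF k] by (intro sum.cong) (auto simp: complex_eq_iff)
    then show ?thesis by (simp add: sum.distrib sum_distrib_left)
  qed
  show ?thesis
    unfolding e cs_integral_complex[OF re(1) im(1)]
    by (intro tendsto_intros re(2) im(2))
qed

end

theorem corollary1p2:
  fixes m :: nat and \<Delta> :: "nat \<Rightarrow> real set" and \<sigma> :: "nat \<Rightarrow> cs_measure"
  assumes "nikishin_generators m \<Delta> \<sigma>"
  shows
    "(\<forall>(n :: nat \<Rightarrow> nat) Q P. type_II m \<sigma> n Q P \<longrightarrow>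
        (\<forall>k\<le>m. \<forall>p :: complex poly. p = 0 \<or> degree p < mi_norm m n + n k \<longrightarrow>
          cs_integral (nik \<sigma> 0 k) (\<lambda>x. poly p (of_real x)) =
            (\<Sum>x\<in>nodes Q. quad_coeff Q (P k) x * poly p (of_real x))))
   \<and> (\<forall>n Q P. type_II m \<sigma> (step_index n) Q P \<longrightarrow>
        (\<forall>k\<le>m. \<forall>x\<in>nodes Q. sgn (quad_coeff Q (P k) x) = of_real (msign (nik \<sigma> 0 k))))
   \<and> (\<forall>Q P. (\<forall>n. type_II m \<sigma> (step_index n) (Q n) (P n)) \<longrightarrow>
        (\<forall>k\<le>m. \<forall>f :: real \<Rightarrow> complex.
          bounded (f ` \<Delta> 0) \<longrightarrow> rs_integrable (nik \<sigma> 0 k) (\<Delta> 0) f \<longrightarrow>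
          (\<lambda>n. \<Sum>x\<in>nodes (Q n). quad_coeff (Q n) (P n k) x * f x)
            \<longlonglongrightarrow> cs_integral (nik \<sigma> 0 k) f))"
proof -
  interpret nikishin m \<Delta> \<sigma> by unfold_locales (rule assms)
  have "sgn (quad_coeff Q (P k) x) = of_real (msign (nik \<sigma> 0 k))"
    if t: "type_II m \<sigma> (step_index n) Q P" and k: "k \<le> m" and x: "x \<in> nodes Q" for n Q P k x
  proof -
    note N = type_II_nodes[OF t]
    have "msign (nik \<sigma> 0 k) = 1 \<or> msign (nik \<sigma> 0 k) = - 1" using nik_properties[OF k le0] by blast
    moreover have "0 < msign (nik \<sigma> 0 k) * node_weight k (nodes Q) x"
      by (rule node_weight_positive[OF N(4,1,2,3) k x])
    ultimately have "sgn (node_weight k (nodes Q) x) = msign (nik \<sigma> 0 k)" by auto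
    then show ?thesis unfolding N(5)[OF k x] by (simp only: sgn_of_real)
  qed
  then show ?thesis
    by (intro conjI allI impI ballI quadrature_exact quadrature_converges) auto
qed

end
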